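(* Let $n\ge2$, let $W\in\mathrm{Gr}^{(n)}$ be in the big cell, $W=\mathcal W(z)H_+^{(n)}$ with $\mathcal W(z)=\Psi_W(0,z)$, and let $\mathcal W(\tilde t;z)=\exp(\xi(\tilde t,\Lambda))\mathcal W(z)$, assumed to extend analytically to a neighbourhood of $S^1$. Then for every $N>0$ (and every $\tilde t$ with $\tau_W(\tilde t)\ne0$) $$\tau_{W,N}(\tilde t)=\tau_W(\tilde t)\,\det\big(I-K_{\mathcal W(\tilde t;z),N}\big),$$ where $K_{\mathcal W(\tilde t;z),N}$ is the operator on $H_+^{(n)}$ with $n\times n$ blocks, $i,j\ge0$, $$\big(K_{\mathcal W(\tilde t;z),N}\big)_{ij}=\begin{cases}0&\text{if }\min\{i,j\}<N,\\[4pt]\displaystyle\sum_{k=1}^\infty\big(\Psi_W(-\tilde t;z)\big)^{(i+k)}\big(\Psi_W(-\tilde t;z)^{-1}\big)^{(-j-k)}&\text{otherwise.}\end{cases}$$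
   Context: Spaces. $H^{(n)}=L^2(S^1,\mathbb C^n)=H^{(n)}_+\oplus H^{(n)}_-$ (nonnegative, resp. negative, powers of $z$), $H=H^{(1)}$. $\mathrm{Gr}^{(n)}$ is the set of closed $W\subseteq H^{(n)}$ with $zW\subseteq W$, with $\mathrm{pr}_+:W\to H_+^{(n)}$ Fredholm and $\mathrm{pr}_-:W\to H_-^{(n)}$ Hilbert-Schmidt; $W$ is in the big cell if $\mathrm{pr}_+:W\to H_+^{(n)}$ is an isomorphism. The isometry $\Xi:H^{(n)}\to H$, $\Xi((f_0,\dots,f_{n-1})^{\mathrm T})(z)=\sum_{k=0}^{n-1}z^kf_k(z^n)$, identifies $W$ with a subspace of $H$ (still denoted $W$) with $z^nW\subseteq W$. For a matrix loop, $\gamma^{(k)}$ is the coefficient of $z^k$. Times. $\tilde t=(t_i)$ with $t_{jn}=0$ for all $j$ and only finitely many nonzero entries; $\xi(\tilde t,z)=\sum_i t_iz^i$; $D=\partial/\partial t_1$. $\Lambda$ is the $n\times n$ matrix with $1$'s on the first subdiagonal, $z$ in the upper right corner, $0$ elsewhere. $\tau$ functions. With $\gamma=\mathcal W(\tilde t;\cdot)$, $\tau_{W,N}(\tilde t)$ is the determinant of the block Toeplitz matrix $(\gamma^{(r-s)})_{0\le r,s\le N-1}$, and $\tau_W(\tilde t)=\lim_{N\to\infty}\tau_{W,N}(\tilde t)$, which equals the Fredholm determinant $\det(T(\gamma)T(\gamma^{-1}))$ with $T(\gamma)=\mathrm{pr}_+\circ\gamma$ on $H_+^{(n)}$. Wave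 matrix. $\psi_W(\tilde t;z)$ is the unique function with $\psi_W(\tilde t;\cdot)\in W\subseteq H$ of the form $e^{\xi(\tilde t,z)}\big(1+\sum_{i\ge1}s_i(\tilde t)z^{-i}\big)$ (defined when $e^{-\xi(\tilde t,\cdot)}W$ is in the big cell). Let $\zeta_1,\dots,\zeta_n$ be the $n$-th roots of $z$ and $V=(\zeta_i^{\,j-1})_{1\le i,j\le n}$; then $\Psi_W(\tilde t;z)=V^{-1}\big(D^{j-1}\psi_W(\tilde t;\zeta_i)\big)_{1\le i,j\le n}$. *)

theory Defs
  imports
    "HOL-Analysis.Analysis"
    "Jordan_Normal_Form.Determinant"
    "Jordan_Normal_Form.Gauss_Jordan_Elimination"
begin

no_notation Finite_Cartesian_Product.vec_nth (infixl "$" 90)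
hide_const (open) Finite_Cartesian_Product.vec Finite_Cartesian_Product.mat
  Determinants.det

section \<open>Square integrable functions on the unit circle\<close>

text \<open>
  Elements of the Hilbert spaces are represented by functions on the complex plane of which only
  the values on the unit circle, up to null sets, are relevant; equality of elements is equality
  almost everywhere with respect to the normalised arc length.
\<close>

definition circle :: "complex measure" where
  "circle = distr (uniform_measure lborel {0..2*pi}) borel cis"

definition L2 :: "(complex \<Rightarrow> complex) set" where
  "L2 = {f \<in> borel_measurable circle. integrable circle (\<lambda>z. (cmod (f z))\<^sup>2)}"

definition L2_norm :: "(complex \<Rightarrow> complex) \<Rightarrow> real" where
  "L2_norm f = sqrt (LINT z|circle. (cmod (f z))\<^sup>2)"

definition fourier :: "(complex \<Rightarrow> complex) \<Rightarrow> int \<Rightarrow> complex" where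
  "fourier f k = (LINT z|circle. z powi (-k) * f z)"

definition L2_plus :: "(complex \<Rightarrow> complex) set" where
  "L2_plus = {f \<in> L2. \<forall>k<0. fourier f k = 0}"

definition L2_minus :: "(complex \<Rightarrow> complex) set" where
  "L2_minus = {f \<in> L2. \<forall>k\<ge>0. fourier f k = 0}"

type_synonym vfun = "complex \<Rightarrow> complex vec"
type_synonym loop = "complex \<Rightarrow> complex mat"

definition H_space :: "nat \<Rightarrow> vfun set" where
  "H_space n = {f. \<forall>z. f z \<in> carrier_vec n} \<inter> {f. \<forall>a<n. (\<lambda>z. f z $ a) \<in> L2}"

definition H_plus :: "nat \<Rightarrow> vfun set" where
  "H_plus n = {f \<in> H_space n. \<forall>a<n. (\<lambda>z. f z $ a) \<in> L2_plus}"

definition H_minus :: "nat \<Rightarrow> vfun set" where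
  "H_minus n = {f \<in> H_space n. \<forall>a<n. (\<lambda>z. f z $ a) \<in> L2_minus}"

definition H_inner :: "vfun \<Rightarrow> vfun \<Rightarrow> complex" where
  "H_inner f g = (LINT z|circle. f z \<bullet>c g z)"

definition H_norm :: "vfun \<Rightarrow> real" where
  "H_norm f = sqrt (Re (H_inner f f))"

definition ae_eq :: "(complex \<Rightarrow> 'a) \<Rightarrow> (complex \<Rightarrow> 'a) \<Rightarrow> bool" (infix "\<approx>" 50) where
  "f \<approx> g \<longleftrightarrow> (AE z in circle. f z = g z)"

text \<open>The components of an element in the decomposition of \<open>H_space n\<close> as the orthogonal sum of
  \<open>H_plus n\<close> and \<open>H_minus n\<close>; they are determined up to almost everywhere equality.\<close>

definition pr_plus :: "nat \<Rightarrow> vfun \<Rightarrow> vfun" where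
  "pr_plus n f = (SOME g. g \<in> H_plus n \<and> (\<lambda>z. f z - g z) \<in> H_minus n)"

definition pr_minus :: "nat \<Rightarrow> vfun \<Rightarrow> vfun" where
  "pr_minus n f = (SOME g. g \<in> H_minus n \<and> (\<lambda>z. f z - g z) \<in> H_plus n)"

section \<open>The Grassmannian\<close>

text \<open>Taking constant sequences, a closed subspace is also saturated under almost everywhere
  equality.\<close>

definition closed_subspace :: "nat \<Rightarrow> vfun set \<Rightarrow> bool" where
  "closed_subspace n W \<longleftrightarrow>
     W \<subseteq> H_space n \<and> (\<lambda>z. 0\<^sub>v n) \<in> W \<and>
     (\<forall>f\<in>W. \<forall>g\<in>W. (\<lambda>z. f z + g z) \<in> W) \<and>
     (\<forall>c. \<forall>f\<in>W. (\<lambda>z. c \<cdot>\<^sub>v f z) \<in> W) \<and>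
     (\<forall>F f. (\<forall>k::nat. F k \<in> W) \<and> f \<in> H_space n \<and>
        (\<lambda>k. H_norm (\<lambda>z. F k z - f z)) \<longlonglongrightarrow> 0 \<longrightarrow> f \<in> W)"

definition lin_comb :: "nat \<Rightarrow> (vfun \<Rightarrow> complex) \<Rightarrow> vfun set \<Rightarrow> vfun" where
  "lin_comb n c B = (\<lambda>z. vec n (\<lambda>a. \<Sum>b\<in>B. c b * b z $ a))"

text \<open>In the next three definitions \<open>X\<close> and \<open>Y\<close> are closed subspaces of \<open>H_space n\<close> and \<open>T\<close> is a bounded
  linear map from \<open>X\<close> to \<open>Y\<close>. Fredholm: finite dimensional kernel and cokernel (the range is then
  automatically closed). By the open mapping theorem the inverse of a bijective \<open>T\<close> is bounded.\<close>

definition fredholm :: "nat \<Rightarrow> vfun set \<Rightarrow> vfun set \<Rightarrow> (vfun \<Rightarrow> vfun) \<Rightarrow> bool" where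
  "fredholm n X Y T \<longleftrightarrow>
     (\<exists>B. finite B \<and> B \<subseteq> X \<and>
        (\<forall>f\<in>X. T f \<approx> (\<lambda>z. 0\<^sub>v n) \<longrightarrow> (\<exists>c. f \<approx> lin_comb n c B))) \<and>
     (\<exists>B. finite B \<and> B \<subseteq> Y \<and>
        (\<forall>g\<in>Y. \<exists>f\<in>X. \<exists>c. g \<approx> (\<lambda>z. T f z + lin_comb n c B z)))"

definition isomorphism :: "nat \<Rightarrow> vfun set \<Rightarrow> vfun set \<Rightarrow> (vfun \<Rightarrow> vfun) \<Rightarrow> bool" where
  "isomorphism n X Y T \<longleftrightarrow>
     (\<forall>f\<in>X. \<forall>g\<in>X. T f \<approx> T g \<longrightarrow> f \<approx> g) \<and> (\<forall>g\<in>Y. \<exists>f\<in>X. T f \<approx> g)"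

definition orthonormal_basis :: "vfun set \<Rightarrow> nat \<Rightarrow> vfun set \<Rightarrow> bool" where
  "orthonormal_basis E n X \<longleftrightarrow>
     E \<subseteq> X \<and> (\<forall>e\<in>E. \<forall>f\<in>E. H_inner e f = (if e = f then 1 else 0)) \<and>
     (\<forall>f\<in>X. (\<forall>e\<in>E. H_inner f e = 0) \<longrightarrow> f \<approx> (\<lambda>z. 0\<^sub>v n))"

definition hilbert_schmidt :: "nat \<Rightarrow> vfun set \<Rightarrow> (vfun \<Rightarrow> vfun) \<Rightarrow> bool" where
  "hilbert_schmidt n X T \<longleftrightarrow>
     (\<exists>E. orthonormal_basis E n X \<and> (\<lambda>e. (H_norm (T e))\<^sup>2) summable_on E)"

definition Gr :: "nat \<Rightarrow> vfun set set" where
  "Gr n = {W. closed_subspace n W \<and> (\<forall>f\<in>W. (\<lambda>z. z \<cdot>\<^sub>v f z) \<in> W) \<and>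
              fredholm n W (H_plus n) (pr_plus n) \<and> hilbert_schmidt n W (pr_minus n)}"

definition big_cell :: "nat \<Rightarrow> vfun set \<Rightarrow> bool" where
  "big_cell n W \<longleftrightarrow> isomorphism n W (H_plus n) (pr_plus n)"

definition Xi :: "nat \<Rightarrow> vfun \<Rightarrow> complex \<Rightarrow> complex" where
  "Xi n f = (\<lambda>z. \<Sum>k<n. z ^ k * f (z ^ n) $ k)"

section \<open>Times\<close>

text \<open>The case \<open>j = 0\<close> makes the unused entry \<open>t 0\<close> vanish.\<close>

definition admissible_times :: "nat \<Rightarrow> (nat \<Rightarrow> complex) set" where
  "admissible_times n = {t. finite {i. t i \<noteq> 0} \<and> (\<forall>j. t (j * n) = 0)}"

definition xi :: "(nat \<Rightarrow> complex) \<Rightarrow> complex \<Rightarrow> complex" where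
  "xi t z = (\<Sum>i | t i \<noteq> 0. t i * z ^ i)"

definition Lam :: "nat \<Rightarrow> loop" where
  "Lam n z = mat n n (\<lambda>(i, j). if i = j + 1 then 1 else if i = 0 \<and> j = n - 1 then z else 0)"

definition xi_mat :: "nat \<Rightarrow> (nat \<Rightarrow> complex) \<Rightarrow> complex mat \<Rightarrow> complex mat" where
  "xi_mat n t A = mat n n (\<lambda>(a, b). \<Sum>i | t i \<noteq> 0. t i * (A ^\<^sub>m i) $$ (a, b))"

definition exp_mat :: "nat \<Rightarrow> complex mat \<Rightarrow> complex mat" where
  "exp_mat n A = mat n n (\<lambda>(a, b). \<Sum>k. (A ^\<^sub>m k) $$ (a, b) / fact k)"

section \<open>The wave function and the wave matrix\<close>

text \<open>A square integrable function has the form \<open>e\<^sup>\<xi> (1 + \<Sum>i\<ge>1. s\<^sub>i z\<^sup>-\<^sup>i)\<close> (with convergence in the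
  mean) iff multiplying it by \<open>e\<^sup>-\<^sup>\<xi>\<close> and subtracting 1 leaves negative powers of \<open>z\<close> only.\<close>

definition is_wave_function ::
  "nat \<Rightarrow> vfun set \<Rightarrow> (nat \<Rightarrow> complex) \<Rightarrow> (complex \<Rightarrow> complex) \<Rightarrow> bool" where
  "is_wave_function n W t \<psi> \<longleftrightarrow>
     \<psi> \<in> Xi n ` W \<and> (\<lambda>z. exp (- xi t z) * \<psi> z - 1) \<in> L2_minus"

text \<open>Unique up to almost everywhere equality if \<open>e\<^sup>-\<^sup>\<xi> W\<close> is in the big cell, and only meaningful in
  that case.\<close>

definition psi :: "nat \<Rightarrow> vfun set \<Rightarrow> (nat \<Rightarrow> complex) \<Rightarrow> complex \<Rightarrow> complex" where
  "psi n W t = (SOME \<psi>. is_wave_function n W t \<psi>)"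

text \<open>The derivative in the direction of the first time. Since the values of \<open>F\<close> are elements of the
  Hilbert space, the difference quotient converges in the \<open>L\<^sup>2\<close> norm.\<close>

definition D_t1 :: "((nat \<Rightarrow> complex) \<Rightarrow> complex \<Rightarrow> complex) \<Rightarrow> (nat \<Rightarrow> complex) \<Rightarrow> complex \<Rightarrow> complex" where
  "D_t1 F t = (SOME g. g \<in> L2 \<and>
     ((\<lambda>h. L2_norm (\<lambda>z. (F (t(1 := t 1 + h)) z - F t z) / h - g z)) \<longlongrightarrow> 0) (at 0))"

text \<open>\<open>zeta n z i\<close> for \<open>i < n\<close> are the \<open>n\<close>-th roots of \<open>z\<close>; the wave matrix does not depend on their
  enumeration.\<close>

definition zeta :: "nat \<Rightarrow> complex \<Rightarrow> nat \<Rightarrow> complex" where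
  "zeta n z i = z powr (1 / of_nat n) * cis (2 * pi * real i / real n)"

definition V_mat :: "nat \<Rightarrow> loop" where
  "V_mat n z = mat n n (\<lambda>(i, j). zeta n z i ^ j)"

abbreviation inv_mat :: "complex mat \<Rightarrow> complex mat" where
  "inv_mat A \<equiv> the (mat_inverse A)"

definition Psi :: "nat \<Rightarrow> vfun set \<Rightarrow> (nat \<Rightarrow> complex) \<Rightarrow> loop" where
  "Psi n W t z = inv_mat (V_mat n z) * mat n n (\<lambda>(i, j). (D_t1 ^^ j) (psi n W) t (zeta n z i))"

section \<open>Matrix loops\<close>

definition loop_coeff :: "nat \<Rightarrow> loop \<Rightarrow> int \<Rightarrow> complex mat" where
  "loop_coeff n \<gamma> k = mat n n (\<lambda>(a, b). fourier (\<lambda>z. \<gamma> z $$ (a, b)) k)"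

definition loop_image :: "nat \<Rightarrow> loop \<Rightarrow> vfun set \<Rightarrow> vfun set" where
  "loop_image n \<gamma> X = {f \<in> H_space n. \<exists>h\<in>X. f \<approx> (\<lambda>z. \<gamma> z *\<^sub>v h z)}"

definition extends_analytically :: "nat \<Rightarrow> loop \<Rightarrow> bool" where
  "extends_analytically n \<gamma> \<longleftrightarrow>
     (\<exists>U G. open U \<and> sphere 0 1 \<subseteq> U \<and>
        (\<forall>z. G z \<in> carrier_mat n n) \<and>
        (\<forall>a<n. \<forall>b<n. (\<lambda>z. G z $$ (a, b)) holomorphic_on U) \<and> \<gamma> \<approx> G)"

definition W_loop :: "nat \<Rightarrow> vfun set \<Rightarrow> (nat \<Rightarrow> complex) \<Rightarrow> loop" where
  "W_loop n W t z = exp_mat n (xi_mat n t (Lam n z)) * Psi n W (\<lambda>i. 0) z"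

section \<open>Determinants\<close>

text \<open>The scalar entries of a matrix of \<open>n \<times> n\<close> blocks.\<close>

definition unblock :: "nat \<Rightarrow> (nat \<Rightarrow> nat \<Rightarrow> complex mat) \<Rightarrow> nat \<Rightarrow> nat \<Rightarrow> complex" where
  "unblock n B p q = B (p div n) (q div n) $$ (p mod n, q mod n)"

text \<open>\<open>det (I + A)\<close> for a trace class operator on a Hilbert space with orthonormal basis
  \<open>e\<^sub>0, e\<^sub>1, \<dots>\<close> and matrix \<open>A\<close>: the sum over all \<open>k\<close> of the traces of the exterior powers
  \<open>\<Lambda>\<^sup>k A\<close>. The diagonal entries of \<open>\<Lambda>\<^sup>k A\<close> are the principal minors of \<open>A\<close> of order \<open>k\<close>, and the
  sum of all of them converges absolutely.\<close>

definition fredholm_det :: "(nat \<Rightarrow> nat \<Rightarrow> complex) \<Rightarrow> complex" where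
  "fredholm_det A = (\<Sum>\<^sub>\<infinity>S\<in>{S. finite S}.
     det (mat (card S) (card S) (\<lambda>(i, j). A (sorted_list_of_set S ! i) (sorted_list_of_set S ! j))))"

definition tau_N :: "nat \<Rightarrow> vfun set \<Rightarrow> nat \<Rightarrow> (nat \<Rightarrow> complex) \<Rightarrow> complex" where
  "tau_N n W N t = det (mat (N * n) (N * n)
     (\<lambda>(p, q). unblock n (\<lambda>r s. loop_coeff n (W_loop n W t) (int r - int s)) p q))"

definition tau :: "nat \<Rightarrow> vfun set \<Rightarrow> (nat \<Rightarrow> complex) \<Rightarrow> complex" where
  "tau n W t = lim (\<lambda>N. tau_N n W N t)"

definition K_block :: "nat \<Rightarrow> vfun set \<Rightarrow> (nat \<Rightarrow> complex) \<Rightarrow> nat \<Rightarrow> nat \<Rightarrow> nat \<Rightarrow> complex mat" where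
  "K_block n W t N i j =
     (if min i j < N then 0\<^sub>m n n
      else mat n n (\<lambda>(a, b). \<Sum>k.
        (loop_coeff n (Psi n W (\<lambda>m. - t m)) (int i + int (Suc k)) *
         loop_coeff n (\<lambda>z. inv_mat (Psi n W (\<lambda>m. - t m) z)) (- int j - int (Suc k))) $$ (a, b)))"

text \<open>The matrix of the operator in the orthonormal basis of \<open>H_plus n\<close> consisting of the \<open>z\<^sup>i e\<^sub>a\<close>
  with \<open>i \<ge> 0\<close> and \<open>a < n\<close>, which has the index \<open>i * n + a\<close>.\<close>

definition K_mat :: "nat \<Rightarrow> vfun set \<Rightarrow> (nat \<Rightarrow> complex) \<Rightarrow> nat \<Rightarrow> nat \<Rightarrow> nat \<Rightarrow> complex" where
  "K_mat n W t N = unblock n (K_block n W t N)"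

end

theory Submission
  imports
    "HOL-Complex_Analysis.Complex_Analysis"
    "HOL-Library.Diagonal_Subsequence"
    "HOL-Probability.Probability_Measure"
    Defs
begin

text \<open>
  Write \<open>\<Gamma>\<close> for the loop \<open>exp(\<xi>(t,\<Lambda>)) \<Psi>(0,z)\<close>. The theorem is an instance of the
  Borodin--Okounkov--Geronimo--Case formula: the finite sections of a block Toeplitz operator
  \<open>T(\<Gamma>)\<close> are computed from its strong limit determinant and from a Fredholm determinant built out
  of a second, oppositely ordered, factorisation of \<open>\<Gamma>\<close>. The proof is algebra in a ring of
  matrices, fed by a few analytic facts about \<open>W\<close>.

  \<^emph>\<open>Coordinates.\<close> The isometry \<open>Xi\<close> followed by Fourier coefficients turns \<open>H\<^sup>(\<^sup>n\<^sup>)\<close> into sequences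
  indexed by the integers and matrix loops into matrices that are invariant under the shift by
  \<open>n\<close> along the diagonal. All loops that occur have coefficients with exponential decay, so these
  matrices have exponentially decaying entries off the diagonal and form a ring (\<open>emat\<close>), in which
  \<open>Pp\<close> is the projection to nonnegative indices. In these coordinates \<open>exp(\<xi>(t,\<Lambda>))\<close> is
  multiplication by the scalar function \<open>e\<^sup>\<xi>\<close>, because \<open>\<Lambda>\<close> has the left eigenvectors
  \<open>(1, \<zeta>, ..., \<zeta>\<^sup>n\<^sup>-\<^sup>1)\<close>; it is a lower unitriangular matrix \<open>a\<close>. The columns of \<open>\<Psi>(0,z)\<close> are
  the vectors \<open>D\<^sup>j\<psi>\<close>, whose top coordinate is a 1 in position \<open>j\<close> (\<open>wave_derivatives\<close>); hence
  \<open>\<Psi>(0,z)\<close> is an upper unitriangular matrix \<open>b\<close>, and \<open>\<Gamma> = a b\<close>.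

  \<^emph>\<open>Determinants.\<close> Let \<open>P\<close> be the projection \<open>Pp\<close> and \<open>X = P a\<^sup>-\<^sup>1 P \<Gamma> P b\<^sup>-\<^sup>1 P\<close>. The outer factors are
  unitriangular, so \<open>X\<close> and \<open>P \<Gamma> P\<close> have the same leading minors, while \<open>X - P\<close> factors through
  the negative half space and therefore has exponentially small entries. So the minors converge
  to a Fredholm determinant, which is \<open>\<tau>\<close>. When it does not vanish,
  \<open>X\<close> is invertible with an inverse of the same kind (\<open>fredholm_alternative\<close>), and Jacobi's
  identity expresses the leading minor of size \<open>m\<close> of \<open>X\<close> by the determinant of the complementary
  corner of \<open>X\<^sup>-\<^sup>1\<close> (\<open>det_on_eq_complementary_fredholm_det\<close>). It remains to find \<open>X\<^sup>-\<^sup>1\<close>: if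
  \<open>\<Gamma> h = \<theta>\<close> with \<open>h\<close> preserving the nonnegative and \<open>\<theta>\<close> the negative half space, then
  \<open>X\<^sup>-\<^sup>1 = P c P c\<^sup>-\<^sup>1 P\<close> for \<open>c = b h = a\<^sup>-\<^sup>1 \<theta>\<close>, and this is \<open>P - P c Q c\<^sup>-\<^sup>1 P\<close> with
  \<open>Q = 1 - P\<close> (\<open>det_toeplitz_eq\<close>).

  \<^emph>\<open>Wave functions.\<close> The factor \<open>\<theta>\<close> comes from the wave matrix at \<open>-t\<close>. The vectors
  \<open>e\<^sup>\<xi> D\<^sup>j\<psi>(-t)\<close> lie in \<open>e\<^sup>\<xi> W\<close>, which is in the big cell since \<open>\<tau> \<noteq> 0\<close>; they again have top
  coordinate 1 in position \<open>j\<close>, so they are the columns of an upper unitriangular \<open>\<theta>\<close>, and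
  \<open>c = \<Psi>(-t)\<close>. Two inversions are needed. That \<open>b\<close> is invertible with exponentially decaying
  inverse follows from \<open>W = \<Psi>(0,z) H\<^sub>+\<close> being in the big cell (\<open>invertible_of_big_cell\<close>); that
  \<open>\<theta>\<close> is invertible follows from the inverse of \<open>P \<Gamma> P\<close> (\<open>wave_matrix_inverse\<close>).
\<close>

no_notation Finite_Cartesian_Product.vec_nth (infixl "$" 90)
no_notation Infinite_Set_Sum.abs_summable_on (infix "abs'_summable'_on" 50)
hide_const (open) Finite_Cartesian_Product.vec Finite_Cartesian_Product.mat
  Determinants.det

section \<open>Fredholm determinants of matrices with exponentially small entries\<close>

text \<open>Determinants over an arbitrary finite index set, so that principal minors and complementary
  corners need no renumbering.\<close>

definition det_on :: "nat set => (nat => nat => complex) => complex" where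
  "det_on I A = (\<Sum>\<pi> | \<pi> permutes I. signof \<pi> * (\<Prod>i\<in>I. A i (\<pi> i)))"

lemma det_on_cong:
  assumes "!!i j. i \<in> I ==> j \<in> I ==> A i j = B i j"
  shows "det_on I A = det_on I B"
  unfolding det_on_def using assms
  by (intro sum.cong refl arg_cong2[of _ _ _ _ "(*)"] prod.cong) (auto simp: permutes_in_image)

lemma det_mat_eq_det_on: "det (mat m m (\<lambda>(i, j). A i j)) = det_on {..<m} A"
proof -
  have "det (mat m m (\<lambda>(i, j). A i j)) = (\<Sum>\<pi> | \<pi> permutes {0..<m}. signof \<pi> *
      (\<Prod>i = 0..<m. mat m m (\<lambda>(i, j). A i j) $$ (i, \<pi> i)))"
    by (rule det_def') simp
  also have "\<dots> = (\<Sum>\<pi> | \<pi> permutes {0..<m}. signof \<pi> * (\<Prod>i = 0..<m. A i (\<pi> i)))"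
  proof (rule sum.cong[OF refl], clarify)
    fix \<pi> assume "\<pi> permutes {0..<m}"
    then have "\<pi> i < m" if "i < m" for i
      using that permutes_in_image[of \<pi> "{0..<m}" i] by auto
    then show "signof \<pi> * (\<Prod>i = 0..<m. mat m m (\<lambda>(i, j). A i j) $$ (i, \<pi> i)) =
      signof \<pi> * (\<Prod>i = 0..<m. A i (\<pi> i))" by (auto intro!: prod.cong)
  qed
  finally show ?thesis by (simp add: det_on_def atLeast0LessThan)
qed

lemma det_on_reindex:
  assumes f: "bij_betw f I J" and fin: "finite I"
  shows "det_on J A = det_on I (\<lambda>i j. A (f i) (f j))"
proof -
  have inj: "inj_on f I" and img: "f ` I = J" using f by (auto simp: bij_betw_def)
  let ?g = "inv_into I f"
  have g: "bij_betw ?g J I" using f by (rule bij_betw_inv_into)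
  have bij: "bij_betw (map_permutation I f) {\<pi>. \<pi> permutes I} {\<pi>. \<pi> permutes J}"
  proof (rule bij_betw_byWitness[where f' = "map_permutation J ?g"])
    show "\<forall>a\<in>{\<pi>. \<pi> permutes I}. map_permutation J ?g (map_permutation I f a) = a"
      using map_permutation_compose_inv[OF f] inj by (auto simp: inv_into_f_f)
    show "\<forall>a\<in>{\<pi>. \<pi> permutes J}. map_permutation I f (map_permutation J ?g a) = a"
      using map_permutation_compose_inv[OF g, of _ f] f
      by (auto simp: bij_betw_inv_into_right)
  qed (use map_permutation_permutes f g in auto)
  have "det_on J A = (\<Sum>\<pi> | \<pi> permutes I. signof (map_permutation I f \<pi>) *
      (\<Prod>i\<in>J. A i (map_permutation I f \<pi> i)))"
    unfolding det_on_def by (rule sum.reindex_bij_betw[OF bij, symmetric])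
  also have "\<dots> = det_on I (\<lambda>i j. A (f i) (f j))"
    unfolding det_on_def
  proof (rule sum.cong[OF refl], clarify)
    fix \<pi> assume p: "\<pi> permutes I"
    have "(\<Prod>i\<in>J. A i (map_permutation I f \<pi> i)) = (\<Prod>i\<in>I. A (f i) (map_permutation I f \<pi> (f i)))"
      by (rule prod.reindex_bij_betw[OF f, symmetric])
    also have "\<dots> = (\<Prod>i\<in>I. A (f i) (f (\<pi> i)))"
      by (intro prod.cong refl) (simp add: map_permutation_apply[OF inj])
    finally show "signof (map_permutation I f \<pi>) * (\<Prod>i\<in>J. A i (map_permutation I f \<pi> i)) =
      signof \<pi> * (\<Prod>i\<in>I. A (f i) (f (\<pi> i)))"
      using sign_map_permutation[OF inj p fin] by simp
  qed
  finally show ?thesis .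
qed

lemma principal_minor_eq_det_on:
  assumes "finite S"
  shows "det (mat (card S) (card S)
    (\<lambda>(i, j). A (sorted_list_of_set S ! i) (sorted_list_of_set S ! j))) = det_on S A"
proof -
  have "bij_betw ((!) (sorted_list_of_set S)) {..<card S} S"
    using bij_betw_nth[of "sorted_list_of_set S" "{..<card S}" S] assms by auto
  from det_on_reindex[OF this, of A] show ?thesis
    by (simp add: det_mat_eq_det_on[of _ "\<lambda>i j. A (sorted_list_of_set S ! i) (sorted_list_of_set S ! j)"])
qed

lemma fredholm_det_eq: "fredholm_det A = (\<Sum>\<^sub>\<infinity>S\<in>{S. finite S}. det_on S A)"
  unfolding fredholm_det_def by (rule infsum_cong) (simp add: principal_minor_eq_det_on)

definition one_plus :: "(nat => nat => complex) => nat => nat => complex" where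
  "one_plus A i j = (if i = j then 1 else 0) + A i j"

lemma det_on_one_plus:
  assumes "finite I"
  shows "det_on I (one_plus A) = (\<Sum>S\<in>Pow I. det_on S A)"
proof -
  have "det_on I (one_plus A) = (\<Sum>\<pi> | \<pi> permutes I. signof \<pi> *
      (\<Sum>S\<in>Pow I. (\<Prod>i\<in>S. A i (\<pi> i)) * (\<Prod>i\<in>I - S. if i = \<pi> i then 1 else 0)))"
    unfolding det_on_def one_plus_def
    by (subst prod_add[OF assms, symmetric]) (simp add: add.commute)
  also have "\<dots> = (\<Sum>S\<in>Pow I. \<Sum>\<pi> | \<pi> permutes I. signof \<pi> *
      ((\<Prod>i\<in>S. A i (\<pi> i)) * (\<Prod>i\<in>I - S. if i = \<pi> i then 1 else 0)))"
    unfolding sum_distrib_left by (rule sum.swap)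
  also have "\<dots> = (\<Sum>S\<in>Pow I. det_on S A)"
  proof (rule sum.cong[OF refl])
    fix S assume "S \<in> Pow I"
    then have S: "S \<subseteq> I" by simp
    have z: "(\<Prod>i\<in>I - S. if i = \<pi> i then 1 else 0) = (if \<pi> permutes S then 1 else (0::complex))"
      if "\<pi> permutes I" for \<pi>
    proof (cases "\<pi> permutes S")
      case True
      then show ?thesis by (auto intro!: prod.neutral simp: permutes_not_in)
    next
      case False
      have "\<exists>i\<in>I - S. \<pi> i ~= i"
      proof (rule ccontr)
        assume "\<not> ?thesis"
        then have "!!x. x \<in> I - S ==> \<pi> x = x" by simp
        then have "\<pi> permutes S" by (rule permutes_superset[OF that])
        with False show False by simp
      qed
      then show ?thesis using False assms by (auto simp: eq_commute[of _ "\<pi> _"])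
    qed
    have "(\<Sum>\<pi> | \<pi> permutes I. signof \<pi> *
        ((\<Prod>i\<in>S. A i (\<pi> i)) * (\<Prod>i\<in>I - S. if i = \<pi> i then 1 else 0))) =
      (\<Sum>\<pi> | \<pi> permutes I. if \<pi> permutes S then signof \<pi> * (\<Prod>i\<in>S. A i (\<pi> i)) else 0)"
      by (intro sum.cong refl) (simp add: z)
    also have "\<dots> = (\<Sum>\<pi> | \<pi> permutes S. signof \<pi> * (\<Prod>i\<in>S. A i (\<pi> i)))"
      using assms S by (intro sum.mono_neutral_cong_right)
        (auto simp: finite_permutations intro: permutes_subset)
    finally show "(\<Sum>\<pi> | \<pi> permutes I. signof \<pi> *
        ((\<Prod>i\<in>S. A i (\<pi> i)) * (\<Prod>i\<in>I - S. if i = \<pi> i then 1 else 0))) = det_on S A"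
      by (simp add: det_on_def)
  qed
  finally show ?thesis .
qed

text \<open>The Leibniz expansion is dominated termwise by the expansion of the product of the row sums.\<close>

lemma norm_det_on_le:
  assumes "finite I"
  shows "norm (det_on I A) \<le> (\<Prod>i\<in>I. \<Sum>j\<in>I. norm (A i j))"
proof -
  have "norm (det_on I A) \<le> (\<Sum>\<pi> | \<pi> permutes I. \<Prod>i\<in>I. norm (A i (\<pi> i)))"
    unfolding det_on_def
    by (rule order_trans[OF norm_sum]) (auto intro!: sum_mono simp: norm_mult prod_norm sign_def)
  also have "\<dots> = (\<Sum>\<pi>\<in>(\<lambda>\<pi>. restrict \<pi> I) ` {\<pi>. \<pi> permutes I}. \<Prod>i\<in>I. norm (A i (\<pi> i)))"
  proof (subst sum.reindex)
    show "inj_on (\<lambda>\<pi>. restrict \<pi> I) {\<pi>. \<pi> permutes I}"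
    proof (rule inj_onI, rule ext)
      fix p q x assume "p \<in> {\<pi>. \<pi> permutes I}" "q \<in> {\<pi>. \<pi> permutes I}" "restrict p I = restrict q I"
      then show "p x = q x" by (metis mem_Collect_eq permutes_not_in restrict_apply')
    qed
  qed (auto intro!: sum.cong prod.cong)
  also have "\<dots> \<le> (\<Sum>\<pi>\<in>PiE I (\<lambda>_. I). \<Prod>i\<in>I. norm (A i (\<pi> i)))"
    using assms by (intro sum_mono2) (auto simp: finite_PiE permutes_in_image intro!: prod_nonneg)
  also have "\<dots> = (\<Prod>i\<in>I. \<Sum>j\<in>I. norm (A i j))"
    by (rule prod_sum_PiE[symmetric]) (use assms in auto)
  finally show ?thesis .
qed

lemma det_on_row_diff:
  assumes fin: "finite I" and k: "k \<in> I"
    and eq: "!!i j. i ~= k ==> A i j = B i j"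
  shows "det_on I A - det_on I B = det_on I (\<lambda>i j. if i = k then A i j - B i j else A i j)"
proof -
  have *: "(\<Prod>i\<in>I. M i (\<pi> i)) = M k (\<pi> k) * (\<Prod>i\<in>I - {k}. M i (\<pi> i))"
    for M :: "nat => nat => complex" and \<pi> using fin k by (simp add: prod.remove)
  have e: "(\<Prod>i\<in>I - {k}. A i (\<pi> i)) = (\<Prod>i\<in>I - {k}. B i (\<pi> i))" for \<pi>
    by (rule prod.cong) (auto simp: eq)
  have e2: "(\<Prod>i\<in>I - {k}. if i = k then A i (\<pi> i) - B i (\<pi> i) else A i (\<pi> i)) =
    (\<Prod>i\<in>I - {k}. B i (\<pi> i))" for \<pi>
    by (rule prod.cong) (auto simp: eq)
  show ?thesis
    unfolding det_on_def sum_subtractf[symmetric]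
    by (rule sum.cong[OF refl], subst (1 2 3) *, subst e, subst e2) (simp add: algebra_simps)
qed

lemma norm_det_on_diff_le:
  fixes x d :: "nat => real"
  assumes fin: "finite I"
    and A: "!!i. i \<in> I ==> (\<Sum>j\<in>I. norm (A i j)) \<le> x i"
    and B: "!!i. i \<in> I ==> (\<Sum>j\<in>I. norm (B i j)) \<le> x i"
    and x: "!!i. i \<in> I ==> 1 \<le> x i"
    and d: "!!i. i \<in> I ==> (\<Sum>j\<in>I. norm (A i j - B i j)) \<le> d i"
  shows "norm (det_on I A - det_on I B) \<le> (\<Sum>i\<in>I. d i) * (\<Prod>i\<in>I. x i)"
proof -
  define M where "M J = (\<lambda>i j. if i \<in> J then A i j else B i j)" for J
  have "norm (det_on I (M J) - det_on I B) \<le> (\<Sum>i\<in>J. d i) * (\<Prod>i\<in>I. x i)" if "J \<subseteq> I" for J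
    using finite_subset[OF that fin] that
  proof (induction J rule: finite_induct)
    case empty
    then show ?case by (simp add: M_def)
  next
    case (insert k J)
    then have k: "k \<in> I" by auto
    let ?N = "\<lambda>i j. if i = k then M (insert k J) i j - M J i j else M (insert k J) i j"
    have "det_on I (M (insert k J)) - det_on I (M J) = det_on I ?N"
      by (rule det_on_row_diff[OF fin k]) (auto simp: M_def)
    moreover have "norm (det_on I ?N) \<le> d k * (\<Prod>i\<in>I. x i)"
    proof -
      have dk: "0 \<le> d k" using d[OF k] by (meson norm_ge_zero order_trans sum_nonneg)
      have "norm (det_on I ?N) \<le> (\<Prod>i\<in>I. \<Sum>j\<in>I. norm (?N i j))" by (rule norm_det_on_le[OF fin])
      also have "\<dots> = (\<Sum>j\<in>I. norm (?N k j)) * (\<Prod>i\<in>I - {k}. \<Sum>j\<in>I. norm (?N i j))"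
        using fin k by (simp add: prod.remove)
      also have "\<dots> \<le> d k * (\<Prod>i\<in>I - {k}. x i)"
      proof (intro mult_mono prod_mono conjI)
        show "(\<Sum>j\<in>I. norm (?N k j)) \<le> d k" using d[OF k] insert.hyps by (simp add: M_def)
        show "(\<Sum>j\<in>I. norm (?N i j)) \<le> x i" if "i \<in> I - {k}" for i
          using that A[of i] B[of i] by (cases "i \<in> J") (auto simp: M_def)
      qed (auto intro!: sum_nonneg prod_nonneg dk)
      also have "\<dots> \<le> d k * (x k * (\<Prod>i\<in>I - {k}. x i))"
      proof (intro mult_left_mono dk)
        have "0 \<le> (\<Prod>i\<in>I - {k}. x i)" using x by (intro prod_nonneg) force
        then show "(\<Prod>i\<in>I - {k}. x i) \<le> x k * (\<Prod>i\<in>I - {k}. x i)"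
          using x[OF k] mult_right_mono[of 1 "x k" "\<Prod>i\<in>I - {k}. x i"] by simp
      qed
      also have "\<dots> = d k * (\<Prod>i\<in>I. x i)" using fin k by (simp add: prod.remove)
      finally show ?thesis .
    qed
    moreover have "norm (det_on I (M (insert k J)) - det_on I B) \<le>
      norm (det_on I (M (insert k J)) - det_on I (M J)) + norm (det_on I (M J) - det_on I B)"
      by (metis dist_norm dist_triangle)
    ultimately show ?case using insert by (simp add: algebra_simps)
  qed
  from this[of I] have "norm (det_on I (M I) - det_on I B) \<le> (\<Sum>i\<in>I. d i) * (\<Prod>i\<in>I. x i)" by simp
  moreover have "det_on I (M I) = det_on I A" by (rule det_on_cong) (simp add: M_def)
  ultimately show ?thesis by simp
qed

lemma det_on_mult:
  "det_on {..<m} A * det_on {..<m} B = det_on {..<m} (\<lambda>i j. \<Sum>k<m. A i k * B k j)"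
proof -
  have "det (mat m m (\<lambda>(i, j). A i j)) * det (mat m m (\<lambda>(i, j). B i j)) =
    det (mat m m (\<lambda>(i, j). A i j) * mat m m (\<lambda>(i, j). B i j))"
    by (rule det_mult[symmetric]) auto
  also have "mat m m (\<lambda>(i, j). A i j) * mat m m (\<lambda>(i, j). B i j) =
    mat m m (\<lambda>(i, j). \<Sum>k<m. A i k * B k j)"
    by (rule eq_matI) (auto simp: scalar_prod_def atLeast0LessThan intro!: sum.cong)
  finally show ?thesis by (simp add: det_mat_eq_det_on)
qed

lemma det_on_zero_column:
  assumes "finite I" "k \<in> I" "!!i. i \<in> I ==> A i k = 0"
  shows "det_on I A = 0"
  unfolding det_on_def
proof (rule sum.neutral, clarify)
  fix \<pi> assume p: "\<pi> permutes I"
  then obtain i where "i \<in> I" "\<pi> i = k" using assms(2) by (metis permutes_image imageE)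
  then have "(\<Prod>i\<in>I. A i (\<pi> i)) = 0" using assms by (auto intro!: bexI[of _ i])
  then show "signof \<pi> * (\<Prod>i\<in>I. A i (\<pi> i)) = 0" by simp
qed

lemma det_on_unit_lower:
  assumes "!!i j. i < j ==> j < m ==> A i j = 0" "!!i. i < m ==> A i i = 1"
  shows "det_on {..<m} A = 1"
proof -
  have "det (mat m m (\<lambda>(i, j). A i j)) = prod_list (diag_mat (mat m m (\<lambda>(i, j). A i j)))"
    by (rule det_lower_triangular[of m]) (auto simp: assms)
  also have "diag_mat (mat m m (\<lambda>(i, j). A i j)) = map (\<lambda>_. 1) [0..<m]"
    unfolding diag_mat_def by (rule map_cong) (auto simp: assms)
  finally show ?thesis by (simp add: det_mat_eq_det_on map_replicate_const)
qed

lemma det_on_unit_upper: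
  assumes "!!i j. j < i ==> i < m ==> A i j = 0" "!!i. i < m ==> A i i = 1"
  shows "det_on {..<m} A = 1"
proof -
  have "det (mat m m (\<lambda>(i, j). A i j)) = prod_list (diag_mat (mat m m (\<lambda>(i, j). A i j)))"
    by (rule det_upper_triangular[of _ m]) (auto simp: assms upper_triangular_def)
  also have "diag_mat (mat m m (\<lambda>(i, j). A i j)) = map (\<lambda>_. 1) [0..<m]"
    unfolding diag_mat_def by (rule map_cong) (auto simp: assms)
  finally show ?thesis by (simp add: det_mat_eq_det_on map_replicate_const)
qed

text \<open>Entries that decay in the sum of the two indices. Such matrices are trace class for elementary
  reasons, and sums of products of their entries converge geometrically.\<close>

definition geo :: "real => real => (nat => nat => complex) => bool" where
  "geo C r A \<longleftrightarrow> 0 \<le> C \<and> 0 < r \<and> r < 1 \<and> (\<forall>p q. norm (A p q) \<le> C * r ^ (p + q))"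

lemma sum_geometric_le:
  fixes r :: real
  assumes "0 < r" "r < 1" "finite I"
  shows "(\<Sum>q\<in>I. r ^ q) \<le> 1 / (1 - r)"
proof -
  have "(\<Sum>q\<in>I. r ^ q) \<le> (\<Sum>q. r ^ q)"
    by (rule sum_le_suminf) (use assms in \<open>auto intro: summable_geometric\<close>)
  then show ?thesis using suminf_geometric[of r] assms by simp
qed

lemma geo_row_le:
  assumes "geo C r A" "finite I"
  shows "(\<Sum>q\<in>I. norm (A p q)) \<le> C / (1 - r) * r ^ p"
proof -
  have g: "0 \<le> C" "0 < r" "r < 1" "!!q. norm (A p q) \<le> C * r ^ (p + q)"
    using assms by (auto simp: geo_def)
  have "(\<Sum>q\<in>I. norm (A p q)) \<le> (\<Sum>q\<in>I. C * r ^ p * r ^ q)"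
    by (intro sum_mono) (use g(4) in \<open>auto simp: power_add algebra_simps\<close>)
  also have "\<dots> = C * r ^ p * (\<Sum>q\<in>I. r ^ q)" by (simp add: sum_distrib_left)
  also have "\<dots> \<le> C * r ^ p * (1 / (1 - r))"
    by (intro mult_left_mono sum_geometric_le) (use g assms in auto)
  finally show ?thesis by (simp add: field_simps)
qed

lemma prod_geometric_le:
  fixes r :: real
  assumes "0 \<le> K" "0 < r" "r < 1" "finite I"
  shows "(\<Prod>p\<in>I. 1 + K * r ^ p) \<le> exp (K / (1 - r))"
proof -
  have "(\<Prod>p\<in>I. 1 + K * r ^ p) \<le> exp (\<Sum>p\<in>I. K * r ^ p)"
    by (rule prod_le_exp_sum) (use assms in auto)
  also have "(\<Sum>p\<in>I. K * r ^ p) = K * (\<Sum>p\<in>I. r ^ p)" by (simp add: sum_distrib_left)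
  also have "\<dots> \<le> K * (1 / (1 - r))"
    by (intro mult_left_mono sum_geometric_le assms)
  finally show ?thesis by simp
qed

lemma geo_one_plus_row_le:
  assumes "geo C r A" "finite I"
  shows "(\<Sum>q\<in>I. norm (one_plus A p q)) \<le> 1 + C / (1 - r) * r ^ p"
proof -
  have "(\<Sum>q\<in>I. norm (one_plus A p q)) \<le> (\<Sum>q\<in>I. (if p = q then 1 else 0) + norm (A p q))"
    by (intro sum_mono) (auto simp: one_plus_def intro: norm_triangle_le)
  also have "\<dots> \<le> 1 + C / (1 - r) * r ^ p"
    unfolding sum.distrib using geo_row_le[OF assms] assms(2) by (intro add_mono) auto
  finally show ?thesis .
qed

text \<open>Every minor is at most a product of geometric row bounds over its index set, and
  the sum of these products over all finite sets is an infinite product.\<close>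

lemma geo_minors_summable:
  assumes "geo C r A"
  shows "(\<lambda>S. norm (det_on S A)) summable_on {S. finite S}"
proof (rule nonneg_bdd_above_summable_on)
  define K where "K = C / (1 - r)"
  have K: "0 \<le> K" "0 < r" "r < 1" using assms by (auto simp: geo_def K_def)
  show "bdd_above (sum (\<lambda>S. norm (det_on S A)) ` {F. F \<subseteq> {S. finite S} \<and> finite F})"
  proof (rule bdd_aboveI2)
    fix F assume "F \<in> {F. F \<subseteq> {S::nat set. finite S} \<and> finite F}"
    then have F: "finite F" "!!S. S \<in> F ==> finite S" by auto
    define U where "U = \<Union>F"
    have U: "finite U" using F by (auto simp: U_def)
    have "(\<Sum>S\<in>F. norm (det_on S A)) \<le> (\<Sum>S\<in>F. \<Prod>p\<in>S. K * r ^ p)"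
    proof (rule sum_mono)
      fix S assume S: "S \<in> F"
      show "norm (det_on S A) \<le> (\<Prod>p\<in>S. K * r ^ p)"
        by (rule order_trans[OF norm_det_on_le[OF F(2)[OF S]]], rule prod_mono)
          (use geo_row_le[OF assms F(2)[OF S]] K in \<open>auto simp: K_def intro: sum_nonneg\<close>)
    qed
    also have "\<dots> \<le> (\<Sum>S\<in>Pow U. \<Prod>p\<in>S. K * r ^ p)"
      by (rule sum_mono2) (use U K in \<open>auto simp: U_def intro!: prod_nonneg\<close>)
    also have "\<dots> = (\<Prod>p\<in>U. K * r ^ p + 1)" by (subst prod_add[OF U]) simp
    also have "\<dots> \<le> exp (K / (1 - r))"
      using prod_geometric_le[OF K U] by (simp add: add.commute)
    finally show "(\<Sum>S\<in>F. norm (det_on S A)) \<le> exp (K / (1 - r))" .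
  qed
qed auto

text \<open>The leading minor is the sum of the principal minors of the perturbation over the
  subsets of \<open>{..<M}\<close>, a part of an absolutely convergent sum over all finite sets.\<close>

lemma det_on_tendsto_fredholm_det:
  assumes "geo C r A"
  shows "(\<lambda>M. det_on {..<M} (one_plus A)) \<longlonglongrightarrow> fredholm_det A"
proof -
  have "((\<lambda>F. \<Sum>S\<in>F. det_on S A) \<longlongrightarrow> fredholm_det A) (finite_subsets_at_top {S. finite S})"
    unfolding fredholm_det_eq
    by (rule infsum_tendsto, rule abs_summable_summable) (use geo_minors_summable[OF assms] in simp)
  moreover have "filterlim (\<lambda>M. Pow {..<M}) (finite_subsets_at_top {S::nat set. finite S}) sequentially"
    unfolding filterlim_finite_subsets_at_top
  proof (intro allI impI)
    fix X :: "nat set set" assume X: "finite X \<and> X \<subseteq> {S. finite S}"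
    then have "finite (\<Union>X)" by auto
    then obtain m where m: "!!p. p \<in> \<Union>X ==> p < m" using finite_nat_bounded[of "\<Union>X"] by (auto simp: subset_iff)
    show "\<forall>\<^sub>F M in sequentially. finite (Pow {..<M}) \<and> X \<subseteq> Pow {..<M} \<and> Pow {..<M} \<subseteq> {S. finite S}"
      using eventually_ge_at_top[of m]
    proof eventually_elim
      case (elim M)
      have "S \<subseteq> {..<M}" if "S \<in> X" for S
        using m that elim by fastforce
      then show ?case by (auto intro: finite_subset[OF _ finite_lessThan])
    qed
  qed
  ultimately have "(\<lambda>M. \<Sum>S\<in>Pow {..<M}. det_on S A) \<longlonglongrightarrow> fredholm_det A"
    by (rule filterlim_compose)
  then show ?thesis by (simp add: det_on_one_plus)
qed

definition delta :: "nat => nat => complex" where "delta p q = (if p = q then 1 else 0)"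

lemma one_plus_eq: "one_plus A p q = delta p q + A p q" by (simp add: one_plus_def delta_def)

lemma geo_weaken: "geo C r A ==> C \<le> C' ==> (!!p q. norm (B p q) \<le> norm (A p q)) ==> geo C' r B"
  unfolding geo_def
proof (intro conjI allI; elim conjE)
  fix p q assume *: "C \<le> C'" "!!p q. norm (B p q) \<le> norm (A p q)" "0 < r"
    "\<forall>p q. norm (A p q) \<le> C * r ^ (p + q)"
  have "norm (B p q) \<le> C * r ^ (p + q)" using * by (meson order_trans)
  also have "\<dots> \<le> C' * r ^ (p + q)" using * by (intro mult_right_mono) auto
  finally show "norm (B p q) \<le> C' * r ^ (p + q)" .
qed auto

text \<open>Cutting off the product of two such matrices costs \<open>r\<^sup>M\<close>: only the terms with an inner
  index beyond \<open>M\<close> are lost.\<close>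

lemma geo_product_tail:
  assumes A: "geo C r A" and B: "geo C r B"
  assumes inv: "(\<lambda>k. one_plus A p k * one_plus B k q) sums s"
  assumes M: "p < M" "q < M"
  shows "norm (s - (\<Sum>k<M. one_plus A p k * one_plus B k q)) \<le> C\<^sup>2 / (1 - r) * r ^ (p + q) * r ^ M"
proof -
  have g: "0 \<le> C" "0 < r" "r < 1" "!!p q. norm (A p q) \<le> C * r ^ (p + q)"
    "!!p q. norm (B p q) \<le> C * r ^ (p + q)"
    using A B by (auto simp: geo_def)
  let ?f = "\<lambda>k. one_plus A p k * one_plus B k q"
  have s: "(\<lambda>k. ?f (k + M)) sums (s - (\<Sum>k<M. ?f k))" by (rule sums_split_initial_segment[OF inv])
  have b: "norm (?f (k + M)) \<le> C\<^sup>2 * r ^ (p + q) * r ^ M * r ^ k" for k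
  proof -
    have "?f (k + M) = A p (k + M) * B (k + M) q" using M by (simp add: one_plus_def)
    then have "norm (?f (k + M)) \<le> (C * r ^ (p + (k + M))) * (C * r ^ (k + M + q))"
      using g by (auto simp: norm_mult intro!: mult_mono)
    also have "\<dots> = C\<^sup>2 * r ^ (p + q) * (r ^ M * r ^ k) * (r ^ M * r ^ k)"
      by (simp add: power_add power2_eq_square)
    also have "\<dots> \<le> C\<^sup>2 * r ^ (p + q) * (r ^ M * r ^ k) * 1"
      using g by (intro mult_left_mono mult_le_one) (auto intro: power_le_one)
    finally show ?thesis by simp
  qed
  have "norm (\<Sum>k. ?f (k + M)) \<le> (\<Sum>k. C\<^sup>2 * r ^ (p + q) * r ^ M * r ^ k)"
    by (rule norm_suminf_le[OF b]) (use g in \<open>auto intro!: summable_mult summable_geometric\<close>)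
  also have "\<dots> = C\<^sup>2 * r ^ (p + q) * r ^ M * (1 / (1 - r))"
    using g by (subst suminf_mult) (auto simp: suminf_geometric summable_geometric)
  finally show ?thesis unfolding sums_unique[OF s, symmetric] by (simp add: field_simps)
qed

text \<open>Jacobi's identity for complementary minors in infinite dimension. In a section of
  size \<open>M\<close> replace the last \<open>M - m\<close> columns of the identity by those of the inverse: multiplying by
  \<open>1 + A\<close> leaves a block triangular matrix up to an error that vanishes as \<open>M\<close> grows.\<close>

theorem det_on_eq_complementary_fredholm_det:
  assumes A: "geo C r A" and B: "geo C r B"
  assumes inv: "!!p q. (\<lambda>k. one_plus A p k * one_plus B k q) sums delta p q"
  shows "det_on {..<m} (one_plus A) =
    fredholm_det A * fredholm_det (\<lambda>p q. if min p q < m then 0 else B p q)"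
proof -
  have g: "0 \<le> C" "0 < r" "r < 1" using A by (auto simp: geo_def)
  define B1 where "B1 p q = (if q < m then 0 else B p q)" for p q
  define A1 where "A1 p q = (if q < m then A p q else 0)" for p q
  have B1: "geo C r B1" by (rule geo_weaken[OF B]) (auto simp: B1_def)
  have A1: "geo C r A1" by (rule geo_weaken[OF A]) (auto simp: A1_def)
  have fB: "fredholm_det (\<lambda>p q. if min p q < m then 0 else B p q) = fredholm_det B1"
    unfolding fredholm_det_eq
  proof (rule infsum_cong)
    fix S :: "nat set" assume "S \<in> {S. finite S}"
    then have S: "finite S" by simp
    show "det_on S (\<lambda>p q. if min p q < m then 0 else B p q) = det_on S B1"
    proof (cases "\<exists>k\<in>S. k < m")
      case True
      then obtain k where "k \<in> S" "k < m" by auto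
      then show ?thesis using S det_on_zero_column[of S k] by (simp add: B1_def)
    next
      case False
      then show ?thesis by (intro det_on_cong) (auto simp: B1_def min_def)
    qed
  qed
  have dA: "det_on {..<M} (one_plus A1) = det_on {..<m} (one_plus A)" if "m \<le> M" for M
  proof -
    have "(\<Sum>S\<in>Pow {..<M}. det_on S A1) = (\<Sum>S\<in>Pow {..<m}. det_on S A)"
    proof (rule sum.mono_neutral_cong_right)
      show "\<forall>S\<in>Pow {..<M} - Pow {..<m}. det_on S A1 = 0"
      proof
        fix S assume S: "S \<in> Pow {..<M} - Pow {..<m}"
        then obtain k where "k \<in> S" "\<not> k < m" by auto
        moreover have "finite S" using S by (auto intro: finite_subset)
        ultimately show "det_on S A1 = 0" using det_on_zero_column[of S k] by (simp add: A1_def)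
      qed
      show "det_on S A1 = det_on S A" if "S \<in> Pow {..<m}" for S
        using that by (intro det_on_cong) (auto simp: A1_def)
    qed (use that in auto)
    then show ?thesis by (simp add: det_on_one_plus)
  qed
  define T where "T M = (\<lambda>i j. \<Sum>k<M. one_plus A i k * one_plus B1 k j)" for M
  define R where "R = C\<^sup>2 / (1 - r)"
  have R: "0 \<le> R" using g by (simp add: R_def)
  have diff: "norm (T M p q - one_plus A1 p q) \<le> R * r ^ (p + q) * r ^ M" if "p < M" "q < M" for M p q
  proof (cases "q < m")
    case True
    have "T M p q = (\<Sum>k<M. if k = q then one_plus A p k else 0)"
      unfolding T_def using True by (intro sum.cong) (auto simp: one_plus_def B1_def)
    also have "\<dots> = one_plus A p q" using that by simp
    also have "\<dots> = one_plus A1 p q" using True by (simp add: one_plus_def A1_def)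
    finally show ?thesis using R g by simp
  next
    case False
    have "T M p q = (\<Sum>k<M. one_plus A p k * one_plus B k q)"
      unfolding T_def using False by (intro sum.cong) (auto simp: one_plus_def B1_def)
    moreover have "one_plus A1 p q = delta p q" using False by (simp add: one_plus_def A1_def delta_def)
    ultimately show ?thesis
      using geo_product_tail[OF A B inv that] by (simp add: norm_minus_commute R_def)
  qed
  define x where "x p = 1 + (C + R) / (1 - r) * r ^ p" for p
  define Z where "Z = exp ((C + R) / (1 - r) / (1 - r)) * (R / (1 - r) / (1 - r))"
  have row: "(\<Sum>q<M. norm (T M p q - one_plus A1 p q)) \<le> R / (1 - r) * r ^ M * r ^ p" if "p < M" for M p
  proof -
    have "(\<Sum>q<M. norm (T M p q - one_plus A1 p q)) \<le> (\<Sum>q<M. R * r ^ p * r ^ M * r ^ q)"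
      by (rule sum_mono) (use diff[OF that] in \<open>auto simp: power_add algebra_simps\<close>)
    also have "\<dots> = R * r ^ p * r ^ M * (\<Sum>q<M. r ^ q)" by (simp add: sum_distrib_left)
    also have "\<dots> \<le> R * r ^ p * r ^ M * (1 / (1 - r))"
      using g R by (intro mult_left_mono sum_geometric_le) auto
    finally show ?thesis by (simp add: field_simps)
  qed
  have bnd: "norm (det_on {..<M} (T M) - det_on {..<M} (one_plus A1)) \<le> Z * r ^ M" for M
  proof -
    have "norm (det_on {..<M} (T M) - det_on {..<M} (one_plus A1)) \<le>
      (\<Sum>p<M. R / (1 - r) * r ^ M * r ^ p) * (\<Prod>p<M. x p)"
    proof (rule norm_det_on_diff_le)
      fix p assume "p \<in> {..<M}"
      then have p: "p < M" by simp
      show "(\<Sum>j<M. norm (T M p j - one_plus A1 p j)) \<le> R / (1 - r) * r ^ M * r ^ p"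
        by (rule row[OF p])
      have o: "(\<Sum>q<M. norm (one_plus A1 p q)) \<le> 1 + C / (1 - r) * r ^ p"
        by (rule geo_one_plus_row_le[OF A1]) simp
      have "C / (1 - r) * r ^ p \<le> (C + R) / (1 - r) * r ^ p"
        using g R by (intro mult_right_mono divide_right_mono) auto
      then show "(\<Sum>q<M. norm (one_plus A1 p q)) \<le> x p" using o by (simp add: x_def)
      have "(\<Sum>q<M. norm (T M p q)) \<le>
          (\<Sum>q<M. norm (T M p q - one_plus A1 p q) + norm (one_plus A1 p q))"
        by (intro sum_mono) (metis diff_add_cancel norm_triangle_ineq)
      also have "\<dots> \<le> R / (1 - r) * r ^ M * r ^ p + (1 + C / (1 - r) * r ^ p)"
        unfolding sum.distrib using row[OF p] o by (intro add_mono) auto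
      also have "R / (1 - r) * r ^ M * r ^ p \<le> R / (1 - r) * 1 * r ^ p"
        using g R by (intro mult_right_mono mult_left_mono) (auto intro: power_le_one)
      finally show "(\<Sum>q<M. norm (T M p q)) \<le> x p" by (simp add: x_def add_divide_distrib algebra_simps)
      show "1 \<le> x p" using g R by (auto simp: x_def)
    qed simp
    also have "(\<Prod>p<M. x p) \<le> exp ((C + R) / (1 - r) / (1 - r))"
      unfolding x_def by (rule prod_geometric_le) (use g R in auto)
    also have "(\<Sum>p<M. R / (1 - r) * r ^ M * r ^ p) = R / (1 - r) * r ^ M * (\<Sum>p<M. r ^ p)"
      by (simp add: sum_distrib_left)
    also have "\<dots> * exp ((C + R) / (1 - r) / (1 - r)) \<le>
        R / (1 - r) * r ^ M * (1 / (1 - r)) * exp ((C + R) / (1 - r) / (1 - r))"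
      using g R by (intro mult_right_mono mult_left_mono sum_geometric_le) auto
    also have "\<dots> = Z * r ^ M" by (simp add: Z_def field_simps)
    finally show ?thesis using g R by (simp add: mult_left_mono sum_nonneg)
  qed
  have "(\<lambda>M. det_on {..<M} (T M) - det_on {..<M} (one_plus A1)) \<longlonglongrightarrow> 0"
  proof (rule Lim_null_comparison[OF always_eventually])
    show "\<forall>M. norm (det_on {..<M} (T M) - det_on {..<M} (one_plus A1)) \<le> Z * r ^ M" using bnd by simp
    show "(\<lambda>M. Z * r ^ M) \<longlonglongrightarrow> 0" using g by (intro tendsto_mult_right_zero LIMSEQ_power_zero) auto
  qed
  then have "(\<lambda>M. det_on {..<M} (T M) - det_on {..<m} (one_plus A)) \<longlonglongrightarrow> 0"
    by (rule Lim_transform_eventually) (rule eventually_mono[OF eventually_ge_at_top[of m]], simp add: dA)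
  moreover have "det_on {..<M} (T M) = det_on {..<M} (one_plus A) * det_on {..<M} (one_plus B1)" for M
    by (simp add: det_on_mult T_def)
  moreover have "(\<lambda>M. det_on {..<M} (one_plus A) * det_on {..<M} (one_plus B1))
      \<longlonglongrightarrow> fredholm_det A * fredholm_det B1"
    by (intro tendsto_mult det_on_tendsto_fredholm_det[OF A] det_on_tendsto_fredholm_det[OF B1])
  ultimately have "fredholm_det A * fredholm_det B1 = det_on {..<m} (one_plus A)"
    by (auto dest!: LIM_zero_cancel dest: LIMSEQ_unique)
  then show ?thesis using fB by simp
qed

text \<open>Used to extract a limit from the inverses of the finite sections.\<close>

lemma diagonal_convergent:
  fixes f :: "nat => nat => complex"
  assumes bd: "!!M n. norm (f M n) \<le> b n"
  shows "\<exists>s. strict_mono s \<and> (\<forall>n. convergent (\<lambda>k. f (s k) n))"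
proof -
  interpret subseqs "\<lambda>n s. convergent (\<lambda>k. f (s k) n)"
  proof
    fix n and s :: "nat => nat" assume "strict_mono s"
    have "\<forall>k. f (s k) n \<in> cball 0 (b n)" using bd by simp
    then obtain l r where "strict_mono r" "((\<lambda>k. f (s k) n) \<circ> r) \<longlonglongrightarrow> l"
      using compact_cball[of 0 "b n"] unfolding compact_def by meson
    then show "\<exists>r'. strict_mono r' \<and> convergent (\<lambda>k. f ((s \<circ> r') k) n)"
      by (auto simp: o_def convergent_def)
  qed
  have "convergent (\<lambda>k. f (diagseq k) n)" for n
  proof -
    have "convergent (\<lambda>k. f ((diagseq \<circ> (+) (Suc n)) k) n)"
    proof (rule diagseq_holds)
      fix n :: nat and s r :: "nat => nat"
      assume "strict_mono r" "convergent (\<lambda>k. f (s k) n)"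
      then show "convergent (\<lambda>k. f ((s \<circ> r) k) n)"
        using LIMSEQ_subseq_LIMSEQ[of "\<lambda>k. f (s k) n" _ r] by (auto simp: convergent_def o_def)
    qed
    then obtain l where "(\<lambda>k. f (diagseq (Suc n + k)) n) \<longlonglongrightarrow> l" by (auto simp: convergent_def o_def)
    then have "(\<lambda>k. f (diagseq (k + Suc n)) n) \<longlonglongrightarrow> l" by (simp add: add.commute)
    then have "(\<lambda>k. f (diagseq k) n) \<longlonglongrightarrow> l" by (rule LIMSEQ_offset)
    then show ?thesis by (auto simp: convergent_def)
  qed
  then show ?thesis using subseq_diagseq by blast
qed

text \<open>The bound does not depend on the size of the section, which makes the inverses of the sections
  uniformly bounded.\<close>

lemma cofactor_bound:
  assumes A: "geo C r A" and ij: "i < m" "j < m"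
  shows "norm (cofactor (mat m m (\<lambda>(i, j). one_plus A i j)) i j) \<le> exp (C / (1 - r) / (1 - r))"
proof -
  have g: "0 \<le> C" "0 < r" "r < 1" using A by (auto simp: geo_def)
  let ?e = "\<lambda>k::nat. if k < i then k else Suc k" and ?c = "\<lambda>k::nat. if k < j then k else Suc k"
  have "mat_delete (mat m m (\<lambda>(i, j). one_plus A i j)) i j =
      mat (m - 1) (m - 1) (\<lambda>(k, l). one_plus A (?e k) (?c l))"
    by (rule eq_matI) (auto simp: mat_delete_def)
  then have "norm (cofactor (mat m m (\<lambda>(i, j). one_plus A i j)) i j) =
      norm (det_on {..<m - 1} (\<lambda>k l. one_plus A (?e k) (?c l)))"
    unfolding cofactor_def
    using det_mat_eq_det_on[of "m - 1" "\<lambda>k l. one_plus A (?e k) (?c l)"]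
    by (simp add: norm_mult norm_power)
  also have "\<dots> \<le> (\<Prod>k<m - 1. \<Sum>l<m - 1. norm (one_plus A (?e k) (?c l)))"
    by (rule norm_det_on_le) simp
  also have "\<dots> \<le> (\<Prod>k<m - 1. 1 + C / (1 - r) * r ^ k)"
  proof (intro prod_mono conjI sum_nonneg)
    fix k
    have "inj_on ?c {..<m - 1}" by (auto simp: inj_on_def split: if_splits)
    then have "(\<Sum>l<m - 1. norm (one_plus A (?e k) (?c l))) =
        (\<Sum>q\<in>?c ` {..<m - 1}. norm (one_plus A (?e k) q))" by (subst sum.reindex) (auto simp: o_def)
    also have "\<dots> \<le> 1 + C / (1 - r) * r ^ ?e k" by (rule geo_one_plus_row_le[OF A]) simp
    also have "r ^ ?e k \<le> r ^ k" using g by (intro power_decreasing) auto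
    then have "1 + C / (1 - r) * r ^ ?e k \<le> 1 + C / (1 - r) * r ^ k"
      using g by (intro add_left_mono mult_left_mono) auto
    finally show "(\<Sum>l<m - 1. norm (one_plus A (?e k) (?c l))) \<le> 1 + C / (1 - r) * r ^ k" .
  qed simp
  also have "\<dots> \<le> exp (C / (1 - r) / (1 - r))" by (rule prod_geometric_le) (use g in auto)
  finally show ?thesis .
qed

text \<open>The decay of \<open>N - 1\<close> comes from \<open>N - 1 = A N A - A\<close>, with the middle factor bounded by Cramer's
  rule.\<close>

lemma truncated_inverse:
  assumes A: "geo C r A" and d: "0 < d" "d \<le> norm (det_on {..<m} (one_plus A))"
  defines "E \<equiv> exp (C / (1 - r) / (1 - r)) / d"
  shows "\<exists>N. (\<forall>p<m. \<forall>q<m. (\<Sum>k<m. one_plus A p k * N k q) = delta p q) \<and>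
    (\<forall>p<m. \<forall>q<m. (\<Sum>k<m. N p k * one_plus A k q) = delta p q) \<and>
    (\<forall>p<m. \<forall>q<m. norm (N p q - delta p q) \<le> (C + C\<^sup>2 * E / (1 - r) / (1 - r)) * r ^ (p + q))"
proof -
  have g: "0 \<le> C" "0 < r" "r < 1" "!!p q. norm (A p q) \<le> C * r ^ (p + q)" using A by (auto simp: geo_def)
  define X where "X = mat m m (\<lambda>(i, j). one_plus A i j)"
  have X: "X \<in> carrier_mat m m" by (simp add: X_def)
  have Xe: "X $$ (i, j) = one_plus A i j" if "i < m" "j < m" for i j using that by (simp add: X_def)
  define D where "D = det X"
  have D: "D = det_on {..<m} (one_plus A)" unfolding D_def X_def by (rule det_mat_eq_det_on)
  have D0: "D ~= 0" "d \<le> norm D" using d D by auto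
  note adj = adj_mat[OF X]
  define N where "N p q = adj_mat X $$ (p, q) / D" for p q
  have r1: "(\<Sum>k<m. one_plus A p k * N k q) = delta p q" if "p < m" "q < m" for p q
  proof -
    have "(X * adj_mat X) $$ (p, q) = (\<Sum>k<m. one_plus A p k * adj_mat X $$ (k, q))"
      using that X adj(1) by (auto simp: scalar_prod_def atLeast0LessThan Xe intro!: sum.cong)
    then have "(\<Sum>k<m. one_plus A p k * adj_mat X $$ (k, q)) = D * delta p q"
      using that by (simp add: adj(2) D_def delta_def)
    then have "(\<Sum>k<m. one_plus A p k * adj_mat X $$ (k, q)) / D = delta p q" using D0 by simp
    then show ?thesis unfolding N_def by (simp add: sum_divide_distrib)
  qed
  have r2: "(\<Sum>k<m. N p k * one_plus A k q) = delta p q" if "p < m" "q < m" for p q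
  proof -
    have "(adj_mat X * X) $$ (p, q) = (\<Sum>k<m. adj_mat X $$ (p, k) * one_plus A k q)"
      using that X adj(1) by (auto simp: scalar_prod_def atLeast0LessThan Xe intro!: sum.cong)
    then have "(\<Sum>k<m. adj_mat X $$ (p, k) * one_plus A k q) = D * delta p q"
      using that by (simp add: adj(3) D_def delta_def)
    then have "(\<Sum>k<m. adj_mat X $$ (p, k) * one_plus A k q) / D = delta p q" using D0 by simp
    then show ?thesis unfolding N_def by (simp add: sum_divide_distrib)
  qed
  have b: "norm (N p q) \<le> E" if "p < m" "q < m" for p q
  proof -
    have "norm (N p q) = norm (cofactor X q p) / norm D"
      using that X by (simp add: N_def adj_mat_def norm_divide)
    also have "\<dots> \<le> exp (C / (1 - r) / (1 - r)) / d"
      using cofactor_bound[OF A that(2,1)] D0 d by (intro frac_le) (auto simp: X_def)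
    finally show ?thesis by (simp add: E_def)
  qed
  have E: "0 \<le> E" using d by (simp add: E_def)
  have exp1: "(\<Sum>k<m. one_plus A p k * f k) = f p + (\<Sum>k<m. A p k * f k)" if "p < m" for p f
  proof -
    have "(\<Sum>k<m. one_plus A p k * f k) = (\<Sum>k<m. (if p = k then f k else 0) + A p k * f k)"
      by (intro sum.cong) (auto simp: one_plus_def algebra_simps)
    then show ?thesis using that by (simp add: sum.distrib)
  qed
  have exp2: "(\<Sum>k<m. f k * one_plus A k q) = f q + (\<Sum>k<m. f k * A k q)" if "q < m" for q f
  proof -
    have "(\<Sum>k<m. f k * one_plus A k q) = (\<Sum>k<m. (if k = q then f k else 0) + f k * A k q)"
      by (intro sum.cong) (auto simp: one_plus_def algebra_simps)
    then show ?thesis using that by (simp add: sum.distrib)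
  qed
  have "norm (N p q - delta p q) \<le> (C + C\<^sup>2 * E / (1 - r) / (1 - r)) * r ^ (p + q)"
    if pq: "p < m" "q < m" for p q
  proof -
    have n2: "N k q = delta k q - (\<Sum>l<m. N k l * A l q)" if "k < m" for k
      using exp2[OF pq(2), of "N k"] r2[OF that pq(2)] by (simp add: algebra_simps)
    have "N p q - delta p q = - (\<Sum>k<m. A p k * N k q)"
      using exp1[OF pq(1), of "\<lambda>k. N k q"] r1[OF pq] by (simp add: algebra_simps)
    also have "(\<Sum>k<m. A p k * N k q) = (\<Sum>k<m. A p k * (delta k q - (\<Sum>l<m. N k l * A l q)))"
      by (intro sum.cong refl) (subst n2, auto)
    also have "\<dots> = (\<Sum>k<m. (if k = q then A p k else 0) - A p k * (\<Sum>l<m. N k l * A l q))"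
      by (intro sum.cong refl) (simp add: delta_def right_diff_distrib)
    also have "\<dots> = A p q - (\<Sum>k<m. \<Sum>l<m. A p k * N k l * A l q)"
      using pq by (simp add: sum_subtractf sum_distrib_left mult.assoc)
    finally have e: "N p q - delta p q = - (A p q - (\<Sum>k<m. \<Sum>l<m. A p k * N k l * A l q))" .
    have "norm (N p q - delta p q) \<le>
        norm (A p q) + norm (\<Sum>k<m. \<Sum>l<m. A p k * N k l * A l q)"
      unfolding e norm_minus_cancel by (rule norm_triangle_ineq4)
    also have "norm (\<Sum>k<m. \<Sum>l<m. A p k * N k l * A l q) \<le>
        (\<Sum>k<m. \<Sum>l<m. (C * r ^ (p + k)) * E * (C * r ^ (l + q)))"
    proof (intro sum_norm_le)
      fix k l assume "k \<in> {..<m}" "l \<in> {..<m}"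
      then show "norm (A p k * N k l * A l q) \<le> (C * r ^ (p + k)) * E * (C * r ^ (l + q))"
        unfolding norm_mult using g b E by (intro mult_mono mult_nonneg_nonneg) auto
    qed
    also have "\<dots> = C\<^sup>2 * E * r ^ (p + q) * ((\<Sum>k<m. r ^ k) * (\<Sum>l<m. r ^ l))"
      unfolding sum_product by (simp add: sum_distrib_left power_add power2_eq_square mult_ac)
    also have "\<dots> \<le> C\<^sup>2 * E * r ^ (p + q) * ((1 / (1 - r)) * (1 / (1 - r)))"
      using g E by (intro mult_left_mono mult_mono sum_geometric_le) (auto intro: sum_nonneg)
    finally show ?thesis using g(4)[of p q] by (simp add: algebra_simps)
  qed
  with r1 r2 show ?thesis by (intro exI[of _ N]) blast
qed

text \<open>Dominated convergence for the series that express that a limit of inverses is an inverse.\<close>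

lemma geo_tannery:
  fixes f :: "nat => nat => complex"
  assumes lim: "!!k. (\<lambda>n. f n k) \<longlonglongrightarrow> g k"
    and bd: "!!n k. norm (f n k) \<le> (if k = p then K else 0) + K * r ^ k"
    and r: "0 < r" "r < 1" and s: "!!n. n \<ge> nb ==> (\<lambda>k. f n k) sums s"
  shows "g sums s"
proof -
  have sm: "summable (\<lambda>k. (if k = p then K else 0) + K * r ^ k)"
    using r by (intro summable_add summable_mult summable_geometric)
      (auto intro: summable_finite[of "{p}"])
  have "\<forall>\<^sub>F (k, n) in at_top \<times>\<^sub>F sequentially. norm (f n k) \<le> (if k = p then K else 0) + K * r ^ k"
    using bd by (intro always_eventually) auto
  from tannerys_theorem[of "\<lambda>k n. f n k" g sequentially, OF lim this sm]
  have "summable (\<lambda>n. norm (g n))" "(\<lambda>n. \<Sum>k. f n k) \<longlonglongrightarrow> suminf g"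
    by auto
  moreover have "(\<lambda>n. \<Sum>k. f n k) \<longlonglongrightarrow> s"
    using s by (intro tendsto_eventually eventually_sequentiallyI[of nb]) (simp add: sums_iff)
  ultimately show ?thesis using LIMSEQ_unique summable_norm_cancel by (auto simp: sums_iff)
qed

text \<open>The finite sections have determinants bounded away from 0, hence inverses with uniform
  decay, and a diagonal subsequence of these converges entrywise to the inverse.\<close>

theorem fredholm_alternative:
  assumes A: "geo C r A" and nz: "fredholm_det A ~= 0"
  shows "\<exists>C' B. geo C' r B \<and> (\<forall>p q. (\<lambda>k. one_plus A p k * one_plus B k q) sums delta p q) \<and>
    (\<forall>p q. (\<lambda>k. one_plus B p k * one_plus A k q) sums delta p q)"
proof -
  have g: "0 \<le> C" "0 < r" "r < 1" "!!p q. norm (A p q) \<le> C * r ^ (p + q)" using A by (auto simp: geo_def)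
  define d where "d = norm (fredholm_det A) / 2"
  have d: "0 < d" "d < norm (fredholm_det A)" using nz by (auto simp: d_def)
  have "\<forall>\<^sub>F m in sequentially. d < norm (det_on {..<m} (one_plus A))"
    using tendsto_norm[OF det_on_tendsto_fredholm_det[OF A]] d(2) by (rule order_tendstoD)
  then obtain m0 where m0: "!!m. m \<ge> m0 ==> d \<le> norm (det_on {..<m} (one_plus A))"
    by (force simp: eventually_sequentially)
  define E where "E = exp (C / (1 - r) / (1 - r)) / d"
  define K where "K = C + C\<^sup>2 * E / (1 - r) / (1 - r)"
  have K: "0 \<le> K" using g d by (auto simp: K_def E_def)
  define good where "good m N \<longleftrightarrow>
      (\<forall>p<m. \<forall>q<m. (\<Sum>k<m. one_plus A p k * N k q) = delta p q) \<and>
      (\<forall>p<m. \<forall>q<m. (\<Sum>k<m. N p k * one_plus A k q) = delta p q) \<and>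
      (\<forall>p<m. \<forall>q<m. norm (N p q - delta p q) \<le> K * r ^ (p + q))" for m N
  have "\<exists>N. m \<ge> m0 --> good m N" for m
    using truncated_inverse[OF A d(1), of m, folded E_def, folded K_def] m0[of m]
    unfolding good_def by blast
  then obtain N where N: "!!m. m \<ge> m0 ==> good m (N m)" by metis
  define F where "F m p q = (if m \<ge> m0 \<and> p < m \<and> q < m then N m p q - delta p q else 0)" for m p q
  have F: "norm (F m p q) \<le> K * r ^ (p + q)" for m p q
    using N[of m] K g by (auto simp: F_def good_def)
  obtain s where s: "strict_mono s"
    "!!n. convergent (\<lambda>k. F (s k) (fst (prod_decode n)) (snd (prod_decode n)))"
    using diagonal_convergent[of "\<lambda>m n. F m (fst (prod_decode n)) (snd (prod_decode n))", OF F] by blast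
  have "\<exists>l. (\<lambda>k. F (s k) p q) \<longlonglongrightarrow> l" for p q
    using s(2)[of "prod_encode (p, q)"] by (simp add: convergent_def)
  then obtain B where B: "!!p q. (\<lambda>k. F (s k) p q) \<longlonglongrightarrow> B p q" by metis
  have Bb: "norm (B p q) \<le> K * r ^ (p + q)" for p q
    by (rule Lim_norm_ubound[OF _ B]) (auto simp: F)
  have gB: "geo K r B" using K g Bb by (simp add: geo_def)
  have s_ge: "k \<le> s k" for k using s(1) by (rule strict_mono_imp_increasing)
  have cut: "(\<lambda>n. if k < s n then x else 0) \<longlonglongrightarrow> x" for x :: complex and k
    by (rule tendsto_eventually, rule eventually_sequentiallyI[of "Suc k"]) (use s_ge in \<open>simp add: less_le_trans Suc_le_eq\<close>)
  define R where "R = (1 + C) * (1 + K)"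
  have one_bd: "norm (one_plus G p q) \<le> (if q = p then 1 else 0) + L * r ^ q"
    "norm (one_plus G p q) \<le> (if q = p then 1 else 0) + L * r ^ p"
    "norm (one_plus G p q) \<le> 1 + L"
    if "0 \<le> L" "norm (G p q) \<le> L * r ^ (p + q)" for G p q L
  proof -
    have "r ^ (p + q) \<le> r ^ q" "r ^ (p + q) \<le> r ^ p" "r ^ (p + q) \<le> 1"
      using g by (auto intro!: power_decreasing power_le_one)
    then have "norm (G p q) \<le> L * r ^ q" "norm (G p q) \<le> L * r ^ p" "norm (G p q) \<le> L * 1"
      using that by (meson mult_left_mono order_trans)+
    then show "norm (one_plus G p q) \<le> (if q = p then 1 else 0) + L * r ^ q"
      "norm (one_plus G p q) \<le> (if q = p then 1 else 0) + L * r ^ p"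
      "norm (one_plus G p q) \<le> 1 + L"
      using norm_triangle_ineq[of 1 "G p q"] that by (auto simp: one_plus_def)
  qed
  have prod_bd: "norm (u * v) \<le> (if k = p then R else 0) + R * r ^ k"
    if "norm u \<le> (if k = p then 1 else 0) + L * r ^ k" "norm v \<le> 1 + L'"
      "0 \<le> L" "0 \<le> L'" "(1 + L) * (1 + L') = R" for u v :: complex and k p L L'
  proof -
    have "norm (u * v) \<le> ((if k = p then 1 else 0) + L * r ^ k) * (1 + L')"
      unfolding norm_mult using that g by (intro mult_mono) auto
    also have "\<dots> \<le> ((if k = p then 1 + L else 0) + (1 + L) * r ^ k) * (1 + L')"
      using that g by (intro mult_right_mono add_mono) auto
    also have "\<dots> = (if k = p then (1 + L) * (1 + L') else 0) + (1 + L) * (1 + L') * r ^ k"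
      by (simp add: distrib_right mult.assoc mult.commute[of "r ^ k"])
    finally show ?thesis unfolding that(5) .
  qed
  have lim1: "(\<lambda>n. one_plus (F (s n)) k q) \<longlonglongrightarrow> one_plus B k q" for k q
    unfolding one_plus_def by (intro tendsto_intros B)
  have N_eq: "N m p q = one_plus (F m) p q" if "m \<ge> m0" "p < m" "q < m" for m p q
    using that by (simp add: F_def one_plus_eq)
  have "(\<lambda>k. one_plus A p k * one_plus B k q) sums delta p q" for p q
  proof (rule geo_tannery[where f = "\<lambda>n k. if k < s n then one_plus A p k * one_plus (F (s n)) k q else 0"
        and K = R and p = p and nb = "Suc (m0 + p + q)"])
    show "(\<lambda>n. if k < s n then one_plus A p k * one_plus (F (s n)) k q else 0)
        \<longlonglongrightarrow> one_plus A p k * one_plus B k q" for k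
      using tendsto_mult[OF cut[of k 1] tendsto_mult[OF tendsto_const[of "one_plus A p k"] lim1[of k q]]]
      by (simp add: if_distrib[of "\<lambda>x. x * _"] cong: if_cong)
    show "norm (if k < s n then one_plus A p k * one_plus (F (s n)) k q else 0) \<le>
        (if k = p then R else 0) + R * r ^ k" for n k
      using prod_bd[of "one_plus A p k" k p C "one_plus (F (s n)) k q" K]
        one_bd[of C A, OF g(1) g(4)] one_bd[of K "F (s n)", OF K F] g K by (auto simp: R_def)
    fix n assume n: "Suc (m0 + p + q) \<le> n"
    have sn: "m0 \<le> s n" "p < s n" "q < s n" using n s_ge[of n] by auto
    have "(\<lambda>k. if k < s n then one_plus A p k * one_plus (F (s n)) k q else 0) sums
      (\<Sum>k<s n. if k < s n then one_plus A p k * one_plus (F (s n)) k q else 0)"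
      by (rule sums_finite) auto
    also have "(\<Sum>k<s n. if k < s n then one_plus A p k * one_plus (F (s n)) k q else 0) =
      (\<Sum>k<s n. one_plus A p k * N (s n) k q)"
      by (rule sum.cong) (use sn in \<open>auto simp: N_eq\<close>)
    also have "\<dots> = delta p q" using N[OF sn(1)] sn by (simp add: good_def)
    finally show "(\<lambda>k. if k < s n then one_plus A p k * one_plus (F (s n)) k q else 0) sums delta p q" .
  qed (use g in auto)
  moreover have "(\<lambda>k. one_plus B p k * one_plus A k q) sums delta p q" for p q
  proof (rule geo_tannery[where f = "\<lambda>n k. if k < s n then one_plus (F (s n)) p k * one_plus A k q else 0"
        and K = R and p = p and nb = "Suc (m0 + p + q)"])
    show "(\<lambda>n. if k < s n then one_plus (F (s n)) p k * one_plus A k q else 0)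
        \<longlonglongrightarrow> one_plus B p k * one_plus A k q" for k
      using tendsto_mult[OF cut[of k 1] tendsto_mult[OF lim1[of p k] tendsto_const[of "one_plus A k q"]]]
      by (simp add: if_distrib[of "\<lambda>x. x * _"] cong: if_cong)
    show "norm (if k < s n then one_plus (F (s n)) p k * one_plus A k q else 0) \<le>
        (if k = p then R else 0) + R * r ^ k" for n k
      using prod_bd[of "one_plus (F (s n)) p k" k p K "one_plus A k q" C]
        one_bd[of C A, OF g(1) g(4)] one_bd[of K "F (s n)", OF K F] g K by (auto simp: R_def mult.commute)
    fix n assume n: "Suc (m0 + p + q) \<le> n"
    have sn: "m0 \<le> s n" "p < s n" "q < s n" using n s_ge[of n] by auto
    have "(\<lambda>k. if k < s n then one_plus (F (s n)) p k * one_plus A k q else 0) sums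
      (\<Sum>k<s n. if k < s n then one_plus (F (s n)) p k * one_plus A k q else 0)"
      by (rule sums_finite) auto
    also have "(\<Sum>k<s n. if k < s n then one_plus (F (s n)) p k * one_plus A k q else 0) =
      (\<Sum>k<s n. N (s n) p k * one_plus A k q)"
      by (rule sum.cong) (use sn in \<open>auto simp: N_eq\<close>)
    also have "\<dots> = delta p q" using N[OF sn(1)] sn by (simp add: good_def)
    finally show "(\<lambda>k. if k < s n then one_plus (F (s n)) p k * one_plus A k q else 0) sums delta p q" .
  qed (use g in auto)
  ultimately show ?thesis using gB by blast
qed
section \<open>Matrices over the integers with exponential off-diagonal decay\<close>

lemma summable_on_geometric_int:
  fixes r :: real
  assumes "0 \<le> r" "r < 1"
  shows "(\<lambda>q::int. r ^ nat \<bar>p - q\<bar>) summable_on UNIV"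
proof -
  have g: "(\<lambda>k::nat. r ^ k) summable_on UNIV"
    using assms by (simp add: summable_on_UNIV_nonneg_real_iff summable_geometric)
  have 1: "(\<lambda>q::int. r ^ nat \<bar>p - q\<bar>) summable_on range (\<lambda>k. p + int k)"
    by (subst summable_on_reindex) (auto simp: inj_on_def o_def g)
  have 2: "(\<lambda>q::int. r ^ nat \<bar>p - q\<bar>) summable_on range (\<lambda>k. p - int k)"
    by (subst summable_on_reindex) (auto simp: inj_on_def o_def g)
  have "q \<in> range (\<lambda>k. p + int k) \<union> (range (\<lambda>k. p - int k) - range (\<lambda>k. p + int k))" for q
    by (cases "p \<le> q") (auto simp: image_iff intro: exI[of _ "nat (q - p)"] exI[of _ "nat (p - q)"])
  then have "UNIV = range (\<lambda>k. p + int k) \<union> (range (\<lambda>k. p - int k) - range (\<lambda>k. p + int k))" by blast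
  moreover have "(\<lambda>q::int. r ^ nat \<bar>p - q\<bar>) summable_on
      range (\<lambda>k. p + int k) \<union> (range (\<lambda>k. p - int k) - range (\<lambda>k. p + int k))"
    by (rule summable_on_union[OF 1 summable_on_subset_banach[OF 2]]) auto
  ultimately show ?thesis by simp
qed

lemma infsum_geometric_int:
  fixes r :: real
  shows "(\<Sum>\<^sub>\<infinity>q. r ^ nat \<bar>p - q\<bar>) = (\<Sum>\<^sub>\<infinity>q::int. r ^ nat \<bar>q\<bar>)"
proof -
  have "bij (\<lambda>q::int. p - q)" by (rule bij_betw_byWitness[of _ "\<lambda>q. p - q"]) auto
  from infsum_reindex_bij_betw[OF this, of "\<lambda>q. r ^ nat \<bar>q\<bar>"] show ?thesis by simp
qed

text \<open>Exponential decay away from the diagonal, the matrix form of a loop that extends to an annulus.\<close>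

definition decay :: "real => real => (int => int => complex) => bool" where
  "decay C r A \<longleftrightarrow> 0 \<le> C \<and> 0 < r \<and> r < 1 \<and> (\<forall>p q. cmod (A p q) \<le> C * r ^ nat \<bar>p - q\<bar>)"

lemma decayD:
  assumes "decay C r A"
  shows "0 \<le> C" "0 < r" "r < 1" "cmod (A p q) \<le> C * r ^ nat \<bar>p - q\<bar>"
  using assms by (auto simp: decay_def)

lemma decay_mono:
  assumes "decay C r A" "C \<le> C'" "r \<le> r'" "r' < 1"
  shows "decay C' r' A"
  unfolding decay_def
proof (intro conjI allI)
  fix p q
  note d = decayD[OF assms(1)]
  have "C * r ^ nat \<bar>p - q\<bar> \<le> C' * r' ^ nat \<bar>p - q\<bar>"
    using d assms by (intro mult_mono power_mono) auto
  then show "cmod (A p q) \<le> C' * r' ^ nat \<bar>p - q\<bar>" using d(4)[of p q] by linarith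
qed (use assms decayD[OF assms(1)] in auto)

lemma decay_common:
  assumes "decay C r A" "decay D s B"
  obtains E t where "decay E t A" "decay E t B"
  using decay_mono[OF assms(1), of "max C D" "max r s"] decay_mono[OF assms(2), of "max C D" "max r s"]
    decayD[OF assms(1)] decayD[OF assms(2)] that[of "max C D" "max r s"] by auto

definition bounded_seq :: "(int => complex) => bool" where
  "bounded_seq x \<longleftrightarrow> (\<exists>K. \<forall>p. cmod (x p) \<le> K)"

definition act :: "(int => int => complex) => (int => complex) => int => complex" where
  "act A x p = (\<Sum>\<^sub>\<infinity>q. A p q * x q)"

lemma decay_row_abs_summable:
  assumes "decay C r A" "bounded_seq x"
  shows "(\<lambda>q. A p q * x q) abs_summable_on UNIV"
proof -
  note d = decayD[OF assms(1)]
  obtain K where K: "!!p. cmod (x p) \<le> K" using assms(2) by (auto simp: bounded_seq_def)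
  have "(\<lambda>q::int. C * K * r ^ nat \<bar>p - q\<bar>) abs_summable_on UNIV"
    using summable_on_geometric_int[of r p] d K[of 0]
    by (auto simp: abs_mult intro!: summable_on_cmult_right)
  then show ?thesis
  proof (rule Infinite_Sum.abs_summable_on_comparison_test)
    fix q
    have "cmod (A p q * x q) \<le> (C * r ^ nat \<bar>p - q\<bar>) * K"
      unfolding norm_mult using d K norm_ge_zero[of "x q"] by (intro mult_mono) auto
    then show "cmod (A p q * x q) \<le> norm (C * K * r ^ nat \<bar>p - q\<bar>)" by (simp add: mult_ac)
  qed
qed

lemma decay_row_summable:
  assumes "decay C r A" "bounded_seq x"
  shows "(\<lambda>q. A p q * x q) summable_on UNIV"
  using decay_row_abs_summable[OF assms] by (rule abs_summable_summable)

lemma bounded_seq_column: "decay C r A ==> bounded_seq (\<lambda>p. A p q)"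
proof -
  assume a: "decay C r A"
  have "cmod (A p q) \<le> C" for p
    using decayD[OF a] mult_left_mono[of "r ^ nat \<bar>p - q\<bar>" 1 C] power_le_one[of r]
    by (metis less_imp_le mult.right_neutral order_trans)
  then show ?thesis by (auto simp: bounded_seq_def)
qed

definition mmul :: "(int => int => complex) => (int => int => complex) => int => int => complex" where
  "mmul A B p q = (\<Sum>\<^sub>\<infinity>k. A p k * B k q)"

lemma mmul_eq_act: "mmul A B p q = act A (\<lambda>k. B k q) p"
  by (simp add: mmul_def act_def)

lemma decay_mmul:
  assumes A: "decay C r A" and B: "decay D s B"
  obtains E t where "decay E t (mmul A B)"
proof -
  obtain C t where A: "decay C t A" and B: "decay C t B" using decay_common[OF A B] by blast
  note a = decayD[OF A] and b = decayD[OF B]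
  define u where "u = sqrt t"
  have u: "0 < u" "u < 1" "t = u * u" using a by (auto simp: u_def)
  let ?G = "\<Sum>\<^sub>\<infinity>q::int. u ^ nat \<bar>q\<bar>"
  have "decay (C * C * ?G) u (mmul A B)"
    unfolding decay_def
  proof (intro conjI allI)
    show "0 \<le> C * C * ?G" using a u by (intro mult_nonneg_nonneg infsum_nonneg) auto
    fix p q
    have le: "cmod (A p k * B k q) \<le> C * C * u ^ nat \<bar>p - q\<bar> * u ^ nat \<bar>p - k\<bar>" for k
    proof -
      have "cmod (A p k * B k q) \<le> (C * t ^ nat \<bar>p - k\<bar>) * (C * t ^ nat \<bar>k - q\<bar>)"
        unfolding norm_mult using a b by (intro mult_mono) auto
      also have "\<dots> = C * C * (u ^ (nat \<bar>p - k\<bar> + nat \<bar>k - q\<bar>) * u ^ (nat \<bar>p - k\<bar> + nat \<bar>k - q\<bar>))"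
        unfolding u(3) power_mult_distrib power_add by (simp add: mult_ac)
      also have "\<dots> \<le> C * C * (u ^ nat \<bar>p - q\<bar> * u ^ nat \<bar>p - k\<bar>)"
        using a u by (intro mult_left_mono mult_mono power_decreasing) auto
      finally show ?thesis by (simp add: mult_ac)
    qed
    have "cmod (mmul A B p q) \<le> (\<Sum>\<^sub>\<infinity>k. cmod (A p k * B k q))"
      unfolding mmul_def by (rule norm_infsum_bound, rule decay_row_abs_summable[OF A bounded_seq_column[OF B]])
    also have "\<dots> \<le> (\<Sum>\<^sub>\<infinity>k. C * C * u ^ nat \<bar>p - q\<bar> * u ^ nat \<bar>p - k\<bar>)"
    proof (rule infsum_mono[OF _ _ le])
      show "(\<lambda>k. cmod (A p k * B k q)) summable_on UNIV"
        by (rule decay_row_abs_summable[OF A bounded_seq_column[OF B]])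
      show "(\<lambda>k. C * C * u ^ nat \<bar>p - q\<bar> * u ^ nat \<bar>p - k\<bar>) summable_on UNIV"
        using summable_on_geometric_int[of u p] u by (auto intro!: summable_on_cmult_right)
    qed
    also have "\<dots> = C * C * ?G * u ^ nat \<bar>p - q\<bar>"
      by (subst infsum_cmult_right') (simp add: infsum_geometric_int mult_ac)
    finally show "cmod (mmul A B p q) \<le> C * C * ?G * u ^ nat \<bar>p - q\<bar>" .
  qed (use u in auto)
  then show ?thesis by (rule that)
qed

lemma act_mmul:
  assumes A: "decay C r A" and B: "decay D s B" and x: "bounded_seq x"
  shows "act (mmul A B) x = act A (act B x)"
proof
  fix p
  obtain K where K: "!!p. cmod (x p) \<le> K" using x by (auto simp: bounded_seq_def)
  note a = decayD[OF A] and b = decayD[OF B]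
  have Bx: "(\<lambda>q. B k q * x q) abs_summable_on UNIV" for k by (rule decay_row_abs_summable[OF B x])
  let ?L = "\<lambda>k. \<Sum>\<^sub>\<infinity>q. cmod (B k q * x q)"
  have L: "?L k \<le> D * K * (\<Sum>\<^sub>\<infinity>q::int. s ^ nat \<bar>q\<bar>)" for k
  proof -
    have "?L k \<le> (\<Sum>\<^sub>\<infinity>q. D * K * s ^ nat \<bar>k - q\<bar>)"
    proof (rule infsum_mono[OF Bx])
      show "(\<lambda>q. D * K * s ^ nat \<bar>k - q\<bar>) summable_on UNIV"
        using summable_on_geometric_int[of s k] b by (auto intro!: summable_on_cmult_right)
      fix q
      have "cmod (B k q * x q) \<le> (D * s ^ nat \<bar>k - q\<bar>) * K"
        unfolding norm_mult using b K norm_ge_zero[of "x q"] by (intro mult_mono) auto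
      then show "cmod (B k q * x q) \<le> D * K * s ^ nat \<bar>k - q\<bar>" by (simp add: mult_ac)
    qed
    then show ?thesis by (subst (asm) infsum_cmult_right') (simp add: infsum_geometric_int)
  qed
  have L0: "0 \<le> ?L k" for k by (rule infsum_nonneg) auto
  have bL: "bounded_seq (\<lambda>k. complex_of_real (?L k))"
    unfolding bounded_seq_def using L L0 by (intro exI[of _ "D * K * (\<Sum>\<^sub>\<infinity>q::int. s ^ nat \<bar>q\<bar>)"]) simp
  have "(\<lambda>(k, q). A p k * (B k q * x q)) abs_summable_on UNIV \<times> UNIV"
    unfolding Infinite_Sum.abs_summable_on_Sigma_iff
  proof (intro conjI ballI)
    fix k show "(\<lambda>q. case (k, q) of (k, q) => A p k * (B k q * x q)) abs_summable_on UNIV"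
      using Bx[of k] by (simp add: norm_mult[of "A p k"] summable_on_cmult_right)
  next
    have "(\<Sum>\<^sub>\<infinity>q. cmod (A p k * (B k q * x q))) = cmod (A p k * complex_of_real (?L k))" for k
      unfolding norm_mult[of "A p k"] using L0[of k] by (subst infsum_cmult_right') simp
    then show "(\<lambda>k. \<Sum>\<^sub>\<infinity>q. norm (case (k, q) of (k, q) => A p k * (B k q * x q))) abs_summable_on UNIV"
      using decay_row_abs_summable[OF A bL, of p] by simp
  qed
  from abs_summable_summable[OF this] have sm: "(\<lambda>(k, q). A p k * (B k q * x q)) summable_on UNIV \<times> UNIV" .
  have "act A (act B x) p = (\<Sum>\<^sub>\<infinity>k. \<Sum>\<^sub>\<infinity>q. A p k * (B k q * x q))"
    unfolding act_def by (rule infsum_cong) (simp add: infsum_cmult_right')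
  also have "\<dots> = (\<Sum>\<^sub>\<infinity>q. \<Sum>\<^sub>\<infinity>k. A p k * (B k q * x q))" by (rule infsum_swap_banach[OF sm])
  also have "\<dots> = (\<Sum>\<^sub>\<infinity>q. mmul A B p q * x q)"
    unfolding mmul_def by (rule infsum_cong) (simp add: infsum_cmult_left' mult.assoc[symmetric])
  finally show "act (mmul A B) x p = act A (act B x) p" by (simp add: act_def)
qed

text \<open>A type of its own, so that products of infinite matrices can be handled as in any ring.\<close>

typedef emat = "{A. \<exists>C r. decay C r A}"
  morphisms ent Emat
proof
  show "(\<lambda>p q. 0) \<in> {A. \<exists>C r. decay C r A}"
    unfolding mem_Collect_eq by (rule exI[of _ 0], rule exI[of _ "1/2"]) (auto simp: decay_def)
qed

setup_lifting type_definition_emat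

lemma decay_ent: obtains C r where "decay C r (ent A)" using ent[of A] by auto

lemma emat_eqI: "(!!p q. ent A p q = ent B p q) ==> A = B"
  by (metis ent_inject ext)

instantiation emat :: ring_1
begin

lift_definition zero_emat :: emat is "\<lambda>p q. 0"
  by (rule exI[of _ 0], rule exI[of _ "1/2"]) (auto simp: decay_def)

lift_definition one_emat :: emat is "\<lambda>p q. if p = q then 1 else 0"
  by (rule exI[of _ 1], rule exI[of _ "1/2"]) (auto simp: decay_def)

lift_definition plus_emat :: "emat => emat => emat" is "\<lambda>A B p q. A p q + B p q"
proof -
  fix A B assume "\<exists>C r. decay C r A" "\<exists>C r. decay C r B"
  then obtain C r where A: "decay C r A" and B: "decay C r B" using decay_common by metis
  have "decay (2 * C) r (\<lambda>p q. A p q + B p q)"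
    unfolding decay_def
  proof (intro conjI allI)
    fix p q
    show "cmod (A p q + B p q) \<le> 2 * C * r ^ nat \<bar>p - q\<bar>"
      using norm_triangle_ineq[of "A p q" "B p q"] decayD(4)[OF A, of p q] decayD(4)[OF B, of p q] by simp
  qed (use decayD[OF A] in auto)
  then show "\<exists>C r. decay C r (\<lambda>p q. A p q + B p q)" by blast
qed

lift_definition uminus_emat :: "emat => emat" is "\<lambda>A p q. - A p q"
  by (auto simp: decay_def)

definition minus_emat :: "emat => emat => emat" where "minus_emat A B = A + - B"

lift_definition times_emat :: "emat => emat => emat" is mmul
  using decay_mmul by metis

instance
proof
  fix A B C :: emat
  obtain a r where A: "decay a r (ent A)" by (rule decay_ent)
  obtain b s where B: "decay b s (ent B)" by (rule decay_ent)
  obtain c t where C: "decay c t (ent C)" by (rule decay_ent)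
  note simps = plus_emat.rep_eq times_emat.rep_eq uminus_emat.rep_eq zero_emat.rep_eq one_emat.rep_eq
  show "A + B + C = A + (B + C)" "A + B = B + A" "0 + A = A" "- A + A = 0" "A - B = A + - B"
    by (auto intro!: emat_eqI simp: simps minus_emat_def)
  show "0 ~= (1::emat)"
  proof
    assume "0 = (1::emat)"
    then have "ent 0 0 0 = ent 1 0 0" by simp
    then show False by (simp add: simps)
  qed
  show "A * B * C = A * (B * C)"
  proof (rule emat_eqI)
    fix p q
    have "ent (A * B * C) p q = act (mmul (ent A) (ent B)) (\<lambda>k. ent C k q) p"
      by (simp add: simps mmul_eq_act)
    also have "\<dots> = act (ent A) (act (ent B) (\<lambda>k. ent C k q)) p"
      by (simp add: act_mmul[OF A B bounded_seq_column[OF C]])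
    finally show "ent (A * B * C) p q = ent (A * (B * C)) p q" by (simp add: simps mmul_eq_act)
  qed
  have one: "infsum (\<lambda>k. if k = p then f k else 0) UNIV = f p" for p :: int and f :: "int => complex"
    using infsum_cong_neutral[of "{p}" UNIV f "\<lambda>k. if k = p then f k else 0"] by auto
  show "1 * A = A"
  proof (rule emat_eqI)
    fix p q
    have "(\<lambda>k. ent 1 p k * ent A k q) = (\<lambda>k. if k = p then ent A k q else 0)" by (auto simp: simps)
    then show "ent (1 * A) p q = ent A p q" by (simp add: simps(2) mmul_def one)
  qed
  show "A * 1 = A"
  proof (rule emat_eqI)
    fix p q
    have "(\<lambda>k. ent A p k * ent 1 k q) = (\<lambda>k. if k = q then ent A p k else 0)" by (auto simp: simps)
    then show "ent (A * 1) p q = ent A p q" by (simp add: simps(2) mmul_def one)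
  qed
  show "(A + B) * C = A * C + B * C"
    by (rule emat_eqI) (simp add: simps mmul_def distrib_right infsum_add
        decay_row_summable[OF A bounded_seq_column[OF C]] decay_row_summable[OF B bounded_seq_column[OF C]])
  show "A * (B + C) = A * B + A * C"
    by (rule emat_eqI) (simp add: simps mmul_def distrib_left infsum_add
        decay_row_summable[OF A bounded_seq_column[OF B]] decay_row_summable[OF A bounded_seq_column[OF C]])
qed

end

lemma ent_zero: "ent 0 p q = 0" by (rule zero_emat.rep_eq[THEN fun_cong, THEN fun_cong])
lemma ent_one: "ent 1 p q = (if p = q then 1 else 0)" by (simp add: one_emat.rep_eq)
lemma ent_add: "ent (A + B) p q = ent A p q + ent B p q" by (simp add: plus_emat.rep_eq)
lemma ent_minus: "ent (- A) p q = - ent A p q" by (simp add: uminus_emat.rep_eq)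
lemma ent_diff: "ent (A - B) p q = ent A p q - ent B p q" unfolding minus_emat_def ent_add ent_minus by simp
lemma ent_mult: "ent (A * B) p q = (\<Sum>\<^sub>\<infinity>k. ent A p k * ent B k q)"
  by (simp add: times_emat.rep_eq mmul_def)
lemmas ent_simps = ent_zero ent_one ent_add ent_minus ent_diff

lemma ent_mult_summable: "(\<lambda>k. ent A p k * ent B k q) summable_on UNIV"
  by (metis decay_ent decay_row_summable bounded_seq_column)

lemma act_mult: "bounded_seq x ==> act (ent (A * B)) x = act (ent A) (act (ent B) x)"
  by (metis act_mmul decay_ent times_emat.rep_eq)

lemma act_one: "act (ent 1) x = x"
proof
  fix p show "act (ent 1) x p = x p"
    using infsum_cong_neutral[of "{p}" UNIV x "\<lambda>k. ent 1 p k * x k"] by (auto simp: act_def ent_one)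
qed

lemma act_row_summable: "bounded_seq x ==> (\<lambda>q. ent A p q * x q) summable_on UNIV"
  by (metis decay_ent decay_row_summable)

lift_definition Pp :: emat is "\<lambda>p q. if p = q \<and> 0 \<le> p then 1 else 0"
  by (rule exI[of _ 1], rule exI[of _ "1/2"]) (auto simp: decay_def)

definition Qm :: emat where "Qm = 1 - Pp"

lemma ent_Pp: "ent Pp p q = (if p = q \<and> 0 \<le> p then 1 else 0)" by (simp add: Pp.rep_eq)
lemma infsum_single: "infsum (\<lambda>k. if k = p then f k else 0) UNIV = f p"
  for p :: int and f :: "int => complex"
  using infsum_cong_neutral[of "{p}" UNIV f "\<lambda>k. if k = p then f k else 0"] by auto

lemma ent_Pp_mult: "ent (Pp * A) p q = (if 0 \<le> p then ent A p q else 0)"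
proof -
  have "ent (Pp * A) p q = (\<Sum>\<^sub>\<infinity>k. if k = p then (if 0 \<le> p then ent A k q else 0) else 0)"
    unfolding ent_mult by (rule infsum_cong) (auto simp: ent_Pp)
  then show ?thesis by (simp only: infsum_single)
qed

lemma ent_mult_Pp: "ent (A * Pp) p q = (if 0 \<le> q then ent A p q else 0)"
proof -
  have "ent (A * Pp) p q = (\<Sum>\<^sub>\<infinity>k. if k = q then (if 0 \<le> q then ent A p k else 0) else 0)"
    unfolding ent_mult by (rule infsum_cong) (auto simp: ent_Pp)
  then show ?thesis by (simp only: infsum_single)
qed

lemma Pp_Pp: "Pp * Pp = Pp" by (rule emat_eqI) (auto simp: ent_Pp_mult ent_Pp)

lemma ent_mult_Qm: "ent (A * Qm) p q = (if q < 0 then ent A p q else 0)"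
  by (simp add: Qm_def algebra_simps ent_simps ent_mult_Pp)

lemma act_Pp: "act (ent Pp) x p = (if 0 \<le> p then x p else 0)"
proof -
  have "act (ent Pp) x p = (\<Sum>\<^sub>\<infinity>k. if k = p then (if 0 \<le> p then x k else 0) else 0)"
    unfolding act_def by (rule infsum_cong) (auto simp: ent_Pp)
  then show ?thesis by (simp only: infsum_single)
qed

text \<open>The product passes through the negative indices, so a path from \<open>p\<close> to \<open>q\<close> has length at least
  \<open>p + q\<close>.\<close>

lemma hankel_decay:
  obtains C r where "0 \<le> C" "0 < r" "r < 1"
    "!!p q. 0 \<le> p ==> 0 \<le> q ==> cmod (ent (A * Qm * B) p q) \<le> C * r ^ nat (p + q)"
proof -
  obtain C r where A: "decay C r (ent A)" and B: "decay C r (ent B)"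
    by (metis decay_ent decay_common)
  note a = decayD[OF A] and b = decayD[OF B]
  let ?G = "\<Sum>\<^sub>\<infinity>q::int. r ^ nat \<bar>q\<bar>"
  have "cmod (ent (A * Qm * B) p q) \<le> C * C * ?G * r ^ nat (p + q)" if pq: "0 \<le> p" "0 \<le> q" for p q
  proof -
    have le: "cmod (ent (A * Qm) p k * ent B k q) \<le> C * C * r ^ nat (p + q) * r ^ nat \<bar>k\<bar>" for k
    proof (cases "k < 0")
      case True
      have "cmod (ent (A * Qm) p k * ent B k q) \<le> (C * r ^ nat \<bar>p - k\<bar>) * (C * r ^ nat \<bar>k - q\<bar>)"
        unfolding norm_mult using a b True by (intro mult_mono) (auto simp: ent_mult_Qm)
      also have "\<dots> = C * C * (r ^ (nat \<bar>p - k\<bar> + nat \<bar>k - q\<bar>))" by (simp add: power_add)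
      also have "\<dots> \<le> C * C * r ^ (nat (p + q) + nat \<bar>k\<bar>)"
        using a pq True by (intro mult_left_mono power_decreasing) auto
      finally show ?thesis by (simp add: power_add mult_ac)
    next
      case False
      then show ?thesis using a by (simp add: ent_mult_Qm)
    qed
    have "cmod (ent (A * Qm * B) p q) \<le> (\<Sum>\<^sub>\<infinity>k. cmod (ent (A * Qm) p k * ent B k q))"
      unfolding ent_mult[of "A * Qm"]
      by (rule norm_infsum_bound) (metis decay_ent decay_row_abs_summable bounded_seq_column)
    also have "\<dots> \<le> (\<Sum>\<^sub>\<infinity>k. C * C * r ^ nat (p + q) * r ^ nat \<bar>k\<bar>)"
    proof (rule infsum_mono[OF _ _ le])
      show "(\<lambda>k. cmod (ent (A * Qm) p k * ent B k q)) summable_on UNIV"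
        by (metis decay_ent decay_row_abs_summable bounded_seq_column)
      show "(\<lambda>k. C * C * r ^ nat (p + q) * r ^ nat \<bar>k\<bar>) summable_on UNIV"
        using summable_on_geometric_int[of r 0] a by (auto intro!: summable_on_cmult_right)
    qed
    also have "\<dots> = C * C * ?G * r ^ nat (p + q)"
      by (subst infsum_cmult_right') (simp add: mult_ac)
    finally show ?thesis .
  qed
  moreover have "0 \<le> C * C * ?G" using a by (intro mult_nonneg_nonneg infsum_nonneg) auto
  ultimately show ?thesis using that a by blast
qed
section \<open>Toeplitz determinants of a product of two triangular factors\<close>

lemma infsum_int_eq_sum:
  fixes f :: "int => complex"
  assumes "!!k. k \<notin> int ` {..<M} ==> f k = 0"
  shows "infsum f UNIV = (\<Sum>k<M. f (int k))"
proof -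
  have "infsum f UNIV = infsum f (int ` {..<M})" by (rule infsum_cong_neutral) (use assms in auto)
  also have "\<dots> = (\<Sum>k<M. f (int k))" by (simp add: sum.reindex inj_on_def)
  finally show ?thesis .
qed

lemma infsum_int_nat:
  fixes f :: "int => complex"
  assumes "!!k. k < 0 ==> f k = 0" "f summable_on UNIV"
  shows "(\<lambda>k. f (int k)) sums infsum f UNIV"
proof -
  have r: "range int = {0..}" by (auto simp: image_iff intro: nonneg_int_cases)
  have "f summable_on range int" by (rule summable_on_subset_banach[OF assms(2)]) auto
  then have s: "(f \<circ> int) summable_on UNIV" by (subst summable_on_reindex[symmetric]) auto
  have "infsum f UNIV = infsum f (range int)"
    by (rule infsum_cong_neutral) (use assms(1) r in auto)
  also have "\<dots> = infsum (f \<circ> int) UNIV" by (rule infsum_reindex) auto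
  finally show ?thesis using has_sum_imp_sums[OF has_sum_infsum[OF s]] by (simp add: o_def)
qed

lemma geo_common:
  assumes "geo C r A" "geo D s B"
  obtains E t where "geo E t A" "geo E t B"
proof -
  have *: "geo (max C D) (max r s) A'" if "geo K u A'" "K \<le> max C D" "u \<le> max r s" for K u A'
    unfolding geo_def
  proof (intro conjI allI)
    fix p q
    have g: "0 \<le> K" "0 < u" "norm (A' p q) \<le> K * u ^ (p + q)" using that by (auto simp: geo_def)
    have "K * u ^ (p + q) \<le> max C D * max r s ^ (p + q)"
      using g that by (intro mult_mono power_mono) auto
    then show "norm (A' p q) \<le> max C D * max r s ^ (p + q)" using g by linarith
  qed (use assms in \<open>auto simp: geo_def\<close>)
  show ?thesis by (rule that; rule *) (use assms in auto)
qed

definition natpart :: "emat => nat => nat => complex" where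
  "natpart A p q = ent A (int p) (int q)"

lemma geo_natpart:
  obtains C r where "geo C r (natpart (A * Qm * B))"
proof -
  obtain C r where C: "0 \<le> C" "0 < r" "r < 1"
    "!!p q. 0 \<le> p ==> 0 \<le> q ==> cmod (ent (A * Qm * B) p q) \<le> C * r ^ nat (p + q)"
    using hankel_decay[of A B] by blast
  have "cmod (ent (A * Qm * B) (int p) (int q)) \<le> C * r ^ (p + q)" for p q
    using C(4)[of "int p" "int q"] by (simp add: nat_add_distrib)
  then have "geo C r (natpart (A * Qm * B))" using C by (auto simp: geo_def natpart_def)
  then show ?thesis by (rule that)
qed

text \<open>A loop that is the product of a lower and an upper unitriangular factor, without any commutation
  between them. The last two conditions say that the inverses are triangular with respect to the
  two half spaces.\<close>

locale two_factors =
  fixes a ai b bi :: emat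
  assumes a: "a * ai = 1" "ai * a = 1" and b: "b * bi = 1" "bi * b = 1"
    and a_lower: "!!p q. p < q ==> ent a p q = 0" "!!p. ent a p p = 1"
    and b_upper: "!!p q. q < p ==> ent b p q = 0" "!!p. ent b p p = 1"
    and ai_plus: "!!p q. p < 0 ==> 0 \<le> q ==> ent ai p q = 0"
    and bi_minus: "!!p q. 0 \<le> p ==> q < 0 ==> ent bi p q = 0"
begin

lemma aP: "Pp * (a * Pp) = a * Pp"
  by (rule emat_eqI) (auto simp: ent_Pp_mult ent_mult_Pp a_lower)

lemma aiP: "Pp * (ai * Pp) = ai * Pp"
  by (rule emat_eqI) (auto simp: ent_Pp_mult ent_mult_Pp ai_plus)

lemma Pb: "Pp * (b * Pp) = Pp * b"
  by (rule emat_eqI) (auto simp: ent_Pp_mult ent_mult_Pp b_upper)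

lemma Pbi: "Pp * (bi * Pp) = Pp * bi"
  by (rule emat_eqI) (auto simp: ent_Pp_mult ent_mult_Pp bi_minus)

lemma PP: "Pp * (Pp * x) = Pp * x" by (simp add: mult.assoc[symmetric] Pp_Pp)

lemma inverses: "a * (ai * x) = x" "ai * (a * x) = x" "b * (bi * x) = x" "bi * (b * x) = x"
  by (simp_all add: mult.assoc[symmetric] a b)

lemma shifts: "Pp * (a * (Pp * x)) = a * (Pp * x)" "Pp * (ai * (Pp * x)) = ai * (Pp * x)"
  "Pp * (b * (Pp * x)) = Pp * (b * x)" "Pp * (bi * (Pp * x)) = Pp * (bi * x)"
  using aP aiP Pb Pbi by (simp_all add: mult.assoc[symmetric])

lemma cancels:
  "Pp * (ai * (Pp * (a * (Pp * x)))) = Pp * x"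
  "Pp * (a * (Pp * (ai * (Pp * x)))) = Pp * x"
  "Pp * (b * (Pp * (bi * x))) = Pp * x"
  "Pp * (bi * (Pp * (b * x))) = Pp * x"
  by (simp_all only: shifts inverses PP)

lemmas cancels1 = cancels[of 1, simplified] cancels[of Pp, unfolded Pp_Pp]

text \<open>\<open>T(a)\<^sup>-\<^sup>1 T(a b) T(b)\<^sup>-\<^sup>1\<close>, since triangularity gives \<open>T(a)\<^sup>-\<^sup>1 = P a\<^sup>-\<^sup>1 P\<close> and \<open>T(b)\<^sup>-\<^sup>1 = P b\<^sup>-\<^sup>1 P\<close>.\<close>

definition X :: emat where "X = Pp * ai * Pp * a * b * Pp * bi * Pp"

definition A where "A = ai * Qm * (a * b * Qm * bi)"

lemma X_eq: "X = Pp + Pp * A * Pp"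
proof -
  have 1: "Pp * (b * (Qm * x)) = 0" for x
    unfolding Qm_def using Pb by (simp add: algebra_simps) (metis mult.assoc)
  have 2: "Qm * (a * Pp) = 0" unfolding Qm_def using aP by (simp add: algebra_simps)
  have "X = Pp * ai * (1 - Qm) * a * b * (1 - Qm) * bi * Pp" by (simp add: X_def Qm_def)
  also have "\<dots> = Pp * (ai * a) * (b * bi) * Pp - Pp * (ai * a) * b * Qm * bi * Pp
      - Pp * ai * Qm * a * (b * bi) * Pp + Pp * ai * Qm * a * b * Qm * bi * Pp"
    by (simp add: algebra_simps)
  also have "\<dots> = Pp * Pp + Pp * ai * Qm * a * b * Qm * bi * Pp"
    by (simp add: a b mult.assoc 1 2)
  finally show ?thesis by (simp add: A_def Pp_Pp mult.assoc)
qed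

lemma natpart_X: "natpart X = one_plus (natpart A)"
  by (rule ext)+ (simp add: natpart_def one_plus_def X_eq ent_add ent_Pp ent_mult_Pp ent_Pp_mult)

lemma geo_A: obtains C r where "geo C r (natpart A)"
  unfolding A_def by (rule geo_natpart)

lemma toeplitz_factor: "Pp * a * b * Pp = Pp * a * Pp * X * Pp * b * Pp"
  by (simp add: X_def mult.assoc PP Pp_Pp cancels cancels1)

text \<open>The factor on the left is lower and the one on the right is upper unitriangular, so truncation is
  compatible with the product and neither changes the minor.\<close>

lemma det_toeplitz: "det_on {..<M} (natpart (a * b)) = det_on {..<M} (natpart X)"
proof -
  have out: "k < 0 \<or> int M \<le> k" if "k \<notin> int ` {..<M}" for k
    using that by (metis image_eqI lessThan_iff not_le of_nat_less_iff zero_le_imp_eq_int)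
  have "natpart (a * b) p q = (\<Sum>r<M. (\<Sum>s<M. natpart a p s * natpart X s r) * natpart b r q)"
    if "p < M" "q < M" for p q
  proof -
    have "natpart (a * b) p q = ent (Pp * ((a * b) * Pp)) (int p) (int q)"
      by (simp add: natpart_def ent_mult_Pp ent_Pp_mult)
    also have "Pp * ((a * b) * Pp) = Pp * (((a * Pp * X) * (Pp * b)) * Pp)"
      using toeplitz_factor by (simp add: mult.assoc)
    also have "ent \<dots> (int p) (int q) = ent ((a * Pp * X) * (Pp * b)) (int p) (int q)"
      by (simp add: ent_mult_Pp ent_Pp_mult)
    also have "\<dots> = (\<Sum>r<M. ent (a * Pp * X) (int p) (int r) * natpart b r q)"
      unfolding ent_mult[of "a * Pp * X"] natpart_def
    proof (subst infsum_int_eq_sum[of M])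
      fix k assume "k \<notin> int ` {..<M}"
      with out have "k < 0 \<or> int q < k" using that by fastforce
      then show "ent (a * Pp * X) (int p) k * ent (Pp * b) k (int q) = 0"
        by (auto simp: ent_Pp_mult b_upper)
    qed (simp add: ent_Pp_mult)
    also have "\<dots> = (\<Sum>r<M. (\<Sum>s<M. natpart a p s * natpart X s r) * natpart b r q)"
    proof (rule sum.cong[OF refl])
      fix r
      have "ent ((a * Pp) * X) (int p) (int r) = (\<Sum>s<M. natpart a p s * natpart X s r)"
        unfolding ent_mult[of "a * Pp"] natpart_def
      proof (subst infsum_int_eq_sum[of M])
        fix k assume "k \<notin> int ` {..<M}"
        with out have "k < 0 \<or> int p < k" using that by fastforce
        then show "ent (a * Pp) (int p) k * ent X k (int r) = 0"
          by (auto simp: ent_mult_Pp a_lower)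
      qed (simp add: ent_mult_Pp)
      then show "ent (a * Pp * X) (int p) (int r) * natpart b r q =
        (\<Sum>s<M. natpart a p s * natpart X s r) * natpart b r q" by simp
    qed
    finally show ?thesis .
  qed
  then have "det_on {..<M} (natpart (a * b)) =
      det_on {..<M} (\<lambda>p q. \<Sum>r<M. (\<Sum>s<M. natpart a p s * natpart X s r) * natpart b r q)"
    by (intro det_on_cong) auto
  also have "\<dots> = det_on {..<M} (natpart a) * det_on {..<M} (natpart X) * det_on {..<M} (natpart b)"
    by (simp add: det_on_mult)
  also have "det_on {..<M} (natpart a) = 1"
    by (rule det_on_unit_lower) (auto simp: natpart_def a_lower)
  also have "det_on {..<M} (natpart b) = 1"
    by (rule det_on_unit_upper) (auto simp: natpart_def b_upper)
  finally show ?thesis by simp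
qed

lemma det_toeplitz_tendsto:
  "(\<lambda>M. det_on {..<M} (natpart (a * b))) \<longlonglongrightarrow> fredholm_det (natpart A)"
proof -
  obtain C r where "geo C r (natpart A)" by (rule geo_A)
  from det_on_tendsto_fredholm_det[OF this] show ?thesis by (simp add: det_toeplitz natpart_X)
qed

lemma X_inverse:
  assumes "fredholm_det (natpart A) ~= 0"
  obtains X' where "Pp * X' = X'" "X' * Pp = X'" "X * X' = Pp" "X' * X = Pp"
proof -
  obtain C r where A: "geo C r (natpart A)" by (rule geo_A)
  obtain D B where B: "geo D r B"
    "!!p q. (\<lambda>k. one_plus (natpart A) p k * one_plus B k q) sums delta p q"
    "!!p q. (\<lambda>k. one_plus B p k * one_plus (natpart A) k q) sums delta p q"
    using fredholm_alternative[OF A assms] by blast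
  have g: "0 \<le> D" "0 < r" "r < 1" "!!p q. cmod (B p q) \<le> D * r ^ (p + q)"
    using B(1) by (auto simp: geo_def)
  define F where "F p q = (if 0 \<le> p \<and> 0 \<le> q then one_plus B (nat p) (nat q) else 0)" for p q
  have "decay (1 + D) r F"
    unfolding decay_def
  proof (intro conjI allI)
    fix p q :: int
    have "cmod (B (nat p) (nat q)) \<le> D * r ^ nat \<bar>p - q\<bar>"
      if "0 \<le> p" "0 \<le> q"
      by (rule order_trans[OF g(4)]) (use g that in \<open>auto intro!: mult_left_mono power_decreasing\<close>)
    then show "cmod (F p q) \<le> (1 + D) * r ^ nat \<bar>p - q\<bar>"
      using g norm_triangle_ineq[of 1 "B (nat p) (nat q)"]
      by (auto simp: F_def one_plus_def distrib_right intro: order_trans)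
  qed (use g in auto)
  then have F: "ent (Emat F) = F" by (subst Emat_inverse) auto
  have XF: "ent X p q = (if 0 \<le> p \<and> 0 \<le> q then one_plus (natpart A) (nat p) (nat q) else 0)" for p q
    by (auto simp: X_eq ent_add ent_Pp ent_mult_Pp ent_Pp_mult one_plus_def natpart_def)
  have "X * Emat F = Pp"
  proof (rule emat_eqI)
    fix p q
    have "(\<lambda>k. ent X p (int k) * F (int k) q) sums ent (X * Emat F) p q"
      using infsum_int_nat[of "\<lambda>k. ent X p k * F k q"] ent_mult_summable[of X p "Emat F" q]
      by (simp add: ent_mult F) (simp add: F_def)
    moreover have "(\<lambda>k. ent X p (int k) * F (int k) q) sums ent Pp p q"
      using B(2)[of "nat p" "nat q"]
      by (cases "0 \<le> p"; cases "0 \<le> q") (auto simp: XF F_def ent_Pp delta_def eq_nat_nat_iff)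
    ultimately show "ent (X * Emat F) p q = ent Pp p q" by (rule sums_unique2)
  qed
  moreover have "Emat F * X = Pp"
  proof (rule emat_eqI)
    fix p q
    have "(\<lambda>k. F p (int k) * ent X (int k) q) sums ent (Emat F * X) p q"
      using infsum_int_nat[of "\<lambda>k. F p k * ent X k q"] ent_mult_summable[of "Emat F" p X q]
      by (simp add: ent_mult F) (simp add: F_def)
    moreover have "(\<lambda>k. F p (int k) * ent X (int k) q) sums ent Pp p q"
      using B(3)[of "nat p" "nat q"]
      by (cases "0 \<le> p"; cases "0 \<le> q") (auto simp: XF F_def ent_Pp delta_def eq_nat_nat_iff)
    ultimately show "ent (Emat F * X) p q = ent Pp p q" by (rule sums_unique2)
  qed
  moreover have "Pp * Emat F = Emat F" "Emat F * Pp = Emat F"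
    by (auto intro!: emat_eqI simp: ent_Pp_mult ent_mult_Pp F) (auto simp: F_def)
  ultimately show ?thesis by (intro that)
qed

text \<open>\<open>S = T(b)\<^sup>-\<^sup>1 X\<^sup>-\<^sup>1 T(a)\<^sup>-\<^sup>1\<close>.\<close>

lemma toeplitz_inverse:
  assumes "fredholm_det (natpart A) ~= 0"
  obtains S where "Pp * S = S" "S * Pp = S" "Pp * a * b * S = Pp" "S * a * b * Pp = Pp"
proof -
  obtain X' where X': "Pp * X' = X'" "X' * Pp = X'" "X * X' = Pp" "X' * X = Pp"
    using X_inverse[OF assms] .
  define S where "S = Pp * bi * X' * ai * Pp"
  have S: "Pp * S = S" "S * Pp = S" by (simp_all add: S_def mult.assoc PP Pp_Pp)
  have "Pp * a * b * S = Pp * a * b * Pp * S" by (simp add: S mult.assoc)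
  also have "\<dots> = Pp * a * Pp * X * (Pp * (b * (Pp * (bi * (Pp * X'))))) * ai * Pp"
    unfolding toeplitz_factor by (simp add: S_def mult.assoc PP X')
  also have "\<dots> = Pp * (a * (Pp * (X * X') * (ai * Pp)))"
    unfolding cancels by (simp add: mult.assoc PP X')
  also have "\<dots> = Pp" by (simp add: X' mult.assoc PP Pp_Pp cancels1)
  finally have 1: "Pp * a * b * S = Pp" .
  have "S * a * b * Pp = S * (Pp * a * b * Pp)" by (simp add: S mult.assoc[symmetric])
  also have "\<dots> = Pp * bi * X' * (Pp * (ai * (Pp * (a * (Pp * X))))) * Pp * b * Pp"
    unfolding toeplitz_factor using X' by (simp add: S_def mult.assoc PP) (metis mult.assoc)
  also have "\<dots> = Pp * (bi * ((X' * X) * (Pp * (b * Pp))))"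
    unfolding cancels using X' by (simp add: mult.assoc PP) (metis mult.assoc)
  also have "\<dots> = Pp" by (simp add: X' mult.assoc PP Pp_Pp cancels1)
  finally show ?thesis using that[OF S 1] by simp
qed

text \<open>The second factorisation \<open>a b h = \<theta>\<close> makes \<open>Y = P c P c' P\<close> an inverse of \<open>X\<close>: in \<open>X Y\<close> all the
  inner projections can be absorbed, because \<open>h\<close> preserves the nonnegative and \<open>\<theta>\<close> the negative
  half space. As \<open>c c' = 1\<close>, the perturbation in \<open>Y\<close> is minus the Hankel product \<open>c Q c'\<close>, and
  Jacobi's identity applies to \<open>X\<close> and \<open>Y\<close>.\<close>

theorem det_toeplitz_eq:
  assumes h: "Pp * (h * Pp) = h * Pp" and th: "Pp * (a * b * h * Pp) = Pp * (a * b * h)"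
    and inv: "a * b * h * thi = 1" and c: "c = b * h" "c' = thi * a" and cc: "c * c' = 1"
  shows "det_on {..<m} (natpart (a * b)) = fredholm_det (natpart A) *
    fredholm_det (\<lambda>p q. - (if min p q < m then 0 else natpart (c * Qm * c') p q))"
proof -
  (* The candidate for the inverse of X. *)
  define Y where "Y = Pp * c * Pp * c' * Pp"
  have hP: "h * (Pp * x) = Pp * (h * (Pp * x))" for x using h by (metis mult.assoc)
  have thP: "Pp * (a * (b * (h * (Pp * x)))) = Pp * (a * (b * (h * x)))" for x
    using th by (metis mult.assoc)
  have inv': "a * (b * (h * (thi * x))) = x" for x using inv by (metis mult.assoc mult_1_left)
  have "X * Y = Pp * ai * Pp * a * b * (Pp * (bi * (Pp * (b * (h * (Pp * (thi * a * Pp)))))))"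
    by (simp add: X_def Y_def c mult.assoc PP)
  also have "\<dots> = Pp * ai * Pp * a * b * (Pp * (h * (Pp * (thi * a * Pp))))" unfolding cancels ..
  also have "\<dots> = Pp * ai * (Pp * (a * (b * (h * (Pp * (thi * a * Pp))))))"
    unfolding hP[symmetric] by (simp add: mult.assoc)
  also have "\<dots> = Pp" unfolding thP by (simp add: mult.assoc inv' cancels1)
  finally have XY: "X * Y = Pp" .
  define B where "B = (\<lambda>p q. - natpart (c * Qm * c') p q)"
  have "Y = Pp * (c * c') * Pp - Pp * c * Qm * c' * Pp"
    unfolding Y_def Qm_def by (simp add: algebra_simps)
  then have Y: "Y = Pp - Pp * (c * Qm * c') * Pp" by (simp add: cc Pp_Pp mult.assoc)
  then have nY: "natpart Y = one_plus B"
    by (intro ext) (simp add: natpart_def one_plus_def B_def ent_diff ent_Pp ent_mult_Pp ent_Pp_mult)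
  obtain C r where A: "geo C r (natpart A)" by (rule geo_A)
  obtain D s where "geo D s (natpart (c * Qm * c'))" by (rule geo_natpart)
  then have "geo D s B" by (simp add: geo_def B_def)
  then obtain E t where AB: "geo E t (natpart A)" "geo E t B" using geo_common[OF A] by metis
  have "(\<lambda>k. one_plus (natpart A) p k * one_plus B k q) sums delta p q" for p q
  proof -
    have "(\<lambda>k. ent X (int p) (int k) * ent Y (int k) (int q)) sums ent (X * Y) (int p) (int q)"
      unfolding ent_mult
      by (rule infsum_int_nat[OF _ ent_mult_summable]) (simp add: X_def ent_mult_Pp)
    then show ?thesis
      using natpart_X nY by (simp add: XY natpart_def fun_eq_iff ent_Pp delta_def)
  qed
  from det_on_eq_complementary_fredholm_det[OF AB this, of m]
  have "det_on {..<m} (natpart (a * b)) = fredholm_det (natpart A) *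
    fredholm_det (\<lambda>p q. if min p q < m then 0 else B p q)"
    by (simp add: det_toeplitz natpart_X)
  also have "(\<lambda>p q. if min p q < m then 0 else B p q) =
    (\<lambda>p q. - (if min p q < m then 0 else natpart (c * Qm * c') p q))"
    by (auto simp: B_def fun_eq_iff)
  finally show ?thesis .
qed

end
section \<open>The Hilbert space of square summable sequences\<close>

text \<open>The bounded inverse theorem by Baire's category theorem, for an operator restricted to a closed
  subspace.\<close>

theorem bounded_inverse_on:
  fixes T :: "'a::banach => 'b::banach"
  assumes T: "bounded_linear T" and V: "closed V" "subspace V"
    and onto: "T ` V = UNIV" and inj: "!!x. x \<in> V ==> T x = 0 ==> x = 0"
  shows "\<exists>C. \<forall>x\<in>V. norm x \<le> C * norm (T x)"
proof -
  interpret T: bounded_linear T by (rule T)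
  define B where "B k = closure (T ` (V \<inter> cball 0 (real k)))" for k :: nat
  have "\<exists>k. interior (B k) ~= {}"
  proof (rule ccontr)
    assume "\<not> ?thesis"
    then have e: "interior (B k) = {}" for k by blast
    have mc: "Met_TC.mcomplete TYPE('b)"
      unfolding Met_TC.mcomplete_def by (auto simp: convergent_eq_Cauchy)
    have "euclidean interior_of \<Union>(range B) = {}"
      unfolding mtopology_is_euclidean[symmetric]
    proof (rule Met_TC.metric_Baire_category_alt[OF mc])
      fix S assume "S \<in> range B"
      then obtain k where S: "S = B k" by blast
      show "closedin Met_TC.mtopology S \<and> Met_TC.mtopology interior_of S = {}"
        unfolding S mtopology_is_euclidean using e[of k]
        by (simp add: B_def euclidean_interior_of)
    qed simp
    moreover have "\<Union>(range B) = UNIV"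
    proof -
      have "y \<in> \<Union>(range B)" for y
      proof -
        obtain x where x: "x \<in> V" "T x = y" using onto by (metis UNIV_I imageE)
        obtain k :: nat where "norm x \<le> real k" using real_arch_simple by blast
        then have "y \<in> T ` (V \<inter> cball 0 (real k))" using x by auto
        then have "y \<in> B k" unfolding B_def by (rule subsetD[OF closure_subset])
        then show ?thesis by blast
      qed
      then show ?thesis by blast
    qed
    ultimately show False by simp
  qed
  then obtain k y0 where "y0 \<in> interior (B k)" by blast
  then obtain e where e: "0 < e" "ball y0 e \<subseteq> B k" using mem_interior by blast
  have half: "\<exists>x\<in>V. norm x \<le> real (4 * k) / e * norm y \<and> norm (y - T x) \<le> norm y / 2" for y
  proof (cases "y = 0")
    case True
    then show ?thesis using subspace_0[OF V(2)] by (intro bexI[of _ 0]) (auto simp: T.zero)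
  next
    case False
    define c where "c = 2 * norm y / e"
    have c: "0 < c" using False e by (simp add: c_def)
    let ?z = "y0 + y /\<^sub>R c"
    have "norm (y /\<^sub>R c) = e / 2" using False e by (simp add: c_def field_simps)
    then have "?z \<in> B k" "y0 \<in> B k" using e by (auto simp: dist_norm subset_iff)
    moreover have d: "0 < norm y / (4 * c)" using False c by simp
    ultimately obtain u' v' where uv: "u' \<in> T ` (V \<inter> cball 0 (real k))" "dist u' ?z < norm y / (4 * c)"
      "v' \<in> T ` (V \<inter> cball 0 (real k))" "dist v' y0 < norm y / (4 * c)"
      unfolding B_def closure_approachable using d by blast
    then obtain u v where u: "u \<in> V" "norm u \<le> real k" "dist (T u) ?z < norm y / (4 * c)"
      and v: "v \<in> V" "norm v \<le> real k" "dist (T v) y0 < norm y / (4 * c)" by auto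
    have "norm (y /\<^sub>R c - (T u - T v)) \<le> norm (?z - T u) + norm (T v - y0)"
      using norm_triangle_ineq[of "?z - T u" "T v - y0"] by (simp add: algebra_simps)
    also have "\<dots> \<le> norm y / (2 * c)" using u v c by (simp add: dist_norm norm_minus_commute)
    finally have "c * norm (y /\<^sub>R c - (T u - T v)) \<le> norm y / 2" using c by (simp add: field_simps)
    also have "c * norm (y /\<^sub>R c - (T u - T v)) = norm (c *\<^sub>R (y /\<^sub>R c - (T u - T v)))"
      using c by simp
    also have "c *\<^sub>R (y /\<^sub>R c - (T u - T v)) = y - T (c *\<^sub>R (u - v))"
      using c by (simp add: T.scaleR T.diff scaleR_diff_right)
    finally have 1: "norm (y - T (c *\<^sub>R (u - v))) \<le> norm y / 2" .
    have "norm (u - v) \<le> real (2 * k)" using u v norm_triangle_ineq4[of u v] by simp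
    then have "c * norm (u - v) \<le> c * real (2 * k)" using c by (intro mult_left_mono) auto
    then have 2: "norm (c *\<^sub>R (u - v)) \<le> real (4 * k) / e * norm y"
    proof -
      have "norm (c *\<^sub>R (u - v)) = c * norm (u - v)" using c by simp
      moreover have "c * real (2 * k) = real (4 * k) / e * norm y" by (simp add: c_def)
      ultimately show ?thesis using \<open>c * norm (u - v) \<le> c * real (2 * k)\<close> by linarith
    qed
    show ?thesis using 1 2 u v V(2)
      by (intro bexI[of _ "c *\<^sub>R (u - v)"]) (auto simp: subspace_diff subspace_scale)
  qed
  define K where "K = real (4 * k) / e"
  have K: "0 \<le> K" using e by (simp add: K_def)
  obtain g where g: "!!y. g y \<in> V" "!!y. norm (g y) \<le> K * norm y" "!!y. norm (y - T (g y)) \<le> norm y / 2"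
    using half unfolding K_def[symmetric] by metis
  have "norm x \<le> (2 * K) * norm (T x)" if x: "x \<in> V" for x
  proof -
    define r where "r n = ((\<lambda>y. y - T (g y)) ^^ n) (T x)" for n
    have r_Suc: "r (Suc n) = r n - T (g (r n))" and r0: "r 0 = T x" for n by (simp_all add: r_def)
    have rn: "norm (r n) \<le> norm (T x) * (1 / 2) ^ n" for n
    proof (induction n)
      case (Suc n)
      then show ?case using g(3)[of "r n"] by (simp add: r_Suc)
    qed (simp add: r0)
    have gn: "norm (g (r n)) \<le> K * norm (T x) * (1 / 2) ^ n" for n
    proof -
      have "K * norm (r n) \<le> K * (norm (T x) * (1 / 2) ^ n)" by (rule mult_left_mono[OF rn K])
      then show ?thesis using g(2)[of "r n"] by (simp add: mult.assoc)
    qed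
    have sg: "summable (\<lambda>n. K * norm (T x) * (1 / 2) ^ n)"
      by (intro summable_mult summable_geometric) simp
    have s: "summable (\<lambda>n. g (r n))" by (rule summable_comparison_test'[OF sg, of 0]) (rule gn)
    define z where "z = (\<Sum>n. g (r n))"
    have part: "(\<Sum>i<n. T (g (r i))) = T x - r n" for n
      by (induction n) (simp_all add: r0 r_Suc)
    have "r \<longlonglongrightarrow> 0"
      by (rule Lim_null_comparison[OF always_eventually[OF allI[OF rn]]])
        (intro tendsto_mult_right_zero LIMSEQ_power_zero, simp)
    then have "(\<lambda>n. \<Sum>i<n. T (g (r i))) \<longlonglongrightarrow> T x - 0" unfolding part by (intro tendsto_intros)
    moreover have "(\<lambda>n. T (g (r n))) sums T z" unfolding z_def by (rule T.sums[OF summable_sums[OF s]])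
    ultimately have Tz: "T z = T x" unfolding sums_def using LIMSEQ_unique by auto
    have "(\<lambda>n. \<Sum>i<n. g (r i)) \<longlonglongrightarrow> z" using summable_sums[OF s] by (simp add: z_def sums_def)
    moreover have "(\<Sum>i<n. g (r i)) \<in> V" for n by (intro subspace_sum V) (rule g(1))
    ultimately have zV: "z \<in> V" by (rule closed_sequentially[OF V(1), rotated])
    have "z - x = 0" using inj[of "z - x"] subspace_diff[OF V(2) zV x] Tz by (simp add: T.diff)
    moreover have "norm z \<le> (\<Sum>n. K * norm (T x) * (1 / 2) ^ n)"
      unfolding z_def by (rule norm_suminf_le[OF gn sg])
    moreover have "(\<Sum>n. K * norm (T x) * (1 / 2) ^ n) = K * norm (T x) * 2"
      by (subst suminf_mult) (auto simp: suminf_geometric summable_geometric)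
    ultimately show ?thesis by simp
  qed
  then show ?thesis by blast
qed

text \<open>A type of its own, so that completeness is available through the type class \<open>banach\<close>.\<close>

typedef ell2 = "{x :: int => complex. (\<lambda>p. (cmod (x p))\<^sup>2) summable_on UNIV}"
  morphisms crd Ell2
  by (rule exI[of _ "\<lambda>p. 0"]) simp

lemma crd_summable: "(\<lambda>p. (cmod (crd x p))\<^sup>2) summable_on UNIV"
  using crd[of x] by simp

lemma ell2_eqI: "(!!p. crd x p = crd y p) ==> x = y"
  by (metis crd_inject ext)

definition ell2norm :: "(int => complex) => real" where
  "ell2norm x = sqrt (\<Sum>\<^sub>\<infinity>p. (cmod (x p))\<^sup>2)"

lemma ell2_boundI:
  assumes "!!F. finite F ==> L2_set (\<lambda>p. cmod (x p)) F \<le> K"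
  shows "(\<lambda>p. (cmod (x p))\<^sup>2) summable_on UNIV" "ell2norm x \<le> K"
proof -
  have K: "0 \<le> K" using assms[of "{}"] by simp
  have b: "(\<Sum>p\<in>F. (cmod (x p))\<^sup>2) \<le> K\<^sup>2" if "finite F" for F
    using assms[OF that] K by (simp add: L2_set_def real_sqrt_le_iff' sum_nonneg)
  then show s: "(\<lambda>p. (cmod (x p))\<^sup>2) summable_on UNIV"
    by (intro nonneg_bdd_above_summable_on) (auto simp: bdd_above_def)
  have "(\<Sum>\<^sub>\<infinity>p. (cmod (x p))\<^sup>2) \<le> K\<^sup>2" by (rule infsum_le_finite_sums[OF s]) (use b in auto)
  then show "ell2norm x \<le> K" using K by (simp add: ell2norm_def real_le_lsqrt)
qed

lemma L2_set_le_ell2norm: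
  assumes "(\<lambda>p. (cmod (x p))\<^sup>2) summable_on UNIV" "finite F"
  shows "L2_set (\<lambda>p. cmod (x p)) F \<le> ell2norm x"
  unfolding L2_set_def ell2norm_def
  by (intro real_sqrt_le_mono finite_sum_le_infsum assms) auto

lemma L2_set_cmod_add_le:
  "L2_set (\<lambda>p. cmod (x p + y p)) F \<le> L2_set (\<lambda>p. cmod (x p)) F + L2_set (\<lambda>p. cmod (y p)) F"
  by (rule order_trans[OF L2_set_mono L2_set_triangle_ineq]) (auto intro: norm_triangle_ineq)

lemma ell2_add:
  assumes "(\<lambda>p. (cmod (x p))\<^sup>2) summable_on UNIV" "(\<lambda>p. (cmod (y p))\<^sup>2) summable_on UNIV"
  shows "(\<lambda>p. (cmod (x p + y p))\<^sup>2) summable_on UNIV" "ell2norm (\<lambda>p. x p + y p) \<le> ell2norm x + ell2norm y"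
proof -
  have *: "L2_set (\<lambda>p. cmod (x p + y p)) F \<le> ell2norm x + ell2norm y" if "finite F" for F
    using L2_set_cmod_add_le[of x y F] L2_set_le_ell2norm[OF assms(1) that]
      L2_set_le_ell2norm[OF assms(2) that] by linarith
  show "(\<lambda>p. (cmod (x p + y p))\<^sup>2) summable_on UNIV" "ell2norm (\<lambda>p. x p + y p) \<le> ell2norm x + ell2norm y"
    by (rule ell2_boundI, erule *)+
qed

lemma ell2_mult:
  assumes "(\<lambda>p. (cmod (x p))\<^sup>2) summable_on UNIV"
  shows "(\<lambda>p. (cmod (c * x p))\<^sup>2) summable_on UNIV" "ell2norm (\<lambda>p. c * x p) = cmod c * ell2norm x"
  unfolding norm_mult power_mult_distrib ell2norm_def
  using assms by (auto intro!: summable_on_cmult_right simp: infsum_cmult_right' real_sqrt_mult)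

setup_lifting type_definition_ell2

instantiation ell2 :: real_vector
begin

lift_definition zero_ell2 :: ell2 is "\<lambda>p. 0" by simp
lift_definition plus_ell2 :: "ell2 => ell2 => ell2" is "\<lambda>x y p. x p + y p" by (rule ell2_add)
lift_definition uminus_ell2 :: "ell2 => ell2" is "\<lambda>x p. - x p" by simp
lift_definition minus_ell2 :: "ell2 => ell2 => ell2" is "\<lambda>x y p. x p - y p"
  using ell2_add(1)[of _ "\<lambda>p. - _ p"] by simp
lift_definition scaleR_ell2 :: "real => ell2 => ell2" is "\<lambda>c x p. complex_of_real c * x p" by (rule ell2_mult)
instance
proof
  fix x y z :: ell2 and a b :: real
  show "x + y + z = x + (y + z)" by transfer (simp add: add.assoc)
  show "x + y = y + x" by transfer (simp add: add.commute)
  show "0 + x = x" by transfer simp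
  show "- x + x = 0" by transfer simp
  show "x - y = x + - y" by transfer simp
  show "a *\<^sub>R (x + y) = a *\<^sub>R x + a *\<^sub>R y" by transfer (simp add: distrib_left)
  show "(a + b) *\<^sub>R x = a *\<^sub>R x + b *\<^sub>R x" by transfer (simp add: distrib_right)
  show "a *\<^sub>R b *\<^sub>R x = (a * b) *\<^sub>R x" by transfer (simp add: mult.assoc)
  show "1 *\<^sub>R x = x" by transfer simp
qed

end

instantiation ell2 :: real_normed_vector
begin

lift_definition norm_ell2 :: "ell2 => real" is ell2norm .

definition dist_ell2 :: "ell2 => ell2 => real" where "dist_ell2 x y = norm (x - y)"
definition sgn_ell2 :: "ell2 => ell2" where "sgn_ell2 x = x /\<^sub>R norm x"
definition [code del]: "(uniformity :: (ell2 \<times> ell2) filter) = (INF e\<in>{0 <..}. principal {(x, y). dist x y < e})"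
definition [code del]: "open (U :: ell2 set) \<longleftrightarrow> (\<forall>x\<in>U. \<forall>\<^sub>F (x', y) in uniformity. x' = x --> y \<in> U)"

instance
proof
  fix x y :: ell2 and a :: real
  show "dist x y = norm (x - y)" by (rule dist_ell2_def)
  show "sgn x = x /\<^sub>R norm x" by (rule sgn_ell2_def)
  show "(uniformity :: (ell2 \<times> ell2) filter) = (INF e\<in>{0 <..}. principal {(x, y). dist x y < e})"
    by (rule uniformity_ell2_def)
  show "open U \<longleftrightarrow> (\<forall>x\<in>U. \<forall>\<^sub>F (x', y) in uniformity. x' = x --> y \<in> U)" for U :: "ell2 set"
    by (rule open_ell2_def)
  show "norm (x + y) \<le> norm x + norm y" by transfer (rule ell2_add)
  show "norm (a *\<^sub>R x) = \<bar>a\<bar> * norm x" by transfer (simp add: ell2_mult)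
  show "norm x = 0 \<longleftrightarrow> x = 0"
  proof transfer
    fix x :: "int => complex" assume s: "(\<lambda>p. (cmod (x p))\<^sup>2) summable_on UNIV"
    show "ell2norm x = 0 \<longleftrightarrow> x = (\<lambda>p. 0)"
    proof
      assume "ell2norm x = 0"
      then have "cmod (x p) \<le> 0" for p using L2_set_le_ell2norm[OF s, of "{p}"] by simp
      then show "x = (\<lambda>p. 0)" by (simp add: fun_eq_iff)
    qed (simp add: ell2norm_def)
  qed
qed

end

lemma crd_zero: "crd 0 p = 0" by (simp add: zero_ell2.rep_eq)
lemma crd_add: "crd (x + y) p = crd x p + crd y p" by (simp add: plus_ell2.rep_eq)
lemma crd_minus: "crd (- x) p = - crd x p" by (simp add: uminus_ell2.rep_eq)
lemma crd_diff: "crd (x - y) p = crd x p - crd y p" by (simp add: minus_ell2.rep_eq)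
lemma crd_scaleR: "crd (c *\<^sub>R x) p = complex_of_real c * crd x p" by (simp add: scaleR_ell2.rep_eq)

lift_definition cmul :: "complex => ell2 => ell2" is "\<lambda>c x p. c * x p" by (rule ell2_mult)

lemma crd_cmul: "crd (cmul c x) p = c * crd x p" by (simp add: cmul.rep_eq)

lemmas crd_simps = crd_zero crd_add crd_minus crd_diff crd_scaleR crd_cmul

lemma norm_ell2_eq: "norm x = sqrt (\<Sum>\<^sub>\<infinity>p. (cmod (crd x p))\<^sup>2)"
  by (simp add: norm_ell2.rep_eq ell2norm_def)

lemma norm_crd_le: "cmod (crd x p) \<le> norm x"
  using L2_set_le_ell2norm[OF crd_summable, of "{p}" x] by (simp add: norm_ell2.rep_eq)

lemma norm_cmul: "norm (cmul c x) = cmod c * norm x"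
  by transfer (rule ell2_mult)

lemma bounded_bilinear_cmul: "bounded_bilinear cmul"
proof
  show "\<exists>K. \<forall>a b. norm (cmul a b) \<le> norm a * norm b * K"
    by (rule exI[of _ 1]) (simp add: norm_cmul)
qed (auto intro!: ell2_eqI simp: crd_simps algebra_simps scaleR_conv_of_real)

lemma bounded_linear_crd: "bounded_linear (\<lambda>x. crd x p)"
  by (rule bounded_linear_intro[where K = 1])
    (auto simp: crd_simps norm_crd_le scaleR_conv_of_real)

lemma norm_ell2_boundI:
  assumes "!!F. finite F ==> L2_set (\<lambda>p. cmod (crd x p)) F \<le> K"
  shows "norm x \<le> K"
  using ell2_boundI(2)[OF assms] by (simp add: norm_ell2.rep_eq)

lemma L2_set_crd_le: "finite F ==> L2_set (\<lambda>p. cmod (crd x p)) F \<le> norm x"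
  using L2_set_le_ell2norm[OF crd_summable] by (simp add: norm_ell2.rep_eq)

instance ell2 :: banach
proof
  fix X :: "nat => ell2" assume C: "Cauchy X"
  have "Cauchy (\<lambda>n. crd (X n) p)" for p
    by (rule bounded_linear.Cauchy[OF bounded_linear_crd C])
  then have "\<exists>l. (\<lambda>n. crd (X n) p) \<longlonglongrightarrow> l" for p by (simp add: convergent_eq_Cauchy)
  then obtain x where x: "!!p. (\<lambda>n. crd (X n) p) \<longlonglongrightarrow> x p" by metis
  have key: "L2_set (\<lambda>p. cmod (crd (X m) p - x p)) F \<le> e"
    if "!!n. n \<ge> m ==> norm (X m - X n) \<le> e" "finite F" for m e F
  proof (rule tendsto_upperbound)
    show "(\<lambda>n. L2_set (\<lambda>p. cmod (crd (X m) p - crd (X n) p)) F) \<longlonglongrightarrow> L2_set (\<lambda>p. cmod (crd (X m) p - x p)) F"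
      unfolding L2_set_def by (intro tendsto_intros x)
    show "\<forall>\<^sub>F n in sequentially. L2_set (\<lambda>p. cmod (crd (X m) p - crd (X n) p)) F \<le> e"
    proof (rule eventually_sequentiallyI[of m])
      fix n assume "m \<le> n"
      then show "L2_set (\<lambda>p. cmod (crd (X m) p - crd (X n) p)) F \<le> e"
        using that(1)[of n] L2_set_crd_le[OF that(2), of "X m - X n"] by (simp add: crd_diff)
    qed
  qed simp
  have "\<exists>m. \<forall>n\<ge>m. norm (X m - X n) \<le> e" if "0 < e" for e
    using CauchyD[OF C that] by (meson le_refl less_imp_le)
  from this[of 1] obtain m1 where m1: "!!n. n \<ge> m1 ==> norm (X m1 - X n) \<le> 1" by auto
  have "(\<lambda>p. (cmod (crd (X m1) p - x p))\<^sup>2) summable_on UNIV" by (rule ell2_boundI(1)[OF key[OF m1]])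
  then have "(\<lambda>p. (cmod (- 1 * (crd (X m1) p - x p) + crd (X m1) p))\<^sup>2) summable_on UNIV"
    by (intro ell2_add ell2_mult crd_summable)
  then have xs: "crd (Ell2 x) = x" by (subst Ell2_inverse) auto
  have "X \<longlonglongrightarrow> Ell2 x"
  proof (rule LIMSEQ_I)
    fix e :: real assume e: "0 < e"
    then obtain N where N: "!!m n. m \<ge> N ==> n \<ge> N ==> norm (X m - X n) < e / 2"
      using CauchyD[OF C, of "e / 2"] by auto
    have "norm (X m - Ell2 x) < e" if "m \<ge> N" for m
    proof -
      have "norm (X m - Ell2 x) \<le> e / 2"
      proof (rule norm_ell2_boundI)
        fix F :: "int set" assume "finite F"
        then have "L2_set (\<lambda>p. cmod (crd (X m) p - x p)) F \<le> e / 2"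
          by (intro key) (use N that in \<open>auto intro: less_imp_le\<close>)
        then show "L2_set (\<lambda>p. cmod (crd (X m - Ell2 x) p)) F \<le> e / 2" by (simp add: crd_diff xs)
      qed
      then show ?thesis using e by simp
    qed
    then show "\<exists>N. \<forall>n\<ge>N. norm (X n - Ell2 x) < e" by blast
  qed
  then show "convergent X" by (auto simp: convergent_def)
qed

lemma bounded_seq_crd: "bounded_seq (crd x)"
  unfolding bounded_seq_def using norm_crd_le by blast

lemma L2_set_sum_le:
  assumes "finite D"
  shows "L2_set (\<lambda>p. cmod (\<Sum>d\<in>D. f d p)) F \<le> (\<Sum>d\<in>D. L2_set (\<lambda>p. cmod (f d p)) F)"
  using assms
proof (induction D rule: finite_induct)
  case (insert d D)
  then show ?case using L2_set_cmod_add_le[of "f d" "\<lambda>p. \<Sum>d\<in>D. f d p" F] by simp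
qed (simp add: L2_set_0')

text \<open>Schur's test: the matrix is a sum of its diagonals, and the \<open>k\<close>-th one has norm at most
  \<open>C r\<^sup>k\<close>.\<close>

lemma act_ell2_bound:
  assumes A: "decay C r A" and F: "finite F"
  shows "L2_set (\<lambda>p. cmod (act A (crd x) p)) F \<le> C * (\<Sum>\<^sub>\<infinity>q::int. r ^ nat \<bar>q\<bar>) * norm x"
proof -
  note a = decayD[OF A]
  have inj: "inj_on (\<lambda>p. p - d) S" for d :: int and S by (auto simp: inj_on_def)
  have bij: "bij (\<lambda>d::int. p - d)" for p by (rule bij_betw_byWitness[of _ "\<lambda>q. p - q"]) auto
  have s: "(\<lambda>d. A p (p - d) * crd x (p - d)) summable_on UNIV" for p
    using decay_row_summable[OF A bounded_seq_crd, of p x]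
      summable_on_reindex_bij_betw[OF bij, of "\<lambda>q. A p q * crd x q" p] by simp
  have e: "act A (crd x) p = (\<Sum>\<^sub>\<infinity>d. A p (p - d) * crd x (p - d))" for p
    unfolding act_def using infsum_reindex_bij_betw[OF bij, of "\<lambda>q. A p q * crd x q" p] by simp
  have fin: "L2_set (\<lambda>p. cmod (\<Sum>d\<in>D. A p (p - d) * crd x (p - d))) F \<le>
      C * (\<Sum>\<^sub>\<infinity>q::int. r ^ nat \<bar>q\<bar>) * norm x" if "finite D" for D
  proof -
    have "L2_set (\<lambda>p. cmod (A p (p - d) * crd x (p - d))) F \<le> C * norm x * r ^ nat \<bar>d\<bar>" for d
    proof -
      have "L2_set (\<lambda>p. cmod (A p (p - d) * crd x (p - d))) F \<le>
          L2_set (\<lambda>p. C * r ^ nat \<bar>d\<bar> * cmod (crd x (p - d))) F"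
      proof (rule L2_set_mono)
        fix p
        have "cmod (A p (p - d)) \<le> C * r ^ nat \<bar>d\<bar>" using a(4)[of p "p - d"] by simp
        then show "cmod (A p (p - d) * crd x (p - d)) \<le> C * r ^ nat \<bar>d\<bar> * cmod (crd x (p - d))"
          unfolding norm_mult by (rule mult_right_mono) simp
      qed simp
      also have "\<dots> = C * r ^ nat \<bar>d\<bar> * L2_set (\<lambda>p. cmod (crd x (p - d))) F"
        using a by (subst L2_set_right_distrib) auto
      also have "L2_set (\<lambda>p. cmod (crd x (p - d))) F = L2_set (\<lambda>p. cmod (crd x p)) ((\<lambda>p. p - d) ` F)"
        unfolding L2_set_def by (subst sum.reindex[OF inj]) simp
      also have "C * r ^ nat \<bar>d\<bar> * L2_set (\<lambda>p. cmod (crd x p)) ((\<lambda>p. p - d) ` F) \<le> C * r ^ nat \<bar>d\<bar> * norm x"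
        by (intro mult_left_mono L2_set_crd_le) (use F a in auto)
      finally show ?thesis by (simp add: mult_ac)
    qed
    then have "L2_set (\<lambda>p. cmod (\<Sum>d\<in>D. A p (p - d) * crd x (p - d))) F \<le> (\<Sum>d\<in>D. C * norm x * r ^ nat \<bar>d\<bar>)"
      by (rule order_trans[OF L2_set_sum_le[OF that] sum_mono])
    also have "\<dots> = C * norm x * (\<Sum>d\<in>D. r ^ nat \<bar>d\<bar>)" by (simp add: sum_distrib_left)
    also have "\<dots> \<le> C * norm x * (\<Sum>\<^sub>\<infinity>q::int. r ^ nat \<bar>q\<bar>)"
      using a that summable_on_geometric_int[of r 0] by (intro mult_left_mono finite_sum_le_infsum) auto
    finally show ?thesis by (simp add: mult_ac)
  qed
  have "((\<lambda>D. \<Sum>d\<in>D. A p (p - d) * crd x (p - d)) \<longlongrightarrow> act A (crd x) p) (finite_subsets_at_top UNIV)" for p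
    unfolding e by (rule infsum_tendsto[OF s])
  then have "((\<lambda>D. L2_set (\<lambda>p. cmod (\<Sum>d\<in>D. A p (p - d) * crd x (p - d))) F) \<longlongrightarrow>
      L2_set (\<lambda>p. cmod (act A (crd x) p)) F) (finite_subsets_at_top UNIV)"
    unfolding L2_set_def by (intro tendsto_intros)
  then show ?thesis
    by (rule tendsto_upperbound) (auto intro!: eventually_finite_subsets_at_top_weakI fin)
qed

definition actL :: "emat => ell2 => ell2" where "actL A x = Ell2 (act (ent A) (crd x))"

lemma crd_actL: "crd (actL A x) = act (ent A) (crd x)"
proof -
  obtain C r where A: "decay C r (ent A)" by (rule decay_ent)
  show ?thesis unfolding actL_def
    by (rule Ell2_inverse) (use ell2_boundI(1)[OF act_ell2_bound[OF A]] in simp)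
qed

lemma actL_mult: "actL (A * B) x = actL A (actL B x)"
  by (rule ell2_eqI) (simp add: crd_actL act_mult[OF bounded_seq_crd])

lemma actL_one: "actL 1 x = x"
  by (rule ell2_eqI) (simp add: crd_actL act_one)

lemma act_add: "bounded_seq x ==> bounded_seq y ==> act (ent A) (\<lambda>p. x p + y p) p = act (ent A) x p + act (ent A) y p"
  unfolding act_def distrib_left by (rule infsum_add) (auto intro: act_row_summable)

lemma act_cmult: "act (ent A) (\<lambda>p. c * x p) p = c * act (ent A) x p"
  unfolding act_def by (subst infsum_cmult_right'[symmetric]) (simp add: mult_ac)

lemma actL_cmul: "actL A (cmul c x) = cmul c (actL A x)"
  by (rule ell2_eqI) (simp add: crd_actL cmul.rep_eq act_cmult)

lemma bounded_linear_actL: "bounded_linear (actL A)"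
proof -
  obtain C r where A: "decay C r (ent A)" by (rule decay_ent)
  show ?thesis
  proof (rule bounded_linear_intro)
    show "actL A (x + y) = actL A x + actL A y" for x y
      by (rule ell2_eqI) (simp add: crd_actL plus_ell2.rep_eq act_add[OF bounded_seq_crd bounded_seq_crd])
    show "actL A (c *\<^sub>R x) = c *\<^sub>R actL A x" for c x
      by (rule ell2_eqI) (simp add: crd_actL scaleR_ell2.rep_eq act_cmult)
    show "norm (actL A x) \<le> norm x * (C * (\<Sum>\<^sub>\<infinity>q::int. r ^ nat \<bar>q\<bar>))" for x
      by (rule norm_ell2_boundI) (use act_ell2_bound[OF A] in \<open>simp add: crd_actL mult.commute\<close>)
  qed
qed

section \<open>The coordinate half spaces\<close>

definition plus_space :: "ell2 set" where "plus_space = {x. \<forall>p<0. crd x p = 0}"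
definition minus_space :: "ell2 set" where "minus_space = {x. \<forall>p\<ge>0. crd x p = 0}"

abbreviation prP :: "ell2 => ell2" where "prP \<equiv> actL Pp"

lemma crd_prP: "crd (prP x) p = (if 0 \<le> p then crd x p else 0)"
  by (simp add: crd_actL act_Pp)

lemma norm_prP_le: "norm (prP x) \<le> norm x"
proof (rule norm_ell2_boundI)
  fix F :: "int set" assume "finite F"
  have "L2_set (\<lambda>p. cmod (crd (prP x) p)) F \<le> L2_set (\<lambda>p. cmod (crd x p)) F"
    by (rule L2_set_mono) (auto simp: crd_prP)
  also have "\<dots> \<le> norm x" by (rule L2_set_crd_le) fact
  finally show "L2_set (\<lambda>p. cmod (crd (prP x) p)) F \<le> norm x" .
qed

lemma prP_plus: "x \<in> plus_space ==> prP x = x"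
  by (rule ell2_eqI) (auto simp: crd_prP plus_space_def)

lemma prP_in_plus: "prP x \<in> plus_space" by (simp add: plus_space_def crd_prP)

lemma closed_coord: "closed {x. crd x p = 0}"
proof -
  have "closed ((\<lambda>x. crd x p) -` {0})"
    by (intro continuous_closed_vimage closed_singleton)
      (simp add: bounded_linear.isCont[OF bounded_linear_crd])
  then show ?thesis by (simp add: vimage_def)
qed

lemma closed_minus_space: "closed minus_space"
proof -
  have e: "minus_space = (\<Inter>p\<in>{0..}. {x. crd x p = 0})" by (auto simp: minus_space_def)
  show ?thesis unfolding e by (intro closed_INT ballI closed_coord)
qed

definition csubspace :: "ell2 set => bool" where
  "csubspace V \<longleftrightarrow> 0 \<in> V \<and> (\<forall>x\<in>V. \<forall>y\<in>V. x + y \<in> V) \<and> (\<forall>c. \<forall>x\<in>V. cmul c x \<in> V)"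

lemma scaleR_cmul: "c *\<^sub>R x = cmul (complex_of_real c) x"
  by (rule ell2_eqI) (simp add: crd_simps)

lemma subspace_csubspace: "csubspace V ==> subspace V"
  unfolding csubspace_def subspace_def by (auto simp: scaleR_cmul)

lemma csubspace_diff: "csubspace V ==> x \<in> V ==> y \<in> V ==> x - y \<in> V"
  by (rule subspace_diff[OF subspace_csubspace])

text \<open>On \<open>V \<times> minus_space\<close> the map \<open>(x, m) \<mapsto> prP x + m\<close> is a bijection to the whole space, to which
  the bounded inverse theorem applies.\<close>

theorem bounded_below_prP:
  assumes V: "closed V" "csubspace V"
    and onto: "!!y. y \<in> plus_space ==> \<exists>x\<in>V. prP x = y"
    and inj: "!!x. x \<in> V ==> prP x = 0 ==> x = 0"
  obtains C where "0 < C" "!!x. x \<in> V ==> norm x \<le> C * norm (prP x)"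
proof -
  note blP = bounded_linear_actL[of Pp]
  define T :: "ell2 \<times> ell2 => ell2" where "T z = prP (fst z) + snd z" for z
  have T: "bounded_linear T" unfolding T_def
    by (intro bounded_linear_add bounded_linear_compose[OF blP] bounded_linear_fst bounded_linear_snd)
  have ms: "subspace minus_space"
    by (auto simp: subspace_def minus_space_def crd_simps)
  have zero_if: "prP x = 0 \<and> m = 0" if "m \<in> minus_space" "prP x + m = 0" for x m
  proof -
    have "crd (prP x) p + crd m p = 0" for p using that(2) by (metis crd_add crd_zero)
    moreover have "crd m p = 0 \<or> crd (prP x) p = 0" for p
      using that(1) by (cases "0 \<le> p") (auto simp: crd_prP minus_space_def)
    ultimately have "crd m p = 0" "crd (prP x) p = 0" for p
      by (metis add.right_neutral add_0)+
    then show ?thesis by (auto intro!: ell2_eqI simp: crd_zero)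
  qed
  have "\<exists>C. \<forall>z\<in>V \<times> minus_space. norm z \<le> C * norm (T z)"
  proof (rule bounded_inverse_on[OF T])
    show "closed (V \<times> minus_space)" by (intro closed_Times V closed_minus_space)
    show "subspace (V \<times> minus_space)" by (intro subspace_Times subspace_csubspace V ms)
    show "T ` (V \<times> minus_space) = UNIV"
    proof -
      have "y \<in> T ` (V \<times> minus_space)" for y
      proof -
        obtain x where x: "x \<in> V" "prP x = prP y" using onto[OF prP_in_plus[of y]] by auto
        have "y - prP y \<in> minus_space" by (simp add: minus_space_def crd_diff crd_prP)
        then show ?thesis using x by (intro image_eqI[of _ _ "(x, y - prP y)"]) (auto simp: T_def)
      qed
      then show ?thesis by blast
    qed
    fix z assume "z \<in> V \<times> minus_space" "T z = 0"
    then show "z = 0" using zero_if[of "snd z" "fst z"] inj[of "fst z"]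
      by (auto simp: T_def prod_eq_iff)
  qed
  then obtain C where C: "!!z. z \<in> V \<times> minus_space ==> norm z \<le> C * norm (T z)" by blast
  have "norm x \<le> (\<bar>C\<bar> + 1) * norm (prP x)" if "x \<in> V" for x
  proof -
    have "norm x \<le> C * norm (prP x)"
      using C[of "(x, 0)"] that subspace_0[OF ms] by (simp add: T_def)
    also have "\<dots> \<le> (\<bar>C\<bar> + 1) * norm (prP x)" by (intro mult_right_mono) auto
    finally show ?thesis .
  qed
  then show ?thesis by (intro that[of "\<bar>C\<bar> + 1"]) auto
qed
section \<open>Uniqueness of Fourier coefficients on the circle\<close>

lemma sets_circle [simp, measurable_cong]: "sets circle = sets borel"
  and space_circle [simp]: "space circle = UNIV"
  by (simp_all add: circle_def)

lemma measurable_cis [measurable]: "cis \<in> borel_measurable borel"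
  by (intro borel_measurable_continuous_onI continuous_intros)

lemma measurable_powi [measurable]: "(\<lambda>z::complex. z powi k) \<in> borel_measurable borel"
  unfolding power_int_def by measurable

interpretation circle: prob_space circle
  unfolding circle_def
proof (rule prob_space.prob_space_distr)
  show "prob_space (uniform_measure lborel {0..2 * pi})"
    by (rule prob_space_uniform_measure) auto
qed simp

lemma AE_circle_norm: "AE z in circle. cmod z = 1"
  unfolding circle_def by (subst AE_distr_iff) auto

lemma AE_circleI: "(!!z. cmod z = 1 ==> P z) ==> AE z in circle. P z"
  using AE_circle_norm by eventually_elim auto

lemma integral_circle:
  assumes [measurable]: "f \<in> borel_measurable borel"
  shows "(LINT z|circle. (f z :: complex)) = (LINT x|lborel. indicator {0..2 * pi} x *\<^sub>R f (cis x)) / of_real (2 * pi)"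
proof -
  have "(LINT z|circle. f z) = (LINT x|uniform_measure lborel {0..2 * pi}. f (cis x))"
    unfolding circle_def by (rule integral_distr) auto
  also have "uniform_measure lborel {0..2 * pi} =
      density lborel (\<lambda>x. ennreal (indicator {0..2 * pi} x / (2 * pi)))"
    unfolding uniform_measure_def
    by (rule arg_cong[where f = "density lborel"])
      (auto simp: fun_eq_iff indicator_def divide_ennreal ennreal_1[symmetric] simp del: ennreal_1)
  also have "(LINT x|\<dots>. f (cis x)) = (LINT x|lborel. (indicator {0..2 * pi} x / (2 * pi)) *\<^sub>R f (cis x))"
    by (rule integral_density) auto
  also have "\<dots> = (LINT x|lborel. (indicator {0..2 * pi} x *\<^sub>R f (cis x)) / of_real (2 * pi))"
    by (rule Bochner_Integration.integral_cong) (auto simp: indicator_def scaleR_conv_of_real)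
  finally show ?thesis by simp
qed

lemma circle_moment: "(LINT z|circle. z powi k) = (if k = 0 then 1 else 0)"
proof (cases "k = 0")
  case True
  then show ?thesis using circle.prob_space by simp
next
  case False
  let ?F = "\<lambda>x. cis (of_int k * x) / (\<i> * of_int k)"
  have "(LINT x|lborel. indicator {0..2 * pi} x *\<^sub>R cis (of_int k * x)) = ?F (2 * pi) - ?F 0"
  proof (rule integral_FTC_Icc)
    fix x :: real
    show "(?F has_vector_derivative cis (of_int k * x)) (at x within {0..2 * pi})"
    proof -
      have "((\<lambda>z. exp (\<i> * of_int k * z) / (\<i> * of_int k)) has_field_derivative exp (\<i> * of_int k * of_real x))
          (at (of_real x))"
        using False by (auto intro!: derivative_eq_intros)
      from has_vector_derivative_real_field[OF this] show ?thesis
        by (simp add: cis_conv_exp mult.assoc)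
    qed
  qed (auto intro!: continuous_intros)
  also have "cis (of_int k * (2 * pi)) = 1"
    using cis_multiple_2pi[of "of_int k"] by (simp add: mult.commute mult.left_commute)
  finally have "(LINT x|lborel. indicator {0..2 * pi} x *\<^sub>R cis (of_int k * x)) = 0" by simp
  then show ?thesis using False by (simp add: integral_circle cis_power_int)
qed

inductive trig :: "(complex => complex) => bool" where
  mono: "trig (\<lambda>z. c * z powi k)"
| add: "trig p ==> trig q ==> trig (\<lambda>z. p z + q z)"
| cong: "trig p ==> (!!z. cmod z = 1 ==> p z = q z) ==> trig q"

lemma trig_mult_mono:
  assumes "trig q" shows "trig (\<lambda>z. c * z powi k * q z)"
  using assms
proof induction
  case (mono d j)
  show ?case
  proof (rule trig.cong[OF trig.mono[of "c * d" "k + j"]])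
    fix z :: complex assume "cmod z = 1"
    then have "z ~= 0" by auto
    then show "c * d * z powi (k + j) = c * z powi k * (d * z powi j)" by (simp add: power_int_add)
  qed
next
  case (add p q)
  show ?case by (rule trig.cong[OF trig.add[OF add.IH]]) (simp add: algebra_simps)
next
  case (cong p q)
  then show ?case by (auto intro: trig.cong)
qed

lemma trig_mult:
  assumes "trig p" "trig q" shows "trig (\<lambda>z. p z * q z)"
  using assms(1)
proof induction
  case (mono c k)
  show ?case by (rule trig_mult_mono[OF assms(2)])
next
  case (add p r)
  show ?case by (rule trig.cong[OF trig.add[OF add.IH]]) (simp add: algebra_simps)
next
  case (cong p r)
  then show ?case by (auto intro: trig.cong)
qed

lemma trig_real_polynomial:
  assumes "real_polynomial_function g" shows "trig (\<lambda>z. complex_of_real (g z))"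
  using assms
proof induction
  case (linear f)
  then interpret f: bounded_linear f .
  have eq: "complex_of_real (f z) =
      (of_real (f 1) / 2 - \<i> * of_real (f \<i>) / 2) * z powi 1 + (of_real (f 1) / 2 + \<i> * of_real (f \<i>) / 2) * z powi (-1)"
    if "cmod z = 1" for z
  proof -
    have "z = Re z *\<^sub>R 1 + Im z *\<^sub>R \<i>" by (simp add: complex_eq_iff)
    then have "f z = Re z * f 1 + Im z * f \<i>" by (metis f.add f.scaleR real_scaleR_def)
    then have "complex_of_real (f z) = (of_real (f 1) / 2 - \<i> * of_real (f \<i>) / 2) * z +
        (of_real (f 1) / 2 + \<i> * of_real (f \<i>) / 2) * cnj z"
      by (simp add: complex_eq_iff field_simps)
    moreover have "z powi (-1) = cnj z"
      using that complex_norm_square[of z] by (simp add: power_int_minus inverse_unique)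
    ultimately show ?thesis by (simp only: power_int_1_right)
  qed
  show ?case by (rule trig.cong[OF trig.add[OF trig.mono trig.mono]]) (rule eq[symmetric])
next
  case (const c)
  show ?case by (rule trig.cong[OF trig.mono[of "of_real c" 0]]) simp
next
  case (add f g)
  then show ?case by (auto intro: trig.cong[OF trig.add])
next
  case (mult f g)
  then show ?case by (auto intro: trig.cong[OF trig_mult])
qed

lemma trig_approx:
  fixes g :: "complex => real"
  assumes "continuous_on UNIV g" "0 < e"
  obtains p where "trig p" "p \<in> borel_measurable borel" "!!z. cmod z = 1 ==> cmod (of_real (g z) - p z) < e"
proof -
  have "continuous_on (sphere 0 1) g" by (rule continuous_on_subset[OF assms(1)]) simp
  then obtain p where p: "real_polynomial_function p" "!!z. z \<in> sphere 0 1 ==> \<bar>g z - p z\<bar> < e"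
    using Stone_Weierstrass_real_polynomial_function[of "sphere 0 1" g e] assms by auto
  have [measurable]: "p \<in> borel_measurable borel"
    using p(1) continuous_on_polymonial_function[of p UNIV] real_polynomial_function_eq
    by (intro borel_measurable_continuous_onI) auto
  show ?thesis
  proof (rule that)
    show "trig (\<lambda>z. complex_of_real (p z))" by (rule trig_real_polynomial[OF p(1)])
    fix z :: complex assume "cmod z = 1"
    then have "\<bar>g z - p z\<bar> < e" using p(2)[of z] by simp
    then show "cmod (of_real (g z) - of_real (p z)) < e" by (metis norm_of_real of_real_diff)
  qed simp
qed

lemma closed_indicator_limit:
  assumes "closed C" "C ~= {}"
  shows "(\<lambda>m. max 0 (1 - real m * infdist z C)) \<longlonglongrightarrow> indicator C z"
proof (cases "z \<in> C")
  case True
  then show ?thesis by (simp add: infdist_zero)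
next
  case False
  then have d: "0 < infdist z C"
    using assms in_closed_iff_infdist_zero infdist_nonneg[of z C] by (metis less_eq_real_def)
  obtain n :: nat where n: "1 < real n * infdist z C" using reals_Archimedean3[OF d] by blast
  have "max 0 (1 - real m * infdist z C) = 0" if "n \<le> m" for m
  proof -
    have "real n * infdist z C \<le> real m * infdist z C" using that d by (intro mult_right_mono) auto
    then show ?thesis using n by simp
  qed
  then show ?thesis
    using False by (intro tendsto_eventually eventually_sequentiallyI[of n]) simp
qed

lemma continuous_approx_indicator:
  "continuous_on UNIV (\<lambda>z. max 0 (1 - real m * infdist z (C :: complex set)))"
  by (intro continuous_intros)

lemma trig_integral_zero:
  assumes f: "integrable circle f" and z: "!!k. (LINT z|circle. z powi k * f z) = (0::complex)"
    and p: "trig p" and [measurable]: "p \<in> borel_measurable borel"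
  shows "integrable circle (\<lambda>z. p z * f z)" "(LINT z|circle. p z * f z) = 0"
proof -
  have i: "integrable circle (\<lambda>z. c * z powi k * f z)" for c k
    by (rule Bochner_Integration.integrable_bound[OF integrable_norm[OF integrable_mult_right[OF f, of c]]])
      (use f in \<open>auto intro!: AE_circleI simp: norm_mult norm_power_int\<close>)
  have "\<exists>q. q \<in> borel_measurable borel \<and> (\<forall>z. cmod z = 1 --> q z = p z) \<and>
      integrable circle (\<lambda>z. q z * f z) \<and> (LINT z|circle. q z * f z) = 0"
    using p
  proof induction
    case (mono c k)
    have "(LINT z|circle. c * z powi k * f z) = 0" using z by (simp add: mult.assoc)
    then show ?case using i by (intro exI[of _ "\<lambda>z. c * z powi k"]) auto
  next
    case (add p q)
    then obtain p' q' where *: "p' \<in> borel_measurable borel" "q' \<in> borel_measurable borel"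
      "\<forall>z. cmod z = 1 --> p' z = p z" "\<forall>z. cmod z = 1 --> q' z = q z"
      "integrable circle (\<lambda>z. p' z * f z)" "integrable circle (\<lambda>z. q' z * f z)"
      "(LINT z|circle. p' z * f z) = 0" "(LINT z|circle. q' z * f z) = 0" by blast
    then show ?case by (intro exI[of _ "\<lambda>z. p' z + q' z"]) (auto simp: distrib_right)
  next
    case (cong p q)
    then show ?case by metis
  qed
  then obtain q where q: "q \<in> borel_measurable borel" "!!z. cmod z = 1 ==> q z = p z"
    "integrable circle (\<lambda>z. q z * f z)" "(LINT z|circle. q z * f z) = 0" by blast
  have [measurable]: "f \<in> borel_measurable borel" using f by auto
  note [measurable] = q(1)
  have ae: "AE z in circle. q z * f z = p z * f z" by (rule AE_circleI) (simp add: q(2))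
  show "integrable circle (\<lambda>z. p z * f z)"
    by (rule iffD1[OF integrable_cong_AE[OF _ _ ae] q(3)]) measurable
  have "(LINT z|circle. q z * f z) = (LINT z|circle. p z * f z)"
    by (rule integral_cong_AE[OF _ _ ae]) measurable
  then show "(LINT z|circle. p z * f z) = 0" using q(4) by simp
qed

text \<open>Trigonometric polynomials approximate continuous functions uniformly, and these approximate
  the indicators of closed sets, so the integrals over all closed sets vanish.\<close>

theorem fourier_zero_imp_zero:
  assumes f: "integrable circle f" and z: "!!k. fourier f k = 0"
  shows "AE z in circle. f z = 0"
proof -
  have [measurable]: "f \<in> borel_measurable borel" using f by auto
  have z': "(LINT z|circle. z powi k * f z) = 0" for k
    using z[of "- k"] by (simp add: fourier_def)
  have cont: "(LINT z|circle. of_real (g z) * f z) = 0"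
    if g: "continuous_on UNIV g" "!!z. \<bar>g z\<bar> \<le> 1" for g :: "complex => real"
  proof -
    have [measurable]: "g \<in> borel_measurable borel" by (rule borel_measurable_continuous_onI[OF g(1)])
    have ig: "integrable circle (\<lambda>z. of_real (g z) * f z)"
      by (rule Bochner_Integration.integrable_bound[OF integrable_norm[OF f]])
        (use g(2) in \<open>auto simp: norm_mult intro!: AE_I2 mult_left_le_one_le\<close>)
    have "cmod (LINT z|circle. of_real (g z) * f z) \<le> e * (LINT z|circle. cmod (f z))" if "0 < e" for e
    proof -
      obtain p where p: "trig p" "p \<in> borel_measurable borel"
        "!!z. cmod z = 1 ==> cmod (of_real (g z) - p z) < e"
        using trig_approx[OF g(1) \<open>0 < e\<close>] by blast
      note ip = trig_integral_zero[OF f z' p(1,2)]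
      have ip': "integrable circle (\<lambda>z. p z * f z)" by (rule ip(1))
      have "(LINT z|circle. of_real (g z) * f z) = (LINT z|circle. of_real (g z) * f z - p z * f z)"
        using ip(2) by (simp add: Bochner_Integration.integral_diff[OF ig ip'])
      also have "cmod \<dots> \<le> (LINT z|circle. cmod (of_real (g z) * f z - p z * f z))"
        by (rule integral_norm_bound)
      also have "\<dots> \<le> (LINT z|circle. e * cmod (f z))"
      proof (rule integral_mono_AE)
        show "AE z in circle. cmod (of_real (g z) * f z - p z * f z) \<le> e * cmod (f z)"
        proof (rule AE_circleI)
          fix z :: complex assume "cmod z = 1"
          then have "cmod ((of_real (g z) - p z) * f z) \<le> e * cmod (f z)"
            unfolding norm_mult by (intro mult_right_mono less_imp_le[OF p(3)]) auto
          then show "cmod (of_real (g z) * f z - p z * f z) \<le> e * cmod (f z)"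
            by (simp add: algebra_simps)
        qed
      qed (use f ig ip' in auto)
      finally show ?thesis using f by simp
    qed
    then have "cmod (LINT z|circle. of_real (g z) * f z) / (1 + (LINT z|circle. cmod (f z))) \<le> e"
      if "0 < e" for e
    proof -
      have n: "0 \<le> (LINT z|circle. cmod (f z))" by (rule integral_nonneg_AE) simp
      have "cmod (LINT z|circle. of_real (g z) * f z) \<le> e * (1 + (LINT z|circle. cmod (f z)))"
        using \<open>!!e. 0 < e ==> cmod (LINT z|circle. of_real (g z) * f z) \<le> e * (LINT z|circle. cmod (f z))\<close>[OF that]
          that by (simp add: algebra_simps)
      moreover have "0 < 1 + (LINT z|circle. cmod (f z))" using n by linarith
      ultimately show ?thesis by (simp only: pos_divide_le_eq)
    qed
    then have "cmod (LINT z|circle. of_real (g z) * f z) / (1 + (LINT z|circle. cmod (f z))) \<le> 0"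
      by (rule field_le_epsilon[of _ 0, simplified])
    moreover have "0 \<le> (LINT z|circle. cmod (f z))" by (rule integral_nonneg_AE) simp
    ultimately show ?thesis by (auto simp: divide_le_0_iff)
  qed
  have ind: "integrable circle (\<lambda>z. indicator A z * f z)" if "A \<in> sets borel" for A
    by (rule Bochner_Integration.integrable_bound[OF integrable_norm[OF f]])
      (use that in \<open>auto simp: norm_mult indicator_def\<close>)
  have closed: "(LINT z|circle. indicator C z * f z) = 0" if C: "closed C" for C
  proof (cases "C = {}")
    case False
    have "(\<lambda>m. LINT z|circle. complex_of_real (max 0 (1 - real m * infdist z C)) * f z)
        \<longlonglongrightarrow> (LINT z|circle. indicator C z * f z)"
    proof (rule integral_dominated_convergence[where w = "\<lambda>z. cmod (f z)"])
      show "(\<lambda>z. indicator C z * f z) \<in> borel_measurable circle" using borel_closed[OF C] by measurable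
      show "(\<lambda>z. complex_of_real (max 0 (1 - real m * infdist z C)) * f z) \<in> borel_measurable circle" for m
        using borel_measurable_continuous_onI[OF continuous_approx_indicator[of m C]] by measurable
      show "AE z in circle. (\<lambda>m. complex_of_real (max 0 (1 - real m * infdist z C)) * f z)
          \<longlonglongrightarrow> indicator C z * f z"
      proof (rule AE_I2)
        fix z
        have "(\<lambda>m. complex_of_real (max 0 (1 - real m * infdist z C))) \<longlonglongrightarrow> of_real (indicator C z)"
          by (rule tendsto_of_real[OF closed_indicator_limit[OF C False]])
        then show "(\<lambda>m. complex_of_real (max 0 (1 - real m * infdist z C)) * f z) \<longlonglongrightarrow> indicator C z * f z"
          by (intro tendsto_mult tendsto_const) (cases "z \<in> C"; simp)
      qed
      show "AE z in circle. cmod (complex_of_real (max 0 (1 - real m * infdist z C)) * f z) \<le> cmod (f z)" for m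
      proof (rule AE_I2)
        fix z
        have "0 \<le> real m * infdist z C" by (simp add: infdist_nonneg)
        then have "\<bar>max 0 (1 - real m * infdist z C)\<bar> \<le> 1" by auto
        then show "cmod (complex_of_real (max 0 (1 - real m * infdist z C)) * f z) \<le> cmod (f z)"
          unfolding norm_mult norm_of_real by (rule mult_left_le_one_le[OF norm_ge_zero abs_ge_zero])
      qed
    qed (use f in auto)
    moreover have "(LINT z|circle. complex_of_real (max 0 (1 - real m * infdist z C)) * f z) = 0" for m
    proof (rule cont[OF continuous_approx_indicator])
      fix z
      have "0 \<le> real m * infdist z C" by (simp add: infdist_nonneg)
      then show "\<bar>max 0 (1 - real m * infdist z C)\<bar> \<le> 1" by auto
    qed
    ultimately show ?thesis by (simp add: LIMSEQ_const_iff)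
  qed simp
  have all: "(LINT z|circle. indicator A z * f z) = 0" if "A \<in> sets borel" for A
  proof -
    have "Int_stable (Collect closed :: complex set set)" "Collect closed \<subseteq> Pow (UNIV :: complex set)"
      by (auto simp: Int_stable_def)
    moreover have "A \<in> sigma_sets UNIV (Collect closed)" using that by (simp add: borel_eq_closed)
    ultimately show ?thesis
    proof (induction rule: sigma_sets_induct_disjoint)
      case (compl A)
      have A: "A \<in> sets borel" using compl(1) by (simp add: borel_eq_closed)
      have "(LINT z|circle. indicator (UNIV - A) z * f z) =
          (LINT z|circle. indicator UNIV z * f z - indicator A z * f z)"
        by (rule Bochner_Integration.integral_cong) (auto simp: indicator_def)
      also have "\<dots> = 0"
        using ind[of UNIV] ind[OF A] closed[of UNIV] compl(2) by (subst Bochner_Integration.integral_diff) auto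
      finally show ?case .
    next
      case (union A)
      have A: "A i \<in> sets borel" for i using union(2) by (auto simp: borel_eq_closed)
      have d: "(\<lambda>i. indicator (A i) z * f z) sums (indicator (\<Union>i. A i) z * f z)" for z
      proof (rule sums_mult2)
        show "(\<lambda>i. indicator (A i) z :: complex) sums indicator (\<Union>i. A i) z"
        proof (cases "\<exists>i. z \<in> A i")
          case True
          then obtain k where k: "z \<in> A k" by blast
          then have "(\<lambda>i. indicator (A i) z :: complex) = (\<lambda>i. if i = k then 1 else 0)"
            using union(1) by (auto simp: disjoint_family_on_def indicator_def fun_eq_iff)
          moreover have "indicator (\<Union>i. A i) z = (1 :: complex)" using k by (auto simp: indicator_def)
          ultimately show ?thesis using sums_single[of k "\<lambda>_. 1 :: complex"] by simp
        qed (auto simp: indicator_def)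
      qed
      have "(\<lambda>n. LINT z|circle. (\<Sum>i<n. indicator (A i) z * f z)) \<longlonglongrightarrow> (LINT z|circle. indicator (\<Union>i. A i) z * f z)"
      proof (rule integral_dominated_convergence[where w = "\<lambda>z. cmod (f z)"])
        show "AE z in circle. (\<lambda>n. \<Sum>i<n. indicator (A i) z * f z) \<longlonglongrightarrow> indicator (\<Union>i. A i) z * f z"
          using d by (auto simp: sums_def)
        show "AE z in circle. cmod (\<Sum>i<n. indicator (A i) z * f z) \<le> cmod (f z)" for n
        proof (rule AE_I2)
          fix z
          have "(\<Sum>i<n. indicator (A i) z :: complex) = indicator (\<Union>i<n. A i) z"
            using union(1) by (subst indicator_UN_disjoint) (auto simp: disjoint_family_on_def)
          then show "cmod (\<Sum>i<n. indicator (A i) z * f z) \<le> cmod (f z)"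
            by (simp add: sum_distrib_right[symmetric] norm_mult indicator_def)
        qed
      qed (use f A in auto)
      moreover have "(LINT z|circle. (\<Sum>i<n. indicator (A i) z * f z)) = 0" for n
        using union(3) ind[OF A] by (subst Bochner_Integration.integral_sum) auto
      ultimately show ?case by (simp add: LIMSEQ_const_iff)
    qed (use closed in auto)
  qed
  have pos: "AE z in circle. Re (c * f z) \<le> 0" for c :: complex
  proof -
    define A where "A = {z. 0 < Re (c * f z)}"
    have A: "A \<in> sets borel" unfolding A_def by measurable
    define h where "h z = c * (indicator A z * f z)" for z
    have h: "integrable circle h" unfolding h_def by (rule integrable_mult_right[OF ind[OF A]])
    have "(LINT z|circle. h z) = 0" using all[OF A] by (simp add: h_def)
    then have "(LINT z|circle. Re (h z)) = 0" using integral_Re[OF h] by simp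
    moreover have "0 \<le> Re (h z)" for z by (cases "z \<in> A") (auto simp: h_def A_def)
    ultimately have "AE z in circle. Re (h z) = 0"
      using integral_nonneg_eq_0_iff_AE[of circle "\<lambda>z. Re (h z)"] h by auto
    then show ?thesis
    proof eventually_elim
      case (elim z)
      show ?case
      proof (cases "z \<in> A")
        case True
        then have "h z = c * f z" by (simp add: h_def)
        then show ?thesis using elim by (metis order_refl)
      next
        case False
        then show ?thesis unfolding A_def mem_Collect_eq by (simp only: not_less)
      qed
    qed
  qed
  show ?thesis
    using pos[of 1] pos[of "-1"] pos[of "\<i>"] pos[of "-\<i>"]
    by eventually_elim (auto simp: complex_eq_iff)
qed

theorem circle_eqI:
  fixes M :: "complex measure"
  assumes M: "prob_space M" "sets M = sets borel" "AE z in M. cmod z = 1"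
    and m: "!!k. (LINT z|M. z powi k) = (if k = 0 then 1 else 0)"
  shows "M = circle"
proof -
  interpret M: prob_space M by (rule M(1))
  note [measurable_cong] = M(2)
  have AEI: "AE z in M. P z" if "!!z. cmod z = 1 ==> P z" for P
    using M(3) by eventually_elim (use that in auto)
  have tr: "\<exists>q. q \<in> borel_measurable borel \<and> (\<forall>z. cmod z = 1 --> q z = p z) \<and>
      integrable M q \<and> integrable circle q \<and> (LINT z|M. q z) = (LINT z|circle. q z)"
    if "trig p" for p
    using that
  proof induction
    case (mono c k)
    have "integrable M (\<lambda>z. z powi k)" "integrable circle (\<lambda>z. z powi k)"
      by (auto intro!: M.integrable_const_bound[of _ 1] circle.integrable_const_bound[of _ 1]
          AEI AE_circleI simp: norm_power_int)
    then show ?case using m circle_moment by (intro exI[of _ "\<lambda>z. c * z powi k"]) auto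
  next
    case (add p q)
    then obtain p' q' where "p' \<in> borel_measurable borel" "q' \<in> borel_measurable borel"
      "\<forall>z. cmod z = 1 --> p' z = p z" "\<forall>z. cmod z = 1 --> q' z = q z"
      "integrable M p'" "integrable circle p'" "integrable M q'" "integrable circle q'"
      "(LINT z|M. p' z) = (LINT z|circle. p' z)" "(LINT z|M. q' z) = (LINT z|circle. q' z)" by blast
    then show ?case by (intro exI[of _ "\<lambda>z. p' z + q' z"]) auto
  next
    case (cong p q)
    then show ?case by metis
  qed
  have cont: "(LINT z|M. g z) = (LINT z|circle. g z)"
    if g: "continuous_on UNIV g" "!!z. \<bar>g z\<bar> \<le> 1" for g :: "complex => real"
  proof -
    have [measurable]: "g \<in> borel_measurable borel" by (rule borel_measurable_continuous_onI[OF g(1)])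
    have ig: "integrable M (\<lambda>z. complex_of_real (g z))" "integrable circle (\<lambda>z. complex_of_real (g z))"
      using g(2) by (auto intro!: M.integrable_const_bound[of _ 1] circle.integrable_const_bound[of _ 1])
    have "cmod ((LINT z|M. complex_of_real (g z)) - (LINT z|circle. complex_of_real (g z))) \<le> 0 + e" if "0 < e" for e
    proof -
      have e: "0 < e / 2" using that by simp
      obtain p where p: "trig p" "!!z. cmod z = 1 ==> cmod (of_real (g z) - p z) < e / 2"
        using trig_approx[OF g(1) e] by blast
      obtain q where q: "q \<in> borel_measurable borel" "!!z. cmod z = 1 ==> q z = p z"
        "integrable M q" "integrable circle q" "(LINT z|M. q z) = (LINT z|circle. q z)"
        using tr[OF p(1)] by blast
      have b: "cmod (of_real (g z) - q z) \<le> e / 2" if "cmod z = 1" for z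
        using p(2)[OF that] q(2)[OF that] by simp
      have "cmod ((LINT z|M. complex_of_real (g z)) - (LINT z|M. q z)) \<le> (LINT z|M. cmod (of_real (g z) - q z))"
        unfolding Bochner_Integration.integral_diff[OF ig(1) q(3), symmetric] by (rule integral_norm_bound)
      also have "\<dots> \<le> (LINT z|M. e / 2)"
        by (rule integral_mono_AE) (use ig q b in \<open>auto intro!: AEI\<close>)
      finally have 1: "cmod ((LINT z|M. complex_of_real (g z)) - (LINT z|M. q z)) \<le> e / 2"
        by (simp add: M.prob_space)
      have "cmod ((LINT z|circle. complex_of_real (g z)) - (LINT z|circle. q z)) \<le> (LINT z|circle. cmod (of_real (g z) - q z))"
        unfolding Bochner_Integration.integral_diff[OF ig(2) q(4), symmetric] by (rule integral_norm_bound)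
      also have "\<dots> \<le> (LINT z|circle. e / 2)"
        by (rule integral_mono_AE) (use ig q b in \<open>auto intro!: AE_circleI\<close>)
      finally have 2: "cmod ((LINT z|circle. complex_of_real (g z)) - (LINT z|circle. q z)) \<le> e / 2"
        using circle.prob_space by simp
      show ?thesis using 1 2 q(5) norm_triangle_ineq4[of "(LINT z|M. complex_of_real (g z)) - (LINT z|M. q z)"
          "(LINT z|circle. complex_of_real (g z)) - (LINT z|circle. q z)"] by simp
    qed
    then have "cmod ((LINT z|M. complex_of_real (g z)) - (LINT z|circle. complex_of_real (g z))) \<le> 0"
      by (rule field_le_epsilon)
    then show ?thesis by simp
  qed
  show ?thesis
  proof (rule measure_eqI_generator_eq[where E = "Collect closed" and \<Omega> = UNIV and A = "\<lambda>_. UNIV"])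
    fix C :: "complex set" assume "C \<in> Collect closed"
    then have C: "closed C" by simp
    then have Cb: "C \<in> sets borel" by (rule borel_closed)
    have "measure M C = measure circle C"
    proof (cases "C = {}")
      case False
      have lim: "(\<lambda>m. LINT z|N. max 0 (1 - real m * infdist z C)) \<longlonglongrightarrow> measure N C"
        if N: "prob_space N" "sets N = sets borel" for N
      proof -
        interpret N: prob_space N by (rule N(1))
        note [measurable_cong] = N(2)
        have "(\<lambda>m. LINT z|N. max 0 (1 - real m * infdist z C)) \<longlonglongrightarrow> (LINT z|N. indicator C z)"
        proof (rule integral_dominated_convergence[where w = "\<lambda>z. 1"])
          show "(indicator C :: _ => real) \<in> borel_measurable N" using Cb by measurable
          show "(\<lambda>z. max 0 (1 - real m * infdist z C)) \<in> borel_measurable N" for m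
            using borel_measurable_continuous_onI[OF continuous_approx_indicator[of m C]] by measurable
          show "AE z in N. norm (max 0 (1 - real m * infdist z C)) \<le> 1" for m
            by (rule AE_I2) (auto simp: infdist_nonneg)
        qed (use closed_indicator_limit[OF C False] in auto)
        also have "(LINT z|N. indicator C z) = measure N C"
          using Cb N by (simp add: sets_eq_imp_space_eq[OF N(2)])
        finally show ?thesis .
      qed
      have "(LINT z|M. max 0 (1 - real m * infdist z C)) = (LINT z|circle. max 0 (1 - real m * infdist z C))" for m
        by (rule cont[OF continuous_approx_indicator]) (auto simp: infdist_nonneg abs_le_iff)
      then show ?thesis
        using lim[OF M(1,2)] lim[OF circle.prob_space_axioms] LIMSEQ_unique by auto
    qed simp
    then show "emeasure M C = emeasure circle C"
      by (simp add: M.emeasure_eq_measure circle.emeasure_eq_measure)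
  qed (use M in \<open>auto simp: Int_stable_def borel_eq_closed\<close>)
qed
section \<open>Square integrable functions and their Fourier coefficients\<close>

lemma measurable_circle: "borel_measurable circle = (borel_measurable borel :: (complex => 'a::topological_space) set)"
  by (rule measurable_cong_sets) auto

lemma L2_measurable: "f \<in> L2 ==> f \<in> borel_measurable borel"
  and L2_square_integrable: "f \<in> L2 ==> integrable circle (\<lambda>z. (cmod (f z))\<^sup>2)"
  by (simp_all add: L2_def measurable_circle)

lemma L2I: "f \<in> borel_measurable borel ==> integrable circle (\<lambda>z. (cmod (f z))\<^sup>2) ==> f \<in> L2"
  by (simp add: L2_def measurable_circle)

lemma L2_integrable:
  assumes "f \<in> L2" shows "integrable circle f"
proof (rule Bochner_Integration.integrable_bound)
  show "integrable circle (\<lambda>z. 1 + (cmod (f z))\<^sup>2)" using L2_square_integrable[OF assms] by simp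
  have "x \<le> 1 + x\<^sup>2" for x :: real
  proof -
    have "0 \<le> (x - 1 / 2)\<^sup>2" by simp
    also have "(x - 1 / 2)\<^sup>2 = x\<^sup>2 - x + 1 / 4" by (simp add: power2_eq_square algebra_simps)
    finally show ?thesis by simp
  qed
  then show "AE z in circle. cmod (f z) \<le> norm (1 + (cmod (f z))\<^sup>2)" by (intro AE_I2) simp
qed (use L2_measurable[OF assms] in simp)

lemma L2_bounded_mult:
  assumes f: "f \<in> L2" and p: "\<phi> \<in> borel_measurable borel" "!!z. cmod z = 1 ==> cmod (\<phi> z) \<le> B"
  shows "(\<lambda>z. \<phi> z * f z) \<in> L2"
    "(LINT z|circle. (cmod (\<phi> z * f z))\<^sup>2) \<le> B\<^sup>2 * (LINT z|circle. (cmod (f z))\<^sup>2)"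
proof -
  note [measurable] = L2_measurable[OF f] p(1)
  have b: "AE z in circle. (cmod (\<phi> z * f z))\<^sup>2 \<le> B\<^sup>2 * (cmod (f z))\<^sup>2"
  proof (rule AE_circleI)
    fix z :: complex assume "cmod z = 1"
    then show "(cmod (\<phi> z * f z))\<^sup>2 \<le> B\<^sup>2 * (cmod (f z))\<^sup>2"
      unfolding norm_mult power_mult_distrib using p(2) by (intro mult_right_mono power_mono) auto
  qed
  have i: "integrable circle (\<lambda>z. (cmod (\<phi> z * f z))\<^sup>2)"
    by (rule Bochner_Integration.integrable_bound[OF integrable_mult_right[OF L2_square_integrable[OF f], of "B\<^sup>2"]])
      (use b in auto)
  then show "(\<lambda>z. \<phi> z * f z) \<in> L2" by (intro L2I) auto
  have "(LINT z|circle. (cmod (\<phi> z * f z))\<^sup>2) \<le> (LINT z|circle. B\<^sup>2 * (cmod (f z))\<^sup>2)"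
    by (rule integral_mono_AE) (use i b L2_square_integrable[OF f] in auto)
  then show "(LINT z|circle. (cmod (\<phi> z * f z))\<^sup>2) \<le> B\<^sup>2 * (LINT z|circle. (cmod (f z))\<^sup>2)"
    using L2_square_integrable[OF f] by simp
qed

lemma L2_add:
  assumes f: "f \<in> L2" and g: "g \<in> L2" shows "(\<lambda>z. f z + g z) \<in> L2"
proof (rule L2I)
  note [measurable] = L2_measurable[OF f] L2_measurable[OF g]
  show "(\<lambda>z. f z + g z) \<in> borel_measurable borel" by measurable
  show "integrable circle (\<lambda>z. (cmod (f z + g z))\<^sup>2)"
  proof (rule Bochner_Integration.integrable_bound)
    show "integrable circle (\<lambda>z. 2 * (cmod (f z))\<^sup>2 + 2 * (cmod (g z))\<^sup>2)"
      using L2_square_integrable[OF f] L2_square_integrable[OF g] by simp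
    have "(cmod (f z + g z))\<^sup>2 \<le> 2 * (cmod (f z))\<^sup>2 + 2 * (cmod (g z))\<^sup>2" for z
    proof -
      have "(cmod (f z + g z))\<^sup>2 \<le> (cmod (f z) + cmod (g z))\<^sup>2"
        by (intro power_mono norm_triangle_ineq) simp
      also have "\<dots> \<le> (cmod (f z) + cmod (g z))\<^sup>2 + (cmod (f z) - cmod (g z))\<^sup>2" by simp
      also have "\<dots> = 2 * (cmod (f z))\<^sup>2 + 2 * (cmod (g z))\<^sup>2" by (simp add: power2_eq_square algebra_simps)
      finally show ?thesis .
    qed
    then show "AE z in circle. norm ((cmod (f z + g z))\<^sup>2) \<le> norm (2 * (cmod (f z))\<^sup>2 + 2 * (cmod (g z))\<^sup>2)"
      by (intro AE_I2) (simp add: abs_of_nonneg)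
  qed measurable
qed

lemma L2_cmult: "f \<in> L2 ==> (\<lambda>z. c * f z) \<in> L2"
  using L2_bounded_mult(1)[of f "\<lambda>_. c" "cmod c"] by simp

lemma L2_diff: "f \<in> L2 ==> g \<in> L2 ==> (\<lambda>z. f z - g z) \<in> L2"
  using L2_add[OF _ L2_cmult, of f g "-1"] by simp

lemma L2_const: "(\<lambda>z. c) \<in> L2"
  by (rule L2I) auto

lemma L2_mono: "(\<lambda>z. c * z powi k) \<in> L2"
  using L2_bounded_mult(1)[OF L2_const[of c], of "\<lambda>z. z powi k" 1]
  by (simp add: norm_power_int mult.commute)

lemma L2_sum: "(!!i. i \<in> I ==> f i \<in> L2) ==> (\<lambda>z. \<Sum>i\<in>I. f i z) \<in> L2"
  by (induction I rule: infinite_finite_induct) (auto intro: L2_add simp: L2_const)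

lemma powi_mult_integrable:
  assumes "f \<in> L2" shows "integrable circle (\<lambda>z. z powi k * f z)"
  by (rule L2_integrable, rule L2_bounded_mult(1)[OF assms, of _ 1]) (auto simp: norm_power_int)

lemma fourier_add: "f \<in> L2 ==> g \<in> L2 ==> fourier (\<lambda>z. f z + g z) k = fourier f k + fourier g k"
  unfolding fourier_def by (simp add: distrib_left powi_mult_integrable)

lemma fourier_cmult: "fourier (\<lambda>z. c * f z) k = c * fourier f k"
  unfolding fourier_def by (simp add: mult.left_commute)

lemma fourier_diff: "f \<in> L2 ==> g \<in> L2 ==> fourier (\<lambda>z. f z - g z) k = fourier f k - fourier g k"
  unfolding fourier_def by (simp add: right_diff_distrib powi_mult_integrable)

lemma fourier_sum:
  "(!!i. i \<in> I ==> f i \<in> L2) ==> fourier (\<lambda>z. \<Sum>i\<in>I. f i z) k = (\<Sum>i\<in>I. fourier (f i) k)"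
  unfolding fourier_def sum_distrib_left by (rule Bochner_Integration.integral_sum) (rule powi_mult_integrable)

lemma fourier_mono: "fourier (\<lambda>z. c * z powi j) k = (if j = k then c else 0)"
proof -
  have "(LINT z|circle. z powi (- k) * (z powi j)) = (LINT z|circle. z powi (j - k))"
  proof (rule integral_cong_AE)
    show "AE z in circle. z powi (- k) * z powi j = z powi (j - k)"
    proof (rule AE_circleI)
      fix z :: complex assume "cmod z = 1"
      then have "z ~= 0" by auto
      then show "z powi (- k) * z powi j = z powi (j - k)" by (simp add: power_int_add[symmetric])
    qed
  qed auto
  then have "fourier (\<lambda>z. z powi j) k = (if j = k then 1 else 0)"
    by (simp add: fourier_def circle_moment)
  then show ?thesis by (simp add: fourier_cmult)
qed

lemma fourier_cong: "f \<approx> g ==> f \<in> borel_measurable borel ==> g \<in> borel_measurable borel ==> fourier f k = fourier g k"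
  unfolding fourier_def ae_eq_def by (intro integral_cong_AE) (auto elim: eventually_mono)

definition trigsum :: "(int => complex) => int set => complex => complex" where
  "trigsum c F z = (\<Sum>k\<in>F. c k * z powi k)"

lemma trigsum_L2: "trigsum c F \<in> L2"
  unfolding trigsum_def by (rule L2_sum) (rule L2_mono)

lemma fourier_trigsum: "finite F ==> fourier (trigsum c F) k = (if k \<in> F then c k else 0)"
  unfolding trigsum_def by (subst fourier_sum) (auto simp: L2_mono fourier_mono)

lemma cnj_powi: "cmod z = 1 ==> cnj z powi k = z powi (- k)"
proof -
  assume z: "cmod z = 1"
  then have "cnj z = inverse z"
    using complex_norm_square[of z] by (metis inverse_unique of_real_1 one_power2)
  then show "cnj z powi k = z powi (- k)" by (simp add: power_int_minus power_int_inverse)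
qed

lemma measurable_cnj [measurable]: "cnj \<in> borel_measurable borel"
  by (intro borel_measurable_continuous_onI continuous_intros)

lemma integral_mult_cnj_trigsum:
  assumes "f \<in> L2" "finite F"
  shows "(LINT z|circle. f z * cnj (trigsum c F z)) = (\<Sum>k\<in>F. cnj (c k) * fourier f k)"
    "integrable circle (\<lambda>z. f z * cnj (trigsum c F z))"
proof -
  note [measurable] = L2_measurable[OF assms(1)] L2_measurable[OF trigsum_L2[of c F]]
  have ae: "AE z in circle. (\<Sum>k\<in>F. cnj (c k) * (z powi (- k) * f z)) = f z * cnj (trigsum c F z)"
    by (rule AE_circleI) (simp add: trigsum_def cnj_powi sum_distrib_left mult_ac)
  have i: "integrable circle (\<lambda>z. \<Sum>k\<in>F. cnj (c k) * (z powi (- k) * f z))"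
    by (intro Bochner_Integration.integrable_sum integrable_mult_right powi_mult_integrable assms)
  show "integrable circle (\<lambda>z. f z * cnj (trigsum c F z))"
    by (rule iffD1[OF integrable_cong_AE[OF _ _ ae] i]) measurable
  have "(LINT z|circle. f z * cnj (trigsum c F z)) = (LINT z|circle. (\<Sum>k\<in>F. cnj (c k) * (z powi (- k) * f z)))"
    by (rule integral_cong_AE[OF _ _ ae, symmetric]) measurable
  also have "\<dots> = (\<Sum>k\<in>F. cnj (c k) * fourier f k)"
    unfolding fourier_def
    by (subst Bochner_Integration.integral_sum) (auto intro!: integrable_mult_right powi_mult_integrable assms)
  finally show "(LINT z|circle. f z * cnj (trigsum c F z)) = (\<Sum>k\<in>F. cnj (c k) * fourier f k)" .
qed

lemma norm2_trigsum:
  assumes "finite F" shows "(LINT z|circle. (cmod (trigsum c F z))\<^sup>2) = (\<Sum>k\<in>F. (cmod (c k))\<^sup>2)"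
proof -
  have "complex_of_real (LINT z|circle. (cmod (trigsum c F z))\<^sup>2) = (LINT z|circle. trigsum c F z * cnj (trigsum c F z))"
    by (simp add: complex_norm_square[symmetric] flip: of_real_power)
  also have "\<dots> = (\<Sum>k\<in>F. cnj (c k) * (if k \<in> F then c k else 0))"
    using assms by (simp add: integral_mult_cnj_trigsum[OF trigsum_L2] fourier_trigsum)
  also have "\<dots> = of_real (\<Sum>k\<in>F. (cmod (c k))\<^sup>2)"
    unfolding of_real_sum by (intro sum.cong) (simp_all del: of_real_power add: complex_norm_square mult.commute)
  finally show ?thesis by (simp only: of_real_eq_iff)
qed

lemma bessel:
  assumes f: "f \<in> L2" and F: "finite F"
  shows "(\<Sum>k\<in>F. (cmod (fourier f k))\<^sup>2) \<le> (LINT z|circle. (cmod (f z))\<^sup>2)"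
proof -
  let ?s = "trigsum (fourier f) F"
  note i = integral_mult_cnj_trigsum[OF f F, of "fourier f"]
  define q where "q z = Re (f z * cnj (?s z))" for z
  note i1 = L2_square_integrable[OF f] and i2 = L2_square_integrable[OF trigsum_L2, of "fourier f" F]
  have e: "(cmod (f z - ?s z))\<^sup>2 = (cmod (f z))\<^sup>2 - 2 * q z + (cmod (?s z))\<^sup>2" for z
    unfolding cmod_power2 q_def by (simp add: power2_eq_square algebra_simps)
  have "(LINT z|circle. f z * cnj (?s z)) = of_real (\<Sum>k\<in>F. (cmod (fourier f k))\<^sup>2)"
    unfolding i(1) of_real_sum by (intro sum.cong) (simp_all del: of_real_power add: complex_norm_square mult.commute)
  then have re: "(LINT z|circle. q z) = (\<Sum>k\<in>F. (cmod (fourier f k))\<^sup>2)"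
    unfolding q_def integral_Re[OF i(2)] by simp
  have iq: "integrable circle q" unfolding q_def by (rule integrable_Re[OF i(2)])
  have "0 \<le> (LINT z|circle. (cmod (f z - ?s z))\<^sup>2)" by (rule integral_nonneg_AE) simp
  also have "\<dots> = (LINT z|circle. (cmod (f z))\<^sup>2) - 2 * (\<Sum>k\<in>F. (cmod (fourier f k))\<^sup>2)
      + (\<Sum>k\<in>F. (cmod (fourier f k))\<^sup>2)"
    unfolding e using iq i1 i2 re norm2_trigsum[OF F, of "fourier f"] by simp
  finally show ?thesis by simp
qed

lemma fourier_summable: "f \<in> L2 ==> (\<lambda>k. (cmod (fourier f k))\<^sup>2) summable_on UNIV"
  by (rule nonneg_bdd_above_summable_on) (auto simp: bdd_above_def intro: bessel)

definition FT :: "(complex => complex) => ell2" where "FT f = Ell2 (fourier f)"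

lemma crd_FT: "f \<in> L2 ==> crd (FT f) = fourier f"
  unfolding FT_def by (rule Ell2_inverse) (simp add: fourier_summable)

lemma integral_norm_le_sqrt:
  assumes f: "f \<in> L2" and b: "(LINT z|circle. (cmod (f z))\<^sup>2) \<le> e\<^sup>2" "0 < e"
  shows "(LINT z|circle. cmod (f z)) \<le> e"
proof -
  have "cmod (f z) \<le> e / 2 + (cmod (f z))\<^sup>2 / (2 * e)" for z
  proof -
    have "0 \<le> (cmod (f z) - e)\<^sup>2" by simp
    also have "\<dots> = (cmod (f z))\<^sup>2 - 2 * e * cmod (f z) + e\<^sup>2" by (simp add: power2_eq_square algebra_simps)
    finally have "2 * e * cmod (f z) \<le> (cmod (f z))\<^sup>2 + e\<^sup>2" by simp
    then show ?thesis using b(2) by (simp add: field_simps power2_eq_square)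
  qed
  then have "(LINT z|circle. cmod (f z)) \<le> (LINT z|circle. e / 2 + (cmod (f z))\<^sup>2 / (2 * e))"
    using L2_integrable[OF f] L2_square_integrable[OF f] by (intro integral_mono_AE) auto
  also have "\<dots> = e / 2 + (LINT z|circle. (cmod (f z))\<^sup>2) / (2 * e)"
    using L2_square_integrable[OF f] circle.prob_space by simp
  also have "\<dots> \<le> e / 2 + e\<^sup>2 / (2 * e)" using b by (intro add_left_mono divide_right_mono) auto
  finally show ?thesis using b(2) by (simp add: power2_eq_square)
qed

text \<open>A rapidly convergent subsequence of the partial sums converges almost everywhere; its limit has
  the prescribed coefficients.\<close>

theorem riesz_fischer:
  obtains f where "f \<in> L2" "FT f = x" "(LINT z|circle. (cmod (f z))\<^sup>2) \<le> (norm x)\<^sup>2"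
proof -
  let ?s = "\<lambda>F. \<Sum>k\<in>F. (cmod (crd x k))\<^sup>2"
  have tot: "?s F \<le> (norm x)\<^sup>2" if "finite F" for F
    unfolding norm_ell2_eq
    using finite_sum_le_infsum[OF crd_summable[of x] that] by (simp add: infsum_nonneg)
  have "\<exists>N::nat. \<forall>F. finite F --> F \<inter> {- int N..int N} = {} --> ?s F \<le> (1 / 4) ^ j" for j
  proof -
    have e: "0 < (1 / 4 :: real) ^ j" by simp
    obtain F0 where "finite F0" "dist (?s F0) (\<Sum>\<^sub>\<infinity>k. (cmod (crd x k))\<^sup>2) \<le> (1 / 4) ^ j"
      using infsum_finite_approximation[OF crd_summable e, of x] by blast
    then have F0: "finite F0" "(\<Sum>\<^sub>\<infinity>k. (cmod (crd x k))\<^sup>2) - (1 / 4) ^ j \<le> ?s F0"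
      by (auto simp: dist_real_def abs_le_iff)
    obtain N :: nat where N: "F0 \<subseteq> {- int N..int N}"
    proof -
      have "F0 \<subseteq> {- int (nat (Max (insert 0 (abs ` F0))))..int (nat (Max (insert 0 (abs ` F0))))}"
      proof
        fix k assume "k \<in> F0"
        then have "\<bar>k\<bar> \<le> Max (insert 0 (abs ` F0))" using F0(1) by (intro Max_ge) auto
        then show "k \<in> {- int (nat (Max (insert 0 (abs ` F0))))..int (nat (Max (insert 0 (abs ` F0))))}" by auto
      qed
      then show ?thesis by (rule that)
    qed
    have "?s F \<le> (1 / 4) ^ j" if F: "finite F" "F \<inter> {- int N..int N} = {}" for F
    proof -
      have "?s F0 + ?s F = ?s (F0 \<union> F)"
        by (rule sum.union_disjoint[symmetric]) (use F0 F N in auto)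
      also have "\<dots> \<le> (\<Sum>\<^sub>\<infinity>k. (cmod (crd x k))\<^sup>2)"
        by (rule finite_sum_le_infsum[OF crd_summable]) (use F0 F in auto)
      finally show ?thesis using F0(2) by simp
    qed
    then show ?thesis by blast
  qed
  then obtain N :: "nat => nat" where N: "!!j F. finite F ==> F \<inter> {- int (N j)..int (N j)} = {} ==> ?s F \<le> (1 / 4) ^ j"
    by metis
  define M where "M j = (\<Sum>i\<le>j. N i + 1)" for j
  define R where "R j = {- int (M j)..int (M j)}" for j
  have NM: "N j \<le> M j" for j
    unfolding M_def by (rule order_trans[OF _ member_le_sum[of j]]) auto
  have Mge: "j \<le> M j" for j unfolding M_def by (induction j) auto
  have R_mono: "R j \<subseteq> R (Suc j)" for j by (auto simp: R_def M_def)
  define D where "D j = (case j of 0 => R 0 | Suc i => R (Suc i) - R i)" for j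
  have finD: "finite (D j)" for j by (auto simp: D_def R_def split: nat.split)
  define g where "g j = trigsum (crd x) (D j)" for j
  have part: "(\<Sum>i\<le>j. g i z) = trigsum (crd x) (R j) z" for j z
  proof (induction j)
    case (Suc j)
    have "trigsum (crd x) (R (Suc j)) z = trigsum (crd x) (R j) z + trigsum (crd x) (R (Suc j) - R j) z"
      unfolding trigsum_def using R_mono[of j] by (subst add.commute, subst sum.subset_diff[of "R j"]) (auto simp: R_def)
    then show ?case using Suc by (simp add: g_def D_def)
  qed (simp add: g_def D_def)
  have gL2: "g j \<in> L2" for j unfolding g_def by (rule trigsum_L2)
  have gb: "(LINT z|circle. cmod (g (Suc j) z)) \<le> (1 / 2) ^ j" for j
  proof (rule integral_norm_le_sqrt[OF gL2])
    have "(LINT z|circle. (cmod (g (Suc j) z))\<^sup>2) = ?s (D (Suc j))"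
      unfolding g_def by (rule norm2_trigsum[OF finD])
    also have "\<dots> \<le> (1 / 4) ^ j" by (rule N[OF finD]) (use NM[of j] in \<open>auto simp: D_def R_def\<close>)
    also have "(1 / 4) ^ j = ((1 / 2 :: real) ^ j)\<^sup>2" by (simp add: power2_eq_square power_mult_distrib[symmetric])
    finally show "(LINT z|circle. (cmod (g (Suc j) z))\<^sup>2) \<le> ((1 / 2) ^ j)\<^sup>2" .
  qed simp
  have sI: "summable (\<lambda>j. LINT z|circle. cmod (g j z))"
  proof (subst summable_Suc_iff[symmetric], rule summable_comparison_test'[of "\<lambda>j. (1 / 2) ^ j" 0])
    show "norm (LINT z|circle. cmod (g (Suc j) z)) \<le> (1 / 2) ^ j" for j
      using gb[of j] integral_nonneg_AE[of "\<lambda>z. cmod (g (Suc j) z)" circle] by simp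
  qed (simp add: summable_geometric)
  have gi: "integrable circle (g j)" for j by (rule L2_integrable[OF gL2])
  note [measurable] = L2_measurable[OF gL2]
  have sAE: "AE z in circle. summable (\<lambda>j. cmod (g j z))"
  proof -
    have "(\<integral>\<^sup>+z. (\<Sum>j. ennreal (cmod (g j z))) \<partial>circle) = (\<Sum>j. \<integral>\<^sup>+z. ennreal (cmod (g j z)) \<partial>circle)"
      by (rule nn_integral_suminf) simp
    also have "\<dots> = (\<Sum>j. ennreal (LINT z|circle. cmod (g j z)))"
      by (intro arg_cong[where f = suminf] ext nn_integral_eq_integral integrable_norm gi) auto
    also have "\<dots> ~= \<infinity>" using sI by (simp add: ennreal_suminf_neq_top integral_nonneg_AE)
    finally have "AE z in circle. (\<Sum>j. ennreal (cmod (g j z))) ~= \<infinity>"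
      by (intro nn_integral_noteq_infinite) auto
    then show ?thesis by eventually_elim (auto intro: summable_suminf_not_top)
  qed
  define f where "f z = (\<Sum>j. g j z)" for z
  have [measurable]: "f \<in> borel_measurable borel" unfolding f_def by measurable
  have lim: "AE z in circle. (\<lambda>j. trigsum (crd x) (R j) z) \<longlonglongrightarrow> f z"
    using sAE
  proof eventually_elim
    case (elim z)
    then have "(\<lambda>j. g j z) sums f z" unfolding f_def by (rule summable_sums[OF summable_norm_cancel])
    then show ?case by (simp add: sums_def_le part)
  qed
  have "(\<integral>\<^sup>+z. ennreal ((cmod (f z))\<^sup>2) \<partial>circle) = (\<integral>\<^sup>+z. liminf (\<lambda>j. ennreal ((cmod (trigsum (crd x) (R j) z))\<^sup>2)) \<partial>circle)"
  proof (rule nn_integral_cong_AE)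
    show "AE z in circle. ennreal ((cmod (f z))\<^sup>2) = liminf (\<lambda>j. ennreal ((cmod (trigsum (crd x) (R j) z))\<^sup>2))"
      using lim
    proof eventually_elim
      case (elim z)
      have "(\<lambda>j. ennreal ((cmod (trigsum (crd x) (R j) z))\<^sup>2)) \<longlonglongrightarrow> ennreal ((cmod (f z))\<^sup>2)"
        by (intro tendsto_ennrealI tendsto_intros elim)
      show ?case by (rule lim_imp_Liminf[symmetric, OF sequentially_bot]) fact
    qed
  qed
  also have "\<dots> \<le> liminf (\<lambda>j. \<integral>\<^sup>+z. ennreal ((cmod (trigsum (crd x) (R j) z))\<^sup>2) \<partial>circle)"
    by (rule nn_integral_liminf) (use L2_measurable[OF trigsum_L2] in auto)
  also have "(\<lambda>j. \<integral>\<^sup>+z. ennreal ((cmod (trigsum (crd x) (R j) z))\<^sup>2) \<partial>circle) = (\<lambda>j. ennreal (?s (R j)))"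
    by (rule ext, subst nn_integral_eq_integral)
      (auto simp: norm2_trigsum R_def intro: L2_square_integrable trigsum_L2)
  also have "liminf \<dots> \<le> ennreal ((norm x)\<^sup>2)"
    by (rule Liminf_le) (auto intro!: always_eventually ennreal_leI tot simp: R_def)
  finally have nn: "(\<integral>\<^sup>+z. ennreal ((cmod (f z))\<^sup>2) \<partial>circle) \<le> ennreal ((norm x)\<^sup>2)" .
  have i2: "integrable circle (\<lambda>z. (cmod (f z))\<^sup>2)"
    by (rule integrableI_bounded) (use nn in \<open>auto simp: top_unique intro: le_less_trans\<close>)
  then have fL2: "f \<in> L2" by (intro L2I) auto
  have b: "(LINT z|circle. (cmod (f z))\<^sup>2) \<le> (norm x)\<^sup>2"
    using nn by (subst (asm) nn_integral_eq_integral[OF i2]) auto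
  have "fourier f k = crd x k" for k
  proof -
    have "(\<lambda>j. LINT z|circle. z powi (- k) * g j z) sums (LINT z|circle. (\<Sum>j. z powi (- k) * g j z))"
    proof (rule sums_integral)
      show "integrable circle (\<lambda>z. z powi (- k) * g j z)" for j by (rule powi_mult_integrable[OF gL2])
      show "AE z in circle. summable (\<lambda>j. norm (z powi (- k) * g j z))"
        using sAE AE_circle_norm by eventually_elim (simp add: norm_mult norm_power_int)
      have "(LINT z|circle. norm (z powi (- k) * g j z)) = (LINT z|circle. cmod (g j z))" for j
      proof (rule integral_cong_AE)
        show "AE z in circle. norm (z powi (- k) * g j z) = cmod (g j z)"
          by (rule AE_circleI) (simp add: norm_mult norm_power_int)
      qed measurable
      then show "summable (\<lambda>j. LINT z|circle. norm (z powi (- k) * g j z))" using sI by simp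
    qed
    also have "(LINT z|circle. (\<Sum>j. z powi (- k) * g j z)) = fourier f k"
      unfolding fourier_def
    proof (rule integral_cong_AE)
      show "AE z in circle. (\<Sum>j. z powi (- k) * g j z) = z powi (- k) * f z"
        using sAE by eventually_elim (simp add: f_def suminf_mult summable_norm_cancel)
    qed auto
    finally have "(\<lambda>j. \<Sum>i\<le>j. fourier (g i) k) \<longlonglongrightarrow> fourier f k"
      by (simp add: sums_def_le fourier_def)
    moreover have "(\<Sum>i\<le>j. fourier (g i) k) = (if k \<in> R j then crd x k else 0)" for j
    proof -
      have "(\<Sum>i\<le>j. fourier (g i) k) = fourier (\<lambda>z. \<Sum>i\<le>j. g i z) k" by (rule fourier_sum[symmetric]) (rule gL2)
      also have "(\<lambda>z. \<Sum>i\<le>j. g i z) = trigsum (crd x) (R j)" by (rule ext) (rule part)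
      finally show ?thesis by (simp add: fourier_trigsum R_def)
    qed
    moreover have "(\<lambda>j. if k \<in> R j then crd x k else 0) \<longlonglongrightarrow> crd x k"
    proof (rule tendsto_eventually, rule eventually_sequentiallyI[of "nat \<bar>k\<bar>"])
      fix j assume "nat \<bar>k\<bar> \<le> j"
      then have "\<bar>k\<bar> \<le> int (M j)" using Mge[of j] by linarith
      then show "(if k \<in> R j then crd x k else 0) = crd x k" by (auto simp: R_def)
    qed
    ultimately show ?thesis using LIMSEQ_unique by auto
  qed
  then have "FT f = x" by (intro ell2_eqI) (simp add: crd_FT[OF fL2])
  then show ?thesis by (rule that[OF fL2 _ b])
qed

lemma norm_FT: assumes f: "f \<in> L2" shows "(norm (FT f))\<^sup>2 = (LINT z|circle. (cmod (f z))\<^sup>2)"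
proof (rule antisym)
  have "(norm (FT f))\<^sup>2 = (\<Sum>\<^sub>\<infinity>p. (cmod (fourier f p))\<^sup>2)"
    by (simp add: norm_ell2_eq crd_FT[OF f] infsum_nonneg)
  also have "\<dots> \<le> (LINT z|circle. (cmod (f z))\<^sup>2)"
    by (rule infsum_le_finite_sums[OF fourier_summable[OF f]]) (rule bessel[OF f])
  finally show "(norm (FT f))\<^sup>2 \<le> (LINT z|circle. (cmod (f z))\<^sup>2)" .
  obtain g where g: "g \<in> L2" "FT g = FT f" "(LINT z|circle. (cmod (g z))\<^sup>2) \<le> (norm (FT f))\<^sup>2"
    by (rule riesz_fischer)
  have "fourier (\<lambda>z. f z - g z) k = 0" for k
    using g(2) by (simp add: fourier_diff[OF f g(1)]) (metis crd_FT f g(1))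
  then have "AE z in circle. f z - g z = 0"
    by (rule fourier_zero_imp_zero[OF L2_integrable[OF L2_diff[OF f g(1)]]])
  then have "AE z in circle. (cmod (f z))\<^sup>2 = (cmod (g z))\<^sup>2" by eventually_elim simp
  then have "(LINT z|circle. (cmod (f z))\<^sup>2) = (LINT z|circle. (cmod (g z))\<^sup>2)"
    using L2_measurable[OF f] L2_measurable[OF g(1)] by (intro integral_cong_AE) auto
  then show "(LINT z|circle. (cmod (f z))\<^sup>2) \<le> (norm (FT f))\<^sup>2" using g(3) by simp
qed

lemma norm_FT_L2_norm: "f \<in> L2 ==> norm (FT f) = L2_norm f"
  by (simp add: L2_norm_def norm_FT[symmetric])

lemma FT_add: "f \<in> L2 ==> g \<in> L2 ==> FT (\<lambda>z. f z + g z) = FT f + FT g"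
  by (rule ell2_eqI) (simp add: crd_FT L2_add crd_add fourier_add)

lemma FT_diff: "f \<in> L2 ==> g \<in> L2 ==> FT (\<lambda>z. f z - g z) = FT f - FT g"
  by (rule ell2_eqI) (simp add: crd_FT L2_diff crd_diff fourier_diff)

lemma FT_cmult: "f \<in> L2 ==> FT (\<lambda>z. c * f z) = cmul c (FT f)"
  by (rule ell2_eqI) (simp add: crd_FT L2_cmult crd_cmul fourier_cmult)

lemma FT_eq_iff: assumes "f \<in> L2" "g \<in> L2" shows "FT f = FT g \<longleftrightarrow> f \<approx> g"
proof
  assume "FT f = FT g"
  then have "fourier (\<lambda>z. f z - g z) k = 0" for k
    by (simp add: fourier_diff[OF assms]) (metis crd_FT assms)
  then have "AE z in circle. f z - g z = 0"
    by (rule fourier_zero_imp_zero[OF L2_integrable[OF L2_diff[OF assms]]])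
  then show "f \<approx> g" unfolding ae_eq_def by eventually_elim simp
next
  assume "f \<approx> g"
  then show "FT f = FT g"
    by (intro ell2_eqI) (simp add: crd_FT assms fourier_cong L2_measurable)
qed

definition IFT :: "ell2 => complex => complex" where "IFT x = (SOME f. f \<in> L2 \<and> FT f = x)"

lemma IFT: "IFT x \<in> L2" "FT (IFT x) = x"
proof -
  have "\<exists>f. f \<in> L2 \<and> FT f = x" using riesz_fischer[of x] by blast
  from someI_ex[OF this] show "IFT x \<in> L2" "FT (IFT x) = x" by (simp_all add: IFT_def)
qed

lemma fourier_IFT: "fourier (IFT x) = crd x" using crd_FT[OF IFT(1), of x] by (simp add: IFT(2))

definition bmf :: "(complex => complex) => bool" where
  "bmf \<phi> \<longleftrightarrow> \<phi> \<in> borel_measurable borel \<and> (\<exists>B. \<forall>z. cmod z = 1 --> cmod (\<phi> z) \<le> B)"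

lemma bmf_L2: "bmf \<phi> ==> f \<in> L2 ==> (\<lambda>z. \<phi> z * f z) \<in> L2"
  unfolding bmf_def using L2_bounded_mult(1) by blast

lemma bmf_add: "bmf \<phi> ==> bmf \<psi> ==> bmf (\<lambda>z. \<phi> z + \<psi> z)"
  unfolding bmf_def
proof (elim conjE exE, intro conjI exI allI impI)
  fix B C z assume "\<forall>z. cmod z = 1 --> cmod (\<phi> z) \<le> B" "\<forall>z. cmod z = 1 --> cmod (\<psi> z) \<le> C" "cmod z = 1"
  then show "cmod (\<phi> z + \<psi> z) \<le> B + C" by (intro norm_triangle_mono) auto
qed auto

lemma bmf_mult: "bmf \<phi> ==> bmf \<psi> ==> bmf (\<lambda>z. \<phi> z * \<psi> z)"
  unfolding bmf_def
proof (elim conjE exE, intro conjI exI allI impI)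
  fix B C z assume *: "\<forall>z. cmod z = 1 --> cmod (\<phi> z) \<le> B" "\<forall>z. cmod z = 1 --> cmod (\<psi> z) \<le> C" "cmod z = 1"
  then have "0 \<le> B" by (metis norm_ge_zero order_trans)
  then show "cmod (\<phi> z * \<psi> z) \<le> B * C" unfolding norm_mult using * by (intro mult_mono) auto
qed auto

lemma bmf_const: "bmf (\<lambda>_. c)" by (auto simp: bmf_def)
lemma bmf_powi: "bmf (\<lambda>z. z powi k)" by (auto simp: bmf_def norm_power_int)

lemma bmf_continuous:
  assumes "continuous_on UNIV \<phi>" shows "bmf \<phi>"
proof -
  have "compact (\<phi> ` sphere 0 1)" by (rule compact_continuous_image[OF continuous_on_subset[OF assms]]) auto
  then have "bounded (\<phi> ` sphere 0 1)" by (rule compact_imp_bounded)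
  then obtain B where "\<forall>z\<in>sphere 0 1. cmod (\<phi> z) \<le> B" by (auto simp: bounded_iff)
  then show ?thesis using borel_measurable_continuous_onI[OF assms] by (auto simp: bmf_def intro!: exI[of _ B])
qed

lemma bmf_in_L2: "bmf \<phi> ==> \<phi> \<in> L2" using bmf_L2[OF _ L2_const[of 1], of \<phi>] by simp

definition Mul :: "(complex => complex) => ell2 => ell2" where "Mul \<phi> x = FT (\<lambda>z. \<phi> z * IFT x z)"

lemma Mul_FT: assumes "bmf \<phi>" "f \<in> L2" shows "Mul \<phi> (FT f) = FT (\<lambda>z. \<phi> z * f z)"
proof -
  have "IFT (FT f) \<approx> f" using IFT[of "FT f"] FT_eq_iff assms by blast
  then have "(\<lambda>z. \<phi> z * IFT (FT f) z) \<approx> (\<lambda>z. \<phi> z * f z)" unfolding ae_eq_def by eventually_elim simp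
  then show ?thesis unfolding Mul_def by (subst FT_eq_iff) (auto intro!: bmf_L2 assms IFT)
qed

lemma Mul_add_right: "bmf \<phi> ==> Mul \<phi> (x + y) = Mul \<phi> x + Mul \<phi> y"
proof -
  assume p: "bmf \<phi>"
  have "Mul \<phi> (FT (\<lambda>z. IFT x z + IFT y z)) = FT (\<lambda>z. \<phi> z * (IFT x z + IFT y z))"
    by (rule Mul_FT[OF p L2_add[OF IFT(1) IFT(1)]])
  then show ?thesis using p by (simp add: FT_add IFT distrib_left bmf_L2 Mul_def[of \<phi> x] Mul_def[of \<phi> y])
qed

lemma Mul_cmul: "bmf \<phi> ==> Mul \<phi> (cmul c x) = cmul c (Mul \<phi> x)"
proof -
  assume p: "bmf \<phi>"
  have "Mul \<phi> (FT (\<lambda>z. c * IFT x z)) = FT (\<lambda>z. \<phi> z * (c * IFT x z))"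
    by (rule Mul_FT[OF p L2_cmult[OF IFT(1)]])
  then show ?thesis using p
    by (simp add: FT_cmult IFT mult.left_commute[of _ c] bmf_L2 Mul_def[of \<phi> x])
qed

lemma Mul_add_left: "bmf \<phi> ==> bmf \<psi> ==> Mul (\<lambda>z. \<phi> z + \<psi> z) x = Mul \<phi> x + Mul \<psi> x"
  by (simp add: Mul_def distrib_right FT_add bmf_L2 IFT)

lemma Mul_cmult_left: "bmf \<phi> ==> Mul (\<lambda>z. c * \<phi> z) x = cmul c (Mul \<phi> x)"
  by (simp add: Mul_def mult.assoc FT_cmult bmf_L2 IFT)

lemma Mul_Mul: "bmf \<phi> ==> bmf \<psi> ==> Mul \<phi> (Mul \<psi> x) = Mul (\<lambda>z. \<phi> z * \<psi> z) x"
  unfolding Mul_def[of \<psi>] by (simp add: Mul_FT bmf_L2 IFT) (simp add: Mul_def mult.assoc)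

lemma Mul_cong: "bmf \<phi> ==> bmf \<psi> ==> (!!z. cmod z = 1 ==> \<phi> z = \<psi> z) ==> Mul \<phi> x = Mul \<psi> x"
  unfolding Mul_def by (subst FT_eq_iff) (auto intro!: bmf_L2 IFT AE_circleI simp: ae_eq_def)

lemma Mul_one: "Mul (\<lambda>_. 1) x = x" by (simp add: Mul_def IFT)

lemma norm_Mul_le:
  assumes "bmf \<phi>" "!!z. cmod z = 1 ==> cmod (\<phi> z) \<le> B"
  shows "norm (Mul \<phi> x) \<le> B * norm x"
proof -
  have B: "0 \<le> B" by (rule order_trans[OF norm_ge_zero assms(2)[of 1]]) simp
  have "(norm (Mul \<phi> x))\<^sup>2 = (LINT z|circle. (cmod (\<phi> z * IFT x z))\<^sup>2)"
    unfolding Mul_def by (rule norm_FT[OF bmf_L2[OF assms(1) IFT(1)]])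
  also have "\<dots> \<le> B\<^sup>2 * (LINT z|circle. (cmod (IFT x z))\<^sup>2)"
    by (rule L2_bounded_mult(2)[OF IFT(1) _ assms(2)]) (use assms(1) in \<open>auto simp: bmf_def\<close>)
  also have "\<dots> = (B * norm x)\<^sup>2"
    using norm_FT[OF IFT(1), of x] by (simp add: IFT(2) power_mult_distrib)
  finally show ?thesis by (rule power2_le_imp_le) (simp add: B)
qed

lemma bounded_linear_Mul: assumes "bmf \<phi>" shows "bounded_linear (Mul \<phi>)"
proof -
  obtain B where B: "!!z. cmod z = 1 ==> cmod (\<phi> z) \<le> B" using assms by (auto simp: bmf_def)
  show ?thesis
    by (rule bounded_linear_intro[where K = B])
      (use assms norm_Mul_le[OF assms B] in \<open>auto simp: Mul_add_right scaleR_cmul Mul_cmul mult.commute\<close>)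
qed

lemma crd_Mul_powi: "crd (Mul (\<lambda>z. z powi k) x) p = crd x (p - k)"
proof -
  have "crd (Mul (\<lambda>z. z powi k) x) p = (LINT z|circle. z powi (- p) * (z powi k * IFT x z))"
    by (simp add: Mul_def crd_FT bmf_L2 bmf_powi IFT fourier_def)
  also have "\<dots> = (LINT z|circle. z powi (- (p - k)) * IFT x z)"
  proof (rule integral_cong_AE)
    show "AE z in circle. z powi (- p) * (z powi k * IFT x z) = z powi (- (p - k)) * IFT x z"
    proof (rule AE_circleI)
      fix z :: complex assume "cmod z = 1"
      then have "z ~= 0" by auto
      then show "z powi (- p) * (z powi k * IFT x z) = z powi (- (p - k)) * IFT x z"
        by (simp add: power_int_add[symmetric] mult.assoc[symmetric])
    qed
  qed (use L2_measurable[OF IFT(1)[of x]] in auto)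
  also have "\<dots> = crd x (p - k)" unfolding fourier_def[symmetric] fourier_IFT ..
  finally show ?thesis .
qed

section \<open>Absolutely convergent Fourier series\<close>

definition wser :: "(int => complex) => complex => complex" where
  "wser a z = (if cmod z = 1 then \<Sum>\<^sub>\<infinity>k. a k * z powi k else 0)"

lemma wser_tail:
  assumes a: "a abs_summable_on UNIV" and F: "finite F" and z: "cmod z = 1"
  shows "cmod (wser a z - trigsum a F z) \<le> (\<Sum>\<^sub>\<infinity>k. cmod (a k)) - (\<Sum>k\<in>F. cmod (a k))"
proof -
  have n: "cmod (a k * z powi k) = cmod (a k)" for k using z by (simp add: norm_mult norm_power_int)
  have s: "(\<lambda>k. a k * z powi k) abs_summable_on UNIV" using a by (simp add: n)
  have s2: "(\<lambda>k. a k * z powi k) abs_summable_on UNIV - F" by (rule summable_on_subset_banach[OF s]) auto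
  have "wser a z - trigsum a F z = (\<Sum>\<^sub>\<infinity>k\<in>UNIV - F. a k * z powi k)"
    using z F by (simp add: wser_def trigsum_def infsum_Diff[OF abs_summable_summable[OF s]])
  also have "cmod \<dots> \<le> (\<Sum>\<^sub>\<infinity>k\<in>UNIV - F. cmod (a k))"
    using norm_infsum_bound[OF s2] by (simp add: n)
  also have "\<dots> = (\<Sum>\<^sub>\<infinity>k. cmod (a k)) - (\<Sum>k\<in>F. cmod (a k))"
    using F a by (simp add: infsum_Diff)
  finally show ?thesis .
qed

lemma abs_tail_tendsto:
  fixes a :: "int => complex"
  assumes a: "a abs_summable_on UNIV"
  shows "((\<lambda>F. (\<Sum>\<^sub>\<infinity>k. cmod (a k)) - (\<Sum>k\<in>F. cmod (a k))) \<longlongrightarrow> 0) (finite_subsets_at_top UNIV)"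
  using tendsto_diff[OF tendsto_const[of "\<Sum>\<^sub>\<infinity>k. cmod (a k)"] infsum_tendsto[OF a]] by simp

lemma symmetric_intervals_filterlim: "filterlim (\<lambda>N. {- int N..int N}) (finite_subsets_at_top UNIV) sequentially"
  unfolding filterlim_finite_subsets_at_top
proof (intro allI impI)
  fix X :: "int set" assume X: "finite X \<and> X \<subseteq> UNIV"
  show "\<forall>\<^sub>F N in sequentially. finite {- int N..int N} \<and> X \<subseteq> {- int N..int N} \<and> {- int N..int N} \<subseteq> UNIV"
  proof (rule eventually_sequentiallyI[of "nat (Max (insert 0 (abs ` X)))"])
    fix N assume N: "nat (Max (insert 0 (abs ` X))) \<le> N"
    have "\<bar>k\<bar> \<le> int N" if "k \<in> X" for k
    proof -
      have "\<bar>k\<bar> \<le> Max (insert 0 (abs ` X))" using X that by (intro Max_ge) auto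
      then show ?thesis using N by linarith
    qed
    then show "finite {- int N..int N} \<and> X \<subseteq> {- int N..int N} \<and> {- int N..int N} \<subseteq> UNIV"
      by (auto simp: abs_le_iff) (metis abs_le_iff minus_le_iff)+
  qed
qed

lemma bmf_wser: assumes a: "a abs_summable_on UNIV" shows "bmf (wser a)"
  unfolding bmf_def
proof (intro conjI exI allI impI)
  have "(\<lambda>z. indicator (sphere 0 1) z * trigsum a {- int N..int N} z) \<in> borel_measurable borel" for N
    using L2_measurable[OF trigsum_L2] by (intro borel_measurable_times borel_measurable_indicator) auto
  moreover have "(\<lambda>N. indicator (sphere 0 1) z * trigsum a {- int N..int N} z) \<longlonglongrightarrow> wser a z" for z
  proof (cases "cmod z = 1")
    case True
    have "(\<lambda>N. wser a z - trigsum a {- int N..int N} z) \<longlonglongrightarrow> 0"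
      by (rule Lim_null_comparison[OF _ filterlim_compose[OF abs_tail_tendsto[OF a] symmetric_intervals_filterlim]])
        (use wser_tail[OF a _ True] in \<open>auto intro!: always_eventually\<close>)
    from tendsto_diff[OF tendsto_const[of "wser a z"] this] show ?thesis using True by simp
  qed (simp add: wser_def)
  ultimately show "wser a \<in> borel_measurable borel" by (rule borel_measurable_LIMSEQ_metric)
  fix z :: complex assume "cmod z = 1"
  from wser_tail[OF a _ this, of "{}"] show "cmod (wser a z) \<le> (\<Sum>\<^sub>\<infinity>k. cmod (a k))" by (simp add: trigsum_def)
qed

lemma bmf_trigsum: "bmf (trigsum a F)"
  unfolding trigsum_def
  by (induction F rule: infinite_finite_induct) (auto intro!: bmf_add bmf_mult bmf_const bmf_powi)

lemma crd_Mul_trigsum: "finite F ==> crd (Mul (trigsum a F) x) p = (\<Sum>k\<in>F. a k * crd x (p - k))"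
proof (induction F rule: finite_induct)
  case empty
  have "trigsum a {} = (\<lambda>z. 0 * 1)" by (simp add: trigsum_def fun_eq_iff)
  then show ?case using Mul_cmult_left[OF bmf_const, of 0 1 x] by (simp add: crd_cmul)
next
  case (insert k F)
  have "trigsum a (insert k F) = (\<lambda>z. a k * z powi k + trigsum a F z)" using insert by (simp add: trigsum_def fun_eq_iff)
  then have "Mul (trigsum a (insert k F)) x = cmul (a k) (Mul (\<lambda>z. z powi k) x) + Mul (trigsum a F) x"
    by (simp add: Mul_add_left bmf_mult bmf_const bmf_powi bmf_trigsum Mul_cmult_left)
  then show ?case using insert by (simp add: crd_add crd_cmul crd_Mul_powi)
qed

lemma crd_Mul_wser:
  assumes a: "a abs_summable_on UNIV"
  shows "crd (Mul (wser a) x) p = (\<Sum>\<^sub>\<infinity>k. a k * crd x (p - k))"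
proof -
  have s: "(\<lambda>k. a k * crd x (p - k)) abs_summable_on UNIV"
  proof (rule Infinite_Sum.abs_summable_on_comparison_test)
    show "(\<lambda>k. norm x * cmod (a k)) abs_summable_on UNIV" using a by (simp add: abs_mult summable_on_cmult_right)
    have "cmod (a k) * cmod (crd x (p - k)) \<le> cmod (a k) * norm x" for k
      by (intro mult_left_mono norm_crd_le) simp
    then show "norm (a k * crd x (p - k)) \<le> norm (norm x * cmod (a k))" for k
      by (simp add: norm_mult mult.commute[of "norm x"])
  qed
  have "cmod (crd (Mul (wser a) x) p - (\<Sum>k\<in>F. a k * crd x (p - k))) \<le>
      ((\<Sum>\<^sub>\<infinity>k. cmod (a k)) - (\<Sum>k\<in>F. cmod (a k))) * norm x" if F: "finite F" for F
  proof -
    have "Mul (wser a) x = Mul (\<lambda>z. (wser a z - trigsum a F z) + trigsum a F z) x" by simp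
    also have "\<dots> = Mul (\<lambda>z. wser a z - trigsum a F z) x + Mul (trigsum a F) x"
    proof (rule Mul_add_left[OF _ bmf_trigsum])
      show "bmf (\<lambda>z. wser a z - trigsum a F z)"
        using bmf_add[OF bmf_wser[OF a] bmf_mult[OF bmf_const[of "-1"] bmf_trigsum]] by simp
    qed
    finally have "crd (Mul (wser a) x) p - (\<Sum>k\<in>F. a k * crd x (p - k)) = crd (Mul (\<lambda>z. wser a z - trigsum a F z) x) p"
      using F by (simp add: crd_add crd_Mul_trigsum)
    also have "cmod \<dots> \<le> norm (Mul (\<lambda>z. wser a z - trigsum a F z) x)" by (rule norm_crd_le)
    also have "\<dots> \<le> ((\<Sum>\<^sub>\<infinity>k. cmod (a k)) - (\<Sum>k\<in>F. cmod (a k))) * norm x"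
      by (rule norm_Mul_le[OF _ wser_tail[OF a F]])
        (use bmf_add[OF bmf_wser[OF a] bmf_mult[OF bmf_const[of "-1"] bmf_trigsum]] in simp)
    finally show ?thesis .
  qed
  then have "((\<lambda>F. crd (Mul (wser a) x) p - (\<Sum>k\<in>F. a k * crd x (p - k))) \<longlongrightarrow> 0) (finite_subsets_at_top UNIV)"
    by (intro Lim_null_comparison[OF eventually_finite_subsets_at_top_weakI
          tendsto_mult_left_zero[OF abs_tail_tendsto[OF a]]]) auto
  from tendsto_diff[OF tendsto_const[of "crd (Mul (wser a) x) p"] this]
  have "((\<lambda>F. \<Sum>k\<in>F. a k * crd x (p - k)) \<longlongrightarrow> crd (Mul (wser a) x) p) (finite_subsets_at_top UNIV)" by simp
  moreover have "((\<lambda>F. \<Sum>k\<in>F. a k * crd x (p - k)) \<longlongrightarrow> (\<Sum>\<^sub>\<infinity>k. a k * crd x (p - k))) (finite_subsets_at_top UNIV)"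
    by (rule infsum_tendsto[OF abs_summable_summable[OF s]])
  ultimately show ?thesis using tendsto_unique[OF finite_subsets_at_top_neq_bot] by blast
qed

definition expdec :: "(int => complex) => bool" where
  "expdec a \<longleftrightarrow> (\<exists>C r. 0 \<le> C \<and> 0 < r \<and> r < 1 \<and> (\<forall>k. cmod (a k) \<le> C * r ^ nat \<bar>k\<bar>))"

lemma expdec_summable: assumes "expdec a" shows "a abs_summable_on UNIV"
proof -
  obtain C r where a: "0 \<le> C" "0 < r" "r < 1" "!!k. cmod (a k) \<le> C * r ^ nat \<bar>k\<bar>"
    using assms by (auto simp: expdec_def)
  show ?thesis
  proof (rule Infinite_Sum.abs_summable_on_comparison_test)
    show "(\<lambda>k::int. C * r ^ nat \<bar>k\<bar>) abs_summable_on UNIV"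
      using summable_on_geometric_int[of r 0] a by (simp add: abs_mult summable_on_cmult_right)
  qed (use a in \<open>simp add: abs_mult\<close>)
qed

definition toep :: "(int => complex) => emat" where "toep a = Emat (\<lambda>p q. a (p - q))"

lemma ent_toep: assumes "expdec a" shows "ent (toep a) p q = a (p - q)"
proof -
  have "\<exists>C r. decay C r (\<lambda>p q. a (p - q))" using assms by (auto simp: expdec_def decay_def)
  then show ?thesis unfolding toep_def by (subst Emat_inverse) auto
qed

text \<open>Multiplication by a function with exponentially decaying coefficients is convolution with these.\<close>

lemma Mul_wser_eq: assumes "expdec a" shows "Mul (wser a) x = actL (toep a) x"
proof (rule ell2_eqI)
  fix p
  have bij: "bij (\<lambda>d::int. p - d)" by (rule bij_betw_byWitness[of _ "\<lambda>q. p - q"]) auto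
  show "crd (Mul (wser a) x) p = crd (actL (toep a) x) p"
    unfolding crd_Mul_wser[OF expdec_summable[OF assms]] crd_actL act_def ent_toep[OF assms]
    using infsum_reindex_bij_betw[OF bij, of "\<lambda>q. a (p - q) * crd x q"] by simp
qed

lemma fourier_wser: assumes "a abs_summable_on UNIV" shows "fourier (wser a) k = a k"
proof -
  have c: "crd (FT (\<lambda>_. 1)) p = (if p = 0 then 1 else 0)" for p
    using fourier_mono[of 1 0 p] by (simp add: crd_FT[OF L2_const])
  have "fourier (wser a) k = crd (Mul (wser a) (FT (\<lambda>_. 1))) k"
    by (simp add: Mul_FT bmf_wser[OF assms] L2_const crd_FT bmf_in_L2)
  also have "\<dots> = (\<Sum>\<^sub>\<infinity>j. if j = k then a j else 0)"
    unfolding crd_Mul_wser[OF assms] c by (rule infsum_cong) auto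
  finally show ?thesis by (simp only: infsum_single)
qed

lemma wser_fourier: assumes "m \<in> L2" "fourier m abs_summable_on UNIV" shows "m \<approx> wser (fourier m)"
proof -
  have "FT m = FT (wser (fourier m))"
    by (rule ell2_eqI) (simp add: crd_FT assms(1) bmf_in_L2 bmf_wser assms(2) fourier_wser)
  then show ?thesis using FT_eq_iff[OF assms(1) bmf_in_L2[OF bmf_wser[OF assms(2)]]] by simp
qed

section \<open>Powers and roots of the variable\<close>

text \<open>Both measures have the same moments.\<close>

lemma circle_distr_power:
  assumes "0 < n" shows "distr circle borel (\<lambda>z. z ^ n) = circle"
proof (rule circle_eqI)
  show "prob_space (distr circle borel (\<lambda>z. z ^ n))" by (rule circle.prob_space_distr) auto
  show "AE z in distr circle borel (\<lambda>z. z ^ n). cmod z = 1"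
    by (subst AE_distr_iff) (auto intro!: AE_circleI simp: norm_power)
  fix k
  have "(LINT z|distr circle borel (\<lambda>z. z ^ n). z powi k) = (LINT z|circle. (z ^ n) powi k)"
    by (rule integral_distr) auto
  also have "\<dots> = (LINT z|circle. z powi (int n * k))" by (simp add: power_int_mult)
  also have "\<dots> = (if k = 0 then 1 else 0)" using assms by (simp add: circle_moment)
  finally show "(LINT z|distr circle borel (\<lambda>z. z ^ n). z powi k) = (if k = 0 then 1 else 0)" .
qed simp

lemma circle_distr_rotate:
  assumes "cmod c = 1" shows "distr circle borel (\<lambda>z. c * z) = circle"
proof (rule circle_eqI)
  show "prob_space (distr circle borel (\<lambda>z. c * z))" by (rule circle.prob_space_distr) auto
  show "AE z in distr circle borel (\<lambda>z. c * z). cmod z = 1"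
    by (subst AE_distr_iff) (auto intro!: AE_circleI simp: norm_mult assms)
  fix k
  have "(LINT z|distr circle borel (\<lambda>z. c * z). z powi k) = (LINT z|circle. (c * z) powi k)"
    by (rule integral_distr) auto
  also have "\<dots> = (if k = 0 then 1 else 0)" by (simp add: power_int_mult_distrib circle_moment)
  finally show "(LINT z|distr circle borel (\<lambda>z. c * z). z powi k) = (if k = 0 then 1 else 0)" .
qed simp

lemma AE_circle_power: "0 < n ==> (AE z in circle. P z) ==> AE z in circle. P (z ^ n)"
  by (rule AE_distrD[of "\<lambda>z. z ^ n" circle borel P], simp add: measurable_circle)
    (subst circle_distr_power, assumption+)

lemma AE_circle_rotate: "cmod c = 1 ==> (AE z in circle. P z) ==> AE z in circle. P (c * z)"
  by (rule AE_distrD[of "\<lambda>z. c * z" circle borel P], simp add: measurable_circle)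
    (subst circle_distr_rotate, assumption+)

lemma L2_power:
  assumes n: "0 < n" and f: "f \<in> L2" shows "(\<lambda>z. f (z ^ n)) \<in> L2"
proof (rule L2I)
  note [measurable] = L2_measurable[OF f]
  show "(\<lambda>z. f (z ^ n)) \<in> borel_measurable borel" by measurable
  have "integrable (distr circle borel (\<lambda>z. z ^ n)) (\<lambda>z. (cmod (f z))\<^sup>2)"
    using L2_square_integrable[OF f] by (simp add: circle_distr_power[OF n])
  then show "integrable circle (\<lambda>z. (cmod (f (z ^ n)))\<^sup>2)"
    by (subst (asm) integrable_distr_eq) auto
qed

lemma fourier_power:
  assumes n: "0 < n" and f: "f \<in> L2"
  shows "fourier (\<lambda>z. f (z ^ n)) k = (if int n dvd k then fourier f (k div int n) else 0)"
proof -
  note [measurable] = L2_measurable[OF f]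
  show ?thesis
  proof (cases "int n dvd k")
    case True
    then obtain j where j: "k = int n * j" by (rule dvdE)
    have "fourier (\<lambda>z. f (z ^ n)) k = (LINT z|circle. (\<lambda>w. w powi (- j) * f w) (z ^ n))"
      unfolding fourier_def j by (simp add: power_int_mult power_int_minus power_int_inverse)
    also have "\<dots> = (LINT w|distr circle borel (\<lambda>z. z ^ n). w powi (- j) * f w)"
      by (rule integral_distr[symmetric]) auto
    also have "\<dots> = fourier f j" by (simp add: circle_distr_power[OF n] fourier_def)
    finally show ?thesis using True j n by simp
  next
    case False
    define c where "c = cis (2 * pi / real n)"
    have e: "real n * (2 * pi / real n) = 2 * pi" using n by simp
    have c: "cmod c = 1" "c ^ n = 1" unfolding c_def Complex.DeMoivre e by simp_all
    have ck: "c powi (- k) ~= 1"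
    proof
      assume "c powi (- k) = 1"
      then have "cis (of_int (- k) * (2 * pi / real n)) = 1" by (simp add: c_def cis_power_int)
      then have "cos (of_int (- k) * (2 * pi / real n)) = 1" by (simp add: complex_eq_iff)
      then obtain m :: int where "of_int (- k) * (2 * pi / real n) = of_int m * 2 * pi"
        using cos_one_2pi_int by blast
      then have "pi * real_of_int (- k) = pi * (of_int m * real n)" using n by (simp add: field_simps)
      then have "real_of_int (- k) = of_int m * real n" by (metis mult_left_cancel pi_neq_zero)
      then have "- k = m * int n" by (metis of_int_eq_iff of_int_mult of_int_of_nat_eq)
      then show False using False by (metis dvd_minus_iff dvd_triv_right)
    qed
    have "fourier (\<lambda>z. f (z ^ n)) k = (LINT z|distr circle borel (\<lambda>z. c * z). z powi (- k) * f (z ^ n))"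
      by (simp add: fourier_def circle_distr_rotate[OF c(1)])
    also have "\<dots> = (LINT z|circle. (c * z) powi (- k) * f ((c * z) ^ n))" by (rule integral_distr) auto
    also have "\<dots> = c powi (- k) * fourier (\<lambda>z. f (z ^ n)) k"
      by (simp add: fourier_def power_int_mult_distrib power_mult_distrib c(2) mult.assoc)
    finally show ?thesis using ck False by simp
  qed
qed

lemma AE_circle_neq_minus_one: "AE z in circle. z ~= - 1"
proof -
  have "AE x in lborel. x ~= pi" by (rule AE_lborel_singleton)
  then have "AE x in uniform_measure lborel {0..2 * pi}. cis x ~= - 1"
  proof (intro AE_uniform_measureI, simp, eventually_elim, intro impI)
    fix x :: real assume x: "x ~= pi" "x \<in> {0..2 * pi}"
    show "cis x ~= - 1"
    proof
      assume "cis x = - 1"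
      then have s: "sin x = 0" and c: "cos x = - 1" by (auto simp: complex_eq_iff)
      have "\<not> x < pi" using s c x sin_gt_zero[of x] by (cases "x = 0") auto
      moreover have "\<not> pi < x"
        using s c x sin_lt_zero[of x] by (cases "x = 2 * pi") auto
      ultimately show False using x by simp
    qed
  qed
  then show ?thesis unfolding circle_def by (subst AE_distr_iff) auto
qed

lemma zeta_power: assumes "0 < n" "z ~= 0" shows "zeta n z i ^ n = z"
proof -
  have "(z powr (1 / of_nat n)) ^ n = z"
    using assms by (simp add: powr_def exp_of_nat_mult[symmetric])
  moreover have "cis (2 * pi * real i / real n) ^ n = 1"
  proof -
    have e: "real n * (2 * pi * real i / real n) = 2 * pi * real i" using assms by simp
    show ?thesis unfolding Complex.DeMoivre e by (rule cis_multiple_2pi) simp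
  qed
  ultimately show ?thesis by (simp add: zeta_def power_mult_distrib)
qed

text \<open>As \<open>w \<mapsto> w\<^sup>n\<close> preserves the measure, it suffices to consider \<open>z = w\<^sup>n\<close>; there \<open>zeta\<close> is \<open>w\<close> times one of
  the \<open>n\<close>-th roots of unity, and rotations preserve null sets.\<close>

lemma AE_circle_zeta:
  assumes n: "0 < n" and P: "AE z in circle. P z"
  shows "AE z in circle. P (zeta n z i)"
proof -
  define h where "h z = (if z \<in> \<real>\<^sub>\<le>\<^sub>0 then 1 else zeta n z i)" for z
  have h: "h \<in> borel_measurable borel"
    unfolding h_def zeta_def
  proof (rule borel_measurable_continuous_on_if)
    have "(\<lambda>z. z powr (1 / of_nat n)) holomorphic_on - \<real>\<^sub>\<le>\<^sub>0"
      by (intro holomorphic_intros) auto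
    then show "continuous_on (- \<real>\<^sub>\<le>\<^sub>0) (\<lambda>z. z powr (1 / of_nat n) * cis (2 * pi * real i / real n))"
      by (intro continuous_on_mult continuous_on_const holomorphic_on_imp_continuous_on)
  qed auto
  obtain N where N: "N \<in> null_sets circle" "{z. \<not> P z} \<subseteq> N"
    using P unfolding eventually_ae_filter by auto
  define c where "c j = cis (2 * pi * real j / real n)" for j
  have c: "cmod (c j) = 1" for j by (simp add: c_def)
  have Ns: "N \<in> sets borel" "AE z in circle. z \<notin> N" using N(1) by (auto intro: AE_not_in dest: null_setsD2)
  have "AE w in circle. \<forall>j<n. c j * w \<notin> N"
    using AE_circle_rotate[OF c Ns(2)] by (simp add: AE_all_countable)
  moreover have "AE w in circle. w ^ n ~= - 1" by (rule AE_circle_power[OF n AE_circle_neq_minus_one])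
  ultimately have "AE w in circle. h (w ^ n) \<notin> N"
    using AE_circle_norm
  proof eventually_elim
    case (elim w)
    have w0: "w ~= 0" using elim by auto
    have "w ^ n \<notin> \<real>\<^sub>\<le>\<^sub>0"
    proof
      assume "w ^ n \<in> \<real>\<^sub>\<le>\<^sub>0"
      then obtain x where x: "w ^ n = of_real x" "x \<le> 0" by (auto simp: nonpos_Reals_def)
      have "\<bar>x\<bar> = 1" using elim(3) x by (metis norm_of_real norm_power power_one)
      then show False using x elim(2) by simp
    qed
    then have "h (w ^ n) = zeta n (w ^ n) i" by (simp add: h_def)
    moreover have "(zeta n (w ^ n) i / w) ^ n = 1"
      using zeta_power[OF n, of "w ^ n" i] w0 by (simp add: power_divide)
    then obtain j where "j < n" "zeta n (w ^ n) i / w = c j"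
      using Complex.bij_betw_roots_unity[OF n] by (auto simp: bij_betw_def c_def)
    ultimately show ?case using elim(1) w0 by (metis nonzero_eq_divide_eq)
  qed
  then have "AE z in distr circle borel (\<lambda>z. z ^ n). h z \<notin> N"
    using h Ns(1) by (subst AE_distr_iff) auto
  then have "AE z in circle. h z \<notin> N" unfolding circle_distr_power[OF n] .
  then show ?thesis using AE_circle_neq_minus_one AE_circle_norm
  proof eventually_elim
    case (elim z)
    have "z \<notin> \<real>\<^sub>\<le>\<^sub>0"
    proof
      assume "z \<in> \<real>\<^sub>\<le>\<^sub>0"
      then obtain x where x: "z = of_real x" "x \<le> 0" by (auto simp: nonpos_Reals_def)
      then show False using elim by simp
    qed
    then show ?case using elim(1) N(2) by (auto simp: h_def)
  qed
qed
section \<open>Differentiable families of wave vectors\<close>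

definition Sh :: "ell2 => ell2" where "Sh = Mul (\<lambda>z. z)"
definition U :: "complex => ell2 => ell2" where "U s = Mul (\<lambda>z. exp (- (s * z)))"
definition e0 :: ell2 where "e0 = FT (\<lambda>_. 1)"

lemma crd_e0: "crd e0 p = (if p = 0 then 1 else 0)"
  using fourier_mono[of 1 0 p] by (simp add: e0_def crd_FT[OF L2_const])

lemma bmf_id: "bmf (\<lambda>z. z)" by (rule bmf_continuous) (intro continuous_intros)
lemma bmf_exp: "bmf (\<lambda>z. exp (- (s * z)))" by (rule bmf_continuous) (intro continuous_intros)

lemma crd_Sh: "crd (Sh x) p = crd x (p - 1)"
  using crd_Mul_powi[of 1 x p] by (simp add: Sh_def)

lemma bounded_linear_Sh: "bounded_linear Sh" unfolding Sh_def by (rule bounded_linear_Mul[OF bmf_id])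
lemma bounded_linear_U: "bounded_linear (U s)" unfolding U_def by (rule bounded_linear_Mul[OF bmf_exp])
lemma Sh_cmul: "Sh (cmul c x) = cmul c (Sh x)" unfolding Sh_def by (rule Mul_cmul[OF bmf_id])
lemma U_cmul: "U s (cmul c x) = cmul c (U s x)" unfolding U_def by (rule Mul_cmul[OF bmf_exp])
lemma U_0: "U 0 x = x" by (simp add: U_def Mul_one)
lemma U_Sh: "U s (Sh x) = Sh (U s x)"
  unfolding U_def Sh_def Mul_Mul[OF bmf_exp bmf_id] Mul_Mul[OF bmf_id bmf_exp] by (simp only: mult.commute)

definition Eop :: "complex => ell2 \<Rightarrow>\<^sub>L ell2" where "Eop s = Blinfun (U s)"

lemma Eop: "blinfun_apply (Eop s) x = U s x"
  unfolding Eop_def by (simp add: bounded_linear_Blinfun_apply bounded_linear_U)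

text \<open>The second order Taylor remainder of the exponential, uniform on the circle; it gives
  differentiability in operator norm.\<close>

lemma U_derivative_bound:
  "norm (U (s + h) x - U s x + cmul h (U s (Sh x))) \<le> exp (cmod s) * (exp (cmod h) * (cmod h)\<^sup>2) * norm x"
proof -
  have "U (s + h) x - U s x + cmul h (U s (Sh x)) =
      Mul (\<lambda>z. exp (- (s * z)) * (exp (- (h * z)) - 1 - (- (h * z)))) x"
  proof -
    have c: "cmul h (U s (Sh x)) = Mul (\<lambda>z. h * (exp (- (s * z)) * z)) x"
      unfolding U_def Sh_def
      by (simp add: Mul_Mul bmf_exp bmf_id Mul_cmult_left bmf_mult)
    have m: "- U s x = Mul (\<lambda>z. - 1 * exp (- (s * z))) x"
      unfolding Mul_cmult_left[OF bmf_exp] U_def by (rule ell2_eqI) (simp add: crd_simps)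
    have "U (s + h) x - U s x + cmul h (U s (Sh x)) = U (s + h) x + (- U s x) + cmul h (U s (Sh x))" by simp
    also have "\<dots> = Mul (\<lambda>z. exp (- ((s + h) * z)) + - 1 * exp (- (s * z)) + h * (exp (- (s * z)) * z)) x"
      unfolding c m unfolding U_def
      by (simp only: Mul_add_left bmf_add bmf_mult bmf_const bmf_exp bmf_id)
    also have "(\<lambda>z. exp (- ((s + h) * z)) + - 1 * exp (- (s * z)) + h * (exp (- (s * z)) * z)) =
        (\<lambda>z. exp (- (s * z)) * (exp (- (h * z)) - 1 - (- (h * z))))"
      by (rule ext) (simp add: algebra_simps exp_add[symmetric])
    finally show ?thesis .
  qed
  also have "norm \<dots> \<le> exp (cmod s) * (exp (cmod h) * (cmod h)\<^sup>2) * norm x"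
  proof (rule norm_Mul_le)
    show "bmf (\<lambda>z. exp (- (s * z)) * (exp (- (h * z)) - 1 - (- (h * z))))"
      by (rule bmf_continuous) (intro continuous_intros)
    fix z :: complex assume z: "cmod z = 1"
    have n: "cmod (exp (- (c * z))) \<le> exp (cmod c)" for c
      using abs_Re_le_cmod[of "c * z"] z by (simp add: norm_mult)
    have "cmod (exp (- (h * z)) - (\<Sum>k\<le>1. (- (h * z)) ^ k / fact k)) \<le>
        exp \<bar>Re (- (h * z))\<bar> * cmod (- (h * z)) ^ Suc 1 / fact 1" by (rule Taylor_exp)
    also have "\<dots> \<le> exp (cmod h) * (cmod h)\<^sup>2"
      using z abs_Re_le_cmod[of "h * z"] by (simp add: norm_mult power2_eq_square mult_right_mono)
    also have "exp (- (h * z)) - (\<Sum>k\<le>1. (- (h * z)) ^ k / fact k) = exp (- (h * z)) - 1 - (- (h * z))"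
      by simp
    finally have "cmod (exp (- (h * z)) - 1 - (- (h * z))) \<le> exp (cmod h) * (cmod h)\<^sup>2" .
    then show "cmod (exp (- (s * z)) * (exp (- (h * z)) - 1 - (- (h * z)))) \<le> exp (cmod s) * (exp (cmod h) * (cmod h)\<^sup>2)"
      unfolding norm_mult using n by (intro mult_mono) auto
  qed
  finally show ?thesis .
qed

lemma U_diff_bound: "norm (U s x - x) \<le> exp (cmod s) * cmod s * norm x"
proof -
  have "U s x - x = Mul (\<lambda>z. exp (- (s * z)) + - 1 * 1) x"
    unfolding Mul_add_left[OF bmf_exp bmf_mult[OF bmf_const bmf_const]] Mul_cmult_left[OF bmf_const] U_def Mul_one
    by (rule ell2_eqI) (simp add: crd_simps)
  also have "norm \<dots> \<le> exp (cmod s) * cmod s * norm x"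
  proof (rule norm_Mul_le)
    show "bmf (\<lambda>z. exp (- (s * z)) + - 1 * 1)" by (intro bmf_add bmf_exp bmf_mult bmf_const)
    fix z :: complex assume z: "cmod z = 1"
    have "cmod (exp (- (s * z)) - (\<Sum>k\<le>0. (- (s * z)) ^ k / fact k)) \<le>
        exp \<bar>Re (- (s * z))\<bar> * cmod (- (s * z)) ^ Suc 0 / fact 0" by (rule Taylor_exp)
    also have "\<dots> \<le> exp (cmod s) * cmod s"
      using z abs_Re_le_cmod[of "s * z"] by (simp add: norm_mult mult_right_mono)
    finally show "cmod (exp (- (s * z)) + - 1 * 1) \<le> exp (cmod s) * cmod s" by simp
  qed
  finally show ?thesis .
qed

abbreviation has_cderiv :: "(complex => ell2) => ell2 => complex => bool" where
  "has_cderiv f f' s \<equiv> (f has_derivative (\<lambda>h. cmul h f')) (at s)"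

interpretation cmul: bounded_bilinear cmul by (rule bounded_bilinear_cmul)

lemma Eop_derivative: "(Eop has_derivative (\<lambda>h. - Blinfun (\<lambda>x. cmul h (U s (Sh x))))) (at s)"
proof -
  have bl: "bounded_linear (\<lambda>x. cmul h (U s (Sh x)))" for h
    by (intro bounded_linear_compose[OF cmul.bounded_linear_right] bounded_linear_compose[OF bounded_linear_U] bounded_linear_Sh)
  have ap: "blinfun_apply (Blinfun (\<lambda>x. cmul h (U s (Sh x)))) x = cmul h (U s (Sh x))" for h x
    by (simp add: bounded_linear_Blinfun_apply bl)
  obtain K where K: "!!x. norm (U s (Sh x)) \<le> norm x * K"
    using bounded_linear.bounded[OF bounded_linear_compose[OF bounded_linear_U bounded_linear_Sh]] by blast
  define D where "D h = Blinfun (\<lambda>x. cmul h (U s (Sh x)))" for h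
  have apD: "blinfun_apply (D h) x = cmul h (U s (Sh x))" for h x by (simp add: D_def ap)
  have lin: "bounded_linear (\<lambda>h. - D h)"
  proof (rule bounded_linear_intro[where K = "\<bar>K\<bar>"])
    fix h
    show "norm (- D h) \<le> norm h * \<bar>K\<bar>"
    proof (simp, rule norm_blinfun_bound)
      fix x
      have "cmod h * norm (U s (Sh x)) \<le> cmod h * (norm x * \<bar>K\<bar>)"
        by (intro mult_left_mono order_trans[OF K]) auto
      then show "norm (blinfun_apply (D h) x) \<le> cmod h * \<bar>K\<bar> * norm x"
        by (simp add: apD norm_cmul mult_ac)
    qed simp
  next
    show "- D (g + h) =
        - D g + - D h" for g h
      by (rule blinfun_eqI) (simp add: apD blinfun.bilinear_simps cmul.add_left)
    show "- D (r *\<^sub>R h) = r *\<^sub>R - D h" for r h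
      by (rule blinfun_eqI) (simp add: apD blinfun.bilinear_simps cmul.scaleR_left)
  qed
  have "(Eop has_derivative (\<lambda>h. - D h)) (at s)"
    unfolding has_derivative_at
  proof (intro conjI lin)
    show "(\<lambda>h. norm (Eop (s + h) - Eop s - - D h) / norm h) \<midarrow>0\<rightarrow> 0"
    proof (rule Lim_null_comparison)
      have "norm (Eop (s + h) - Eop s - - D h) \<le> exp (cmod s) * (exp (cmod h) * (cmod h)\<^sup>2)" for h
        by (rule norm_blinfun_bound) (use U_derivative_bound[of s h] in \<open>auto simp: blinfun.bilinear_simps apD Eop\<close>)
      then have "norm (Eop (s + h) - Eop s - - D h) / norm h \<le>
          exp (cmod s) * (exp (cmod h) * (cmod h)\<^sup>2) / norm h" for h
        by (intro divide_right_mono) auto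
      then show "\<forall>\<^sub>F h in at 0. norm (norm (Eop (s + h) - Eop s - - D h) / norm h)
          \<le> exp (cmod s) * (exp (cmod h) * cmod h)"
      proof (intro always_eventually allI)
        fix h
        have "norm (Eop (s + h) - Eop s - - D h) / norm h \<le> exp (cmod s) * (exp (cmod h) * (cmod h)\<^sup>2) / norm h"
          by fact
        also have "\<dots> = exp (cmod s) * (exp (cmod h) * cmod h)"
          by (cases "h = 0") (simp_all add: power2_eq_square)
        finally show "norm (norm (Eop (s + h) - Eop s - - D h) / norm h) \<le> exp (cmod s) * (exp (cmod h) * cmod h)"
          by simp
      qed
      have "((\<lambda>h. exp (cmod s) * (exp (cmod h) * cmod h)) \<longlongrightarrow> exp (cmod s) * (exp (cmod 0) * cmod 0)) (at (0::complex))"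
        by (intro tendsto_intros)
      then show "((\<lambda>h. exp (cmod s) * (exp (cmod h) * cmod h)) \<longlongrightarrow> 0) (at (0::complex))" by simp
    qed
  qed
  then show ?thesis by (simp add: D_def)
qed

lemma has_cderiv_U:
  assumes "has_cderiv f f' s"
  shows "has_cderiv (\<lambda>s. U s (f s)) (U s (f' - Sh (f s))) s"
proof -
  have bl: "bounded_linear (\<lambda>x. cmul h (U s (Sh x)))" for h
    by (intro bounded_linear_compose[OF cmul.bounded_linear_right] bounded_linear_compose[OF bounded_linear_U] bounded_linear_Sh)
  have "((\<lambda>s. blinfun_apply (Eop s) (f s)) has_derivative
      (\<lambda>h. blinfun_apply (Eop s) (cmul h f') + blinfun_apply (- Blinfun (\<lambda>x. cmul h (U s (Sh x)))) (f s))) (at s)"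
    by (rule bounded_bilinear.FDERIV[OF bounded_bilinear_blinfun_apply Eop_derivative assms])
  moreover have "(\<lambda>h. blinfun_apply (Eop s) (cmul h f') + blinfun_apply (- Blinfun (\<lambda>x. cmul h (U s (Sh x)))) (f s))
      = (\<lambda>h. cmul h (U s (f' - Sh (f s))))"
    by (rule ext) (simp add: Eop blinfun.bilinear_simps bounded_linear_Blinfun_apply bl U_cmul cmul.diff_right
        bounded_linear.linear[OF bounded_linear_U, THEN linear_diff])
  ultimately show ?thesis by (simp add: Eop)
qed

lemma has_cderiv_linear:
  assumes "has_cderiv f f' s" "bounded_linear T" "!!c x. T (cmul c x) = cmul c (T x)"
  shows "has_cderiv (\<lambda>s. T (f s)) (T f') s"
  using bounded_linear.has_derivative[OF assms(2,1)] by (simp add: assms(3))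

lemma has_cderiv_add: "has_cderiv f f' s ==> has_cderiv g g' s ==> has_cderiv (\<lambda>s. f s + g s) (f' + g') s"
  using has_derivative_add[of f "\<lambda>h. cmul h f'" "at s" g "\<lambda>h. cmul h g'"] by (simp add: cmul.add_right)

lemma has_cderiv_diff: "has_cderiv f f' s ==> has_cderiv g g' s ==> has_cderiv (\<lambda>s. f s - g s) (f' - g') s"
  using has_derivative_diff[of f "\<lambda>h. cmul h f'" "at s" g "\<lambda>h. cmul h g'"] by (simp add: cmul.diff_right)

lemma has_cderiv_quotient:
  assumes "has_cderiv f f' s"
  shows "((\<lambda>h. cmul (1 / h) (f (s + h) - f s)) \<longlongrightarrow> f') (at 0)"
proof -
  have "((\<lambda>h. norm (f (s + h) - f s - cmul h f') / norm h) \<longlongrightarrow> 0) (at 0)"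
    using assms unfolding has_derivative_at by blast
  moreover have "\<forall>\<^sub>F h in at 0. norm (f (s + h) - f s - cmul h f') / norm h = norm (cmul (1 / h) (f (s + h) - f s) - f')"
    unfolding eventually_at_topological
  proof (intro exI[of _ UNIV] conjI ballI impI)
    fix h :: complex assume h: "h ~= 0"
    have "cmul (1 / h) (f (s + h) - f s) - f' = cmul (1 / h) (f (s + h) - f s - cmul h f')"
      by (rule ell2_eqI) (use h in \<open>simp add: crd_simps field_simps\<close>)
    then show "norm (f (s + h) - f s - cmul h f') / norm h = norm (cmul (1 / h) (f (s + h) - f s) - f')"
      by (simp add: norm_cmul norm_divide)
  qed auto
  ultimately have "((\<lambda>h. norm (cmul (1 / h) (f (s + h) - f s) - f')) \<longlongrightarrow> 0) (at 0)"
    by (rule Lim_transform_eventually)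
  then show ?thesis by (simp add: tendsto_norm_zero_iff LIM_zero_iff)
qed

primrec smooth :: "nat => real => (complex => ell2) => bool" where
  "smooth 0 d f \<longleftrightarrow> True"
| "smooth (Suc k) d f \<longleftrightarrow> (\<exists>f'. (\<forall>s\<in>ball 0 d. has_cderiv f (f' s) s) \<and> smooth k d f')"

lemma smooth_Suc_D: "smooth (Suc k) d f ==> smooth k d f"
proof (induction k arbitrary: f)
  case (Suc k)
  then obtain f' where "\<forall>s\<in>ball 0 d. has_cderiv f (f' s) s" "smooth (Suc k) d f'" by auto
  then show ?case using Suc.IH[of f'] by auto
qed simp

lemma smooth_add: "smooth k d f ==> smooth k d g ==> smooth k d (\<lambda>s. f s + g s)"
proof (induction k arbitrary: f g)
  case (Suc k)
  then obtain f' g' where "\<forall>s\<in>ball 0 d. has_cderiv f (f' s) s" "smooth k d f'"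
    "\<forall>s\<in>ball 0 d. has_cderiv g (g' s) s" "smooth k d g'" by auto
  then show ?case using Suc.IH[of f' g'] has_cderiv_add by (auto intro!: exI[of _ "\<lambda>s. f' s + g' s"])
qed simp

lemma smooth_diff: "smooth k d f ==> smooth k d g ==> smooth k d (\<lambda>s. f s - g s)"
proof (induction k arbitrary: f g)
  case (Suc k)
  then obtain f' g' where "\<forall>s\<in>ball 0 d. has_cderiv f (f' s) s" "smooth k d f'"
    "\<forall>s\<in>ball 0 d. has_cderiv g (g' s) s" "smooth k d g'" by auto
  then show ?case using Suc.IH[of f' g'] has_cderiv_diff by (auto intro!: exI[of _ "\<lambda>s. f' s - g' s"])
qed simp

lemma smooth_linear:
  assumes "bounded_linear T" "!!c x. T (cmul c x) = cmul c (T x)"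
  shows "smooth k d f ==> smooth k d (\<lambda>s. T (f s))"
proof (induction k arbitrary: f)
  case (Suc k)
  then obtain f' where "\<forall>s\<in>ball 0 d. has_cderiv f (f' s) s" "smooth k d f'" by auto
  then show ?case using Suc.IH[of f'] has_cderiv_linear[OF _ assms] by (auto intro!: exI[of _ "\<lambda>s. T (f' s)"])
qed simp

lemma smooth_const: "smooth k d (\<lambda>s. c)"
proof (induction k arbitrary: c)
  case (Suc k)
  have "has_cderiv (\<lambda>s. c) 0 s" for s using has_derivative_const[of c "at s"] by (simp add: cmul.zero_right)
  then show ?case using Suc.IH[of 0] by (auto intro!: exI[of _ "\<lambda>_. 0"])
qed simp

lemma smooth_U: "smooth k d f ==> smooth k d (\<lambda>s. U s (f s))"
proof (induction k arbitrary: f)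
  case (Suc k)
  from Suc.prems obtain f' where f': "\<forall>s\<in>ball 0 d. has_cderiv f (f' s) s" "smooth k d f'" by auto
  have "smooth k d (\<lambda>s. U s (f' s - Sh (f s)))"
    by (intro Suc.IH smooth_diff f'(2) smooth_linear[OF bounded_linear_Sh Sh_cmul] smooth_Suc_D[OF Suc.prems])
  then show ?case using f'(1) has_cderiv_U by (auto intro!: exI[of _ "\<lambda>s. U s (f' s - Sh (f s))"])
qed simp

lemma smooth_derivatives:
  "smooth n d f ==> \<exists>W. W 0 = f \<and> (\<forall>j<n. \<forall>s\<in>ball 0 d. has_cderiv (W j) (W (Suc j) s) s)"
proof (induction n arbitrary: f)
  case (Suc n)
  then obtain f' where f': "\<forall>s\<in>ball 0 d. has_cderiv f (f' s) s" "smooth n d f'" by auto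
  obtain W where W: "W 0 = f'" "\<forall>j<n. \<forall>s\<in>ball 0 d. has_cderiv (W j) (W (Suc j) s) s"
    using Suc.IH[OF f'(2)] by blast
  show ?case
    by (rule exI[of _ "\<lambda>j. case j of 0 => f | Suc i => W i"])
      (use f' W in \<open>auto split: nat.split simp: less_Suc_eq_0_disj\<close>)
qed auto

lemma bl_prP: "bounded_linear prP" by (rule bounded_linear_actL)

text \<open>The vector \<open>w(s)\<close> in \<open>V\<close> with \<open>prP (U s w(s)) = e0\<close> exists for small \<open>s\<close> by a contraction argument
  and depends smoothly on \<open>s\<close>. Differentiating the normalisation moves the top coordinate of
  \<open>U s w\<close> up by one place each time, because the derivative of \<open>U s\<close> is \<open>- U s Sh\<close>; and the
  derivatives stay in \<open>V\<close> since \<open>V\<close> is closed.\<close>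

theorem wave_family:
  assumes V: "closed V" "csubspace V"
    and onto: "!!y. y \<in> plus_space ==> \<exists>x\<in>V. prP x = y"
    and inj: "!!x. x \<in> V ==> prP x = 0 ==> x = 0"
  obtains d W where "0 < d"
    "!!s. s \<in> ball 0 d ==> W 0 s \<in> V \<and> prP (U s (W 0 s)) = e0"
    "!!s x. s \<in> ball 0 d ==> x \<in> V ==> prP (U s x) = e0 ==> x = W 0 s"
    "!!j s. j < n ==> s \<in> ball 0 d ==> has_cderiv (W j) (W (Suc j) s) s"
    "!!j. j \<le> n ==> W j 0 \<in> V"
    "!!j. j \<le> n ==> crd (W j 0) (int j) = 1"
    "!!j p. j \<le> n ==> int j < p ==> crd (W j 0) p = 0"
proof -
  interpret P: bounded_linear prP by (rule bl_prP)
  obtain C where C: "0 < C" "!!x. x \<in> V ==> norm x \<le> C * norm (prP x)"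
    using bounded_below_prP[OF V onto inj] by blast
  define b where "b s = exp (cmod s) * cmod s" for s
  have "((\<lambda>s. C * (exp (cmod s) * cmod s)) \<longlongrightarrow> C * (exp (cmod 0) * cmod 0)) (at (0::complex))" by (intro tendsto_intros)
  then have "\<forall>\<^sub>F s in at (0::complex). C * (exp (cmod s) * cmod s) < 1 / 2" by (auto dest: order_tendstoD(2)[of _ 0 _ "1/2"])
  then obtain d where d0: "0 < d" "\<forall>s\<in>UNIV. s ~= (0::complex) \<and> dist s 0 < d --> C * (exp (cmod s) * cmod s) < 1 / 2"
    unfolding eventually_at by blast
  have d: "0 < d" "C * b s \<le> 1 / 2" if "s \<in> ball 0 d" for s :: complex
    using d0 that by (cases "s = 0"; auto simp: b_def dist_norm intro: less_imp_le)+
  have Bd: "norm (prP x - prP (U s x)) \<le> b s * norm x" for s x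
  proof -
    have "norm (prP x - prP (U s x)) \<le> norm (U s x - x)"
      using norm_prP_le[of "U s x - x"] by (simp add: P.diff norm_minus_commute)
    then show ?thesis using U_diff_bound[of s x] by (simp add: b_def)
  qed
  have below: "norm x \<le> 2 * C * norm (prP (U s x))" if "x \<in> V" "s \<in> ball 0 d" for x s
  proof -
    have "norm (prP x) \<le> norm (prP (U s x)) + b s * norm x"
      using Bd[of x s] norm_triangle_sub[of "prP x" "prP (U s x)"] by simp
    then have "C * norm (prP x) \<le> C * norm (prP (U s x)) + (C * b s) * norm x"
      using C(1) by (simp add: mult_left_mono distrib_left[symmetric] mult.assoc)
    also have "(C * b s) * norm x \<le> 1 / 2 * norm x" using d(2)[OF that(2)] by (intro mult_right_mono) auto
    finally show ?thesis using C(2)[OF that(1)] by simp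
  qed
  have U_diff: "U s (x - y) = U s x - U s y" for s x y
    using bounded_linear_U by (rule linear_diff[OF bounded_linear.linear])
  have uniq: "x = y" if "x \<in> V" "y \<in> V" "s \<in> ball 0 d" "prP (U s x) = prP (U s y)" for x y s
    using below[OF csubspace_diff[OF V(2) that(1,2)] that(3)] that(4) by (simp add: U_diff P.diff)
  obtain A where A: "!!y. y \<in> plus_space ==> A y \<in> V \<and> prP (A y) = y" using onto by metis
  have "\<exists>x\<in>V. prP (U s x) = prP y" if s: "s \<in> ball 0 d" for s y
  proof -
    (* A fixed point x of f satisfies prP x = prP (y + x - U s x). *)
    define f where "f x = A (prP (y + x - U s x))" for x
    have f: "f x \<in> V" "prP (f x) = prP (y + x - U s x)" for x
      using A[OF prP_in_plus] by (auto simp: f_def)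
    have "\<exists>!x\<in>V. f x = x"
    proof (rule Banach_fix[of V "1/2"])
      show "complete V" using V(1) by (simp add: complete_eq_closed del: closed_closedin)
      show "V ~= {}" using V(2) by (auto simp: csubspace_def)
      fix x x' assume x: "x \<in> V" "x' \<in> V"
      have "norm (f x - f x') \<le> C * norm (prP (f x - f x'))" by (rule C(2)[OF csubspace_diff[OF V(2) f(1) f(1)]])
      also have "prP (f x - f x') = prP (x - x') - prP (U s (x - x'))"
        by (simp add: P.diff f(2) P.add U_diff)
      also have "C * norm \<dots> \<le> C * (b s * norm (x - x'))" using C(1) Bd by (intro mult_left_mono) auto
      also have "\<dots> = (C * b s) * norm (x - x')" by simp
      also have "\<dots> \<le> 1 / 2 * norm (x - x')" using d(2)[OF s] by (intro mult_right_mono) auto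
      finally show "dist (f x) (f x') \<le> 1 / 2 * dist x x'" by (simp add: dist_norm)
    qed (use f(1) in auto)
    then obtain x where x: "x \<in> V" "f x = x" by blast
    then have "prP x = prP y + prP x - prP (U s x)" using f(2)[of x] by (simp add: P.add P.diff)
    then show ?thesis using x(1) by (intro bexI[of _ x]) auto
  qed
  then obtain R where R: "!!s y. s \<in> ball 0 d ==> R s y \<in> V \<and> prP (U s (R s y)) = prP y" by metis
  have V_cmul: "cmul c x \<in> V" if "x \<in> V" for c x using V(2) that by (auto simp: csubspace_def)
  have P_cmul: "prP (cmul c x) = cmul c (prP x)" for c x by (rule actL_cmul)
  have R_deriv: "has_cderiv (\<lambda>s. R s (f s)) (R s (f' + U s (Sh (R s (f s))))) s"
    if f: "has_cderiv f f' s" and s: "s \<in> ball 0 d" for f f' s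
  proof -
    define x where "x = R s (f s)"
    define v where "v = R s (f' + U s (Sh x))"
    have xV: "x \<in> V" "prP (U s x) = prP (f s)" and vV: "v \<in> V" "prP (U s v) = prP (f' + U s (Sh x))"
      using R[OF s] by (auto simp: x_def v_def)
    have gU: "has_cderiv (\<lambda>s. U s y) (U s (0 - Sh y)) s" for y
      by (rule has_cderiv_U) (simp add: cmul.zero_right)
    define g where "g t = f t - U t x - cmul (t - s) (U t v)" for t
    have U_zero: "U s 0 = 0" and U_uminus: "U s (- y) = - U s y" for y
      using bounded_linear_U[of s] by (simp_all add: linear_0 linear_neg bounded_linear.linear)
    have "has_cderiv g (f' + U s (Sh x) - U s v) s"
    proof -
      have "((\<lambda>t. cmul (t - s) (U t v)) has_derivative (\<lambda>h. cmul (s - s) (cmul h (U s (0 - Sh v))) + cmul h (U s v))) (at s)"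
        by (rule cmul.FDERIV[OF _ gU]) (auto intro!: derivative_eq_intros)
      then have "has_cderiv (\<lambda>t. cmul (t - s) (U t v)) (U s v) s" by (simp add: cmul.zero_left)
      from has_cderiv_diff[OF has_cderiv_diff[OF f gU[of x]] this] show ?thesis
        unfolding g_def by (simp add: U_uminus)
    qed
    then have gd: "has_cderiv (\<lambda>t. prP (g t)) (prP (f' + U s (Sh x) - U s v)) s"
      by (rule has_cderiv_linear[OF _ bl_prP P_cmul])
    have "prP (f' + U s (Sh x) - U s v) = 0" using vV(2) by (simp add: P.diff)
    moreover have "prP (g s) = 0" using xV(2) by (simp add: g_def P.diff cmul.zero_left P.zero)
    ultimately have lim: "((\<lambda>h. norm (prP (g (s + h))) / norm h) \<longlongrightarrow> 0) (at 0)"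
      using gd unfolding has_derivative_at by (simp add: cmul.zero_right)
    have rem: "norm (R (s + h) (f (s + h)) - R s (f s) - cmul h v) \<le> 2 * C * norm (prP (g (s + h)))"
      if "s + h \<in> ball 0 d" for h
    proof -
      have "R (s + h) (f (s + h)) - R s (f s) - cmul h v \<in> V"
        by (intro csubspace_diff[OF V(2)] V_cmul vV) (use R that s in auto)
      note below[OF this that]
      also have "prP (U (s + h) (R (s + h) (f (s + h)) - R s (f s) - cmul h v)) = prP (g (s + h))"
        using R[OF that] by (simp add: U_diff P.diff g_def U_cmul x_def)
      finally show ?thesis .
    qed
    have "\<forall>\<^sub>F h in at 0. s + h \<in> ball 0 d"
    proof -
      have "((\<lambda>h. s + h) \<longlongrightarrow> s + 0) (at 0)" by (intro tendsto_intros)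
      then have "((\<lambda>h. s + h) \<longlongrightarrow> s) (at 0)" by simp
      then show ?thesis by (rule topological_tendstoD[OF _ open_ball s])
    qed
    then have ev: "\<forall>\<^sub>F h in at 0. norm (norm (R (s + h) (f (s + h)) - R s (f s) - cmul h v) / norm h)
        \<le> 2 * C * (norm (prP (g (s + h))) / norm h)"
    proof eventually_elim
      case (elim h)
      show ?case using divide_right_mono[OF rem[OF elim], of "norm h"] by simp
    qed
    have "((\<lambda>h. norm (R (s + h) (f (s + h)) - R s (f s) - cmul h v) / norm h) \<longlongrightarrow> 0) (at 0)"
      by (rule Lim_null_comparison[OF ev tendsto_mult_right_zero[OF lim]])
    then show ?thesis
      unfolding has_derivative_at v_def[symmetric] x_def[symmetric] using cmul.bounded_linear_left by (auto simp: x_def)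
  qed
  have R_smooth: "smooth k d f ==> smooth k d (\<lambda>s. R s (f s))" for k f
  proof (induction k arbitrary: f)
    case (Suc k)
    from Suc.prems obtain f' where f': "\<forall>s\<in>ball 0 d. has_cderiv f (f' s) s" "smooth k d f'" by auto
    have "smooth k d (\<lambda>s. R s (f' s + U s (Sh (R s (f s)))))"
      by (intro Suc.IH smooth_add f'(2) smooth_U smooth_linear[OF bounded_linear_Sh Sh_cmul] smooth_Suc_D[OF Suc.prems])
    then show ?case
      using f'(1) R_deriv by (auto intro!: exI[of _ "\<lambda>s. R s (f' s + U s (Sh (R s (f s))))"])
  qed simp
  define w where "w s = R s e0" for s
  have "smooth n d w" unfolding w_def by (rule R_smooth[OF smooth_const])
  then obtain W where W: "W 0 = w" "!!j s. j < n ==> s \<in> ball 0 d ==> has_cderiv (W j) (W (Suc j) s) s"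
    using smooth_derivatives by blast
  have Pe0: "prP e0 = e0" by (rule ell2_eqI) (simp add: crd_prP crd_e0)
  have w: "w s \<in> V" "prP (U s (w s)) = e0" if "s \<in> ball 0 d" for s
    using R[OF that] by (auto simp: w_def Pe0)
  have WV: "\<forall>s\<in>ball 0 d. W j s \<in> V" if "j \<le> n" for j
    using that
  proof (induction j)
    case (Suc j)
    show ?case
    proof
      fix s :: complex assume s: "s \<in> ball 0 d"
      have "((\<lambda>h. s + h) \<longlongrightarrow> s + 0) (at 0)" by (intro tendsto_intros)
      then have "((\<lambda>h. s + h) \<longlongrightarrow> s) (at 0)" by simp
      from topological_tendstoD[OF this open_ball s]
      have "\<forall>\<^sub>F h in at 0. cmul (1 / h) (W j (s + h) - W j s) \<in> V"
        by eventually_elim (use Suc s in \<open>auto intro!: V_cmul csubspace_diff[OF V(2)]\<close>)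
      then show "W (Suc j) s \<in> V"
        by (rule Lim_in_closed_set[OF V(1) _ _ has_cderiv_quotient[OF W(2)]]) (use Suc s in auto)
    qed
  qed (use w W(1) in auto)
  have Wc: "\<forall>s\<in>ball 0 d. \<forall>p\<ge>int j. crd (U s (W j s)) p = (if p = int j then 1 else 0)" if "j \<le> n" for j
    using that
  proof (induction j)
    case 0
    show ?case
    proof (intro ballI allI impI)
      fix s :: complex and p assume "s \<in> ball 0 d" "int 0 \<le> p"
      then have "crd (U s (W 0 s)) p = crd (prP (U s (w s))) p" by (simp add: crd_prP W(1))
      then show "crd (U s (W 0 s)) p = (if p = int 0 then 1 else 0)"
        using w(2)[OF \<open>s \<in> ball 0 d\<close>] by (simp add: crd_e0)
    qed
  next
    case (Suc j)
    show ?case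
    proof (intro ballI allI impI)
      fix s :: complex and p assume s: "s \<in> ball 0 d" and p: "int (Suc j) \<le> p"
      have "has_cderiv (\<lambda>s. U s (W j s)) (U s (W (Suc j) s - Sh (W j s))) s"
        by (rule has_cderiv_U[OF W(2)[OF _ s]]) (use Suc in simp)
      from bounded_linear.has_derivative[OF bounded_linear_crd this, of p]
      have D: "((\<lambda>s. crd (U s (W j s)) p) has_derivative (\<lambda>h. h * crd (U s (W (Suc j) s - Sh (W j s))) p)) (at s)"
        by (simp add: crd_cmul)
      have "((\<lambda>s. 0 :: complex) has_derivative (\<lambda>h. h * crd (U s (W (Suc j) s - Sh (W j s))) p)) (at s)"
      proof (rule has_derivative_transform_within_open[OF D open_ball s])
        fix t :: complex assume "t \<in> ball 0 d"
        then show "crd (U t (W j t)) p = 0" using Suc.IH Suc.prems p by auto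
      qed
      then have "(\<lambda>h. h * crd (U s (W (Suc j) s - Sh (W j s))) p) = (\<lambda>h. 0)"
        by (rule has_derivative_unique) simp
      then have "1 * crd (U s (W (Suc j) s - Sh (W j s))) p = 0" by meson
      then have "crd (U s (W (Suc j) s)) p = crd (U s (W j s)) (p - 1)"
        by (simp add: U_diff crd_diff U_Sh crd_Sh)
      also have "\<dots> = (if p - 1 = int j then 1 else 0)" using Suc p s by auto
      finally show "crd (U s (W (Suc j) s)) p = (if p = int (Suc j) then 1 else 0)" by auto
    qed
  qed
  have z: "(0 :: complex) \<in> ball 0 d" using d0(1) by simp
  show ?thesis
  proof (rule that[OF d0(1), of W])
    show "W 0 s \<in> V \<and> prP (U s (W 0 s)) = e0" if "s \<in> ball 0 d" for s using w[OF that] W(1) by simp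
    show "x = W 0 s" if "s \<in> ball 0 d" "x \<in> V" "prP (U s x) = e0" for s x
      using uniq[OF that(2) w(1)[OF that(1)] that(1)] w(2)[OF that(1)] that(3) W(1) by simp
    show "W j 0 \<in> V" if "j \<le> n" for j using WV[OF that] z by blast
    show "crd (W j 0) (int j) = 1" if "j \<le> n" for j
      using bspec[OF Wc[OF that] z, rule_format, of "int j"] by (simp add: U_0)
    show "crd (W j 0) p = 0" if "j \<le> n" "int j < p" for j p
      using bspec[OF Wc[OF that(1)] z, rule_format, of p] that(2) by (simp add: U_0)
  qed (use W(2) in auto)
qed
section \<open>The Grassmannian in coordinates\<close>

lemma fourier_powi_mult:
  assumes "g \<in> L2" shows "fourier (\<lambda>z. z powi k * g z) p = fourier g (p - k)"
  using crd_Mul_powi[of k "FT g" p]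
  by (simp add: Mul_FT bmf_powi assms crd_FT bmf_L2)

lemma fourier_power_mult:
  "g \<in> L2 ==> fourier (\<lambda>z. z ^ k * g z) p = fourier g (p - int k)"
  using fourier_powi_mult[of g "int k" p] by simp

lemma bmf_power: "bmf (\<lambda>z. z ^ k)" by (rule bmf_continuous) (intro continuous_intros)

text \<open>The coordinates of a vector valued function after the identification of \<open>H\<^sup>(\<^sup>n\<^sup>)\<close> with \<open>H\<close>.\<close>

definition EH :: "nat => vfun => ell2" where "EH n f = FT (Xi n f)"

lemma H_space_carrier: "f \<in> H_space n ==> f z \<in> carrier_vec n"
  and H_space_L2: "f \<in> H_space n ==> a < n ==> (\<lambda>z. f z $ a) \<in> L2"
  by (auto simp: H_space_def)

lemma H_spaceI: "(!!z. f z \<in> carrier_vec n) ==> (!!a. a < n ==> (\<lambda>z. f z $ a) \<in> L2) ==> f \<in> H_space n"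
  by (auto simp: H_space_def)

context
  fixes n :: nat
  assumes n: "0 < n"
begin

abbreviation blk :: "int => int" where "blk p \<equiv> p div int n"
abbreviation pos :: "int => nat" where "pos p \<equiv> nat (p mod int n)"

lemma pos_less: "pos p < n"
  using n pos_mod_bound[of "int n" p] pos_mod_sign[of "int n" p] by (simp add: nat_less_iff)

lemma blk_pos: "blk p * int n + int (pos p) = p"
  using n pos_mod_sign[of "int n" p] by simp

lemma blk_combine: "a < n ==> blk (k * int n + int a) = k"
  and pos_combine: "a < n ==> pos (k * int n + int a) = a"
  using n by auto

lemma Xi_L2: assumes "f \<in> H_space n" shows "Xi n f \<in> L2"
  unfolding Xi_def
  by (rule L2_sum) (use assms in \<open>auto intro!: bmf_L2[OF bmf_power] L2_power[OF n] H_space_L2\<close>)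

text \<open>The summand \<open>z\<^sup>k f\<^sub>k(z\<^sup>n)\<close> only contributes to the residue class of \<open>k\<close>.\<close>

lemma crd_EH: assumes f: "f \<in> H_space n" shows "crd (EH n f) p = fourier (\<lambda>z. f z $ pos p) (blk p)"
proof -
  have "crd (EH n f) p = fourier (\<lambda>z. \<Sum>k<n. z ^ k * f (z ^ n) $ k) p"
    unfolding EH_def crd_FT[OF Xi_L2[OF f]] by (simp add: Xi_def[abs_def])
  also have "\<dots> = (\<Sum>k<n. fourier (\<lambda>z. z ^ k * f (z ^ n) $ k) p)"
    by (rule fourier_sum) (use f in \<open>auto intro!: bmf_L2[OF bmf_power] L2_power[OF n] H_space_L2\<close>)
  also have "\<dots> = (\<Sum>k<n. if k = pos p then fourier (\<lambda>z. f z $ k) (blk p) else 0)"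
  proof (rule sum.cong[OF refl])
    fix k assume "k \<in> {..<n}"
    then have k: "k < n" by simp
    have "fourier (\<lambda>z. z ^ k * f (z ^ n) $ k) p = fourier (\<lambda>z. f (z ^ n) $ k) (p - int k)"
      by (rule fourier_power_mult) (rule L2_power[OF n H_space_L2[OF f k]])
    also have "\<dots> = (if int n dvd p - int k then fourier (\<lambda>z. f z $ k) ((p - int k) div int n) else 0)"
      by (rule fourier_power[OF n H_space_L2[OF f k]])
    also have "\<dots> = (if k = pos p then fourier (\<lambda>z. f z $ k) (blk p) else 0)"
    proof (cases "k = pos p")
      case True
      then have "p - int k = blk p * int n" using blk_pos[of p] by simp
      then show ?thesis using True n by simp
    next
      case False
      have "\<not> int n dvd p - int k"
      proof
        assume "int n dvd p - int k"
        then obtain j where "p - int k = int n * j" by (rule dvdE)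
        then have "p = j * int n + int k" by (simp add: algebra_simps)
        then show False using pos_combine[OF k, of j] False by simp
      qed
      then show ?thesis using False by simp
    qed
    finally show "fourier (\<lambda>z. z ^ k * f (z ^ n) $ k) p = (if k = pos p then fourier (\<lambda>z. f z $ k) (blk p) else 0)" .
  qed
  also have "\<dots> = fourier (\<lambda>z. f z $ pos p) (blk p)" using pos_less by simp
  finally show ?thesis .
qed

lemma fourier_component: "f \<in> H_space n ==> a < n ==> fourier (\<lambda>z. f z $ a) k = crd (EH n f) (k * int n + int a)"
  by (simp add: crd_EH blk_combine pos_combine)

lemma inj_block: "inj (\<lambda>k::int. k * int n + int a)" using n by (auto simp: inj_on_def)

definition comp2 :: "nat => ell2 => ell2" where "comp2 a x = Ell2 (\<lambda>k. crd x (k * int n + int a))"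

lemma crd_comp2: "crd (comp2 a x) k = crd x (k * int n + int a)"
  and norm_comp2: "norm (comp2 a x) \<le> norm x"
proof -
  have s: "(\<lambda>p. (cmod (crd x p))\<^sup>2) summable_on range (\<lambda>k. k * int n + int a)"
    by (rule summable_on_subset_banach[OF crd_summable]) auto
  then have "(\<lambda>k. (cmod (crd x (k * int n + int a)))\<^sup>2) summable_on UNIV"
    by (subst (asm) summable_on_reindex) (auto simp: o_def intro: inj_block)
  then have c: "crd (comp2 a x) = (\<lambda>k. crd x (k * int n + int a))" unfolding comp2_def by (subst Ell2_inverse) auto
  then show "crd (comp2 a x) k = crd x (k * int n + int a)" by simp
  show "norm (comp2 a x) \<le> norm x"
  proof (rule norm_ell2_boundI)
    fix F :: "int set" assume F: "finite F"
    have i: "inj_on (\<lambda>k. k * int n + int a) F" by (rule inj_on_subset[OF inj_block]) auto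
    have "L2_set (\<lambda>p. cmod (crd (comp2 a x) p)) F = L2_set (\<lambda>p. cmod (crd x p)) ((\<lambda>k. k * int n + int a) ` F)"
      unfolding L2_set_def c by (subst sum.reindex[OF i]) simp
    also have "\<dots> \<le> norm x" by (rule L2_set_crd_le) (use F in simp)
    finally show "L2_set (\<lambda>p. cmod (crd (comp2 a x) p)) F \<le> norm x" .
  qed
qed

definition HI :: "ell2 => vfun" where "HI x z = vec n (\<lambda>a. IFT (comp2 a x) z)"

lemma HI: "HI x \<in> H_space n" "EH n (HI x) = x"
proof -
  show h: "HI x \<in> H_space n" by (rule H_spaceI) (auto simp: HI_def IFT)
  show "EH n (HI x) = x"
  proof (rule ell2_eqI)
    fix p
    have "crd (EH n (HI x)) p = fourier (IFT (comp2 (pos p) x)) (blk p)"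
      unfolding crd_EH[OF h] by (simp add: HI_def pos_less)
    then show "crd (EH n (HI x)) p = crd x p" by (simp only: fourier_IFT crd_comp2 blk_pos)
  qed
qed

lemma FT_component: "f \<in> H_space n ==> a < n ==> FT (\<lambda>z. f z $ a) = comp2 a (EH n f)"
  by (rule ell2_eqI) (simp add: crd_FT H_space_L2 fourier_component crd_comp2)

lemma EH_eq_iff: assumes "f \<in> H_space n" "g \<in> H_space n" shows "EH n f = EH n g \<longleftrightarrow> f \<approx> g"
proof
  assume e: "EH n f = EH n g"
  have "\<forall>a<n. (\<lambda>z. f z $ a) \<approx> (\<lambda>z. g z $ a)"
    using assms e by (auto simp: FT_eq_iff[symmetric] H_space_L2 FT_component)
  then have "AE z in circle. \<forall>a<n. f z $ a = g z $ a" unfolding ae_eq_def by (simp add: AE_all_countable)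
  then show "f \<approx> g" unfolding ae_eq_def
  proof eventually_elim
    fix z assume "\<forall>a<n. f z $ a = g z $ a"
    then show "f z = g z"
      using H_space_carrier[OF assms(1), of z] H_space_carrier[OF assms(2), of z] by (intro eq_vecI) auto
  qed
next
  assume "f \<approx> g"
  then have "(\<lambda>z. f z $ a) \<approx> (\<lambda>z. g z $ a)" for a unfolding ae_eq_def by eventually_elim simp
  then have "fourier (\<lambda>z. f z $ pos p) (blk p) = fourier (\<lambda>z. g z $ pos p) (blk p)" for p
    by (rule fourier_cong) (intro L2_measurable H_space_L2[OF assms(1) pos_less] H_space_L2[OF assms(2) pos_less])+
  then show "EH n f = EH n g" by (intro ell2_eqI) (simp add: crd_EH assms)
qed

lemma H_add: "f \<in> H_space n ==> g \<in> H_space n ==> (\<lambda>z. f z + g z) \<in> H_space n"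
  and EH_add: "f \<in> H_space n ==> g \<in> H_space n ==> EH n (\<lambda>z. f z + g z) = EH n f + EH n g"
proof -
  assume f: "f \<in> H_space n" and g: "g \<in> H_space n"
  have i: "(f z + g z) $ a = f z $ a + g z $ a" if "a < n" for a z
    using that H_space_carrier[OF g, of z] by simp
  show h: "(\<lambda>z. f z + g z) \<in> H_space n"
    using H_space_carrier f g by (intro H_spaceI) (auto simp: i intro!: L2_add H_space_L2)
  show "EH n (\<lambda>z. f z + g z) = EH n f + EH n g"
    by (rule ell2_eqI) (simp add: crd_EH h f g crd_add i pos_less fourier_add[OF H_space_L2[OF f pos_less] H_space_L2[OF g pos_less]])
qed

lemma H_diff: "f \<in> H_space n ==> g \<in> H_space n ==> (\<lambda>z. f z - g z) \<in> H_space n"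
  and EH_diff: "f \<in> H_space n ==> g \<in> H_space n ==> EH n (\<lambda>z. f z - g z) = EH n f - EH n g"
proof -
  assume f: "f \<in> H_space n" and g: "g \<in> H_space n"
  have i: "(f z - g z) $ a = f z $ a - g z $ a" if "a < n" for a z
    using that H_space_carrier[OF g, of z] by simp
  show h: "(\<lambda>z. f z - g z) \<in> H_space n"
    using H_space_carrier f g by (intro H_spaceI) (auto simp: i intro!: L2_diff H_space_L2)
  show "EH n (\<lambda>z. f z - g z) = EH n f - EH n g"
    by (rule ell2_eqI) (simp add: crd_EH h f g crd_diff i pos_less fourier_diff[OF H_space_L2[OF f pos_less] H_space_L2[OF g pos_less]])
qed

lemma EH_smult: "f \<in> H_space n ==> EH n (\<lambda>z. c \<cdot>\<^sub>v f z) = cmul c (EH n f)"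
proof -
  assume f: "f \<in> H_space n"
  have i: "(c \<cdot>\<^sub>v f z) $ a = c * f z $ a" if "a < n" for a z
    using that H_space_carrier[OF f, of z] by simp
  have h: "(\<lambda>z. c \<cdot>\<^sub>v f z) \<in> H_space n"
    using H_space_carrier f by (intro H_spaceI) (auto simp: i intro!: L2_cmult H_space_L2)
  show ?thesis by (rule ell2_eqI) (simp add: crd_EH h f crd_cmul i pos_less fourier_cmult)
qed

lemma H_norm_le: assumes f: "f \<in> H_space n" shows "H_norm f \<le> sqrt (real n) * norm (EH n f)"
proof -
  have c: "f z \<bullet>c f z = of_real (\<Sum>a<n. (cmod (f z $ a))\<^sup>2)" for z
  proof -
    have "f z \<bullet>c f z = (\<Sum>a<n. f z $ a * cnj (f z $ a))"
      using H_space_carrier[OF f, of z] by (auto simp: scalar_prod_def atLeast0LessThan intro!: sum.cong)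
    then show ?thesis by (simp add: complex_norm_square del: of_real_power)
  qed
  have "H_inner f f = (LINT z|circle. of_real (\<Sum>a<n. (cmod (f z $ a))\<^sup>2))"
    unfolding H_inner_def c ..
  also have "\<dots> = of_real (LINT z|circle. (\<Sum>a<n. (cmod (f z $ a))\<^sup>2))" 
    by (rule integral_of_real) (intro Bochner_Integration.integrable_sum L2_square_integrable H_space_L2[OF f], simp)
  finally have "Re (H_inner f f) = (LINT z|circle. (\<Sum>a<n. (cmod (f z $ a))\<^sup>2))" by simp
  also have "\<dots> = (\<Sum>a<n. LINT z|circle. (cmod (f z $ a))\<^sup>2)"
    by (rule Bochner_Integration.integral_sum) (simp add: L2_square_integrable H_space_L2[OF f])
  also have "\<dots> = (\<Sum>a<n. (norm (comp2 a (EH n f)))\<^sup>2)"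
    by (rule sum.cong) (simp_all add: norm_FT[symmetric] H_space_L2[OF f] f FT_component[symmetric])
  also have "\<dots> \<le> (\<Sum>a<n. (norm (EH n f))\<^sup>2)" by (intro sum_mono power_mono norm_comp2) auto
  finally have "Re (H_inner f f) \<le> real n * (norm (EH n f))\<^sup>2" by simp
  then have "H_norm f \<le> sqrt (real n * (norm (EH n f))\<^sup>2)" unfolding H_norm_def by (rule real_sqrt_le_mono)
  then show ?thesis by (simp add: real_sqrt_mult)
qed

lemma H_plus_iff: "f \<in> H_plus n \<longleftrightarrow> f \<in> H_space n \<and> EH n f \<in> plus_space"
proof -
  have "(\<forall>a<n. \<forall>k<0. fourier (\<lambda>z. f z $ a) k = 0) \<longleftrightarrow> EH n f \<in> plus_space" if f: "f \<in> H_space n"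
  proof
    assume "\<forall>a<n. \<forall>k<0. fourier (\<lambda>z. f z $ a) k = 0"
    moreover have "blk p < 0" if "p < 0" for p using that n by (simp add: div_neg_pos_less0)
    ultimately show "EH n f \<in> plus_space" by (auto simp: plus_space_def crd_EH[OF f] pos_less)
  next
    assume x: "EH n f \<in> plus_space"
    have "k * int n + int a < 0" if "a < n" "k < 0" for a k
    proof -
      have "(k + 1) * int n \<le> 0" using that by (simp add: mult_nonpos_nonneg)
      then show ?thesis using that by (simp add: distrib_right)
    qed
    then show "\<forall>a<n. \<forall>k<0. fourier (\<lambda>z. f z $ a) k = 0"
      using x by (auto simp: fourier_component[OF f] plus_space_def)
  qed
  then show ?thesis by (auto simp: H_plus_def L2_plus_def H_space_L2)
qed

lemma H_minus_iff: "f \<in> H_minus n \<longleftrightarrow> f \<in> H_space n \<and> EH n f \<in> minus_space"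
proof -
  have "(\<forall>a<n. \<forall>k\<ge>0. fourier (\<lambda>z. f z $ a) k = 0) \<longleftrightarrow> EH n f \<in> minus_space" if f: "f \<in> H_space n"
  proof
    assume "\<forall>a<n. \<forall>k\<ge>0. fourier (\<lambda>z. f z $ a) k = 0"
    moreover have "0 \<le> blk p" if "0 \<le> p" for p using that n by (simp add: pos_imp_zdiv_nonneg_iff)
    ultimately show "EH n f \<in> minus_space" by (auto simp: minus_space_def crd_EH[OF f] pos_less)
  next
    assume "EH n f \<in> minus_space"
    then show "\<forall>a<n. \<forall>k\<ge>0. fourier (\<lambda>z. f z $ a) k = 0"
      by (auto simp: fourier_component[OF f] minus_space_def)
  qed
  then show ?thesis by (auto simp: H_minus_def L2_minus_def H_space_L2)
qed

lemma pr_plus: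
  assumes f: "f \<in> H_space n" shows "pr_plus n f \<in> H_plus n" "EH n (pr_plus n f) = prP (EH n f)"
proof -
  have "HI (prP (EH n f)) \<in> H_plus n \<and> (\<lambda>z. f z - HI (prP (EH n f)) z) \<in> H_minus n"
    using f by (auto simp: H_plus_iff H_minus_iff HI prP_in_plus H_diff EH_diff minus_space_def crd_diff crd_prP)
  then have "\<exists>g. g \<in> H_plus n \<and> (\<lambda>z. f z - g z) \<in> H_minus n" by blast
  from someI_ex[OF this] have p: "pr_plus n f \<in> H_plus n" "(\<lambda>z. f z - pr_plus n f z) \<in> H_minus n"
    unfolding pr_plus_def by auto
  show "pr_plus n f \<in> H_plus n" by (rule p)
  have h: "pr_plus n f \<in> H_space n" "EH n (pr_plus n f) \<in> plus_space" using p(1) by (auto simp: H_plus_iff)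
  have m: "EH n f - EH n (pr_plus n f) \<in> minus_space" using p(2) by (auto simp: H_minus_iff EH_diff f h)
  show "EH n (pr_plus n f) = prP (EH n f)"
  proof (rule ell2_eqI)
    fix p show "crd (EH n (pr_plus n f)) p = crd (prP (EH n f)) p"
      using h(2) m by (cases "0 \<le> p") (auto simp: plus_space_def minus_space_def crd_prP crd_diff)
  qed
qed

context
  fixes W :: "vfun set"
  assumes W: "W \<in> Gr n" and big: "big_cell n W"
begin

definition Wh :: "ell2 set" where "Wh = EH n ` W"

lemma W_sub: "W \<subseteq> H_space n" and W_closed: "closed_subspace n W"
  using W by (auto simp: Gr_def closed_subspace_def)

lemma W_limit:
  assumes "!!k. F k \<in> W" "f \<in> H_space n" "(\<lambda>k. EH n (F k)) \<longlonglongrightarrow> EH n f" shows "f \<in> W"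
proof -
  have F: "F k \<in> H_space n" for k using assms(1) W_sub by blast
  have "(\<lambda>k. H_norm (\<lambda>z. F k z - f z)) \<longlonglongrightarrow> 0"
  proof (rule Lim_null_comparison[OF always_eventually])
    have "((\<lambda>k. norm (EH n (F k) - EH n f)) \<longlonglongrightarrow> 0)"
      using assms(3) by (simp add: LIM_zero tendsto_norm_zero)
    from tendsto_mult_right_zero[OF this]
    show "(\<lambda>k. sqrt (real n) * norm (EH n (F k) - EH n f)) \<longlonglongrightarrow> 0" .
    show "\<forall>k. norm (H_norm (\<lambda>z. F k z - f z)) \<le> sqrt (real n) * norm (EH n (F k) - EH n f)"
    proof
      fix k
      have "0 \<le> Re (H_inner g g)" if "g \<in> H_space n" for g
      proof -
        have "Re (g z \<bullet>c g z) \<ge> 0" for z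
          by (auto simp: scalar_prod_def simp flip: power2_eq_square intro!: sum_nonneg)
        then show ?thesis
          unfolding H_inner_def
          by (cases "integrable circle (\<lambda>z. g z \<bullet>c g z)")
            (auto simp: integral_Re[symmetric] not_integrable_integral_eq simp del: integral_Re intro!: integral_nonneg_AE)
      qed
      then show "norm (H_norm (\<lambda>z. F k z - f z)) \<le> sqrt (real n) * norm (EH n (F k) - EH n f)"
        using H_norm_le[OF H_diff[OF F[of k] assms(2)]] H_diff[OF F[of k] assms(2)]
        by (simp add: EH_diff F assms(2) H_norm_def)
    qed
  qed
  then show ?thesis using W_closed assms(1,2) unfolding closed_subspace_def by blast
qed

lemma closed_Wh: "closed Wh"
  unfolding closed_sequential_limits
proof (intro allI impI, elim conjE)
  fix x l assume x: "\<forall>k. x k \<in> Wh" "x \<longlonglongrightarrow> l"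
  have "\<forall>k. \<exists>f. f \<in> W \<and> x k = EH n f" using x(1) unfolding Wh_def by (auto simp: image_iff)
  from choice[OF this] obtain F where F: "!!k. F k \<in> W" "!!k. x k = EH n (F k)" by blast
  have "x = (\<lambda>k. EH n (F k))" using F(2) by blast
  then have "(\<lambda>k. EH n (F k)) \<longlonglongrightarrow> EH n (HI l)" using x(2) by (simp add: HI)
  then have "HI l \<in> W" using W_limit[of F] F(1) HI(1) by blast
  then show "l \<in> Wh" unfolding Wh_def using imageI[of "HI l" W "EH n"] HI(2)[of l] by simp
qed

lemma csubspace_Wh: "csubspace Wh"
  unfolding csubspace_def
proof (intro conjI ballI allI)
  have "(\<lambda>z. 0\<^sub>v n) \<in> W" using W_closed by (simp add: closed_subspace_def)
  moreover have "EH n (\<lambda>z. 0\<^sub>v n) = 0"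
  proof (rule ell2_eqI)
    have h: "(\<lambda>z. 0\<^sub>v n) \<in> H_space n" using \<open>(\<lambda>z. 0\<^sub>v n) \<in> W\<close> W_sub by blast
    fix p show "crd (EH n (\<lambda>z. 0\<^sub>v n)) p = crd 0 p"
      unfolding crd_EH[OF h] by (simp add: pos_less crd_zero fourier_def)
  qed
  ultimately show "0 \<in> Wh" unfolding Wh_def by force
next
  fix x y assume "x \<in> Wh" "y \<in> Wh"
  then obtain f g where f: "f \<in> W" "x = EH n f" "g \<in> W" "y = EH n g" by (auto simp: Wh_def)
  then have "(\<lambda>z. f z + g z) \<in> W" using W_closed by (simp add: closed_subspace_def)
  moreover have "EH n (\<lambda>z. f z + g z) = x + y" using EH_add[of f g] f W_sub by blast
  ultimately show "x + y \<in> Wh" unfolding Wh_def by force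
next
  fix c x assume "x \<in> Wh"
  then obtain f where f: "f \<in> W" "x = EH n f" by (auto simp: Wh_def)
  then have "(\<lambda>z. c \<cdot>\<^sub>v f z) \<in> W" using W_closed by (simp add: closed_subspace_def)
  moreover have "EH n (\<lambda>z. c \<cdot>\<^sub>v f z) = cmul c x" using EH_smult[of f c] f W_sub by blast
  ultimately show "cmul c x \<in> Wh" unfolding Wh_def by force
qed

lemma Wh_onto: assumes "y \<in> plus_space" shows "\<exists>x\<in>Wh. prP x = y"
proof -
  have "HI y \<in> H_plus n" using assms by (simp add: H_plus_iff HI)
  then obtain f where f: "f \<in> W" "pr_plus n f \<approx> HI y" using big by (auto simp: big_cell_def isomorphism_def)
  have fh: "f \<in> H_space n" using f W_sub by auto
  have "EH n (pr_plus n f) = EH n (HI y)"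
    using f(2) pr_plus[OF fh] by (subst EH_eq_iff) (auto simp: H_plus_iff HI)
  then have "prP (EH n f) = y" by (simp add: pr_plus[OF fh] HI)
  then show ?thesis using f(1) by (auto simp: Wh_def)
qed

lemma Wh_inj: assumes "x \<in> Wh" "prP x = 0" shows "x = 0"
proof -
  obtain f where f: "f \<in> W" "x = EH n f" using assms by (auto simp: Wh_def)
  obtain g where g: "g \<in> W" "0 = EH n g" using csubspace_Wh by (auto simp: csubspace_def Wh_def)
  have h: "f \<in> H_space n" "g \<in> H_space n" using f g W_sub by auto
  have "prP (EH n g) = 0" unfolding g(2)[symmetric] by (rule ell2_eqI) (simp add: crd_prP crd_zero)
  then have "pr_plus n f \<approx> pr_plus n g"
    using pr_plus[OF h(1)] pr_plus[OF h(2)] assms(2) f(2) by (subst EH_eq_iff[symmetric]) (auto simp: H_plus_iff)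
  then have "f \<approx> g" using big f g by (auto simp: big_cell_def isomorphism_def)
  then show ?thesis using EH_eq_iff[OF h] f g by simp
qed

lemma bmf_exp_xi: "bmf (\<lambda>z. exp (xi t z))" "bmf (\<lambda>z. exp (- xi t z))"
  by (rule bmf_continuous; simp add: xi_def; intro continuous_intros)+

definition Ex :: "(nat => complex) => ell2 => ell2" where "Ex t = Mul (\<lambda>z. exp (xi t z))"
definition Exi :: "(nat => complex) => ell2 => ell2" where "Exi t = Mul (\<lambda>z. exp (- xi t z))"

lemma Ex_Exi: "Ex t (Exi t x) = x" "Exi t (Ex t x) = x"
  unfolding Ex_def Exi_def
  by (simp_all add: Mul_Mul bmf_exp_xi exp_add[symmetric] Mul_one)

lemma wave_function_iff:
  assumes "f \<in> W"
  shows "is_wave_function n W t (Xi n f) \<longleftrightarrow> prP (Exi t (EH n f)) = e0"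
proof -
  have f: "f \<in> H_space n" using assms W_sub by auto
  have L: "(\<lambda>z. exp (- xi t z) * Xi n f z) \<in> L2" by (rule bmf_L2[OF bmf_exp_xi(2) Xi_L2[OF f]])
  have E: "Exi t (EH n f) = FT (\<lambda>z. exp (- xi t z) * Xi n f z)"
    unfolding Exi_def EH_def by (rule Mul_FT[OF bmf_exp_xi(2) Xi_L2[OF f]])
  have F: "fourier (\<lambda>z. exp (- xi t z) * Xi n f z - 1) p = crd (Exi t (EH n f)) p - crd e0 p" for p
    unfolding E e0_def by (simp add: fourier_diff L L2_const crd_FT)
  have "is_wave_function n W t (Xi n f) \<longleftrightarrow> (\<forall>p\<ge>0. crd (Exi t (EH n f)) p = crd e0 p)"
    using assms L2_diff[OF L L2_const[of 1]] by (auto simp: is_wave_function_def L2_minus_def F)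
  also have "\<dots> \<longleftrightarrow> prP (Exi t (EH n f)) = e0"
  proof
    assume "\<forall>p\<ge>0. crd (Exi t (EH n f)) p = crd e0 p"
    then show "prP (Exi t (EH n f)) = e0" by (intro ell2_eqI) (auto simp: crd_prP crd_e0)
  next
    assume "prP (Exi t (EH n f)) = e0"
    then have "crd (prP (Exi t (EH n f))) p = crd e0 p" for p by simp
    then show "\<forall>p\<ge>0. crd (Exi t (EH n f)) p = crd e0 p" by (metis crd_prP)
  qed
  finally show ?thesis .
qed

lemma psi_unique:
  assumes x: "x \<in> Wh" "prP (Exi t x) = e0" and u: "!!y. y \<in> Wh ==> prP (Exi t y) = e0 ==> y = x"
  shows "psi n W t \<in> L2" "FT (psi n W t) = x"
proof -
  obtain f where "f \<in> W" "x = EH n f" using x(1) by (auto simp: Wh_def)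
  then have "\<exists>\<psi>. is_wave_function n W t \<psi>" using wave_function_iff x(2) by blast
  then have w: "is_wave_function n W t (psi n W t)" unfolding psi_def by (rule someI_ex)
  then obtain g where g: "g \<in> W" "psi n W t = Xi n g" by (auto simp: is_wave_function_def)
  have gh: "g \<in> H_space n" using g W_sub by auto
  show "psi n W t \<in> L2" unfolding g(2) by (rule Xi_L2[OF gh])
  have "prP (Exi t (EH n g)) = e0" using w wave_function_iff[OF g(1)] g(2) by simp
  then have "EH n g = x" using u[of "EH n g"] g(1) by (auto simp: Wh_def)
  then show "FT (psi n W t) = x" by (simp add: g(2) EH_def)
qed

end

end

text \<open>\<open>FT\<close> is isometric, so the limit of difference quotients is unique up to null sets, which makes
  the choice in \<open>D_t1\<close> harmless.\<close>

lemma D_t1_eq: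
  assumes d: "0 < d" and F: "!!h. h \<in> ball 0 d ==> F (t(1 := t 1 + h)) \<in> L2 \<and> FT (F (t(1 := t 1 + h))) = y h"
    and y: "has_cderiv y y' 0"
  shows "D_t1 F t \<in> L2" "FT (D_t1 F t) = y'"
proof -
  have F0: "F t \<in> L2" "FT (F t) = y 0" using F[of 0] d by simp_all
  have ev: "\<forall>\<^sub>F h in at 0. h \<in> ball (0::complex) d"
    using eventually_at_in_open'[of "ball (0::complex) d" 0] d by (simp add: centre_in_ball)
  have q: "((\<lambda>h. cmul (1 / h) (y h - y 0)) \<longlongrightarrow> y') (at 0)" using has_cderiv_quotient[OF y] by simp
  have n: "L2_norm (\<lambda>z. (F (t(1 := t 1 + h)) z - F t z) / h - g z) = norm (cmul (1 / h) (y h - y 0) - FT g)"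
    if "h \<in> ball 0 d" "g \<in> L2" for h g
  proof -
    have e: "(\<lambda>z. (F (t(1 := t 1 + h)) z - F t z) / h - g z) = (\<lambda>z. 1 / h * (F (t(1 := t 1 + h)) z - F t z) - g z)"
      by (rule ext) simp
    have L: "(\<lambda>z. 1 / h * (F (t(1 := t 1 + h)) z - F t z)) \<in> L2" "(\<lambda>z. F (t(1 := t 1 + h)) z - F t z) \<in> L2"
      by (intro L2_cmult L2_diff conjunct1[OF F[OF that(1)]] F0(1))+
    show ?thesis
      unfolding e norm_FT_L2_norm[OF L2_diff[OF L(1) that(2)], symmetric] FT_diff[OF L(1) that(2)] FT_cmult[OF L(2)]
      using F[OF that(1)] F0 by (simp add: FT_diff)
  qed
  have ex: "\<exists>g. g \<in> L2 \<and> ((\<lambda>h. L2_norm (\<lambda>z. (F (t(1 := t 1 + h)) z - F t z) / h - g z)) \<longlongrightarrow> 0) (at 0)"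
  proof (intro exI[of _ "IFT y'"] conjI IFT(1))
    have "((\<lambda>h. norm (cmul (1 / h) (y h - y 0) - FT (IFT y'))) \<longlongrightarrow> 0) (at 0)"
      using q by (simp add: IFT LIM_zero tendsto_norm_zero)
    then show "((\<lambda>h. L2_norm (\<lambda>z. (F (t(1 := t 1 + h)) z - F t z) / h - IFT y' z)) \<longlongrightarrow> 0) (at 0)"
      by (rule Lim_transform_eventually) (use ev in \<open>eventually_elim, simp add: n IFT del: One_nat_def\<close>)
  qed
  from someI_ex[OF ex] have D: "D_t1 F t \<in> L2"
    "((\<lambda>h. L2_norm (\<lambda>z. (F (t(1 := t 1 + h)) z - F t z) / h - D_t1 F t z)) \<longlongrightarrow> 0) (at 0)"
    unfolding D_t1_def by auto
  show "D_t1 F t \<in> L2" by (rule D)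
  have "((\<lambda>h. norm (cmul (1 / h) (y h - y 0) - FT (D_t1 F t))) \<longlongrightarrow> 0) (at 0)"
    using D(2) by (rule Lim_transform_eventually) (use ev in \<open>eventually_elim, simp add: n D(1) del: One_nat_def\<close>)
  then have "((\<lambda>h. cmul (1 / h) (y h - y 0)) \<longlongrightarrow> FT (D_t1 F t)) (at 0)"
    by (simp add: tendsto_norm_zero_iff LIM_zero_iff)
  then show "FT (D_t1 F t) = y'" using q tendsto_unique[OF at_neq_bot] by blast
qed

lemma xi_shift:
  assumes "finite {i. t i ~= 0}"
  shows "xi (t(1 := t 1 + s)) z = xi t z + s * z"
proof -
  define A where "A = insert 1 {i. t i ~= 0}"
  have A: "finite A" using assms by (simp add: A_def)
  have "xi (t(1 := t 1 + s)) z = (\<Sum>i\<in>A. (t(1 := t 1 + s)) i * z ^ i)"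
    unfolding xi_def by (rule sum.mono_neutral_left[OF A]) (auto simp: A_def)
  also have "\<dots> = (\<Sum>i\<in>A. t i * z ^ i + (if i = 1 then s * z else 0))"
    by (rule sum.cong) (auto simp: distrib_right)
  also have "\<dots> = (\<Sum>i\<in>A. t i * z ^ i) + s * z" using A by (simp add: sum.distrib A_def)
  also have "(\<Sum>i\<in>A. t i * z ^ i) = xi t z"
    unfolding xi_def by (rule sum.mono_neutral_right[OF A]) (auto simp: A_def)
  finally show ?thesis .
qed

text \<open>Shifting \<open>t\<^sub>1\<close> by \<open>s\<close> multiplies \<open>e\<^sup>-\<^sup>\<xi>\<close> by \<open>e\<^sup>-\<^sup>s\<^sup>z\<close>, so the wave functions near \<open>t\<close> are
  the family of \<open>wave_family\<close> in \<open>V = e\<^sup>-\<^sup>\<xi> W\<close>, transported by \<open>e\<^sup>\<xi>\<close>.\<close>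

theorem wave_derivatives:
  assumes n: "0 < n" and W: "W \<in> Gr n" and big: "big_cell n W"
    and fin: "finite {i. t i ~= 0}"
    and V: "V = Exi t ` Wh n W" "closed V" "csubspace V"
    and onto: "!!y. y \<in> plus_space ==> \<exists>x\<in>V. prP x = y"
    and inj: "!!x. x \<in> V ==> prP x = 0 ==> x = 0"
    and j: "j \<le> m"
  shows "(D_t1 ^^ j) (psi n W) t \<in> L2" "Exi t (FT ((D_t1 ^^ j) (psi n W) t)) \<in> V"
    "crd (Exi t (FT ((D_t1 ^^ j) (psi n W) t))) (int j) = 1"
    "!!p. int j < p ==> crd (Exi t (FT ((D_t1 ^^ j) (psi n W) t))) p = 0"
proof -
  obtain d w where d: "0 < d"
    and w: "!!s. s \<in> ball 0 d ==> w 0 s \<in> V \<and> prP (U s (w 0 s)) = e0"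
      "!!s x. s \<in> ball 0 d ==> x \<in> V ==> prP (U s x) = e0 ==> x = w 0 s"
      "!!j s. j < m ==> s \<in> ball 0 d ==> has_cderiv (w j) (w (Suc j) s) s"
      "!!j. j \<le> m ==> w j 0 \<in> V"
      "!!j. j \<le> m ==> crd (w j 0) (int j) = 1"
      "!!j p. j \<le> m ==> int j < p ==> crd (w j 0) p = 0"
    using wave_family[OF V(2,3) onto inj, of m] by blast
  note Ex_Exi = Ex_Exi[OF n W big]
  have Exs: "Exi (t(1 := t 1 + s)) x = U s (Exi t x)" for s x
    unfolding Exi_def[OF n W big] U_def Mul_Mul[OF bmf_exp bmf_exp_xi(2)[OF n W big]]
    by (simp only: xi_shift[OF fin] exp_add[symmetric] minus_add_distrib mult_minus_left add.commute[of "- (s * _)"])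
  have main: "(D_t1 ^^ j) (psi n W) (t(1 := t 1 + s)) \<in> L2 \<and>
      FT ((D_t1 ^^ j) (psi n W) (t(1 := t 1 + s))) = Ex t (w j s)" if "j \<le> m" "s \<in> ball 0 d" for j s
    using that
  proof (induction j arbitrary: s)
    case 0
    obtain x where x: "x \<in> Wh n W" "w 0 s = Exi t x" using w(1)[OF 0(2)] V(1) by blast
    have "psi n W (t(1 := t 1 + s)) \<in> L2" "FT (psi n W (t(1 := t 1 + s))) = x"
    proof (rule_tac [!] psi_unique[OF n W big x(1)])
      show "prP (Exi (t(1 := t 1 + s)) x) = e0" using w(1)[OF 0(2)] x(2) by (simp only: Exs)
      show "prP (Exi (t(1 := t 1 + s)) x) = e0" using w(1)[OF 0(2)] x(2) by (simp only: Exs)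
      fix y assume y: "y \<in> Wh n W" "prP (Exi (t(1 := t 1 + s)) y) = e0"
      have "Exi t y = w 0 s" by (rule w(2)[OF 0(2)]) (use y V(1) in \<open>auto simp: Exs simp del: One_nat_def\<close>)
      then show "y = x" using x(2) Ex_Exi(1) by metis
      show "y = x" by fact
    qed
    then show ?case using x(2) Ex_Exi(1) by (simp del: One_nat_def fun_upd_apply)
  next
    case (Suc j)
    obtain e where e: "0 < e" "ball s e \<subseteq> ball 0 d" using Suc.prems(2) by (meson open_ball openE)
    have sh: "s + h \<in> ball 0 d" if "h \<in> ball 0 e" for h using e(2) that by (intro subsetD[OF e(2)]) (simp add: dist_norm)
    have y: "has_cderiv (\<lambda>h. Ex t (w j (s + h))) (Ex t (w (Suc j) s)) 0"
    proof (rule has_cderiv_linear[of "\<lambda>h. w j (s + h)" "w (Suc j) s" 0 "Ex t"])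
      have "(w j has_derivative (\<lambda>h. cmul h (w (Suc j) s))) (at (s + 0))" using w(3)[of j s] Suc.prems by simp
      moreover have "((\<lambda>h. s + h) has_derivative (\<lambda>h. h)) (at 0)" by (auto intro!: derivative_eq_intros)
      ultimately show "has_cderiv (\<lambda>h. w j (s + h)) (w (Suc j) s) 0"
        using has_derivative_compose[of "\<lambda>h. s + h" "\<lambda>h. h" 0 UNIV "w j" "\<lambda>h. cmul h (w (Suc j) s)"] by blast
      show "bounded_linear (Ex t)"
        unfolding Ex_def[OF n W big] by (rule bounded_linear_Mul[OF bmf_exp_xi(1)[OF n W big]])
      show "Ex t (cmul c x) = cmul c (Ex t x)" for c x
        unfolding Ex_def[OF n W big] by (rule Mul_cmul[OF bmf_exp_xi(1)[OF n W big]])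
    qed
    have "(D_t1 ^^ j) (psi n W) ((t(1 := t 1 + s))(1 := (t(1 := t 1 + s)) 1 + h)) \<in> L2 \<and>
        FT ((D_t1 ^^ j) (psi n W) ((t(1 := t 1 + s))(1 := (t(1 := t 1 + s)) 1 + h))) = Ex t (w j (s + h))"
      if "h \<in> ball 0 e" for h
      using Suc.IH[OF _ sh[OF that]] Suc.prems by (simp add: add.assoc del: One_nat_def flip: fun_upd_def)
    from D_t1_eq[OF e(1) this y] show ?case by simp
  qed
  have "(D_t1 ^^ j) (psi n W) t \<in> L2" "FT ((D_t1 ^^ j) (psi n W) t) = Ex t (w j 0)"
    using main[OF j, of 0] d by simp_all
  then show "(D_t1 ^^ j) (psi n W) t \<in> L2" "Exi t (FT ((D_t1 ^^ j) (psi n W) t)) \<in> V"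
    "crd (Exi t (FT ((D_t1 ^^ j) (psi n W) t))) (int j) = 1"
    "!!p. int j < p ==> crd (Exi t (FT ((D_t1 ^^ j) (psi n W) t))) p = 0"
    using w(4-6)[OF j] Ex_Exi(2) by simp_all
qed
section \<open>Finitely supported vectors and unit vectors\<close>

lemma det_inverse:
  fixes A :: "complex mat"
  assumes A: "A \<in> carrier_mat n n" and d: "det A ~= 0"
  shows "inv_mat A \<in> carrier_mat n n" "A * inv_mat A = 1\<^sub>m n" "inv_mat A * A = 1\<^sub>m n"
proof -
  have "\<exists>B. mat_inverse A = Some B"
  proof (cases "mat_inverse A")
    case None
    from mat_inverse(1)[OF A None, of "()"] det_non_zero_imp_unit[OF A d, of "()"] show ?thesis by contradiction
  qed auto
  then obtain B where B: "mat_inverse A = Some B" ..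
  from mat_inverse(2)[OF A B] B
  show "inv_mat A \<in> carrier_mat n n" "A * inv_mat A = 1\<^sub>m n" "inv_mat A * A = 1\<^sub>m n" by simp_all
qed

lemma infsum_finite_support:
  fixes f :: "int => complex"
  assumes "finite F" "!!k. k \<notin> F ==> f k = 0"
  shows "infsum f UNIV = (\<Sum>k\<in>F. f k)"
proof -
  have "infsum f UNIV = infsum f F" by (rule infsum_cong_neutral) (use assms in auto)
  then show ?thesis using assms(1) by simp
qed

lemma infsum_finite_sum:
  fixes f :: "nat => int => complex"
  assumes "!!i. i \<in> A ==> f i summable_on UNIV"
  shows "(\<Sum>\<^sub>\<infinity>k. \<Sum>i\<in>A. f i k) = (\<Sum>i\<in>A. \<Sum>\<^sub>\<infinity>k. f i k)"
proof -
  have "(\<lambda>k. \<Sum>i\<in>A. f i k) summable_on UNIV \<and> (\<Sum>\<^sub>\<infinity>k. \<Sum>i\<in>A. f i k) = (\<Sum>i\<in>A. \<Sum>\<^sub>\<infinity>k. f i k)"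
    using assms by (induction A rule: infinite_finite_induct) (auto simp: infsum_add summable_on_add)
  then show ?thesis ..
qed

lemma crd_Ell2_finite: assumes "finite F" "!!p. p \<notin> F ==> f p = 0" shows "crd (Ell2 f) = f"
proof (rule Ell2_inverse)
  have "{p. (cmod (f p))\<^sup>2 ~= 0} \<subseteq> F" using assms(2) by auto
  then have "finite {p \<in> UNIV. (cmod (f p))\<^sup>2 ~= 0}" using finite_subset assms(1) by auto
  then have "(\<lambda>p. (cmod (f p))\<^sup>2) summable_on UNIV" by (rule finite_nonzero_values_imp_summable_on)
  then show "f \<in> {x. (\<lambda>p. (cmod (x p))\<^sup>2) summable_on UNIV}" by simp
qed

definition ev :: "int => ell2" where "ev q = Ell2 (\<lambda>p. if p = q then 1 else 0)"

lemma crd_ev: "crd (ev q) p = (if p = q then 1 else 0)"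
  unfolding ev_def by (subst crd_Ell2_finite[of "{q}"]) auto

lemma crd_actL_ev: "crd (actL A (ev q)) p = ent A p q"
proof -
  have "crd (actL A (ev q)) p = (\<Sum>\<^sub>\<infinity>k. if k = q then ent A p k else 0)"
    unfolding crd_actL act_def by (rule infsum_cong) (simp add: crd_ev)
  then show ?thesis by (simp only: infsum_single)
qed

lemma norm_ev_le: "norm (ev q) \<le> 1"
proof (rule norm_ell2_boundI)
  fix F :: "int set" assume F: "finite F"
  have "(\<Sum>p\<in>F. (cmod (crd (ev q) p))\<^sup>2) = (\<Sum>p\<in>F. if p = q then 1 else 0)"
    by (rule sum.cong) (auto simp: crd_ev)
  also have "\<dots> \<le> 1" using F by simp
  finally show "L2_set (\<lambda>p. cmod (crd (ev q) p)) F \<le> 1" unfolding L2_set_def by simp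
qed

lemma actL_add: "actL A (x + y) = actL A x + actL A y"
  using bounded_linear_actL[of A] by (simp add: bounded_linear.linear linear_add)

lemma actL_diff: "actL A (x - y) = actL A x - actL A y"
  using bounded_linear_actL[of A] by (simp add: bounded_linear.linear linear_diff)

lemma actL_zero: "actL A 0 = 0"
  using bounded_linear_actL[of A] by (simp add: bounded_linear.linear linear_0)

lemma actL_plus: "actL (A + B) x = actL A x + actL B x"
  by (rule ell2_eqI)
    (simp add: crd_actL crd_add act_def ent_add distrib_right infsum_add act_row_summable[OF bounded_seq_crd])

lemma norm_actL_le: "decay C r (ent A) ==> norm (actL A x) \<le> C * (\<Sum>\<^sub>\<infinity>q::int. r ^ nat \<bar>q\<bar>) * norm x"
  by (rule norm_ell2_boundI) (simp add: crd_actL act_ell2_bound)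

lemma ent_Emat: "decay C r A ==> ent (Emat A) = A"
  by (rule Emat_inverse) auto

section \<open>Shifts and periodic matrices\<close>

definition Zn :: "int => emat" where "Zn m = toep (\<lambda>k. if k = m then 1 else 0)"

lemma ent_Zn: "ent (Zn m) p q = (if p - q = m then 1 else 0)"
proof -
  have "expdec (\<lambda>k. if k = m then 1 else 0)"
    unfolding expdec_def
    by (rule exI[of _ "2 ^ nat \<bar>m\<bar>"], rule exI[of _ "1/2"]) (auto simp: power_one_over)
  then show ?thesis by (simp add: Zn_def ent_toep)
qed

lemma ent_Zn_mult: "ent (Zn m * A) p q = ent A (p - m) q"
proof -
  have "ent (Zn m * A) p q = (\<Sum>\<^sub>\<infinity>k. if k = p - m then ent A k q else 0)"
    unfolding ent_mult by (rule infsum_cong) (auto simp: ent_Zn)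
  then show ?thesis by (simp only: infsum_single)
qed

lemma ent_mult_Zn: "ent (A * Zn m) p q = ent A p (q + m)"
proof -
  have "ent (A * Zn m) p q = (\<Sum>\<^sub>\<infinity>k. if k = q + m then ent A p k else 0)"
    unfolding ent_mult by (rule infsum_cong) (auto simp: ent_Zn)
  then show ?thesis by (simp only: infsum_single)
qed

lemma Zn_Zn: "Zn l * Zn m = Zn (l + m)" by (rule emat_eqI) (auto simp: ent_Zn_mult ent_Zn)
lemma Zn_0: "Zn 0 = 1" by (rule emat_eqI) (auto simp: ent_Zn ent_one)
lemma actL_Zn_cancel: "actL (Zn m) (actL (Zn (- m)) x) = x" "actL (Zn (- m)) (actL (Zn m) x) = x"
  by (simp_all add: actL_mult[symmetric] Zn_Zn Zn_0 actL_one)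

lemma crd_Zn: "crd (actL (Zn m) x) p = crd x (p - m)"
proof -
  have "crd (actL (Zn m) x) p = (\<Sum>\<^sub>\<infinity>k. if k = p - m then crd x k else 0)"
    unfolding crd_actL act_def by (rule infsum_cong) (auto simp: ent_Zn)
  then show ?thesis by (simp only: infsum_single)
qed

definition periodic :: "nat => emat => bool" where
  "periodic n A \<longleftrightarrow> (\<forall>p q. ent A (p + int n) (q + int n) = ent A p q)"

lemma periodic_comm: "periodic n A \<longleftrightarrow> A * Zn (int n) = Zn (int n) * A"
proof
  assume "periodic n A"
  then have "ent A (p - int n + int n) (q + int n) = ent A (p - int n) q" for p q unfolding periodic_def by blast
  then show "A * Zn (int n) = Zn (int n) * A" by (intro emat_eqI) (simp add: ent_Zn_mult ent_mult_Zn)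
next
  assume a: "A * Zn (int n) = Zn (int n) * A"
  have "ent (A * Zn (int n)) (p + int n) q = ent (Zn (int n) * A) (p + int n) q" for p q by (simp add: a)
  then show "periodic n A" by (simp add: periodic_def ent_Zn_mult ent_mult_Zn)
qed

lemma periodic_mult: "periodic n A ==> periodic n B ==> periodic n (A * B)"
  unfolding periodic_comm by (metis mult.assoc)

lemma periodic_inverse: assumes "periodic n A" "A * B = 1" "B * A = 1" shows "periodic n B"
proof -
  have "B * (A * Zn (int n)) * B = B * (Zn (int n) * A) * B" using assms(1) by (simp add: periodic_comm)
  then have "(B * A) * (Zn (int n) * B) = (B * Zn (int n)) * (A * B)" by (simp only: mult.assoc)
  then show ?thesis by (simp add: assms periodic_comm)
qed

lemma periodic_shift: assumes "periodic n A" shows "ent A (p + k * int n) (q + k * int n) = ent A p q"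
proof (induction k rule: int_induct[of _ 0])
  case base then show ?case by simp
next
  case (step1 k)
  then show ?case using assms[unfolded periodic_def, rule_format, of "p + k * int n" "q + k * int n"]
    by (simp add: algebra_simps)
next
  case (step2 k)
  then show ?case using assms[unfolded periodic_def, rule_format, of "p + (k - 1) * int n" "q + (k - 1) * int n"]
    by (simp add: algebra_simps)
qed

lemma periodic_actL_Zn: assumes "periodic n A" shows "actL A (actL (Zn (k * int n)) x) = actL (Zn (k * int n)) (actL A x)"
proof -
  have "ent A p (q + k * int n) = ent A (p - k * int n) q" for p q
    using periodic_shift[OF assms, of "p - k * int n" k q] by simp
  then have "A * Zn (k * int n) = Zn (k * int n) * A"
    by (intro emat_eqI) (simp add: ent_Zn_mult ent_mult_Zn)
  then show ?thesis by (simp add: actL_mult[symmetric])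
qed

section \<open>Upper unitriangular matrices\<close>

definition upper :: "emat => bool" where
  "upper A \<longleftrightarrow> (\<forall>p q. q < p --> ent A p q = 0) \<and> (\<forall>p. ent A p p = 1)"

lemma upper_actL_top:
  assumes A: "upper A" and x: "!!q. p < q ==> crd x q = 0" shows "crd (actL A x) p = crd x p"
proof -
  have "crd (actL A x) p = (\<Sum>q\<in>{p}. ent A p q * crd x q)"
    unfolding crd_actL act_def
  proof (rule infsum_finite_support)
    fix q assume "q \<notin> {p}"
    then show "ent A p q * crd x q = 0" using A x[of q] by (cases "q < p") (auto simp: upper_def)
  qed simp
  then show ?thesis using A by (simp add: upper_def)
qed

lemma upper_kernel:
  assumes A: "upper A" and M: "!!p. M < p ==> crd x p = 0" and 0: "actL A x = 0" shows "x = 0"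
proof (rule ell2_eqI)
  have "\<forall>p. M - int k < p --> crd x p = 0" for k
  proof (induction k)
    case (Suc k)
    have "crd x (M - int k) = 0"
      using upper_actL_top[OF A, of "M - int k" x] Suc 0 by (auto simp: crd_zero)
    moreover have "p = M - int k \<or> M - int k < p" if "M - int (Suc k) < p" for p using that by auto
    ultimately show ?case using Suc by blast
  qed (use M in auto)
  moreover have "M - int (nat (M - p) + 1) < p" for p by linarith
  ultimately show "crd x p = crd 0 p" for p unfolding crd_zero by blast
qed

text \<open>Column \<open>q\<close> of the formal inverse of an upper unitriangular matrix, solved by back
  substitution; \<open>d\<close> is the distance to the diagonal.\<close>

fun back_sub :: "emat => int => nat => complex" where
  "back_sub b q d = (if d = 0 then 1 else - (\<Sum>e<d. ent b (q - int d) (q - int e) * back_sub b q e))"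

declare back_sub.simps [simp del]

lemma back_sub_0: "back_sub b q 0 = 1" by (simp add: back_sub.simps)

lemma back_sub_periodic: assumes "periodic n b" shows "back_sub b (q + k * int n) d = back_sub b q d"
proof (induction d rule: less_induct)
  case (less d)
  have "ent b (q + k * int n - int d) (q + k * int n - int e) = ent b (q - int d) (q - int e)" for e
    using periodic_shift[OF assms, of "q - int d" k "q - int e"] by (simp add: algebra_simps)
  then show ?case using less by (simp add: back_sub.simps[of b _ d])
qed

lemma back_sub_solves:
  assumes b: "upper b" and pq: "p \<le> q"
  shows "(\<Sum>k\<in>{p..q}. ent b p k * back_sub b q (nat (q - k))) = (if p = q then 1 else 0)"
proof -
  define d where "d = nat (q - p)"
  have p: "p = q - int d" using pq by (simp add: d_def)
  have "(\<Sum>k\<in>{p..q}. ent b p k * back_sub b q (nat (q - k))) =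
      (\<Sum>e\<le>d. ent b (q - int d) (q - int e) * back_sub b q e)"
    by (rule sum.reindex_bij_witness[of _ "\<lambda>e. q - int e" "\<lambda>k. nat (q - k)"]) (auto simp: p)
  also have "\<dots> = (\<Sum>e<d. ent b (q - int d) (q - int e) * back_sub b q e) + ent b p p * back_sub b q d"
    by (simp add: p lessThan_Suc_atMost[symmetric])
  also have "\<dots> = (if p = q then 1 else 0)"
    using b p by (cases "d = 0") (auto simp: back_sub_0 upper_def back_sub.simps[of b q d])
  finally show ?thesis .
qed

lemma mult_power_le: fixes x :: real assumes "0 \<le> x" "x < 1" shows "real d * x ^ d \<le> 1 / (1 - x)"
proof -
  have "real d * x ^ d = (\<Sum>k<d. x ^ d)" by simp
  also have "\<dots> \<le> (\<Sum>k<d. x ^ k)" by (rule sum_mono) (use assms in \<open>auto intro: power_decreasing\<close>)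
  also have "\<dots> = (1 - x ^ d) / (1 - x)" using assms by (simp add: sum_gp_strict)
  also have "\<dots> \<le> 1 / (1 - x)" using assms by (simp add: divide_right_mono)
  finally show ?thesis .
qed

text \<open>Conjugation by the diagonal matrix with entries \<open>s\<^sup>p\<close> changes an exponentially decaying matrix
  by \<open>O(s - 1)\<close>; the square \<open>\<tau>\<^sup>2\<close> leaves room for the factor \<open>d\<close> from Bernoulli's inequality.\<close>

lemma tilt_bound:
  fixes r s \<tau> :: real
  assumes "0 < r" "0 < \<tau>" "\<tau> < 1" "1 \<le> s" "r * s \<le> \<tau> * \<tau>"
  shows "r ^ d * (s ^ d - 1) \<le> (s - 1) / (1 - \<tau>) * \<tau> ^ d"
proof -
  have "s ^ d - 1 = (s - 1) * (\<Sum>k<d. s ^ k)" by (simp add: power_diff_1_eq)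
  also have "\<dots> \<le> (s - 1) * (\<Sum>k<d. s ^ d)"
    using assms by (intro mult_left_mono sum_mono power_increasing) auto
  finally have "s ^ d - 1 \<le> (s - 1) * (real d * s ^ d)" by simp
  then have "r ^ d * (s ^ d - 1) \<le> r ^ d * ((s - 1) * (real d * s ^ d))"
    using assms by (intro mult_left_mono) auto
  also have "\<dots> = (s - 1) * (real d * (r * s) ^ d)" by (simp add: power_mult_distrib mult_ac)
  also have "\<dots> \<le> (s - 1) * (real d * (\<tau> * \<tau>) ^ d)"
    using assms by (intro mult_left_mono power_mono) auto
  also have "\<dots> = (s - 1) * (real d * \<tau> ^ d) * \<tau> ^ d" by (simp add: power_mult_distrib mult_ac)
  also have "\<dots> \<le> (s - 1) * (1 / (1 - \<tau>)) * \<tau> ^ d"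
    using assms by (intro mult_right_mono mult_left_mono mult_power_le) auto
  finally show ?thesis by simp
qed

text \<open>The Combes--Thomas argument. A small tilt of \<open>b\<close> keeps the lower bound, up to a factor
  2. The tilted columns of the formal inverse are finitely supported and are mapped to unit vectors,
  so they are bounded, and undoing the tilt gives exponential decay.\<close>

lemma back_sub_bound:
  assumes b: "upper b" and c: "0 < c"
    and below: "!!x. x \<in> plus_space ==> c * norm x \<le> norm (prP (actL b x))"
  obtains K s where "0 \<le> K" "1 < s" "!!k q. 0 \<le> k ==> k \<le> q ==> cmod (back_sub b q (nat (q - k))) \<le> K * (1 / s) ^ nat (q - k)"
proof -
  obtain C r where bd: "decay C r (ent b)" by (rule decay_ent)
  note d = decayD[OF bd]
  define \<tau> where "\<tau> = sqrt (sqrt r)"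
  have \<tau>: "0 < \<tau>" "\<tau> < 1" "\<tau> * \<tau> = sqrt r" using d by (simp_all add: \<tau>_def)
  define G where "G = (\<Sum>\<^sub>\<infinity>q::int. \<tau> ^ nat \<bar>q\<bar>)"
  have G: "0 \<le> G" unfolding G_def by (rule infsum_nonneg) (use \<tau> in simp)
  define M where "M = C / (1 - \<tau>) * G"
  have M: "0 \<le> M" using d G \<tau> by (simp add: M_def)
  (* The first bound keeps r s below \<tau>^2, the second one makes the perturbation at most c/2. *)
  define s where "s = min (1 / sqrt r) (1 + c / (2 * M + 1))"
  have s: "1 < s" using d c M by (simp add: s_def)
  have "r * s \<le> r * (1 / sqrt r)" using d by (intro mult_left_mono) (auto simp: s_def)
  also have "\<dots> = \<tau> * \<tau>" using d \<tau>(3) by (simp add: real_div_sqrt)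
  finally have rs: "r * s \<le> \<tau> * \<tau>" .
  have sM: "(s - 1) * M \<le> c / 2"
  proof -
    have "(s - 1) * M \<le> c / (2 * M + 1) * M" using M by (intro mult_right_mono) (auto simp: s_def)
    also have "\<dots> \<le> c / 2" using M c by (simp add: field_simps)
    finally show ?thesis .
  qed
  define E where "E p q = (if p \<le> q then ent b p q * of_real (s ^ nat (q - p) - 1) else 0)" for p q
  have Ed: "decay (C * ((s - 1) / (1 - \<tau>))) \<tau> E"
    unfolding decay_def
  proof (intro conjI allI)
    show "0 \<le> C * ((s - 1) / (1 - \<tau>))" using d s \<tau> by simp
    fix p q
    show "cmod (E p q) \<le> C * ((s - 1) / (1 - \<tau>)) * \<tau> ^ nat \<bar>p - q\<bar>"
    proof (cases "p \<le> q")
      case True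
      then have n: "nat \<bar>p - q\<bar> = nat (q - p)" by simp
      have "cmod (E p q) = cmod (ent b p q) * (s ^ nat (q - p) - 1)"
        using True s by (simp add: E_def norm_mult del: of_real_diff of_real_power)
      also have "\<dots> \<le> C * r ^ nat (q - p) * (s ^ nat (q - p) - 1)"
        using d(4)[of p q] s n by (intro mult_right_mono) auto
      also have "\<dots> = C * (r ^ nat (q - p) * (s ^ nat (q - p) - 1))" by simp
      also have "\<dots> \<le> C * ((s - 1) / (1 - \<tau>) * \<tau> ^ nat (q - p))"
        by (rule mult_left_mono[OF tilt_bound]) (use d s \<tau> rs in auto)
      finally show ?thesis by (simp add: n)
    next
      case False
      then show ?thesis using d s \<tau> by (simp add: E_def)
    qed
  qed (use \<tau> in auto)
  define B where "B = b + Emat E"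
  have entB: "ent B p q = ent b p q * of_real (s ^ nat (q - p))" for p q
    using b by (cases "p \<le> q") (auto simp: B_def ent_add ent_Emat[OF Ed] E_def upper_def algebra_simps)
  have Bbelow: "c / 2 * norm x \<le> norm (prP (actL B x))" if x: "x \<in> plus_space" for x
  proof -
    have "norm (prP (actL (Emat E) x)) \<le> C * ((s - 1) / (1 - \<tau>)) * G * norm x"
      using norm_prP_le[of "actL (Emat E) x"] norm_actL_le[of _ _ "Emat E" x, unfolded ent_Emat[OF Ed], OF Ed]
      unfolding G_def by linarith
    also have "\<dots> = (s - 1) * M * norm x" by (simp add: M_def)
    also have "\<dots> \<le> c / 2 * norm x" using sM by (rule mult_right_mono) simp
    finally have "norm (prP (actL (Emat E) x)) \<le> c / 2 * norm x" .
    moreover have "prP (actL B x) = prP (actL b x) + prP (actL (Emat E) x)"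
      by (simp add: B_def actL_plus actL_add)
    then have "norm (prP (actL b x)) \<le> norm (prP (actL B x)) + norm (prP (actL (Emat E) x))"
      using norm_triangle_sub[of "prP (actL b x)" "prP (actL B x)"] by (simp add: norm_minus_commute)
    ultimately show ?thesis using below[OF x] by linarith
  qed
  have bound: "cmod (back_sub b q (nat (q - k))) \<le> 2 / c * (1 / s) ^ nat (q - k)" if kq: "0 \<le> k" "k \<le> q" for k q
  proof -
    define f where "f j = (if 0 \<le> j \<and> j \<le> q then back_sub b q (nat (q - j)) * of_real (s ^ nat (q - j)) else 0)" for j
    have f: "crd (Ell2 f) = f" by (rule crd_Ell2_finite[of "{0..q}"]) (auto simp: f_def)
    have "prP (actL B (Ell2 f)) = ev q"
    proof (rule ell2_eqI)
      fix p show "crd (prP (actL B (Ell2 f))) p = crd (ev q) p"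
      proof (cases "0 \<le> p")
        case True
        have "act (ent B) f p = (\<Sum>j\<in>{p..q}. ent B p j * f j)"
          unfolding act_def
        proof (rule infsum_finite_support)
          fix j assume "j \<notin> {p..q}"
          then show "ent B p j * f j = 0" using b by (auto simp: entB f_def upper_def)
        qed simp
        also have "\<dots> = (\<Sum>j\<in>{p..q}. of_real (s ^ nat (q - p)) * (ent b p j * back_sub b q (nat (q - j))))"
        proof (rule sum.cong[OF refl])
          fix j assume j: "j \<in> {p..q}"
          then have "nat (q - p) = nat (j - p) + nat (q - j)" by auto
          then show "ent B p j * f j = of_real (s ^ nat (q - p)) * (ent b p j * back_sub b q (nat (q - j)))"
            using j True by (simp add: entB f_def power_add)
        qed
        also have "\<dots> = (if p = q then 1 else 0)"
        proof (cases "p \<le> q")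
          case True
          then show ?thesis by (simp add: sum_distrib_left[symmetric] back_sub_solves[OF b] del: of_real_power)
        qed auto
        finally show ?thesis using True by (simp only: crd_prP crd_actL[of B] f crd_ev if_True)
      next
        case False
        then show ?thesis using kq by (simp add: crd_prP crd_ev)
      qed
    qed
    moreover have "Ell2 f \<in> plus_space" by (auto simp: plus_space_def f f_def)
    ultimately have "c / 2 * norm (Ell2 f) \<le> 1" using Bbelow[of "Ell2 f"] norm_ev_le[of q] by simp
    then have "norm (Ell2 f) \<le> 2 / c" using c by (simp add: field_simps)
    then have "cmod (f k) \<le> 2 / c" using norm_crd_le[of "Ell2 f" k] f by simp
    then show ?thesis using kq s c by (simp add: f_def norm_mult norm_power field_simps)
  qed
  show ?thesis by (rule that[of "2 / c" s]) (use c s bound in auto)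
qed

text \<open>Nonnegative columns are controlled by the lower bound, and periodicity carries the
  estimate to all columns.\<close>

theorem upper_inverse:
  assumes n: "0 < n" and per: "periodic n b" and b: "upper b" and c: "0 < c"
    and below: "!!x. x \<in> plus_space ==> c * norm x \<le> norm (prP (actL b x))"
  obtains bi where "b * bi = 1" "bi * b = 1" "upper bi"
proof -
  obtain K s where K: "0 \<le> K" "1 < s"
    "!!k q. 0 \<le> k ==> k \<le> q ==> cmod (back_sub b q (nat (q - k))) \<le> K * (1 / s) ^ nat (q - k)"
    using back_sub_bound[OF b c below] by blast
  define B where "B p q = (if p \<le> q then back_sub b q (nat (q - p)) else 0)" for p q
  have Bd: "decay K (1 / s) B"
    unfolding decay_def
  proof (intro conjI allI)
    fix p q
    show "cmod (B p q) \<le> K * (1 / s) ^ nat \<bar>p - q\<bar>"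
    proof (cases "p \<le> q")
      case True
      (* A shift by \<bar>p\<bar> periods makes the row index nonnegative. *)
      have "int (nat \<bar>p\<bar>) \<le> int (nat \<bar>p\<bar>) * int n" using n by (simp add: mult_le_cancel_left1)
      then have "0 \<le> p + int (nat \<bar>p\<bar>) * int n" by linarith
      from K(3)[OF this, of "q + int (nat \<bar>p\<bar>) * int n"]
      show ?thesis using True by (simp add: B_def back_sub_periodic[OF per] nat_diff_distrib)
    qed (use K in \<open>simp add: B_def\<close>)
  qed (use K in auto)
  define bi where "bi = Emat B"
  have ebi: "ent bi p q = B p q" for p q by (simp add: bi_def ent_Emat[OF Bd])
  have bi: "upper bi" by (simp add: upper_def ebi B_def back_sub_0)
  have bbi: "b * bi = 1"
  proof (rule emat_eqI)
    fix p q
    have "ent (b * bi) p q = (\<Sum>k\<in>{p..q}. ent b p k * B k q)"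
      unfolding ent_mult ebi
    proof (rule infsum_finite_support)
      fix j assume "j \<notin> {p..q}"
      then show "ent b p j * B j q = 0" using b by (auto simp: B_def upper_def)
    qed simp
    also have "\<dots> = (\<Sum>k\<in>{p..q}. ent b p k * back_sub b q (nat (q - k)))"
      by (rule sum.cong) (auto simp: B_def)
    also have "\<dots> = (if p = q then 1 else 0)" by (cases "p \<le> q") (auto simp: back_sub_solves[OF b])
    finally show "ent (b * bi) p q = ent 1 p q" by (simp add: ent_one)
  qed
  have "bi * b = 1"
  proof (rule emat_eqI)
    fix p q
    have "actL b (actL (bi * b - 1) (ev q)) = 0"
      by (simp add: actL_mult[symmetric] right_diff_distrib mult.assoc[symmetric] bbi)
        (rule ell2_eqI, simp add: crd_actL_ev ent_zero crd_zero)
    moreover have "crd (actL (bi * b - 1) (ev q)) p = 0" if "q < p" for p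
    proof -
      have "ent bi p k * ent b k q = 0" for k using b bi that by (cases "k < p") (auto simp: upper_def)
      then show ?thesis using that by (simp only: crd_actL_ev ent_diff ent_one ent_mult infsum_0_simp) simp
    qed
    ultimately have "actL (bi * b - 1) (ev q) = 0" using upper_kernel[OF b] by blast
    then have "ent (bi * b - 1) p q = 0" using crd_actL_ev[of "bi * b - 1" q p] by (simp add: crd_zero)
    then show "ent (bi * b) p q = ent 1 p q" by (simp add: ent_diff)
  qed
  then show ?thesis using that bbi bi by blast
qed

section \<open>Injectivity from the shift\<close>

text \<open>A vector supported below \<open>n\<close> cannot be mapped into \<open>z\<^sup>n\<close> times a space in the big cell: dividing
  by \<open>z\<^sup>n\<close> would give an element of that space without nonnegative coordinates.\<close>

lemma low_part_zero:
  assumes b: "upper b" and x: "!!p. int n \<le> p ==> crd x p = 0"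
    and e: "actL b x = actL (Zn (int n)) w" and w: "prP w = 0 ==> w = 0"
  shows "x = 0"
proof -
  have "crd w p = 0" if "0 \<le> p" for p
  proof -
    have "crd w p = crd (actL b x) (p + int n)" by (simp add: e crd_Zn)
    also have "\<dots> = crd x (p + int n)" by (rule upper_actL_top[OF b]) (use x that in auto)
    finally show ?thesis using x that by simp
  qed
  then have "prP w = 0" by (intro ell2_eqI) (simp add: crd_prP crd_zero)
  then have "actL b x = 0" using e w by (simp add: actL_zero)
  moreover have "crd x p = 0" if "int n - 1 < p" for p using x[of p] that by simp
  ultimately show ?thesis using upper_kernel[OF b, of "int n - 1" x] by blast
qed

text \<open>After a shift the lowest block of \<open>x\<close> is nonzero. The rest of \<open>x\<close> is \<open>z\<^sup>n\<close> times a vector of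
  the half space, so the lowest block vanishes by the previous lemma.\<close>

lemma plus_kernel:
  assumes n: "0 < n" and per: "periodic n b" and b: "upper b"
    and inj: "!!x. x \<in> plus_space ==> prP (actL b x) = 0 ==> actL b x = 0"
    and x: "x \<in> plus_space" "actL b x = 0"
  shows "x = 0"
proof (rule ccontr)
  assume "x ~= 0"
  then obtain p where "crd x p ~= 0" using ell2_eqI[of x 0] by (auto simp: crd_zero)
  moreover then have "0 \<le> p" using x(1) by (force simp: plus_space_def)
  ultimately have ex: "\<exists>k. crd x (int k) ~= 0" by (metis nonneg_int_cases)
  define N where "N = (LEAST k. crd x (int k) ~= 0)"
  have N: "crd x (int N) ~= 0" unfolding N_def by (rule LeastI_ex[OF ex])
  have below_N: "crd x p = 0" if "p < int N" for p
  proof (cases "0 \<le> p")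
    case True
    then show ?thesis using not_less_Least[of "nat p" "\<lambda>k. crd x (int k) ~= 0"] that by (auto simp: N_def[symmetric] nat_less_iff)
  qed (use x(1) in \<open>simp add: plus_space_def\<close>)
  define m where "m = int (N div n)"
  have m: "int N = m * int n + int (N mod n)" by (simp add: m_def of_nat_mult[symmetric] of_nat_add[symmetric] del: of_nat_mult of_nat_add)
  define x' where "x' = actL (Zn (- m * int n)) x"
  have cx': "crd x' p = crd x (p + m * int n)" for p by (simp add: x'_def crd_Zn)
  have x'p: "crd x' p = 0" if "p < 0" for p
    using that by (subst cx', intro below_N) (use m in linarith)
  have bx': "actL b x' = 0" unfolding x'_def periodic_actL_Zn[OF per] x(2) by (rule actL_zero)
  define y where "y = prP (actL (Zn (- int n)) x')"
  define x0 where "x0 = x' - actL (Zn (int n)) y"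
  have x0: "crd x0 p = (if p < int n then crd x' p else 0)" for p
    by (simp add: x0_def crd_diff crd_Zn y_def crd_prP)
  have "x0 = 0"
  proof (rule low_part_zero[OF b])
    show "crd x0 p = 0" if "int n \<le> p" for p using that by (simp add: x0)
    have "actL b x0 = - actL (Zn (int n)) (actL b y)"
      using periodic_actL_Zn[OF per, of 1 y] by (simp add: x0_def actL_diff bx')
    also have "\<dots> = actL (Zn (int n)) (actL b (- y))"
      using actL_diff[of "Zn (int n)" 0 "actL b y"] actL_diff[of b 0 y] by (simp add: actL_zero)
    finally show "actL b x0 = actL (Zn (int n)) (actL b (- y))" .
    have "- y \<in> plus_space" by (simp add: y_def plus_space_def crd_prP crd_minus)
    then show "prP (actL b (- y)) = 0 ==> actL b (- y) = 0" using inj by blast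
  qed
  then have "crd x' (int (N mod n)) = 0" using x0[of "int (N mod n)"] n by (simp add: crd_zero)
  then show False using N m by (simp add: cx' add.commute)
qed

text \<open>The compression of \<open>b\<close> to the half space is onto because the image of \<open>b\<close> is in the big cell, and
  one-to-one by the shift argument. Open mapping turns this into a lower bound.\<close>

theorem invertible_of_big_cell:
  assumes n: "0 < n" and per: "periodic n b" and b: "upper b"
    and onto: "!!y. y \<in> plus_space ==> \<exists>x\<in>plus_space. prP (actL b x) = y"
    and inj: "!!x. x \<in> plus_space ==> prP (actL b x) = 0 ==> actL b x = 0"
  obtains bi where "b * bi = 1" "bi * b = 1" "upper bi"
proof -
  (* Extended by the identity on the negative half, the compression becomes an operator on the whole space. *)
  define T where "T = (\<lambda>x. prP (actL b (prP x)) + (x - prP x))"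
  have T: "bounded_linear T"
    unfolding T_def
    by (intro bounded_linear_add bounded_linear_sub bounded_linear_ident bounded_linear_actL
        bounded_linear_compose[OF bounded_linear_actL])
  have PT: "prP (T x) = prP (actL b (prP x))" "T x - prP (T x) = x - prP x" for x
    by (rule ell2_eqI, simp add: T_def crd_prP crd_simps)+
  have "\<exists>C. \<forall>x\<in>UNIV. norm x \<le> C * norm (T x)"
  proof (rule bounded_inverse_on[OF T])
    show "T ` UNIV = UNIV"
    proof -
      have "y \<in> range T" for y
      proof -
        obtain x where x: "x \<in> plus_space" "prP (actL b x) = prP y" using onto[OF prP_in_plus[of y]] by blast
        have "T (x + (y - prP y)) = y"
        proof (rule ell2_eqI)
          fix p
          have "prP (x + (y - prP y)) = x"
            using x(1) by (intro ell2_eqI) (auto simp: crd_prP crd_simps plus_space_def)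
          then show "crd (T (x + (y - prP y))) p = crd y p"
            using x by (simp add: T_def crd_simps)
        qed
        then show ?thesis by (metis rangeI)
      qed
      then show ?thesis by blast
    qed
    fix x assume "T x = 0"
    then have "prP (actL b (prP x)) = 0" "x - prP x = 0" using PT[of x] by (simp_all add: actL_zero)
    moreover then have "prP x = 0"
      using plus_kernel[OF n per b inj prP_in_plus[of x]] inj[OF prP_in_plus[of x]] by blast
    ultimately show "x = 0" by simp
  qed (auto simp: subspace_UNIV)
  then obtain C where C: "!!x. norm x \<le> C * norm (T x)" by auto
  have below: "1 / (\<bar>C\<bar> + 1) * norm x \<le> norm (prP (actL b x))" if "x \<in> plus_space" for x
  proof -
    have "norm x \<le> C * norm (prP (actL b x))" using C[of x] that by (simp add: T_def prP_plus)
    also have "\<dots> \<le> (\<bar>C\<bar> + 1) * norm (prP (actL b x))" by (rule mult_right_mono) auto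
    finally show ?thesis by (simp add: field_simps)
  qed
  show ?thesis by (rule upper_inverse[OF n per b _ below]) (use that in auto)
qed

section \<open>Inverting the wave matrix\<close>

text \<open>The rows of \<open>S \<theta>\<close> with index below \<open>n\<close> vanish outside the columns below \<open>n\<close>: for negative
  columns because \<open>\<theta>\<close> is upper triangular, for columns from \<open>n\<close> on because \<open>S \<theta> = h\<close> there. The
  remaining block is invertible by the shift argument. Its inverse times these rows, continued
  periodically, is a left inverse of \<open>\<theta>\<close>; it vanishes far below the diagonal, so that
  unitriangularity of \<open>\<theta>\<close> makes it a right inverse too.\<close>

theorem wave_matrix_inverse:
  assumes n: "0 < n" and \<Gamma>: "\<Gamma> * \<Gamma>i = 1" "\<Gamma>i * \<Gamma> = 1" "periodic n \<Gamma>"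
    and S: "Pp * S = S" "S * Pp = S" "S * \<Gamma> * Pp = Pp"
    and \<theta>: "upper \<theta>" "periodic n \<theta>"
    and h: "Pp * (\<Gamma>i * \<theta> * Pp) = \<Gamma>i * \<theta> * Pp"
  obtains \<theta>' where "\<theta> * \<theta>' = 1" "\<theta>' * \<theta> = 1"
proof -
  define h where "h = \<Gamma>i * \<theta>"
  have hP: "Pp * (h * Pp) = h * Pp" using assms(10) by (simp add: h_def)
  have \<Gamma>h: "\<Gamma> * h = \<theta>" unfolding h_def by (simp add: mult.assoc[symmetric] \<Gamma>)
  have perh: "periodic n h" unfolding h_def by (intro periodic_mult periodic_inverse[OF \<Gamma>(3,1,2)] \<theta>)
  have h0: "ent h p q = 0" if "p < 0" "0 \<le> q" for p q
    using arg_cong[OF hP, of "\<lambda>A. ent A p q"] that by (simp add: ent_Pp_mult ent_mult_Pp)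
  have S\<theta>_nonneg: "ent (S * \<theta>) p q = ent h p q" if "0 \<le> q" for p q
  proof -
    have "S * \<theta> * Pp = S * \<Gamma> * (h * Pp)" by (simp add: \<Gamma>h[symmetric] mult.assoc)
    also have "\<dots> = S * \<Gamma> * (Pp * (h * Pp))" by (simp add: hP)
    also have "\<dots> = S * \<Gamma> * Pp * (h * Pp)" by (simp add: mult.assoc)
    also have "\<dots> = h * Pp" by (simp add: S hP)
    finally have "ent (S * \<theta> * Pp) p q = ent (h * Pp) p q" by simp
    then show ?thesis using that by (simp add: ent_mult_Pp)
  qed
  have S\<theta>_neg: "ent (S * \<theta>) p q = 0" if "q < 0" for p q
  proof -
    have "S * \<theta> = S * (Pp * \<theta>)" by (simp add: S mult.assoc[symmetric])
    moreover have "ent (Pp * \<theta>) k q = 0" for k using \<theta>(1) that by (auto simp: ent_Pp_mult upper_def)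
    ultimately show ?thesis by (simp add: ent_mult)
  qed
  define H0 where "H0 = mat n n (\<lambda>(i, j). ent h (int i) (int j))"
  have H0c: "H0 \<in> carrier_mat n n" by (simp add: H0_def)
  have "det H0 ~= 0"
  proof
    assume "det H0 = 0"
    then obtain v where v: "v \<in> carrier_vec n" "v ~= 0\<^sub>v n" "H0 *\<^sub>v v = 0\<^sub>v n"
      using det_0_iff_vec_prod_zero[OF H0c] by blast
    define f where "f p = (if 0 \<le> p \<and> p < int n then v $ nat p else 0)" for p
    define x where "x = Ell2 f"
    have cx: "crd x = f" unfolding x_def by (rule crd_Ell2_finite[of "{0..<int n}"]) (auto simp: f_def)
    define u where "u = actL h x"
    have cu: "crd u p = (\<Sum>j<n. ent h p (int j) * v $ j)" for p
    proof -
      have "f k = 0" if "k \<notin> int ` {..<n}" for k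
      proof (rule ccontr)
        assume "f k ~= 0"
        then have "k = int (nat k)" "nat k < n" by (auto simp: f_def split: if_splits)
        then show False using that by blast
      qed
      then have "crd u p = (\<Sum>q<n. ent h p (int q) * f (int q))"
        unfolding u_def crd_actL act_def cx by (intro infsum_int_eq_sum) simp
      then show ?thesis by (simp add: f_def)
    qed
    have u_neg: "crd u p = 0" if "p < int n" for p
    proof (cases "0 \<le> p")
      case True
      have "crd u p = (H0 *\<^sub>v v) $ nat p"
        using True that v(1) by (simp add: cu H0_def scalar_prod_def atLeast0LessThan nat_less_iff)
      then show ?thesis using v(3) True that by (simp add: nat_less_iff)
    qed (simp add: cu h0)
    define y where "y = actL (Zn (- int n)) u"
    have y: "y \<in> plus_space" by (auto simp: plus_space_def y_def crd_Zn u_neg)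
    have uy: "u = actL (Zn (int n)) y" by (simp add: y_def actL_Zn_cancel)
    have "x = 0"
    proof (rule low_part_zero[OF \<theta>(1)])
      show "crd x p = 0" if "int n \<le> p" for p using that by (simp add: cx f_def)
      have "actL \<theta> x = actL \<Gamma> u" by (simp add: \<Gamma>h[symmetric] actL_mult u_def)
      also have "\<dots> = actL (Zn (int n)) (actL \<Gamma> y)" using periodic_actL_Zn[OF \<Gamma>(3), of 1 y] by (simp add: uy)
      finally show "actL \<theta> x = actL (Zn (int n)) (actL \<Gamma> y)" .
      assume 0: "prP (actL \<Gamma> y) = 0"
      have "y = actL (S * \<Gamma> * Pp) y" using y by (simp add: S prP_plus)
      also have "\<dots> = actL (S * Pp * \<Gamma> * Pp) y" by (simp only: S)
      also have "\<dots> = actL S (prP (actL \<Gamma> y))" by (simp only: actL_mult prP_plus[OF y])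
      finally show "actL \<Gamma> y = 0" using 0 by (simp add: actL_zero)
    qed
    then have "crd x (int i) = 0" for i by (simp add: crd_zero)
    then have "v $ i = 0" if "i < n" for i using that by (metis cx f_def nat_int of_nat_0_le_iff of_nat_less_iff)
    then show False using v by (auto intro: eq_vecI)
  qed
  then have "\<exists>Hi. Hi \<in> carrier_mat n n \<and> Hi * H0 = 1\<^sub>m n"
    using det_inverse[OF H0c] by blast
  then obtain Hi where Hi: "Hi \<in> carrier_mat n n" "Hi * H0 = 1\<^sub>m n" by blast
  have HiH0: "(\<Sum>i<n. Hi $$ (a, i) * ent h (int i) (int c)) = (if a = c then 1 else 0)" if "a < n" "c < n" for a c
  proof -
    have "(Hi * H0) $$ (a, c) = (\<Sum>i<n. Hi $$ (a, i) * ent h (int i) (int c))"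
      using that Hi(1) by (simp add: H0_def scalar_prod_def atLeast0LessThan)
    then show ?thesis using Hi(2) that by simp
  qed
  define blk where "blk p = p div int n" for p
  define pos where "pos p = nat (p mod int n)" for p
  have pos: "pos p < n" "blk p * int n + int (pos p) = p" for p
    using n pos_mod_bound[of "int n" p] by (auto simp: pos_def blk_def nat_less_iff)
  define th where "th p q = (\<Sum>i<n. Hi $$ (pos p, i) * ent S (int i) (q - blk p * int n))" for p q
  obtain C r where Sd: "decay C r (ent S)" by (rule decay_ent)
  note d = decayD[OF Sd]
  define L where "L = (\<Sum>a<n. \<Sum>i<n. cmod (Hi $$ (a, i)))"
  have L: "0 \<le> L" "(\<Sum>i<n. cmod (Hi $$ (a, i))) \<le> L" if "a < n" for a
    unfolding L_def using that by (auto intro!: sum_nonneg member_le_sum)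
  have thd: "decay (L * (C / r ^ n)) r th"
    unfolding decay_def
  proof (intro conjI allI)
    show "0 \<le> L * (C / r ^ n)" using d L n by simp
    fix p q
    have S1: "cmod (ent S (int i) (q - blk p * int n)) \<le> C / r ^ n * r ^ nat \<bar>p - q\<bar>" if i: "i < n" for i
    proof -
      have "cmod (ent S (int i) (q - blk p * int n)) \<le> C * r ^ nat \<bar>int i - (q - blk p * int n)\<bar>" by (rule d)
      also have "\<dots> \<le> C * (r ^ nat \<bar>p - q\<bar> / r ^ n)"
      proof (rule mult_left_mono[OF _ d(1)])
        have "nat \<bar>p - q\<bar> \<le> nat \<bar>int i - (q - blk p * int n)\<bar> + n"
          using pos[of p] i by linarith
        then have "r ^ (nat \<bar>int i - (q - blk p * int n)\<bar> + n) \<le> r ^ nat \<bar>p - q\<bar>"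
          using d by (intro power_decreasing) auto
        then show "r ^ nat \<bar>int i - (q - blk p * int n)\<bar> \<le> r ^ nat \<bar>p - q\<bar> / r ^ n"
          using d by (simp add: power_add field_simps)
      qed
      finally show ?thesis by simp
    qed
    have "cmod (th p q) \<le> (\<Sum>i<n. cmod (Hi $$ (pos p, i)) * (C / r ^ n * r ^ nat \<bar>p - q\<bar>))"
      unfolding th_def
    proof (rule sum_norm_le)
      fix i assume "i \<in> {..<n}"
      then show "cmod (Hi $$ (pos p, i) * ent S (int i) (q - blk p * int n))
          \<le> cmod (Hi $$ (pos p, i)) * (C / r ^ n * r ^ nat \<bar>p - q\<bar>)"
        unfolding norm_mult by (intro mult_left_mono[OF S1]) auto
    qed
    also have "\<dots> = (\<Sum>i<n. cmod (Hi $$ (pos p, i))) * (C / r ^ n * r ^ nat \<bar>p - q\<bar>)" by (simp only: sum_distrib_right)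
    also have "\<dots> \<le> L * (C / r ^ n * r ^ nat \<bar>p - q\<bar>)"
      using d pos by (intro mult_right_mono L) auto
    finally show "cmod (th p q) \<le> L * (C / r ^ n) * r ^ nat \<bar>p - q\<bar>" by simp
  qed (use d in auto)
  define \<theta>' where "\<theta>' = Emat th"
  have e\<theta>': "ent \<theta>' = th" by (simp add: \<theta>'_def ent_Emat[OF thd])
  have left: "\<theta>' * \<theta> = 1"
  proof (rule emat_eqI)
    fix p q
    define m where "m = blk p * int n"
    have sm: "(\<lambda>k. ent S (int i) (k - m) * ent \<theta> k q) summable_on UNIV"
      and su: "(\<Sum>\<^sub>\<infinity>k. ent S (int i) (k - m) * ent \<theta> k q) = ent (S * \<theta>) (int i) (q - m)" for i
    proof -
      have bij: "bij (\<lambda>k::int. k - m)" by (rule bij_betw_byWitness[of _ "\<lambda>k. k + m"]) auto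
      have \<theta>m: "ent \<theta> (k - m) (q - m) = ent \<theta> k q" for k
        using periodic_shift[OF \<theta>(2), of "k - m" "blk p" "q - m"] by (simp add: m_def)
      have "(\<lambda>k. ent S (int i) k * ent \<theta> k (q - m)) summable_on UNIV" by (rule ent_mult_summable)
      then show "(\<lambda>k. ent S (int i) (k - m) * ent \<theta> k q) summable_on UNIV"
        using summable_on_reindex_bij_betw[OF bij, of "\<lambda>k. ent S (int i) k * ent \<theta> k (q - m)"] by (simp add: \<theta>m)
      show "(\<Sum>\<^sub>\<infinity>k. ent S (int i) (k - m) * ent \<theta> k q) = ent (S * \<theta>) (int i) (q - m)"
        unfolding ent_mult
        using infsum_reindex_bij_betw[OF bij, of "\<lambda>k. ent S (int i) k * ent \<theta> k (q - m)"] by (simp add: \<theta>m)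
    qed
    have "ent (\<theta>' * \<theta>) p q = (\<Sum>\<^sub>\<infinity>k. \<Sum>i<n. Hi $$ (pos p, i) * (ent S (int i) (k - m) * ent \<theta> k q))"
      unfolding ent_mult e\<theta>' th_def by (simp add: sum_distrib_right m_def mult.assoc)
    also have "\<dots> = (\<Sum>i<n. \<Sum>\<^sub>\<infinity>k. Hi $$ (pos p, i) * (ent S (int i) (k - m) * ent \<theta> k q))"
      by (rule infsum_finite_sum) (auto intro: summable_on_cmult_right sm)
    also have "\<dots> = (\<Sum>i<n. Hi $$ (pos p, i) * ent (S * \<theta>) (int i) (q - m))"
      by (simp add: infsum_cmult_right' su)
    also have "\<dots> = (if p = q then 1 else 0)"
    proof -
      consider "q - m < 0" | "0 \<le> q - m" "q - m < int n" | "int n \<le> q - m" by linarith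
      then show ?thesis
      proof cases
        case 1
        then show ?thesis using pos[of p] by (auto simp: S\<theta>_neg m_def)
      next
        case 2
        then have q: "int (nat (q - m)) = q - m" "nat (q - m) < n" by auto
        have "p = q \<longleftrightarrow> pos p = nat (q - m)" using 2 pos(2)[of p] by (auto simp: m_def)
        then show ?thesis
          using HiH0[OF pos(1)[of p] q(2), unfolded q(1)] by (simp only: S\<theta>_nonneg[OF 2(1)])
      next
        case 3
        have "ent h (int i) (q - m) = 0" if "i < n" for i
          using periodic_shift[OF perh, of "int i - int n" 1 "q - m - int n"] h0[of "int i - int n" "q - m - int n"] that 3 by simp
        moreover have "p ~= q" using 3 pos[of p] by (auto simp: m_def)
        ultimately show ?thesis using 3 by (simp add: S\<theta>_nonneg)
      qed
    qed
    finally show "ent (\<theta>' * \<theta>) p q = ent 1 p q" by (simp add: ent_one)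
  qed
  define Z where "Z = \<theta> * \<theta>' - 1"
  have "Z * \<theta> = 0" by (simp add: Z_def left_diff_distrib mult.assoc left)
  have blk_mono: "blk p \<le> blk q" if "p \<le> q" for p q unfolding blk_def by (rule zdiv_mono1) (use that n in auto)
  have Zlow: "ent Z p q = 0" if "q < blk p * int n" for p q
  proof -
    have prod0: "ent \<theta> p k * th k q = 0" for k
    proof (cases "p \<le> k")
      case True
      have "blk p * int n \<le> blk k * int n" using blk_mono[OF True] by (rule mult_right_mono) simp
      then have neg: "q - blk k * int n < 0" using that by simp
      have "ent S i j = 0" if "j < 0" for i j
        using arg_cong[OF S(2), of "\<lambda>A. ent A i j"] that by (simp add: ent_mult_Pp)
      then show ?thesis using neg by (simp add: th_def)
    qed (use \<theta>(1) in \<open>simp add: upper_def\<close>)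
    have "ent (\<theta> * \<theta>') p q = 0" unfolding ent_mult e\<theta>' prod0 by simp
    moreover have "p ~= q" using that pos[of p] by auto
    ultimately show ?thesis by (simp add: Z_def ent_diff ent_one)
  qed
  have "ent Z p q = 0" for p q
  proof -
    have "\<forall>q. q < blk p * int n + int k --> ent Z p q = 0" for k
    proof (induction k)
      case (Suc k)
      define q where "q = blk p * int n + int k"
      have "ent (Z * \<theta>) p q = (\<Sum>j\<in>{q}. ent Z p j * ent \<theta> j q)"
        unfolding ent_mult
      proof (rule infsum_finite_support)
        fix j assume "j \<notin> {q}"
        then show "ent Z p j * ent \<theta> j q = 0"
          using Suc \<theta>(1) by (cases "j < q") (auto simp: q_def upper_def)
      qed simp
      then have "ent Z p q = 0" using \<theta>(1) \<open>Z * \<theta> = 0\<close> by (simp add: upper_def ent_zero)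
      moreover have "j < q \<or> j = q" if "j < blk p * int n + int (Suc k)" for j using that by (auto simp: q_def)
      ultimately show ?case using Suc by (auto simp: q_def)
    qed (use Zlow in auto)
    from this[of "nat (q - blk p * int n) + 1"] show ?thesis by auto
  qed
  then have "Z = 0" by (intro emat_eqI) (simp add: ent_zero)
  then have "\<theta> * \<theta>' = 1" by (simp add: Z_def)
  then show ?thesis using that left by blast
qed

section \<open>Matrix functions\<close>

lemma mat_mult_entry:
  "A \<in> carrier_mat n n ==> B \<in> carrier_mat n n ==> a < n ==> b < n ==> (A * B) $$ (a, b) = (\<Sum>k<n. A $$ (a, k) * B $$ (k, b))"
  by (auto simp: scalar_prod_def atLeast0LessThan intro!: sum.cong)

lemma mult_mat_vec_entry:
  "A \<in> carrier_mat n n ==> v \<in> carrier_vec n ==> a < n ==> (A *\<^sub>v v) $ a = (\<Sum>k<n. A $$ (a, k) * v $ k)"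
  by (auto simp: scalar_prod_def atLeast0LessThan intro!: sum.cong)

lemma inv_mat_unique:
  fixes A B :: "complex mat"
  assumes A: "A \<in> carrier_mat n n" and B: "B \<in> carrier_mat n n" and AB: "A * B = 1\<^sub>m n"
  shows "inv_mat A = B"
proof -
  have "det A * det B = 1" using det_mult[OF A B] AB by simp
  then have d: "det A ~= 0" by auto
  note i = det_inverse[OF A d]
  have "inv_mat A * (A * B) = (inv_mat A * A) * B" by (rule assoc_mult_mat[OF i(1) A B, symmetric])
  then show ?thesis using i B by (simp add: AB)
qed

text \<open>Measurability matters because Bochner integrals of nonmeasurable functions are 0, so that
  almost everywhere equality alone would not determine Fourier coefficients.\<close>

definition mmat :: "nat => loop => bool" where
  "mmat n M \<longleftrightarrow> (\<forall>z. M z \<in> carrier_mat n n) \<and> (\<forall>a<n. \<forall>b<n. (\<lambda>z. M z $$ (a, b)) \<in> borel_measurable borel)"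

lemma mmatD: "mmat n M ==> M z \<in> carrier_mat n n"
  "mmat n M ==> a < n ==> b < n ==> (\<lambda>z. M z $$ (a, b)) \<in> borel_measurable borel"
  by (auto simp: mmat_def)

lemma mmat_mat: "(!!a b. a < n ==> b < n ==> (\<lambda>z. f z a b) \<in> borel_measurable borel) ==> mmat n (\<lambda>z. mat n n (\<lambda>(a, b). f z a b))"
  by (auto simp: mmat_def)

lemma mmat_mult: assumes "mmat n A" "mmat n B" shows "mmat n (\<lambda>z. A z * B z)"
  unfolding mmat_def
proof (intro conjI allI impI)
  show "A z * B z \<in> carrier_mat n n" for z
    by (rule mult_carrier_mat[OF mmatD(1)[OF assms(1)] mmatD(1)[OF assms(2)]])
  fix a b assume ab: "a < n" "b < n"
  have "(\<lambda>z. (A z * B z) $$ (a, b)) = (\<lambda>z. \<Sum>k<n. A z $$ (a, k) * B z $$ (k, b))"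
    by (rule ext) (rule mat_mult_entry[OF mmatD(1)[OF assms(1)] mmatD(1)[OF assms(2)] ab])
  also have "\<dots> \<in> borel_measurable borel"
    by (intro borel_measurable_sum borel_measurable_times mmatD(2)[OF assms(1)] mmatD(2)[OF assms(2)] ab) auto
  finally show "(\<lambda>z. (A z * B z) $$ (a, b)) \<in> borel_measurable borel" .
qed

lemma mmat_pow: assumes "mmat n A" shows "mmat n (\<lambda>z. A z ^\<^sub>m k)"
proof (induction k)
  case 0
  have "A z ^\<^sub>m 0 = 1\<^sub>m n" for z using mmatD(1)[OF assms, of z] by simp
  then show ?case by (simp add: mmat_def)
next
  case (Suc k)
  then show ?case using mmat_mult[OF Suc assms] by simp
qed

lemma mmat_det: assumes "mmat n A" shows "(\<lambda>z. det (A z)) \<in> borel_measurable borel"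
proof -
  have "(\<lambda>z. det (A z)) = (\<lambda>z. \<Sum>p | p permutes {0..<n}. signof p * (\<Prod>i = 0..<n. A z $$ (i, p i)))"
    by (rule ext) (rule det_def'[OF mmatD(1)[OF assms]])
  also have "\<dots> \<in> borel_measurable borel"
  proof (rule borel_measurable_sum)
    fix p assume "p \<in> {p. p permutes {0..<n}}"
    then have "p i < n" if "i < n" for i using that permutes_in_image[of p "{0..<n}" i] by auto
    then show "(\<lambda>z. signof p * (\<Prod>i = 0..<n. A z $$ (i, p i))) \<in> borel_measurable borel"
      by (intro borel_measurable_times borel_measurable_const borel_measurable_prod mmatD(2)[OF assms]) auto
  qed
  finally show ?thesis .
qed

text \<open>Cramer's rule where the determinant is nonzero; elsewhere \<open>inv_mat\<close> is the constant \<open>the None\<close>.\<close>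

lemma measurable_inv_mat:
  assumes A: "mmat n A" and ab: "a < n" "b < n"
  shows "(\<lambda>z. inv_mat (A z) $$ (a, b)) \<in> borel_measurable borel"
proof -
  note Ac = mmatD(1)[OF A]
  have e: "inv_mat (A z) $$ (a, b) = (if det (A z) = 0 then the None $$ (a, b) else adj_mat (A z) $$ (a, b) / det (A z))" for z
  proof (cases "det (A z) = 0")
    case True
    have "mat_inverse (A z) = None"
    proof (rule ccontr)
      assume "mat_inverse (A z) ~= None"
      then obtain B where "mat_inverse (A z) = Some B" by auto
      from mat_inverse(2)[OF Ac this] have "A z * B = 1\<^sub>m n" "B \<in> carrier_mat n n" by auto
      then show False using det_mult[OF Ac[of z], of B] True by simp
    qed
    then show ?thesis using True by simp
  next
    case False
    define B where "B = (1 / det (A z)) \<cdot>\<^sub>m adj_mat (A z)"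
    note adj = adj_mat[OF Ac[of z]]
    have "A z * B = (1 / det (A z)) \<cdot>\<^sub>m (A z * adj_mat (A z))"
      unfolding B_def by (rule mult_smult_distrib[OF Ac adj(1)])
    also have "\<dots> = 1\<^sub>m n" unfolding adj(2) using False by (intro eq_matI) auto
    finally have "inv_mat (A z) = B" using adj(1) by (intro inv_mat_unique[OF Ac]) (auto simp: B_def)
    then show ?thesis using False ab adj(1) by (simp add: B_def)
  qed
  have "(\<lambda>z. adj_mat (A z) $$ (a, b)) \<in> borel_measurable borel"
  proof -
    have "mmat (n - 1) (\<lambda>z. mat_delete (A z) b a)"
      unfolding mmat_def
    proof (intro conjI allI impI)
      show "mat_delete (A z) b a \<in> carrier_mat (n - 1) (n - 1)" for z
        using Ac[of z] by (rule mat_delete_carrier)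
      fix i j assume ij: "i < n - 1" "j < n - 1"
      have "(\<lambda>z. mat_delete (A z) b a $$ (i, j)) = (\<lambda>z. A z $$ (if i < b then i else Suc i, if j < a then j else Suc j))"
        using ij Ac by (auto simp: mat_delete_def fun_eq_iff carrier_matD[OF Ac])
      also have "\<dots> \<in> borel_measurable borel" by (rule mmatD(2)[OF A]) (use ij in auto)
      finally show "(\<lambda>z. mat_delete (A z) b a $$ (i, j)) \<in> borel_measurable borel" .
    qed
    from mmat_det[OF this] have "(\<lambda>z. (- 1) ^ (b + a) * det (mat_delete (A z) b a)) \<in> borel_measurable borel"
      by (intro borel_measurable_times borel_measurable_const)
    moreover have "(\<lambda>z. adj_mat (A z) $$ (a, b)) = (\<lambda>z. (- 1) ^ (b + a) * det (mat_delete (A z) b a))"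
      using ab by (auto simp: adj_mat_def cofactor_def carrier_matD[OF Ac])
    ultimately show ?thesis by simp
  qed
  then show ?thesis unfolding e using mmat_det[OF A]
    by (intro measurable_If borel_measurable_divide borel_measurable_const) (auto intro: borel_measurable_eq)
qed

lemma measurable_off_zero:
  fixes f g :: "complex => complex"
  assumes "g \<in> borel_measurable borel" "!!z. z ~= 0 ==> f z = g z" shows "f \<in> borel_measurable borel"
proof -
  have "f = (\<lambda>z. if z = 0 then f 0 else g z)" using assms(2) by auto
  also have "\<dots> \<in> borel_measurable borel" using assms(1) by (intro measurable_If) auto
  finally show ?thesis .
qed

section \<open>The roots and the Vandermonde matrix\<close>

lemma measurable_Ln: "Ln \<in> borel_measurable borel"
proof -
  let ?f = "\<lambda>z. if z \<in> \<real>\<^sub>\<le>\<^sub>0 then of_real (ln (- Re z)) + \<i> * of_real pi else indicator (UNIV - \<real>\<^sub>\<le>\<^sub>0) z *\<^sub>R Ln z"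
  have S: "(UNIV - \<real>\<^sub>\<le>\<^sub>0 :: complex set) \<in> sets borel" "(\<real>\<^sub>\<le>\<^sub>0 :: complex set) \<in> sets borel"
    by (auto intro: borel_closed)
  have "?f \<in> borel_measurable borel"
  proof (rule measurable_If_set)
    show "(\<lambda>z. indicator (UNIV - \<real>\<^sub>\<le>\<^sub>0) z *\<^sub>R Ln z) \<in> borel_measurable borel"
      by (rule borel_measurable_continuous_on_indicator[OF S(1)]) (auto intro!: continuous_on_Ln)
    show "(\<lambda>z. complex_of_real (ln (- Re z)) + \<i> * complex_of_real pi) \<in> borel_measurable borel" by measurable
    show "\<real>\<^sub>\<le>\<^sub>0 \<inter> space borel \<in> sets (borel :: complex measure)" using S(2) by simp
  qed
  moreover have "Ln z = ?f z" if "z ~= 0" for z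
  proof (cases "z \<in> \<real>\<^sub>\<le>\<^sub>0")
    case True
    then have z: "z = - of_real (- Re z)" "0 < - Re z" using that by (auto simp: complex_nonpos_Reals_iff complex_eq_iff)
    define w where "w = complex_of_real (- Re z)"
    have z0: "Im z = 0" "Re z < 0" using True that by (auto simp: complex_nonpos_Reals_iff complex_eq_iff)
    have w: "w ~= 0" "Im w = 0" "0 < Re w" "z = - w" using z0 by (auto simp: w_def complex_eq_iff)
    have "Ln (- w) = Ln w + \<i> * of_real pi" using Ln_minus[OF w(1)] w by simp
    moreover have "Ln w = of_real (ln (- Re z))" unfolding w_def by (rule Ln_of_real[OF z(2)])
    ultimately show ?thesis using True w(4) by simp
  qed simp
  ultimately show ?thesis by (rule measurable_off_zero)
qed

lemma measurable_zeta: "(\<lambda>z. zeta n z i) \<in> borel_measurable borel"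
proof (rule measurable_off_zero)
  have "(\<lambda>z. 1 / of_nat n * Ln z) \<in> borel_measurable borel"
    by (intro borel_measurable_times borel_measurable_const measurable_Ln)
  then show "(\<lambda>z. exp (1 / of_nat n * Ln z) * cis (2 * pi * real i / real n)) \<in> borel_measurable borel"
    by (intro borel_measurable_times borel_measurable_const) (rule measurable_compose[OF _ borel_measurable_exp])
qed (simp add: zeta_def powr_def)

lemma inj_zeta: assumes n: "0 < n" and z: "z ~= 0" shows "inj_on (zeta n z) {..<n}"
proof (rule inj_onI)
  fix i j assume ij: "i \<in> {..<n}" "j \<in> {..<n}" "zeta n z i = zeta n z j"
  then have "cis (2 * pi * real i / real n) = cis (2 * pi * real j / real n)" using z by (simp add: zeta_def)
  moreover have "inj_on (\<lambda>k. cis (2 * pi * real k / real n)) {..<n}"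
    using Complex.bij_betw_roots_unity[OF n] by (simp add: bij_betw_def)
  ultimately show "i = j" using ij by (auto dest: inj_onD)
qed

text \<open>A kernel vector would be a polynomial of degree below \<open>n\<close> with \<open>n\<close> distinct roots.\<close>

lemma det_V_mat: assumes n: "0 < n" and z: "z ~= 0" shows "det (V_mat n z) ~= 0"
proof
  have V: "V_mat n z \<in> carrier_mat n n" by (simp add: V_mat_def)
  assume "det (V_mat n z) = 0"
  then obtain v where v: "v \<in> carrier_vec n" "v ~= 0\<^sub>v n" "V_mat n z *\<^sub>v v = 0\<^sub>v n"
    using det_0_iff_vec_prod_zero[OF V] by blast
  define p where "p = (\<Sum>k<n. monom (v $ k) k)"
  have coeff: "coeff p k = (if k < n then v $ k else 0)" for k by (simp add: p_def coeff_sum coeff_monom)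
  have root: "poly p (zeta n z i) = 0" if "i < n" for i
  proof -
    have "(V_mat n z *\<^sub>v v) $ i = (\<Sum>k<n. zeta n z i ^ k * v $ k)"
      using that by (subst mult_mat_vec_entry[OF V v(1)]) (auto simp: V_mat_def)
    then show ?thesis using v(3) that by (simp add: p_def poly_sum poly_monom mult.commute)
  qed
  have "p = 0"
  proof (rule ccontr)
    assume p: "p ~= 0"
    have "n = card (zeta n z ` {..<n})" using inj_zeta[OF n z] by (simp add: card_image)
    also have "\<dots> \<le> card {x. poly p x = 0}" using root by (intro card_mono poly_roots_finite p) auto
    also have "\<dots> \<le> degree p" by (rule card_poly_roots_bound[OF p])
    also have "\<dots> < n" unfolding p_def using n by (intro degree_sum_less) (auto intro: le_less_trans[OF degree_monom_le])
    finally show False by simp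
  qed
  then have "v $ k = 0" if "k < n" for k using coeff[of k] that by simp
  then show False using v by (auto intro: eq_vecI)
qed

section \<open>Left eigenvectors\<close>

text \<open>\<open>(1, \<zeta>, ..., \<zeta>\<^sup>n\<^sup>-\<^sup>1)\<close> is a left eigenvector of \<open>A\<close> with eigenvalue \<open>c\<close>.\<close>

definition eigrow :: "nat => complex => complex => complex mat => bool" where
  "eigrow n \<zeta> c A \<longleftrightarrow> A \<in> carrier_mat n n \<and> (\<forall>j<n. (\<Sum>k<n. \<zeta> ^ k * A $$ (k, j)) = c * \<zeta> ^ j)"

lemma eigrow_Lam: assumes "0 < n" shows "eigrow n \<zeta> \<zeta> (Lam n (\<zeta> ^ n))"
  unfolding eigrow_def
proof (intro conjI allI impI)
  fix j assume j: "j < n"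
  have "(\<Sum>k<n. \<zeta> ^ k * Lam n (\<zeta> ^ n) $$ (k, j)) =
      (\<Sum>k<n. (if k = j + 1 then \<zeta> ^ k else 0) + (if k = 0 then (if j = n - 1 then \<zeta> ^ n else 0) else 0))"
    by (rule sum.cong) (use j in \<open>auto simp: Lam_def\<close>)
  also have "\<dots> = (if j + 1 < n then \<zeta> ^ (j + 1) else 0) + (if j = n - 1 then \<zeta> ^ n else 0)"
    using assms by (simp add: sum.distrib)
  also have "\<dots> = \<zeta> * \<zeta> ^ j"
  proof (cases "j = n - 1")
    case True
    then have "n = Suc j" using j by simp
    then show ?thesis by simp
  qed (use j in auto)
  finally show "(\<Sum>k<n. \<zeta> ^ k * Lam n (\<zeta> ^ n) $$ (k, j)) = \<zeta> * \<zeta> ^ j" .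
qed (simp add: Lam_def)

lemma eigrow_mult: assumes A: "eigrow n \<zeta> c A" and B: "eigrow n \<zeta> d B" shows "eigrow n \<zeta> (c * d) (A * B)"
proof -
  have Ac: "A \<in> carrier_mat n n" and Bc: "B \<in> carrier_mat n n" using A B by (auto simp: eigrow_def)
  have "(\<Sum>k<n. \<zeta> ^ k * (A * B) $$ (k, j)) = c * d * \<zeta> ^ j" if j: "j < n" for j
  proof -
    have "(\<Sum>k<n. \<zeta> ^ k * (A * B) $$ (k, j)) = (\<Sum>k<n. \<Sum>l<n. \<zeta> ^ k * (A $$ (k, l) * B $$ (l, j)))"
      using j by (intro sum.cong refl) (simp add: mat_mult_entry[OF Ac Bc] sum_distrib_left)
    also have "\<dots> = (\<Sum>l<n. (\<Sum>k<n. \<zeta> ^ k * A $$ (k, l)) * B $$ (l, j))"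
      by (subst sum.swap) (simp add: sum_distrib_right mult.assoc)
    also have "\<dots> = (\<Sum>l<n. c * (\<zeta> ^ l * B $$ (l, j)))"
      by (intro sum.cong refl) (use A in \<open>simp add: eigrow_def\<close>)
    also have "\<dots> = c * d * \<zeta> ^ j" using B j by (simp add: sum_distrib_left[symmetric] eigrow_def)
    finally show ?thesis .
  qed
  then show ?thesis using Ac Bc by (auto simp: eigrow_def)
qed

lemma eigrow_pow: assumes "eigrow n \<zeta> c A" shows "eigrow n \<zeta> (c ^ i) (A ^\<^sub>m i)"
proof (induction i)
  case 0
  have "(\<Sum>k<n. \<zeta> ^ k * 1\<^sub>m n $$ (k, j)) = \<zeta> ^ j" if "j < n" for j
  proof -
    have "(\<Sum>k<n. \<zeta> ^ k * 1\<^sub>m n $$ (k, j)) = (\<Sum>k<n. if k = j then \<zeta> ^ k else 0)"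
      by (rule sum.cong) (use that in auto)
    then show ?thesis using that by simp
  qed
  then show ?case using assms by (auto simp: eigrow_def)
next
  case (Suc i)
  then show ?case using eigrow_mult[OF Suc assms] by (simp add: mult.commute)
qed

lemma eigrow_xi_mat: assumes "eigrow n \<zeta> c A" shows "eigrow n \<zeta> (xi t c) (xi_mat n t A)"
proof -
  have "(\<Sum>k<n. \<zeta> ^ k * xi_mat n t A $$ (k, j)) = xi t c * \<zeta> ^ j" if j: "j < n" for j
  proof -
    have "(\<Sum>k<n. \<zeta> ^ k * xi_mat n t A $$ (k, j)) = (\<Sum>k<n. \<Sum>i | t i ~= 0. t i * (\<zeta> ^ k * (A ^\<^sub>m i) $$ (k, j)))"
      using j by (intro sum.cong refl) (simp add: xi_mat_def sum_distrib_left mult_ac)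
    also have "\<dots> = (\<Sum>i | t i ~= 0. t i * (\<Sum>k<n. \<zeta> ^ k * (A ^\<^sub>m i) $$ (k, j)))"
      by (subst sum.swap) (simp add: sum_distrib_left)
    also have "\<dots> = (\<Sum>i | t i ~= 0. t i * c ^ i * \<zeta> ^ j)"
      by (intro sum.cong refl) (use eigrow_pow[OF assms] j in \<open>simp add: eigrow_def\<close>)
    finally show ?thesis by (simp add: xi_def sum_distrib_right)
  qed
  then show ?thesis by (auto simp: eigrow_def xi_mat_def)
qed

lemma mat_pow_entry_le:
  fixes A :: "complex mat"
  assumes A: "A \<in> carrier_mat n n" and B: "!!a b. a < n ==> b < n ==> cmod (A $$ (a, b)) \<le> B" and "0 \<le> B"
  shows "a < n ==> b < n ==> cmod ((A ^\<^sub>m i) $$ (a, b)) \<le> (real n * B) ^ i"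
proof (induction i arbitrary: b)
  case 0 then show ?case using A by simp
next
  case (Suc i)
  have "cmod ((A ^\<^sub>m Suc i) $$ (a, b)) = cmod (\<Sum>k<n. (A ^\<^sub>m i) $$ (a, k) * A $$ (k, b))"
    using mat_mult_entry[OF pow_carrier_mat[OF A] A Suc.prems] by simp
  also have "\<dots> \<le> (\<Sum>k<n. (real n * B) ^ i * B)"
    by (rule sum_norm_le) (use Suc B assms(3) in \<open>auto simp: norm_mult intro!: mult_mono\<close>)
  finally show ?case by (simp add: mult_ac)
qed

lemma eigrow_exp_mat: assumes A: "eigrow n \<zeta> c A" shows "eigrow n \<zeta> (exp c) (exp_mat n A)"
proof -
  have Ac: "A \<in> carrier_mat n n" using A by (simp add: eigrow_def)
  define B where "B = (\<Sum>a<n. \<Sum>b<n. cmod (A $$ (a, b)))"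
  have B: "cmod (A $$ (a, b)) \<le> B" if "a < n" "b < n" for a b
  proof -
    have "cmod (A $$ (a, b)) \<le> (\<Sum>b<n. cmod (A $$ (a, b)))" using that by (intro member_le_sum) auto
    also have "\<dots> \<le> B" unfolding B_def using that by (intro member_le_sum[of a "{..<n}" "\<lambda>a. \<Sum>b<n. cmod (A $$ (a, b))"]) (auto intro: sum_nonneg)
    finally show ?thesis .
  qed
  have B0: "0 \<le> B" by (simp add: B_def sum_nonneg)
  have sm: "summable (\<lambda>i. (A ^\<^sub>m i) $$ (a, b) / fact i)" if "a < n" "b < n" for a b
  proof (rule summable_comparison_test)
    show "summable (\<lambda>i. (real n * B) ^ i /\<^sub>R fact i)" by (rule summable_exp_generic)
    have "norm ((A ^\<^sub>m i) $$ (a, b) / fact i) \<le> (real n * B) ^ i /\<^sub>R fact i" for i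
    proof -
      have f: "0 \<le> (fact i :: real)" by (rule fact_ge_zero)
      have "norm ((A ^\<^sub>m i) $$ (a, b) / fact i) = cmod ((A ^\<^sub>m i) $$ (a, b)) / fact i" by (simp add: norm_divide)
      also have "\<dots> \<le> (real n * B) ^ i / fact i" 
        by (rule divide_right_mono[OF mat_pow_entry_le[OF Ac B B0 that] f])
      also have "\<dots> = (real n * B) ^ i /\<^sub>R fact i" by (simp add: divide_inverse mult.commute)
      finally show ?thesis .
    qed
    then show "\<exists>N. \<forall>i\<ge>N. norm ((A ^\<^sub>m i) $$ (a, b) / fact i) \<le> (real n * B) ^ i /\<^sub>R fact i" by blast
  qed
  have "(\<Sum>k<n. \<zeta> ^ k * exp_mat n A $$ (k, j)) = exp c * \<zeta> ^ j" if j: "j < n" for j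
  proof -
    have "(\<Sum>k<n. \<zeta> ^ k * exp_mat n A $$ (k, j)) = (\<Sum>k<n. \<Sum>i. \<zeta> ^ k * ((A ^\<^sub>m i) $$ (k, j) / fact i))"
    proof (rule sum.cong[OF refl])
      fix k assume "k \<in> {..<n}"
      then have k: "k < n" by simp
      have "\<zeta> ^ k * exp_mat n A $$ (k, j) = \<zeta> ^ k * (\<Sum>i. (A ^\<^sub>m i) $$ (k, j) / fact i)"
        using j k by (simp add: exp_mat_def)
      also have "\<dots> = (\<Sum>i. \<zeta> ^ k * ((A ^\<^sub>m i) $$ (k, j) / fact i))" by (rule suminf_mult[OF sm[OF k j], symmetric])
      finally show "\<zeta> ^ k * exp_mat n A $$ (k, j) = (\<Sum>i. \<zeta> ^ k * ((A ^\<^sub>m i) $$ (k, j) / fact i))" .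
    qed
    also have "\<dots> = (\<Sum>i. \<Sum>k<n. \<zeta> ^ k * ((A ^\<^sub>m i) $$ (k, j) / fact i))"
      by (rule suminf_sum[symmetric]) (rule summable_mult[OF sm], simp_all add: j)
    also have "\<dots> = (\<Sum>i. c ^ i /\<^sub>R fact i * \<zeta> ^ j)"
    proof (rule suminf_cong)
      fix i
      have "(\<Sum>k<n. \<zeta> ^ k * ((A ^\<^sub>m i) $$ (k, j) / fact i)) = (\<Sum>k<n. \<zeta> ^ k * (A ^\<^sub>m i) $$ (k, j)) / fact i"
        by (simp add: sum_divide_distrib)
      also have "\<dots> = c ^ i * \<zeta> ^ j / fact i" using eigrow_pow[OF A] j by (simp add: eigrow_def)
      finally show "(\<Sum>k<n. \<zeta> ^ k * ((A ^\<^sub>m i) $$ (k, j) / fact i)) = c ^ i /\<^sub>R fact i * \<zeta> ^ j"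
        by (simp add: scaleR_conv_of_real divide_inverse)
    qed
    also have "\<dots> = exp c * \<zeta> ^ j" unfolding exp_def by (rule suminf_mult2[symmetric]) (rule summable_exp_generic)
    finally show ?thesis .
  qed
  then show ?thesis by (auto simp: eigrow_def exp_mat_def)
qed

abbreviation Exi_mat :: "nat => (nat => complex) => loop" where
  "Exi_mat n t z \<equiv> exp_mat n (xi_mat n t (Lam n z))"

text \<open>\<open>Xi n f \<zeta>\<close> pairs \<open>f(\<zeta>\<^sup>n)\<close> with a left eigenvector of \<open>\<Lambda>(\<zeta>\<^sup>n)\<close>.\<close>

lemma Xi_exp_mat:
  assumes n: "0 < n" and f: "!!z. f z \<in> carrier_vec n"
  shows "Xi n (\<lambda>z. Exi_mat n t z *\<^sub>v f z) \<zeta> = exp (xi t \<zeta>) * Xi n f \<zeta>"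
proof -
  have e: "eigrow n \<zeta> (exp (xi t \<zeta>)) (Exi_mat n t (\<zeta> ^ n))"
    by (intro eigrow_exp_mat eigrow_xi_mat eigrow_Lam n)
  then have c: "Exi_mat n t (\<zeta> ^ n) \<in> carrier_mat n n" by (simp add: eigrow_def)
  have "Xi n (\<lambda>z. Exi_mat n t z *\<^sub>v f z) \<zeta> = (\<Sum>k<n. \<Sum>l<n. \<zeta> ^ k * (Exi_mat n t (\<zeta> ^ n) $$ (k, l) * f (\<zeta> ^ n) $ l))"
    unfolding Xi_def by (intro sum.cong refl) (simp add: mult_mat_vec_entry[OF c f] sum_distrib_left)
  also have "\<dots> = (\<Sum>l<n. (\<Sum>k<n. \<zeta> ^ k * Exi_mat n t (\<zeta> ^ n) $$ (k, l)) * f (\<zeta> ^ n) $ l)"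
    by (subst sum.swap) (simp add: sum_distrib_right mult.assoc)
  also have "\<dots> = (\<Sum>l<n. exp (xi t \<zeta>) * (\<zeta> ^ l * f (\<zeta> ^ n) $ l))"
    by (intro sum.cong refl) (use e in \<open>simp add: eigrow_def\<close>)
  finally show ?thesis by (simp add: Xi_def sum_distrib_left)
qed

lemma mmat_Exi_mat: "mmat n (Exi_mat n t)"
proof -
  have L: "mmat n (Lam n)" unfolding Lam_def[abs_def] by (rule mmat_mat) auto
  have X: "mmat n (\<lambda>z. xi_mat n t (Lam n z))"
    unfolding xi_mat_def
    by (rule mmat_mat) (intro borel_measurable_sum borel_measurable_times borel_measurable_const mmatD(2)[OF mmat_pow[OF L]])
  show ?thesis
    unfolding exp_mat_def
    by (rule mmat_mat) (intro borel_measurable_suminf borel_measurable_divide borel_measurable_const mmatD(2)[OF mmat_pow[OF X]])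
qed

section \<open>Fourier coefficients of functions holomorphic near the circle\<close>

text \<open>Move the circle of integration outwards for positive and inwards for negative indices.\<close>

lemma expdec_holomorphic:
  assumes D: "open D" "sphere 0 1 \<subseteq> D" and g: "g holomorphic_on D"
    and m: "m \<in> borel_measurable borel" "ae_eq m g"
  shows "expdec (fourier m)"
proof -
  obtain \<epsilon> where \<epsilon>: "\<epsilon> > 0" "(\<Union>x\<in>sphere (0::complex) 1. ball x \<epsilon>) \<subseteq> D"
    using compact_subset_open_imp_ball_epsilon_subset[OF compact_sphere D(1) D(2)] by blast
  define e where "e = min (\<epsilon> / 2) (1 / 2)"
  have e: "0 < e" "e < \<epsilon>" "e < 1" using \<epsilon>(1) by (auto simp: e_def)
  define K where "K = {z::complex. 1 - e \<le> cmod z \<and> cmod z \<le> 1 + e}"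
  have KU: "z \<in> D" "z ~= 0" if "z \<in> K" for z
  proof -
    show z: "z ~= 0" using that e by (auto simp: K_def)
    have "z - sgn z = (cmod z - 1) *\<^sub>R sgn z" 
    proof -
      have "cmod z *\<^sub>R sgn z = z" using z by (simp add: sgn_div_norm)
      then show ?thesis by (simp add: scaleR_diff_left)
    qed
    then have "dist (sgn z) z = \<bar>cmod z - 1\<bar>" using z by (simp add: dist_norm norm_minus_commute norm_sgn)
    also have "\<dots> < \<epsilon>" using that e by (auto simp: K_def)
    finally have "z \<in> ball (sgn z) \<epsilon>" by simp
    moreover have "sgn z \<in> sphere 0 1" using z by (simp add: norm_sgn)
    ultimately show "z \<in> D" using \<epsilon>(2) by blast
  qed
  have "compact K"
  proof -
    have "K = cball 0 (1 + e) \<inter> (cmod -` {1 - e..})" by (auto simp: K_def)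
    moreover have "closed (cmod -` {1 - e..} :: complex set)" by (intro continuous_closed_vimage continuous_norm) auto
    ultimately show ?thesis by (simp add: compact_Int_closed)
  qed
  moreover have "continuous_on K g" using g KU by (meson holomorphic_on_imp_continuous_on continuous_on_subset subsetI)
  ultimately obtain B0 where "!!z. z \<in> K ==> cmod (g z) \<le> B0"
    by (metis compact_continuous_image compact_imp_bounded bounded_iff imageI)
  then obtain B where B: "0 \<le> B" "!!z. z \<in> K ==> cmod (g z) \<le> B" using that[of "max 0 B0"] by force
  have main: "cmod (fourier m k) \<le> B * \<rho> powi (- k)" if \<rho>: "1 - e \<le> \<rho>" "\<rho> \<le> 1 + e" for k \<rho>
  proof -
    have \<rho>0: "0 < \<rho>" using \<rho> e by simp
    define h where "h z = g z * z powi (- k - 1)" for z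
    have hol: "h holomorphic_on D - {0}"
      unfolding h_def by (intro holomorphic_intros holomorphic_on_subset[OF g]) auto
    have op: "open (D - {0})" using D(1) by auto
    have hom: "homotopic_loops (D - {0}) (circlepath 0 1) (circlepath 0 \<rho>)"
    proof (rule homotopic_loops_linear)
      fix t :: real
      define w where "w = exp (2 * of_real pi * \<i> * of_real t)"
      have w: "cmod w = 1" by (simp add: w_def)
      show "closed_segment (circlepath 0 1 t) (circlepath 0 \<rho> t) \<subseteq> D - {0}"
      proof
        fix x assume "x \<in> closed_segment (circlepath 0 1 t) (circlepath 0 \<rho> t)"
        then obtain u where u: "0 \<le> u" "u \<le> 1" "x = (1 - u) *\<^sub>R w + u *\<^sub>R (of_real \<rho> * w)"
          by (auto simp: closed_segment_def circlepath w_def)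
        then have x: "x = of_real (1 - u + u * \<rho>) * w" by (simp add: scaleR_conv_of_real algebra_simps)
        have "(1 - u) * (1 - e) + u * (1 - e) \<le> (1 - u) * 1 + u * \<rho>" "(1 - u) * 1 + u * \<rho> \<le> (1 - u) * (1 + e) + u * (1 + e)"
          using u \<rho> e by (intro add_mono mult_left_mono; simp)+
        then have b: "1 - e \<le> 1 - u + u * \<rho>" "1 - u + u * \<rho> \<le> 1 + e" by (simp_all add: algebra_simps)
        then have "cmod x = 1 - u + u * \<rho>" using e unfolding x by (simp only: norm_mult norm_of_real w) simp
        then have "x \<in> K" using b by (simp add: K_def)
        then show "x \<in> D - {0}" using KU by simp
      qed
    qed auto
    have eq: "contour_integral (circlepath 0 1) h = contour_integral (circlepath 0 \<rho>) h"
      by (rule Cauchy_theorem_homotopic_loops[OF hom op hol]) auto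
    have int: "(h has_contour_integral contour_integral (circlepath 0 \<rho>') h) (circlepath 0 \<rho>')" if "1 - e \<le> \<rho>'" "\<rho>' \<le> 1 + e" for \<rho>'
    proof (rule has_contour_integral_integral[OF contour_integrable_holomorphic_simple[OF hol op]])
      show "path_image (circlepath 0 \<rho>') \<subseteq> D - {0}"
      proof
        fix x assume "x \<in> path_image (circlepath 0 \<rho>')"
        then have "cmod x = \<rho>'" using that e by (simp add: path_image_circlepath)
        then have "x \<in> K" using that by (simp add: K_def)
        then show "x \<in> D - {0}" using KU by simp
      qed
    qed auto
    have "cmod (contour_integral (circlepath 0 \<rho>) h) \<le> (B * \<rho> powi (- k - 1)) * (2 * pi * \<rho>)"
    proof (rule has_contour_integral_bound_circlepath[OF int[OF \<rho>]])
      show "0 \<le> B * \<rho> powi (- k - 1)" using B \<rho>0 by simp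
      fix x :: complex assume "cmod (x - 0) = \<rho>"
      then show "cmod (h x) \<le> B * \<rho> powi (- k - 1)"
        using B(2)[of x] \<rho> \<rho>0 by (auto simp: h_def norm_mult norm_power_int K_def intro!: mult_right_mono)
    qed (use \<rho>0 in simp)
    also have "\<dots> = 2 * pi * (B * \<rho> powi (- k))"
      using \<rho>0 power_int_add_1'[of \<rho> "- k - 1"] by (simp add: mult_ac)
    finally have bound: "cmod (contour_integral (circlepath 0 1) h) \<le> 2 * pi * (B * \<rho> powi (- k))" unfolding eq .
    define m' where "m' z = indicator (sphere 0 1) z *\<^sub>R g z" for z
    (* The integrand of the Fourier coefficient in the angle. *)
    define \<phi> where "\<phi> x = cis x powi (- k) * g (cis x)" for x
    have cg: "continuous_on (sphere 0 1) g"
      using g D(2) by (meson holomorphic_on_imp_continuous_on continuous_on_subset)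
    have m': "m' \<in> borel_measurable borel"
      unfolding m'_def by (rule borel_measurable_continuous_on_indicator[OF _ cg]) (simp add: borel_closed)
    have "m \<approx> m'" using m(2) AE_circle_norm unfolding ae_eq_def by eventually_elim (simp add: m'_def)
    then have "fourier m k = fourier m' k" by (rule fourier_cong[OF _ m(1) m'])
    also have "\<dots> = (LINT x|lborel. indicator {0..2 * pi} x *\<^sub>R (cis x powi (- k) * m' (cis x))) / of_real (2 * pi)"
      unfolding fourier_def
      by (rule integral_circle) (intro borel_measurable_times m', use bmf_powi[of "- k"] in \<open>simp add: bmf_def\<close>)
    also have "(\<lambda>x. cis x powi (- k) * m' (cis x)) = \<phi>" by (rule ext) (simp add: \<phi>_def m'_def)
    finally have f: "fourier m k = (LINT x:{0..2 * pi}|lborel. \<phi> x) / of_real (2 * pi)"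
      by (simp add: set_lebesgue_integral_def)
    have c\<phi>: "continuous_on {0..2 * pi} \<phi>"
    proof -
      have "continuous_on UNIV (\<lambda>x. g (cis x))"
        by (rule continuous_on_compose2[OF cg]) (auto intro: continuous_intros)
      then show ?thesis unfolding \<phi>_def
        by (intro continuous_on_mult continuous_on_power_int) (auto intro: continuous_intros continuous_on_subset)
    qed
    have L: "(LINT x:{0..2 * pi}|lborel. \<phi> x) = integral {0..2 * pi} \<phi>"
      by (rule set_borel_integral_eq_integral(2)[OF borel_integrable_atLeastAtMost'[OF c\<phi>]])
    have "((\<lambda>t. h (0 + of_real 1 * cis t) * of_real 1 * \<i> * cis t) has_integral contour_integral (circlepath 0 1) h) {0..2 * pi}"
      using int[of 1] e by (subst has_contour_integral_part_circlepath_iff[symmetric]) (auto simp: circlepath_def)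
    moreover have "(\<lambda>t. h (0 + of_real 1 * cis t) * of_real 1 * \<i> * cis t) = (\<lambda>t. \<i> * \<phi> t)"
    proof
      fix t
      have "cis t powi (- k) = cis t powi (- k - 1) * cis t" using power_int_add_1[of "cis t" "- k - 1"] by simp
      then show "h (0 + of_real 1 * cis t) * of_real 1 * \<i> * cis t = \<i> * \<phi> t" by (simp add: h_def \<phi>_def)
    qed
    moreover have "((\<lambda>t. \<i> * \<phi> t) has_integral \<i> * integral {0..2 * pi} \<phi>) {0..2 * pi}"
      by (intro has_integral_mult_right integrable_integral integrable_continuous_interval c\<phi>)
    ultimately have "contour_integral (circlepath 0 1) h = \<i> * integral {0..2 * pi} \<phi>"
      by (metis has_integral_unique)
    then have "cmod (fourier m k) = cmod (contour_integral (circlepath 0 1) h) / (2 * pi)"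
      by (simp add: f L norm_mult norm_divide)
    also have "\<dots> \<le> B * \<rho> powi (- k)" using bound by (simp add: field_simps)
    finally show ?thesis .
  qed
  define r where "r = max (1 - e) (1 / (1 + e))"
  have r: "0 < r" "r < 1" "1 - e \<le> r" "1 / (1 + e) \<le> r" using e by (auto simp: r_def)
  have "cmod (fourier m k) \<le> B * r ^ nat \<bar>k\<bar>" for k
  proof (cases "0 \<le> k")
    case True
    have "cmod (fourier m k) \<le> B * (1 + e) powi (- k)" by (rule main) (use e in auto)
    also have "(1 + e) powi (- k) = (1 / (1 + e)) ^ nat \<bar>k\<bar>"
      using True by (simp add: power_int_def power_one_over inverse_eq_divide)
    also have "B * \<dots> \<le> B * r ^ nat \<bar>k\<bar>" using e r B by (intro mult_left_mono power_mono) auto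
    finally show ?thesis .
  next
    case False
    have "cmod (fourier m k) \<le> B * (1 - e) powi (- k)" by (rule main) (use e in auto)
    also have "(1 - e) powi (- k) = (1 - e) ^ nat \<bar>k\<bar>" using False by (simp add: power_int_def)
    also have "B * \<dots> \<le> B * r ^ nat \<bar>k\<bar>" using e r B by (intro mult_left_mono power_mono) auto
    finally show ?thesis .
  qed
  then show ?thesis unfolding expdec_def using B r by blast
qed

section \<open>Multiplication by an entire function\<close>

text \<open>The Taylor coefficients at 0 are bounded by a multiple of \<open>2\<^sup>-\<^sup>i\<close>, as the series converges at 2.\<close>

lemma entire_toep:
  assumes f: "f holomorphic_on UNIV" and f0: "f 0 = 1"
  obtains a where "expdec a" "!!k. k < 0 ==> a k = 0" "a 0 = 1" "!!x. Mul f x = actL (toep a) x"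
proof -
  define c where "c i = (deriv ^^ i) f 0 / fact i" for i
  have ser: "(\<lambda>i. c i * z ^ i) sums f z" for z
    using holomorphic_power_series[of f 0 "cmod z + 1" z] holomorphic_on_subset[OF f] by (simp add: c_def)
  define a where "a k = (if k < 0 then 0 else c (nat k))" for k :: int
  have "summable (\<lambda>i. c i * 2 ^ i)" using ser[of 2] by (rule sums_summable)
  then have "Bseq (\<lambda>i. c i * 2 ^ i)" by (intro convergent_imp_Bseq) (use summable_LIMSEQ_zero convergent_def in blast)
  then obtain C where C: "!!i. cmod (c i * 2 ^ i) \<le> C" "0 < C" by (auto simp: Bseq_def)
  have cb: "cmod (c i) \<le> C * (1/2) ^ i" for i using C(1)[of i] by (simp add: norm_mult norm_power field_simps power_one_over)
  have ed: "expdec a" unfolding expdec_def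
    by (rule exI[of _ C], rule exI[of _ "1/2"]) (use C(2) cb in \<open>auto simp: a_def\<close>)
  have "c 0 = 1" using ser[of 0] f0 sums_unique2[OF ser[of 0], of "c 0"] powser_sums_zero[of c] by simp
  then have a0: "a 0 = 1" by (simp add: a_def)
  have w: "wser a z = f z" if z: "cmod z = 1" for z
  proof -
    have s: "(\<lambda>k. a k * z powi k) summable_on UNIV"
    proof (rule abs_summable_summable)
      have e: "norm (a k * z powi k) = norm (a k)" for k by (simp add: norm_mult norm_power_int z)
      show "(\<lambda>k. norm (a k * z powi k)) summable_on UNIV" unfolding e by (rule expdec_summable[OF ed])
    qed
    have "(\<lambda>k. a (int k) * z powi int k) sums (\<Sum>\<^sub>\<infinity>k. a k * z powi k)"
      by (rule infsum_int_nat[OF _ s]) (simp add: a_def)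
    then have "(\<lambda>k. c k * z ^ k) sums wser a z" using z by (simp add: wser_def a_def)
    then show ?thesis using sums_unique2 ser[of z] by metis
  qed
  have cf: "bmf f" by (rule bmf_continuous) (rule holomorphic_on_imp_continuous_on[OF f])
  have "Mul f x = actL (toep a) x" for x
    unfolding Mul_wser_eq[OF ed, symmetric]
    by (rule Mul_cong[OF cf bmf_wser[OF expdec_summable[OF ed]]]) (simp add: w)
  then show ?thesis using that[of a] ed a0 by (auto simp: a_def)
qed

abbreviation bk :: "nat => int => int" where "bk n p \<equiv> p div int n"
abbreviation ps :: "nat => int => nat" where "ps n p \<equiv> nat (p mod int n)"

section \<open>Sums over blocks\<close>

lemma infsum_blocks:
  fixes f :: "int => complex"
  assumes n: "0 < n" and f: "f summable_on UNIV"
  shows "(\<lambda>k. f (k * int n + int a)) summable_on UNIV"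
    "infsum f UNIV = (\<Sum>a<n. \<Sum>\<^sub>\<infinity>k. f (k * int n + int a))"
proof -
  have s: "(\<lambda>k. f (k * int n + int a)) summable_on UNIV" "(\<Sum>\<^sub>\<infinity>k. f (k * int n + int a)) = infsum f (range (\<lambda>k. k * int n + int a))" for a
  proof -
    have "f summable_on range (\<lambda>k. k * int n + int a)" by (rule summable_on_subset_banach[OF f]) auto
    then show "(\<lambda>k. f (k * int n + int a)) summable_on UNIV"
      by (subst (asm) summable_on_reindex[OF inj_block[OF n]]) (simp add: o_def)
    show "(\<Sum>\<^sub>\<infinity>k. f (k * int n + int a)) = infsum f (range (\<lambda>k. k * int n + int a))"
      by (subst infsum_reindex[OF inj_block[OF n]]) (simp add: o_def)
  qed
  then show "(\<lambda>k. f (k * int n + int a)) summable_on UNIV" by blast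
  have r: "p \<in> range (\<lambda>k. k * int n + int a) \<longleftrightarrow> ps n p = a" if "a < n" for a p
  proof
    assume "p \<in> range (\<lambda>k. k * int n + int a)"
    then obtain k where "p = k * int n + int a" by blast
    then show "ps n p = a" using pos_combine[OF n that, of k] by simp
  next
    assume "ps n p = a"
    then have "p = bk n p * int n + int a" using blk_pos[OF n, of p] by simp
    then show "p \<in> range (\<lambda>k. k * int n + int a)" by (rule image_eqI) simp
  qed
  have g: "(\<lambda>p. if ps n p = a then f p else 0) summable_on UNIV"
    "(\<Sum>\<^sub>\<infinity>p. if ps n p = a then f p else 0) = infsum f (range (\<lambda>k. k * int n + int a))" if "a < n" for a
  proof -
    have "f summable_on range (\<lambda>k. k * int n + int a)" by (rule summable_on_subset_banach[OF f]) auto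
    then show "(\<lambda>p. if ps n p = a then f p else 0) summable_on UNIV"
      by (rule summable_on_cong_neutral[THEN iffD1, rotated -1]) (auto simp: r[OF that])
    show "(\<Sum>\<^sub>\<infinity>p. if ps n p = a then f p else 0) = infsum f (range (\<lambda>k. k * int n + int a))"
      by (rule infsum_cong_neutral) (auto simp: r[OF that])
  qed
  have "infsum f UNIV = (\<Sum>\<^sub>\<infinity>p. \<Sum>a<n. if ps n p = a then f p else 0)"
    by (rule infsum_cong) (use pos_less[OF n] in simp)
  also have "\<dots> = (\<Sum>a<n. \<Sum>\<^sub>\<infinity>p. if ps n p = a then f p else 0)"
    by (rule infsum_finite_sum) (use g(1) in simp)
  also have "\<dots> = (\<Sum>a<n. \<Sum>\<^sub>\<infinity>k. f (k * int n + int a))"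
    by (rule sum.cong) (simp_all add: g(2) s(2))
  finally show "infsum f UNIV = (\<Sum>a<n. \<Sum>\<^sub>\<infinity>k. f (k * int n + int a))" .
qed

section \<open>Exponential decay\<close>

lemma expdec_uniform:
  assumes "finite I" "!!i. i \<in> I ==> expdec (f i)"
  obtains C r where "0 \<le> C" "0 < r" "r < 1" "!!i k. i \<in> I ==> cmod (f i k) \<le> C * r ^ nat \<bar>k\<bar>"
proof -
  have "\<exists>C r. 0 \<le> C \<and> 0 < r \<and> r < 1 \<and> (\<forall>i\<in>I. \<forall>k. cmod (f i k) \<le> C * r ^ nat \<bar>k\<bar>)"
    using assms
  proof (induction I rule: finite_induct)
    case empty
    show ?case by (rule exI[of _ 0], rule exI[of _ "1/2"]) simp
  next
    case (insert i I)
    obtain C r where 1: "0 \<le> C" "0 < r" "r < 1" "!!j k. j \<in> I ==> cmod (f j k) \<le> C * r ^ nat \<bar>k\<bar>"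
      using insert by auto
    obtain D s where 2: "0 \<le> D" "0 < s" "s < 1" "!!k. cmod (f i k) \<le> D * s ^ nat \<bar>k\<bar>"
      using insert.prems[of i] by (auto simp: expdec_def)
    have "C * r ^ m \<le> max C D * max r s ^ m" "D * s ^ m \<le> max C D * max r s ^ m" for m
      using 1 2 by (intro mult_mono power_mono; simp)+
    then have "cmod (f j k) \<le> max C D * max r s ^ nat \<bar>k\<bar>" if "j \<in> insert i I" for j k
      using that 1(4)[of j k] 2(4)[of k] by (auto intro: order_trans)
    then show ?case using 1 2 by (intro exI[of _ "max C D"] exI[of _ "max r s"]) auto
  qed
  then show ?thesis using that by blast
qed

lemma expdec_lincomb:
  assumes "finite I" "!!i. i \<in> I ==> expdec (f i)" shows "expdec (\<lambda>k. \<Sum>i\<in>I. f i k * c i)"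
proof -
  obtain C r where 1: "0 \<le> C" "0 < r" "r < 1" "!!i k. i \<in> I ==> cmod (f i k) \<le> C * r ^ nat \<bar>k\<bar>"
    using expdec_uniform[of I f, OF assms] by blast
  have "cmod (\<Sum>i\<in>I. f i k * c i) \<le> C * (\<Sum>i\<in>I. cmod (c i)) * r ^ nat \<bar>k\<bar>" for k
  proof -
    have "cmod (\<Sum>i\<in>I. f i k * c i) \<le> (\<Sum>i\<in>I. C * r ^ nat \<bar>k\<bar> * cmod (c i))"
      by (rule sum_norm_le) (use 1 in \<open>auto simp: norm_mult intro!: mult_right_mono\<close>)
    then show ?thesis by (simp add: sum_distrib_left sum_distrib_right mult_ac)
  qed
  moreover have "0 \<le> C * (\<Sum>i\<in>I. cmod (c i))" using 1 by (simp add: sum_nonneg)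
  ultimately show ?thesis unfolding expdec_def using 1 by blast
qed

lemma expdec_col: "expdec (\<lambda>p. ent A p i)"
proof -
  obtain C r where "decay C r (ent A)" by (rule decay_ent)
  note d = decayD[OF this]
  have "cmod (ent A p i) \<le> C / r ^ nat \<bar>i\<bar> * r ^ nat \<bar>p\<bar>" for p
  proof -
    have "r ^ (nat \<bar>p - i\<bar> + nat \<bar>i\<bar>) \<le> r ^ nat \<bar>p\<bar>" using d by (intro power_decreasing) auto
    then have "r ^ nat \<bar>p - i\<bar> \<le> r ^ nat \<bar>p\<bar> / r ^ nat \<bar>i\<bar>" using d by (simp add: power_add field_simps)
    then have "C * r ^ nat \<bar>p - i\<bar> \<le> C * (r ^ nat \<bar>p\<bar> / r ^ nat \<bar>i\<bar>)" using d by (intro mult_left_mono) auto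
    then show ?thesis using d(4)[of p i] by simp
  qed
  moreover have "0 \<le> C / r ^ nat \<bar>i\<bar>" using d by simp
  ultimately show ?thesis unfolding expdec_def using d by blast
qed

lemma expdec_block: assumes n: "0 < n" and e: "expdec u" shows "expdec (\<lambda>k. u (k * int n + int a))"
proof -
  obtain C r where d: "0 \<le> C" "0 < r" "r < 1" "!!k. cmod (u k) \<le> C * r ^ nat \<bar>k\<bar>" using e by (auto simp: expdec_def)
  have "cmod (u (k * int n + int a)) \<le> C / r ^ a * r ^ nat \<bar>k\<bar>" for k
  proof -
    have "\<bar>k\<bar> \<le> \<bar>k\<bar> * int n" using n by (simp add: mult_le_cancel_left1)
    then have "nat \<bar>k\<bar> \<le> nat \<bar>k * int n + int a\<bar> + a" by (simp add: abs_mult)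
    then have "r ^ (nat \<bar>k * int n + int a\<bar> + a) \<le> r ^ nat \<bar>k\<bar>" using d by (intro power_decreasing) auto
    then have "r ^ nat \<bar>k * int n + int a\<bar> \<le> r ^ nat \<bar>k\<bar> / r ^ a" using d by (simp add: power_add field_simps)
    then have "C * r ^ nat \<bar>k * int n + int a\<bar> \<le> C * (r ^ nat \<bar>k\<bar> / r ^ a)" using d by (intro mult_left_mono) auto
    then show ?thesis using d(4)[of "k * int n + int a"] by simp
  qed
  moreover have "0 \<le> C / r ^ a" using d by simp
  ultimately show ?thesis unfolding expdec_def using d by blast
qed

lemma expdec_interleave:
  assumes n: "0 < n" and e: "!!a. a < n ==> expdec (u a)" shows "expdec (\<lambda>p. u (ps n p) (bk n p))"
proof -
  obtain C r where d: "0 \<le> C" "0 < r" "r < 1" "!!a k. a \<in> {..<n} ==> cmod (u a k) \<le> C * r ^ nat \<bar>k\<bar>"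
    using expdec_uniform[of "{..<n}" u] e by auto
  define s where "s = root n r"
  have s: "0 < s" "s < 1" "s ^ n = r" using d n by (simp_all add: s_def)
  have "cmod (u (ps n p) (bk n p)) \<le> C / r * s ^ nat \<bar>p\<bar>" for p
  proof -
    have "\<bar>p\<bar> \<le> \<bar>bk n p * int n\<bar> + int (ps n p)" using blk_pos[OF n, of p] by linarith
    then have "\<bar>p\<bar> \<le> \<bar>bk n p\<bar> * int n + int n" using pos_less[OF n, of p] by (simp add: abs_mult)
    then have "nat \<bar>p\<bar> \<le> nat (\<bar>bk n p\<bar> * int n + int n)" by (rule nat_mono)
    also have "\<dots> = nat \<bar>bk n p\<bar> * n + n" by (simp add: nat_add_distrib nat_mult_distrib)
    finally have "s ^ (nat \<bar>bk n p\<bar> * n + n) \<le> s ^ nat \<bar>p\<bar>" using s by (intro power_decreasing) auto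
    then have "r ^ nat \<bar>bk n p\<bar> * r \<le> s ^ nat \<bar>p\<bar>" by (simp add: power_add power_mult mult.commute[of _ n] s)
    then have "r ^ nat \<bar>bk n p\<bar> \<le> s ^ nat \<bar>p\<bar> / r" using d by (simp add: field_simps)
    then have "C * r ^ nat \<bar>bk n p\<bar> \<le> C * (s ^ nat \<bar>p\<bar> / r)" using d by (intro mult_left_mono) auto
    then show ?thesis using d(4)[of "ps n p" "bk n p"] pos_less[OF n, of p] by simp
  qed
  moreover have "0 \<le> C / r" using d by simp
  ultimately show ?thesis unfolding expdec_def using s by blast
qed

lemma periodic_extension:
  assumes n: "0 < n" and e: "!!j. j < n ==> expdec (v j)"
  obtains B where "periodic n B" "!!p q. ent B p q = v (ps n q) (p - bk n q * int n)"
proof -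
  obtain C r where d: "0 \<le> C" "0 < r" "r < 1" "!!a k. a \<in> {..<n} ==> cmod (v a k) \<le> C * r ^ nat \<bar>k\<bar>"
    using expdec_uniform[of "{..<n}" v] e by auto
  define F where "F p q = v (ps n q) (p - bk n q * int n)" for p q
  have "decay (C / r ^ n) r F"
    unfolding decay_def
  proof (intro conjI allI)
    show "0 \<le> C / r ^ n" using d by simp
    fix p q
    have "nat \<bar>p - q\<bar> \<le> nat \<bar>p - bk n q * int n\<bar> + n" using blk_pos[OF n, of q] pos_less[OF n, of q] by linarith
    then have "r ^ (nat \<bar>p - bk n q * int n\<bar> + n) \<le> r ^ nat \<bar>p - q\<bar>" using d by (intro power_decreasing) auto
    then have "r ^ nat \<bar>p - bk n q * int n\<bar> \<le> r ^ nat \<bar>p - q\<bar> / r ^ n" using d by (simp add: power_add field_simps)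
    then have "C * r ^ nat \<bar>p - bk n q * int n\<bar> \<le> C * (r ^ nat \<bar>p - q\<bar> / r ^ n)" using d by (intro mult_left_mono) auto
    then show "cmod (F p q) \<le> C / r ^ n * r ^ nat \<bar>p - q\<bar>"
      using d(4)[of "ps n q" "p - bk n q * int n"] pos_less[OF n, of q] by (simp add: F_def)
  qed (use d in auto)
  from ent_Emat[OF this] have B: "ent (Emat F) p q = v (ps n q) (p - bk n q * int n)" for p q by (simp add: F_def)
  have "periodic n (Emat F)" unfolding periodic_def B using n by (simp add: distrib_right)
  then show ?thesis using that B by blast
qed

lemma emat_eq_actL: assumes "!!x. actL A x = actL B x" shows "A = B"
  by (rule emat_eqI) (simp add: crd_actL_ev[symmetric] assms)

section \<open>Matrix functions as block Toeplitz matrices\<close>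

text \<open>The scalar entries of the block Laurent matrix of \<open>M\<close>.\<close>

definition blkent :: "nat => loop => int => int => complex" where
  "blkent n M p q = fourier (\<lambda>z. M z $$ (ps n p, ps n q)) (bk n p - bk n q)"

definition regular :: "nat => loop => bool" where
  "regular n M \<longleftrightarrow> (\<forall>a<n. \<forall>b<n. (\<lambda>z. M z $$ (a, b)) \<in> L2 \<and> expdec (fourier (\<lambda>z. M z $$ (a, b))))"

lemma regular_emat:
  assumes n: "0 < n" and M: "regular n M"
  obtains B where "periodic n B" "!!p q. ent B p q = blkent n M p q"
proof -
  define v where "v j p = fourier (\<lambda>z. M z $$ (ps n p, j)) (bk n p)" for j p
  have "expdec (v j)" if "j < n" for j
    unfolding v_def by (rule expdec_interleave[OF n]) (use M that in \<open>simp add: regular_def\<close>)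
  from periodic_extension[of n v, OF n this] obtain B where
    B: "periodic n B" "!!p q. ent B p q = v (ps n q) (p - bk n q * int n)" by blast
  have "ps n (p - bk n q * int n) = ps n p" "bk n (p - bk n q * int n) = bk n p - bk n q" for p q
    using n blk_combine[OF n pos_less[OF n, of p], of "bk n p - bk n q"] pos_combine[OF n pos_less[OF n, of p], of "bk n p - bk n q"] blk_pos[OF n, of p]
    by (simp_all add: left_diff_distrib algebra_simps)
  then have "ent B p q = blkent n M p q" for p q by (simp add: B(2) v_def blkent_def)
  then show ?thesis using that B(1) by blast
qed

lemma regular_if_emat:
  assumes n: "0 < n" and L: "!!a b. a < n ==> b < n ==> (\<lambda>z. M z $$ (a, b)) \<in> L2"
    and B: "!!p q. ent B p q = blkent n M p q"
  shows "regular n M"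
  unfolding regular_def
proof (intro allI impI conjI L)
  fix a b assume ab: "a < n" "b < n"
  have "fourier (\<lambda>z. M z $$ (a, b)) k = ent B (k * int n + int a) (int b)" for k
    using blk_combine[OF n ab(1), of k] pos_combine[OF n ab(1), of k] blk_combine[OF n ab(2), of 0] pos_combine[OF n ab(2), of 0]
    by (simp add: B blkent_def)
  then have "fourier (\<lambda>z. M z $$ (a, b)) = (\<lambda>k. ent B (k * int n + int a) (int b))" by blast
  then show "expdec (fourier (\<lambda>z. M z $$ (a, b)))" using expdec_block[OF n expdec_col[of B "int b"], of a] by simp
qed

text \<open>Block convolution: each entry of \<open>M\<close> acts on one residue class of coordinates.\<close>

lemma matrix_mult_EH:
  assumes n: "0 < n" and M: "regular n M" and c: "AE z in circle. M z \<in> carrier_mat n n"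
    and B: "!!p q. ent B p q = blkent n M p q" and h: "h \<in> H_space n"
  obtains f where "f \<in> H_space n" "f \<approx> (\<lambda>z. M z *\<^sub>v h z)" "EH n f = actL B (EH n h)"
proof -
  define m where "m a b = fourier (\<lambda>z. M z $$ (a, b))" for a b
  have m: "(\<lambda>z. M z $$ (a, b)) \<in> L2" "expdec (m a b)" if "a < n" "b < n" for a b
    using M that by (auto simp: regular_def m_def)
  have w: "bmf (wser (m a b))" if "a < n" "b < n" for a b by (rule bmf_wser[OF expdec_summable[OF m(2)[OF that]]])
  define f where "f z = vec n (\<lambda>a. \<Sum>b<n. wser (m a b) z * h z $ b)" for z
  have f: "f \<in> H_space n"
    by (rule H_spaceI) (auto simp: f_def intro!: L2_sum bmf_L2 w H_space_L2[OF h])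
  have "(\<lambda>z. M z $$ (a, b)) \<approx> wser (m a b)" if "a < n" "b < n" for a b
    using wser_fourier[OF m(1)[OF that]] expdec_summable[OF m(2)[OF that]] by (simp add: m_def)
  then have "AE z in circle. \<forall>a b. a < n --> b < n --> M z $$ (a, b) = wser (m a b) z"
    unfolding ae_eq_def by (simp add: AE_all_countable)
  with c have eq: "f \<approx> (\<lambda>z. M z *\<^sub>v h z)"
    unfolding ae_eq_def
  proof eventually_elim
    fix z assume z: "M z \<in> carrier_mat n n" "\<forall>a b. a < n --> b < n --> M z $$ (a, b) = wser (m a b) z"
    show "f z = M z *\<^sub>v h z"
    proof (rule eq_vecI)
      fix i assume "i < dim_vec (M z *\<^sub>v h z)"
      then have i: "i < n" using z(1) by simp
      have "(M z *\<^sub>v h z) $ i = (\<Sum>b<n. M z $$ (i, b) * h z $ b)"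
        by (rule mult_mat_vec_entry[OF z(1) H_space_carrier[OF h] i])
      also have "\<dots> = (\<Sum>b<n. wser (m i b) z * h z $ b)" by (rule sum.cong) (use z(2) i in auto)
      finally show "f z $ i = (M z *\<^sub>v h z) $ i" using i by (simp only: f_def index_vec)
    qed (use z(1) in \<open>simp add: f_def\<close>)
  qed
  have "EH n f = actL B (EH n h)"
  proof (rule ell2_eqI)
    fix p
    define a where "a = ps n p"
    have a: "a < n" unfolding a_def by (rule pos_less[OF n])
    have "crd (EH n f) p = fourier (\<lambda>z. \<Sum>b<n. wser (m a b) z * h z $ b) (bk n p)"
      using a by (simp add: crd_EH[OF n f] a_def[symmetric]) (simp add: f_def)
    also have "\<dots> = (\<Sum>b<n. fourier (\<lambda>z. wser (m a b) z * h z $ b) (bk n p))"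
      by (rule fourier_sum) (auto intro!: bmf_L2 w H_space_L2[OF h] a)
    also have "\<dots> = (\<Sum>b<n. \<Sum>\<^sub>\<infinity>k. ent B p (k * int n + int b) * crd (EH n h) (k * int n + int b))"
    proof (rule sum.cong[OF refl])
      fix b assume "b \<in> {..<n}"
      then have b: "b < n" by simp
      have L: "(\<lambda>z. h z $ b) \<in> L2" by (rule H_space_L2[OF h b])
      have "fourier (\<lambda>z. wser (m a b) z * h z $ b) (bk n p) = crd (Mul (wser (m a b)) (FT (\<lambda>z. h z $ b))) (bk n p)"
        by (simp add: Mul_FT[OF w[OF a b] L] crd_FT bmf_L2[OF w[OF a b] L])
      also have "\<dots> = (\<Sum>\<^sub>\<infinity>k. m a b (bk n p - k) * crd (EH n h) (k * int n + int b))"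
        unfolding Mul_wser_eq[OF m(2)[OF a b]] crd_actL act_def ent_toep[OF m(2)[OF a b]] FT_component[OF n h b] crd_comp2[OF n] ..
      also have "\<dots> = (\<Sum>\<^sub>\<infinity>k. ent B p (k * int n + int b) * crd (EH n h) (k * int n + int b))"
        by (simp only: B blkent_def blk_combine[OF n b] pos_combine[OF n b] m_def a_def)
      finally show "fourier (\<lambda>z. wser (m a b) z * h z $ b) (bk n p) =
        (\<Sum>\<^sub>\<infinity>k. ent B p (k * int n + int b) * crd (EH n h) (k * int n + int b))" .
    qed
    also have "\<dots> = crd (actL B (EH n h)) p"
      unfolding crd_actL act_def by (rule infsum_blocks(2)[OF n act_row_summable[OF bounded_seq_crd], symmetric])
    finally show "crd (EH n f) p = crd (actL B (EH n h)) p" .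
  qed
  then show ?thesis using that f eq by blast
qed

lemma L2_cong_AE:
  assumes g: "g \<in> borel_measurable borel" and f: "f \<in> L2" and e: "AE z in circle. g z = f z" shows "g \<in> L2"
proof (rule L2I[OF g])
  have fm: "f \<in> borel_measurable borel" by (rule L2_measurable[OF f])
  show "integrable circle (\<lambda>z. (cmod (g z))\<^sup>2)"
  proof (rule integrable_cong_AE_imp[OF L2_square_integrable[OF f]])
    show "(\<lambda>z. (cmod (g z))\<^sup>2) \<in> borel_measurable circle" unfolding measurable_circle using g by measurable
    show "AE z in circle. (cmod (f z))\<^sup>2 = (cmod (g z))\<^sup>2" using e by eventually_elim simp
  qed
qed

lemma matrix_columns:
  fixes f :: "nat => vfun" and M :: loop
  assumes n: "0 < n" and f: "!!j. j < n ==> f j \<in> H_space n"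
    and m: "!!a b. a < n ==> b < n ==> (\<lambda>z. M z $$ (a, b)) \<in> borel_measurable borel"
    and e: "AE z in circle. \<forall>a<n. \<forall>j<n. M z $$ (a, j) = f j z $ a"
  shows "a < n ==> b < n ==> (\<lambda>z. M z $$ (a, b)) \<in> L2"
    "blkent n M p q = crd (EH n (f (ps n q))) (p - bk n q * int n)"
proof -
  have ae: "AE z in circle. M z $$ (a, b) = f b z $ a" if "a < n" "b < n" for a b
    using e by eventually_elim (use that in blast)
  show "(\<lambda>z. M z $$ (a, b)) \<in> L2" if "a < n" "b < n" for a b
    by (rule L2_cong_AE[OF m[OF that] H_space_L2[OF f[OF that(2)] that(1)] ae[OF that]])
  note P = pos_less[OF n, of p] and Q = pos_less[OF n, of q]
  have "ps n (p - bk n q * int n) = ps n p" "bk n (p - bk n q * int n) = bk n p - bk n q"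
    using n blk_combine[OF n P, of "bk n p - bk n q"] pos_combine[OF n P, of "bk n p - bk n q"] blk_pos[OF n, of p]
    by (simp_all add: left_diff_distrib algebra_simps)
  then have "crd (EH n (f (ps n q))) (p - bk n q * int n) = fourier (\<lambda>z. f (ps n q) z $ ps n p) (bk n p - bk n q)"
    by (simp add: crd_EH[OF n f[OF Q]])
  moreover have "blkent n M p q = fourier (\<lambda>z. f (ps n q) z $ ps n p) (bk n p - bk n q)"
    unfolding blkent_def
    by (rule fourier_cong) (use ae[OF P Q] m[OF P Q] L2_measurable[OF H_space_L2[OF f[OF Q] P]] in \<open>auto simp: ae_eq_def\<close>)
  ultimately show "blkent n M p q = crd (EH n (f (ps n q))) (p - bk n q * int n)" by simp
qed

lemma Xi_V_mat:
  fixes f :: vfun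
  assumes n: "0 < n" and z: "z ~= 0" and f: "f z \<in> carrier_vec n" and i: "i < n"
  shows "(V_mat n z *\<^sub>v f z) $ i = Xi n f (zeta n z i)"
proof -
  have V: "V_mat n z \<in> carrier_mat n n" by (simp add: V_mat_def)
  have "(V_mat n z *\<^sub>v f z) $ i = (\<Sum>k<n. zeta n z i ^ k * f z $ k)"
    using i by (subst mult_mat_vec_entry[OF V f i]) (auto simp: V_mat_def)
  then show ?thesis by (simp add: Xi_def zeta_power[OF n z])
qed

lemma V_mat_inj:
  assumes n: "0 < n" and z: "z ~= 0" and u: "u \<in> carrier_vec n" and v: "v \<in> carrier_vec n"
    and e: "V_mat n z *\<^sub>v u = V_mat n z *\<^sub>v v"
  shows "u = v"
proof -
  have V: "V_mat n z \<in> carrier_mat n n" by (simp add: V_mat_def)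
  note i = det_inverse[OF V det_V_mat[OF n z]]
  have "inv_mat (V_mat n z) *\<^sub>v (V_mat n z *\<^sub>v x) = x" if "x \<in> carrier_vec n" for x
    using assoc_mult_mat_vec[OF i(1) V that] i(3) that by simp
  then show ?thesis using u v e by metis
qed

text \<open>The values of \<open>Xi n f\<close> at the \<open>n\<close>-th roots of \<open>z\<close> are the Vandermonde matrix applied to \<open>f z\<close>.\<close>

lemma AE_eq_if_Xi_eq:
  fixes f g :: vfun
  assumes n: "0 < n" and c: "!!z. f z \<in> carrier_vec n" "!!z. g z \<in> carrier_vec n"
    and e: "AE z in circle. Xi n f z = Xi n g z"
  shows "AE z in circle. f z = g z"
proof -
  have "AE z in circle. \<forall>i. Xi n f (zeta n z i) = Xi n g (zeta n z i)"
    unfolding AE_all_countable using AE_circle_zeta[OF n e] by blast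
  with AE_circle_norm show ?thesis
  proof eventually_elim
    fix z assume z: "cmod z = 1" "\<forall>i. Xi n f (zeta n z i) = Xi n g (zeta n z i)"
    then have z0: "z ~= 0" by auto
    have "V_mat n z *\<^sub>v f z = V_mat n z *\<^sub>v g z"
    proof (rule eq_vecI)
      fix i assume "i < dim_vec (V_mat n z *\<^sub>v g z)"
      then have i: "i < n" by (simp add: V_mat_def)
      show "(V_mat n z *\<^sub>v f z) $ i = (V_mat n z *\<^sub>v g z) $ i"
        by (simp only: Xi_V_mat[of n z f i, OF n z0 c(1) i] Xi_V_mat[of n z g i, OF n z0 c(2) i] z(2))
    qed (simp_all add: V_mat_def)
    then show "f z = g z" by (rule V_mat_inj[OF n z0 c])
  qed
qed

lemma Psi_mmat:
  assumes n: "0 < n" and D: "!!j. j < n ==> (D_t1 ^^ j) (psi n W) t \<in> L2"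
  obtains P where "mmat n P" "!!z. z ~= 0 ==> Psi n W t z = P z"
proof -
  have V: "mmat n (V_mat n)"
    unfolding V_mat_def[abs_def] by (rule mmat_mat) (intro borel_measurable_power measurable_zeta)
  define Vi where "Vi z = (if z = 0 then 0\<^sub>m n n else inv_mat (V_mat n z))" for z
  have "mmat n Vi"
    unfolding mmat_def
  proof (intro conjI allI impI)
    show "Vi z \<in> carrier_mat n n" for z
      using det_inverse(1)[OF mmatD(1)[OF V] det_V_mat[OF n]] by (auto simp: Vi_def)
    fix a b assume "a < n" "b < n"
    from measurable_inv_mat[OF V this] show "(\<lambda>z. Vi z $$ (a, b)) \<in> borel_measurable borel"
      by (rule measurable_off_zero) (simp add: Vi_def)
  qed
  moreover have "mmat n (\<lambda>z. mat n n (\<lambda>(i, j). (D_t1 ^^ j) (psi n W) t (zeta n z i)))"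
    by (rule mmat_mat) (rule measurable_compose[OF measurable_zeta L2_measurable[OF D]])
  ultimately have "mmat n (\<lambda>z. Vi z * mat n n (\<lambda>(i, j). (D_t1 ^^ j) (psi n W) t (zeta n z i)))"
    by (rule mmat_mult)
  then show ?thesis by (rule that) (simp add: Vi_def Psi_def)
qed

text \<open>Evaluating \<open>D\<^sup>j\<psi>\<close> at the roots and inverting the Vandermonde matrix undoes \<open>Xi\<close>.\<close>

lemma Psi_columns:
  assumes n: "0 < n" and D: "!!j. j < n ==> (D_t1 ^^ j) (psi n W) t \<in> L2"
  shows "AE z in circle. \<forall>a<n. \<forall>j<n. Psi n W t z $$ (a, j) = HI n (FT ((D_t1 ^^ j) (psi n W) t)) z $ a"
proof -
  define f where "f j = HI n (FT ((D_t1 ^^ j) (psi n W) t))" for j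
  have fH: "f j \<in> H_space n" "EH n (f j) = FT ((D_t1 ^^ j) (psi n W) t)" for j by (simp_all add: f_def HI[OF n])
  have "AE z in circle. Xi n (f j) z = (D_t1 ^^ j) (psi n W) t z" if "j < n" for j
    using fH[of j] FT_eq_iff[OF Xi_L2[OF n fH(1)[of j]] D[OF that]] by (simp add: EH_def ae_eq_def)
  then have A: "AE z in circle. j < n --> Xi n (f j) z = (D_t1 ^^ j) (psi n W) t z" for j by (cases "j < n") auto
  have "AE z in circle. \<forall>i. \<forall>j. j < n --> Xi n (f j) (zeta n z i) = (D_t1 ^^ j) (psi n W) t (zeta n z i)"
    unfolding AE_all_countable by (intro allI) (rule AE_circle_zeta[OF n A])
  with AE_circle_norm show ?thesis
  proof eventually_elim
    fix z assume z: "cmod z = 1" "\<forall>i j. j < n --> Xi n (f j) (zeta n z i) = (D_t1 ^^ j) (psi n W) t (zeta n z i)"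
    have z0: "z ~= 0" using z by auto
    define F where "F = mat n n (\<lambda>(k, j). f j z $ k)"
    have V: "V_mat n z \<in> carrier_mat n n" and F: "F \<in> carrier_mat n n" by (simp_all add: V_mat_def F_def)
    note i = det_inverse[OF V det_V_mat[OF n z0]]
    have fc: "f j z \<in> carrier_vec n" for j by (rule H_space_carrier[OF fH(1)])
    have e: "mat n n (\<lambda>(i, j). (D_t1 ^^ j) (psi n W) t (zeta n z i)) = V_mat n z * F"
    proof (rule eq_matI)
      fix i j assume "i < dim_row (V_mat n z * F)" "j < dim_col (V_mat n z * F)"
      then have ij: "i < n" "j < n" using V F by auto
      have "(V_mat n z * F) $$ (i, j) = (\<Sum>k<n. V_mat n z $$ (i, k) * F $$ (k, j))" by (rule mat_mult_entry[OF V F ij])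
      also have "\<dots> = (\<Sum>k<n. V_mat n z $$ (i, k) * f j z $ k)" by (rule sum.cong) (use ij in \<open>auto simp: F_def\<close>)
      also have "\<dots> = (V_mat n z *\<^sub>v f j z) $ i" by (rule mult_mat_vec_entry[OF V fc ij(1), symmetric])
      also have "\<dots> = Xi n (f j) (zeta n z i)" by (rule Xi_V_mat[of n z "f j" i, OF n z0 fc ij(1)])
      finally show "mat n n (\<lambda>(i, j). (D_t1 ^^ j) (psi n W) t (zeta n z i)) $$ (i, j) = (V_mat n z * F) $$ (i, j)"
        using z(2) ij by simp
    qed (use V F in auto)
    have "inv_mat (V_mat n z) * (V_mat n z * F) = inv_mat (V_mat n z) * V_mat n z * F"
      by (rule assoc_mult_mat[OF i(1) V F, symmetric])
    also have "\<dots> = F" using F by (simp add: i(3))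
    finally have "Psi n W t z = F" unfolding Psi_def e .
    then show "\<forall>a<n. \<forall>j<n. Psi n W t z $$ (a, j) = HI n (FT ((D_t1 ^^ j) (psi n W) t)) z $ a"
      by (simp add: F_def f_def)
  qed
qed

lemma EH_const_unit:
  assumes n: "0 < n" and j: "j < n"
  shows "(\<lambda>z. unit_vec n j) \<in> H_space n" "EH n (\<lambda>z. unit_vec n j) = ev (int j)"
proof -
  have one: "fourier (\<lambda>_. 1) k = (if k = 0 then 1 else 0)" for k
    using crd_e0[of k] by (simp add: e0_def crd_FT[OF L2_const])
  have zero: "fourier (\<lambda>_. 0) k = 0" for k by (simp add: fourier_def)
  show h: "(\<lambda>z. unit_vec n j) \<in> H_space n" by (rule H_spaceI) (auto intro: L2_const)
  show "EH n (\<lambda>z. unit_vec n j) = ev (int j)"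
  proof (rule ell2_eqI)
    fix p
    have "p = int j \<longleftrightarrow> bk n p = 0 \<and> ps n p = j"
      using blk_pos[OF n, of p] blk_combine[OF n j, of 0] pos_combine[OF n j, of 0] by auto
    then show "crd (EH n (\<lambda>z. unit_vec n j)) p = crd (ev (int j)) p"
      using pos_less[OF n, of p] j
      by (cases "ps n p = j") (simp_all add: crd_EH[OF n h] crd_ev one zero index_unit_vec)
  qed
qed

definition flat :: "nat => loop => emat" where "flat n M = Emat (blkent n M)"

lemma flat: assumes "0 < n" "regular n M" shows "ent (flat n M) p q = blkent n M p q" "periodic n (flat n M)"
proof -
  obtain B where B: "periodic n B" "!!p q. ent B p q = blkent n M p q" using regular_emat[OF assms] by blast
  have "ent B = blkent n M" using B(2) by blast
  then have "flat n M = B" unfolding flat_def by (metis ent_inverse)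
  then show "ent (flat n M) p q = blkent n M p q" "periodic n (flat n M)" using B by auto
qed

section \<open>The point W and its flow\<close>

text \<open>The hypotheses that give the factorisation \<open>\<Gamma> = a b\<close>.\<close>

locale wave_setting =
  fixes n :: nat and W :: "vfun set" and t :: "nat => complex"
  assumes n: "0 < n" and W: "W \<in> Gr n" and big: "big_cell n W"
    and WI: "W = loop_image n (Psi n W (\<lambda>i. 0)) (H_plus n)"
    and t: "t \<in> admissible_times n"
    and an: "extends_analytically n (W_loop n W t)"
begin

lemma fin: "finite {i. t i ~= 0}" and t0: "t 0 = 0"
  using t by (auto simp: admissible_times_def dest: spec[of _ 0])

lemma xi_0: "xi t 0 = 0" unfolding xi_def by (rule sum.neutral) (use t0 in \<open>auto simp: power_0_left\<close>)

lemma xi_minus: "xi (\<lambda>m. - t m) z = - xi t z" by (simp add: xi_def sum_negf)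

lemma Ex_minus: "Ex (\<lambda>m. - t m) = Exi t" "Exi (\<lambda>m. - t m) = Ex t"
  by (simp_all add: Ex_def[OF n W big] Exi_def[OF n W big] xi_minus)

text \<open>The matrix of multiplication by \<open>e\<^sup>s\<^sup>\<xi>\<close>, used for \<open>s = 1\<close> and \<open>s = -1\<close>.\<close>

definition is_exp :: "complex => emat => bool" where
  "is_exp s A \<longleftrightarrow> periodic n A \<and> (\<forall>p q. p < q --> ent A p q = 0) \<and> (\<forall>p. ent A p p = 1) \<and>
    (\<forall>x. Mul (\<lambda>z. exp (s * xi t z)) x = actL A x)"

lemma is_exp_ex: "\<exists>A. is_exp s A"
proof -
  have "(\<lambda>z. exp (s * xi t z)) holomorphic_on UNIV" unfolding xi_def by (intro holomorphic_intros)
  moreover have "exp (s * xi t 0) = 1" by (simp add: xi_0)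
  ultimately obtain a where a: "expdec a" "!!k. k < 0 ==> a k = 0" "a 0 = 1"
    "!!x. Mul (\<lambda>z. exp (s * xi t z)) x = actL (toep a) x" using entire_toep by blast
  have "is_exp s (toep a)" unfolding is_exp_def periodic_def ent_toep[OF a(1)] using a by simp
  then show ?thesis by blast
qed

definition Am :: emat where "Am = (SOME A. is_exp 1 A)"
definition Aim :: emat where "Aim = (SOME A. is_exp (- 1) A)"

lemma Am: "is_exp 1 Am" and Aim: "is_exp (- 1) Aim"
  unfolding Am_def Aim_def by (rule someI_ex[OF is_exp_ex])+

lemma Ex_Am: "Ex t x = actL Am x" and Exi_Aim: "Exi t x = actL Aim x"
  using Am Aim by (simp_all add: Ex_def[OF n W big] Exi_def[OF n W big] is_exp_def)

lemma Am_Aim: "Am * Aim = 1" "Aim * Am = 1"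
  by (rule emat_eq_actL, simp add: actL_mult actL_one Ex_Am[symmetric] Exi_Aim[symmetric] Ex_Exi[OF n W big])+

lemma per_Am: "periodic n Am" "periodic n Aim" using Am Aim by (simp_all add: is_exp_def)

definition D0 :: "nat => complex => complex" where "D0 j = (D_t1 ^^ j) (psi n W) (\<lambda>i. 0)"
definition bcol :: "nat => ell2" where "bcol j = FT (D0 j)"

lemma Exi_0: "Exi (\<lambda>i. 0) x = x"
  by (simp add: Exi_def[OF n W big] xi_def Mul_one)

lemma wave_0:
  "D0 j \<in> L2" "crd (bcol j) (int j) = 1" "int j < p ==> crd (bcol j) p = 0"
proof -
  have V: "Wh n W = Exi (\<lambda>i. 0) ` Wh n W" by (simp add: Exi_0)
  note wd = wave_derivatives[OF n W big _ V closed_Wh[OF n W big] csubspace_Wh[OF n W big]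
      Wh_onto[OF n W big] Wh_inj[OF n W big] order_refl, of j, unfolded Exi_0]
  show "D0 j \<in> L2" "crd (bcol j) (int j) = 1" "int j < p ==> crd (bcol j) p = 0"
    unfolding D0_def bcol_def by (rule wd; simp)+
qed

lemma D0_L2: "(D_t1 ^^ j) (psi n W) (\<lambda>i. 0) \<in> L2" using wave_0(1)[of j] by (simp add: D0_def)

lemma Psi0_columns: "AE z in circle. \<forall>a<n. \<forall>j<n. Psi n W (\<lambda>i. 0) z $$ (a, j) = HI n (bcol j) z $ a"
  unfolding bcol_def D0_def by (rule Psi_columns[OF n D0_L2])

definition P0 :: loop where "P0 = (SOME P. mmat n P \<and> (\<forall>z. z ~= 0 --> Psi n W (\<lambda>i. 0) z = P z))"

lemma P0: "mmat n P0" "z ~= 0 ==> Psi n W (\<lambda>i. 0) z = P0 z"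
proof -
  have "\<exists>P. mmat n P \<and> (\<forall>z. z ~= 0 --> Psi n W (\<lambda>i. 0) z = P z)"
    by (rule Psi_mmat[OF n D0_L2]) blast
  from someI_ex[OF this] show "mmat n P0" "z ~= 0 ==> Psi n W (\<lambda>i. 0) z = P0 z" unfolding P0_def by auto
qed

lemma Psi0_measurable: "a < n ==> b < n ==> (\<lambda>z. Psi n W (\<lambda>i. 0) z $$ (a, b)) \<in> borel_measurable borel"
  by (rule measurable_off_zero[OF mmatD(2)[OF P0(1)]]) (simp_all add: P0(2))

lemma Psi0_carrier: "AE z in circle. Psi n W (\<lambda>i. 0) z \<in> carrier_mat n n"
  by (rule AE_circleI, subst P0(2)) (auto intro: mmatD(1)[OF P0(1)])

lemma W_loop_measurable: "a < n ==> b < n ==> (\<lambda>z. W_loop n W t z $$ (a, b)) \<in> borel_measurable borel"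
  by (rule measurable_off_zero[OF mmatD(2)[OF mmat_mult[OF mmat_Exi_mat P0(1)]]]) (simp_all add: P0(2) W_loop_def)

lemma W_loop_columns: "AE z in circle. \<forall>a<n. \<forall>j<n. W_loop n W t z $$ (a, j) = HI n (Ex t (bcol j)) z $ a"
proof -
  let ?e = "\<lambda>j z. Exi_mat n t z *\<^sub>v HI n (bcol j) z"
  have E: "Exi_mat n t z \<in> carrier_mat n n" for z by (rule mmatD(1)[OF mmat_Exi_mat])
  have fc: "HI n (bcol j) z \<in> carrier_vec n" for j z by (rule H_space_carrier[OF HI(1)[OF n]])
  have "AE z in circle. HI n (Ex t (bcol j)) z = ?e j z" for j
  proof (rule AE_eq_if_Xi_eq[OF n])
    show "HI n (Ex t (bcol j)) z \<in> carrier_vec n" for z by (rule H_space_carrier[OF HI(1)[OF n]])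
    show "?e j z \<in> carrier_vec n" for z by (rule mult_mat_vec_carrier[OF E fc])
    have L: "Xi n (HI n (bcol j)) \<in> L2" "Xi n (HI n (Ex t (bcol j))) \<in> L2" by (rule Xi_L2[OF n HI(1)[OF n]])+
    have L': "(\<lambda>z. exp (xi t z) * Xi n (HI n (bcol j)) z) \<in> L2" by (rule bmf_L2[OF bmf_exp_xi(1)[OF n W big] L(1)])
    have "FT (Xi n (HI n (Ex t (bcol j)))) = Ex t (bcol j)" using HI(2)[OF n, of "Ex t (bcol j)"] by (simp add: EH_def)
    also have "\<dots> = Ex t (FT (Xi n (HI n (bcol j))))" using HI(2)[OF n, of "bcol j"] by (simp add: EH_def)
    also have "\<dots> = FT (\<lambda>z. exp (xi t z) * Xi n (HI n (bcol j)) z)"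
      unfolding Ex_def[OF n W big] by (rule Mul_FT[OF bmf_exp_xi(1)[OF n W big] L(1)])
    finally have "Xi n (HI n (Ex t (bcol j))) \<approx> (\<lambda>z. exp (xi t z) * Xi n (HI n (bcol j)) z)"
      using FT_eq_iff[OF L(2) L'] by blast
    then show "AE z in circle. Xi n (HI n (Ex t (bcol j))) z = Xi n (?e j) z"
      unfolding ae_eq_def Xi_exp_mat[OF n fc] .
  qed
  then have "AE z in circle. \<forall>j. HI n (Ex t (bcol j)) z = ?e j z" unfolding AE_all_countable by blast
  with Psi0_columns Psi0_carrier show ?thesis
  proof eventually_elim
    fix z assume z: "\<forall>a<n. \<forall>j<n. Psi n W (\<lambda>i. 0) z $$ (a, j) = HI n (bcol j) z $ a"
      "Psi n W (\<lambda>i. 0) z \<in> carrier_mat n n" "\<forall>j. HI n (Ex t (bcol j)) z = ?e j z"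
    show "\<forall>a<n. \<forall>j<n. W_loop n W t z $$ (a, j) = HI n (Ex t (bcol j)) z $ a"
    proof (intro allI impI)
      fix a j assume aj: "a < n" "j < n"
      have "W_loop n W t z $$ (a, j) = (\<Sum>k<n. Exi_mat n t z $$ (a, k) * Psi n W (\<lambda>i. 0) z $$ (k, j))"
        unfolding W_loop_def by (rule mat_mult_entry[OF E z(2) aj])
      also have "\<dots> = (\<Sum>k<n. Exi_mat n t z $$ (a, k) * HI n (bcol j) z $ k)"
        by (rule sum.cong) (use z(1) aj in auto)
      also have "\<dots> = ?e j z $ a" by (rule mult_mat_vec_entry[OF E fc aj(1), symmetric])
      finally show "W_loop n W t z $$ (a, j) = HI n (Ex t (bcol j)) z $ a" using z(3) by simp
    qed
  qed
qed

lemma W_loop_L2: "a < n ==> b < n ==> (\<lambda>z. W_loop n W t z $$ (a, b)) \<in> L2"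
  by (rule matrix_columns(1)[OF n HI(1)[OF n] W_loop_measurable W_loop_columns])

lemma W_loop_blkent: "blkent n (W_loop n W t) p q = crd (Ex t (bcol (ps n q))) (p - bk n q * int n)"
  using matrix_columns(2)[OF n HI(1)[OF n] W_loop_measurable W_loop_columns] by (simp add: HI(2)[OF n])

lemma W_loop_regular: "regular n (W_loop n W t)"
  unfolding regular_def
proof (intro allI impI conjI W_loop_L2)
  fix a b assume ab: "a < n" "b < n"
  obtain D G where G: "open D" "sphere 0 1 \<subseteq> D" "\<forall>a<n. \<forall>b<n. (\<lambda>z. G z $$ (a, b)) holomorphic_on D"
    "ae_eq (W_loop n W t) G"
    using an by (auto simp: extends_analytically_def)
  show "expdec (fourier (\<lambda>z. W_loop n W t z $$ (a, b)))"
  proof (rule expdec_holomorphic[OF G(1,2) _ W_loop_measurable[OF ab]])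
    show "(\<lambda>z. G z $$ (a, b)) holomorphic_on D" using G(3) ab by blast
    show "ae_eq (\<lambda>z. W_loop n W t z $$ (a, b)) (\<lambda>z. G z $$ (a, b))"
      using G(4) unfolding ae_eq_def by eventually_elim simp
  qed
qed

definition Gm :: emat where "Gm = flat n (W_loop n W t)"

lemma ent_Gm: "ent Gm p q = blkent n (W_loop n W t) p q" and per_Gm: "periodic n Gm"
  unfolding Gm_def using flat[OF n W_loop_regular] by auto

lemma Gm_col: "actL Gm (ev q) = actL (Zn (bk n q * int n)) (Ex t (bcol (ps n q)))"
  by (rule ell2_eqI) (simp add: crd_actL_ev ent_Gm W_loop_blkent crd_Zn)

definition bm :: emat where "bm = Aim * Gm"

lemma Am_bm: "Am * bm = Gm" by (simp add: bm_def mult.assoc[symmetric] Am_Aim)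
lemma per_bm: "periodic n bm" unfolding bm_def by (rule periodic_mult[OF per_Am(2) per_Gm])

lemma bm_col: "actL bm (ev q) = actL (Zn (bk n q * int n)) (bcol (ps n q))"
proof -
  have "actL bm (ev q) = actL Aim (actL (Zn (bk n q * int n)) (Ex t (bcol (ps n q))))"
    by (simp add: bm_def actL_mult Gm_col)
  also have "\<dots> = actL (Zn (bk n q * int n)) (actL Aim (actL Am (bcol (ps n q))))"
    by (simp add: periodic_actL_Zn[OF per_Am(2)] Ex_Am)
  finally show ?thesis by (simp add: actL_mult[symmetric] Am_Aim actL_one)
qed

lemma ent_bm: "ent bm p q = crd (bcol (ps n q)) (p - bk n q * int n)"
  by (simp add: crd_actL_ev[symmetric] bm_col crd_Zn)

lemma upper_bm: "upper bm"
  unfolding upper_def ent_bm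
proof (intro conjI allI impI)
  fix p q :: int
  have e: "p - bk n p * int n = int (ps n p)" for p using blk_pos[OF n, of p] by linarith
  show "crd (bcol (ps n q)) (p - bk n q * int n) = 0" if "q < p"
    by (rule wave_0(3)) (use e[of q] that in linarith)
  show "crd (bcol (ps n p)) (p - bk n p * int n) = 1" unfolding e by (rule wave_0(2))
qed

lemma Psi0_blkent: "ent bm p q = blkent n (Psi n W (\<lambda>i. 0)) p q"
  using matrix_columns(2)[OF n HI(1)[OF n] Psi0_measurable Psi0_columns] by (simp add: HI(2)[OF n] ent_bm)

lemma Psi0_regular: "regular n (Psi n W (\<lambda>i. 0))"
  by (rule regular_if_emat[OF n matrix_columns(1)[OF n HI(1)[OF n] Psi0_measurable Psi0_columns] Psi0_blkent])

text \<open>The image description in this form, because \<open>W\<close> occurs on both sides of the hypothesis.\<close>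

lemma W_iff: "f \<in> W \<longleftrightarrow> f \<in> H_space n \<and> (\<exists>h\<in>H_plus n. f \<approx> (\<lambda>z. Psi n W (\<lambda>i. 0) z *\<^sub>v h z))"
  using arg_cong[OF WI, of "\<lambda>X. f \<in> X"] unfolding loop_image_def by simp

lemma Wh_eq: "Wh n W = actL bm ` plus_space"
proof (intro equalityI subsetI)
  fix x assume "x \<in> Wh n W"
  then obtain f where f: "f \<in> W" "x = EH n f" by (auto simp: Wh_def[OF n W big])
  then obtain h where h: "f \<in> H_space n" "h \<in> H_plus n" "f \<approx> (\<lambda>z. Psi n W (\<lambda>i. 0) z *\<^sub>v h z)" using W_iff by blast
  then have hH: "h \<in> H_space n" "EH n h \<in> plus_space" by (simp_all add: H_plus_iff[OF n])
  obtain g where g: "g \<in> H_space n" "g \<approx> (\<lambda>z. Psi n W (\<lambda>i. 0) z *\<^sub>v h z)" "EH n g = actL bm (EH n h)"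
    using matrix_mult_EH[OF n Psi0_regular Psi0_carrier Psi0_blkent hH(1)] by blast
  have "f \<approx> g" using h(3) g(2) unfolding ae_eq_def by eventually_elim simp
  then have "EH n f = EH n g" using EH_eq_iff[OF n h(1) g(1)] by blast
  then show "x \<in> actL bm ` plus_space" using f g hH by auto
next
  fix x assume "x \<in> actL bm ` plus_space"
  then obtain y where y: "y \<in> plus_space" "x = actL bm y" by blast
  have h: "HI n y \<in> H_plus n" using y by (simp add: H_plus_iff[OF n] HI[OF n])
  obtain g where g: "g \<in> H_space n" "g \<approx> (\<lambda>z. Psi n W (\<lambda>i. 0) z *\<^sub>v HI n y z)" "EH n g = actL bm (EH n (HI n y))"
    using matrix_mult_EH[OF n Psi0_regular Psi0_carrier Psi0_blkent HI(1)[OF n]] by blast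
  have "g \<in> W" using W_iff g h by blast
  then have "EH n g \<in> Wh n W" unfolding Wh_def[OF n W big] by (rule imageI)
  then show "x \<in> Wh n W" using g(3) y(2) HI(2)[OF n, of y] by simp
qed

lemma bm_invertible: "\<exists>bi. bm * bi = 1 \<and> bi * bm = 1 \<and> upper bi"
proof (rule invertible_of_big_cell[OF n per_bm upper_bm])
  fix y assume "y \<in> plus_space"
  then show "\<exists>x\<in>plus_space. prP (actL bm x) = y" using Wh_onto[OF n W big, of y] unfolding Wh_eq by auto
next
  fix x assume "x \<in> plus_space" "prP (actL bm x) = 0"
  then show "actL bm x = 0" using Wh_inj[OF n W big, of "actL bm x"] unfolding Wh_eq by blast
qed blast

definition bim :: emat where "bim = (SOME bi. bm * bi = 1 \<and> bi * bm = 1 \<and> upper bi)"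

lemma bim: "bm * bim = 1" "bim * bm = 1" "upper bim"
  using someI_ex[OF bm_invertible] by (simp_all add: bim_def)

lemma factors: "two_factors Am Aim bm bim"
  using Am Aim upper_bm bim(3) by unfold_locales (auto simp: Am_Aim bim is_exp_def upper_def)

definition Gim :: emat where "Gim = bim * Aim"

lemma Gm_Gim: "Gm * Gim = 1" "Gim * Gm = 1"
proof -
  have "Gm * Gim = Am * (bm * bim) * Aim" by (simp add: Am_bm[symmetric] Gim_def mult.assoc)
  then show "Gm * Gim = 1" by (simp add: bim Am_Aim)
  have "Gim * Gm = bim * (Aim * Am) * bm" by (simp add: Am_bm[symmetric] Gim_def mult.assoc)
  then show "Gim * Gm = 1" by (simp add: bim Am_Aim)
qed

lemma natpart_Gm: "natpart Gm p q = unblock n (\<lambda>r s. loop_coeff n (W_loop n W t) (int r - int s)) p q"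
  using n by (simp add: natpart_def ent_Gm blkent_def unblock_def loop_coeff_def zdiv_int[symmetric] zmod_int[symmetric])

lemma tau_N_eq: "tau_N n W N t = det_on {..<N * n} (natpart Gm)"
  unfolding tau_N_def natpart_Gm[abs_def] by (rule det_mat_eq_det_on)

lemma tau_eq: assumes "(\<lambda>M. det_on {..<M} (natpart Gm)) \<longlonglongrightarrow> F" shows "tau n W t = F"
proof -
  have "strict_mono (\<lambda>N. N * n)" using n by (simp add: strict_mono_def)
  from LIMSEQ_subseq_LIMSEQ[OF assms this] have "(\<lambda>N. tau_N n W N t) \<longlonglongrightarrow> F" by (simp add: tau_N_eq o_def)
  then show ?thesis unfolding tau_def by (rule limI)
qed

end

locale wave_setting_tau = wave_setting +
  assumes tau: "tau n W t ~= 0"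
begin

text \<open>The inverse of \<open>P \<Gamma> P\<close> on the nonnegative half space.\<close>

lemma Sm_ex: "\<exists>S. Pp * S = S \<and> S * Pp = S \<and> Pp * Gm * S = Pp \<and> S * Gm * Pp = Pp"
proof -
  interpret tf: two_factors Am Aim bm bim by (rule factors)
  have "fredholm_det (natpart tf.A) ~= 0" using tau tau_eq tf.det_toeplitz_tendsto by (simp add: Am_bm)
  from tf.toeplitz_inverse[OF this] obtain S where
    "Pp * S = S" "S * Pp = S" "Pp * Am * bm * S = Pp" "S * Am * bm * Pp = Pp" by blast
  then have "Pp * S = S \<and> S * Pp = S \<and> Pp * Gm * S = Pp \<and> S * Gm * Pp = Pp"
    by (simp add: Am_bm[symmetric] mult.assoc)
  then show ?thesis by blast
qed

definition Sm :: emat where "Sm = (SOME S. Pp * S = S \<and> S * Pp = S \<and> Pp * Gm * S = Pp \<and> S * Gm * Pp = Pp)"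

lemma Sm: "Pp * Sm = Sm" "Sm * Pp = Sm" "Pp * Gm * Sm = Pp" "Sm * Gm * Pp = Pp"
  using someI_ex[OF Sm_ex] by (simp_all add: Sm_def)

lemma Sm_Gm: assumes "u \<in> plus_space" shows "actL Sm (actL Gm u) = u" "actL Sm (prP (actL Gm u)) = u"
proof -
  have "u = actL (Sm * Gm * Pp) u" using assms by (simp add: Sm prP_plus)
  then show "actL Sm (actL Gm u) = u" using prP_plus[OF assms] by (simp add: actL_mult)
  moreover have "actL Sm (prP x) = actL Sm x" for x using Sm(2) by (simp add: actL_mult[symmetric])
  ultimately show "actL Sm (prP (actL Gm u)) = u" by simp
qed

text \<open>\<open>e\<^sup>\<xi> W\<close>, which is in the big cell when the tau function does not vanish.\<close>

definition Vt :: "ell2 set" where "Vt = Ex t ` Wh n W"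

lemma Vt_eq: "Vt = actL Gm ` plus_space"
  unfolding Vt_def Wh_eq image_image Am_bm[symmetric] by (simp add: Ex_Am actL_mult)

lemma Vt_vimage: "Vt = actL Aim -` Wh n W"
proof (intro equalityI subsetI)
  fix x assume "x \<in> actL Aim -` Wh n W"
  then have "Exi t x \<in> Wh n W" by (simp add: Exi_Aim)
  then have "Ex t (Exi t x) \<in> Vt" unfolding Vt_def by (rule imageI)
  then show "x \<in> Vt" by (simp add: Ex_Exi[OF n W big])
qed (auto simp: Vt_def Exi_Aim[symmetric] Ex_Exi[OF n W big])

lemma closed_Vt: "closed Vt"
  unfolding Vt_vimage
  by (rule continuous_closed_vimage[OF closed_Wh[OF n W big]])
    (rule bounded_linear.isCont[OF bounded_linear_actL], rule continuous_ident)

lemma csubspace_Vt: "csubspace Vt"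
  using csubspace_Wh[OF n W big] unfolding Vt_vimage csubspace_def by (simp add: actL_add actL_zero actL_cmul)

lemma Vt_onto: assumes "y \<in> plus_space" shows "\<exists>x\<in>Vt. prP x = y"
proof
  have "actL Sm y = prP (actL Sm y)" by (simp add: actL_mult[symmetric] Sm)
  then have "actL Sm y \<in> plus_space" using prP_in_plus[of "actL Sm y"] by simp
  then show "actL Gm (actL Sm y) \<in> Vt" unfolding Vt_eq by blast
  have "prP (actL Gm (actL Sm y)) = actL (Pp * Gm * Sm) y" by (simp only: actL_mult)
  then show "prP (actL Gm (actL Sm y)) = y" by (simp add: Sm prP_plus[OF assms])
qed

lemma Vt_inj: assumes "x \<in> Vt" "prP x = 0" shows "x = 0"
proof -
  obtain u where u: "u \<in> plus_space" "x = actL Gm u" using assms(1) Vt_eq by blast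
  have "u = actL Sm (prP x)" using Sm_Gm(2)[OF u(1)] u(2) by simp
  then show ?thesis using assms(2) u(2) by (simp add: actL_zero)
qed

definition Dt :: "nat => complex => complex" where "Dt j = (D_t1 ^^ j) (psi n W) (\<lambda>m. - t m)"
definition tcol :: "nat => ell2" where "tcol j = actL Am (FT (Dt j))"

lemma wave_t:
  "Dt j \<in> L2" "tcol j \<in> Vt" "crd (tcol j) (int j) = 1" "int j < p ==> crd (tcol j) p = 0"
proof -
  have f: "finite {i. - t i ~= 0}" using fin by simp
  have V: "Vt = Exi (\<lambda>m. - t m) ` Wh n W" by (simp add: Ex_minus Vt_def)
  note wd = wave_derivatives[OF n W big f V closed_Vt csubspace_Vt Vt_onto Vt_inj order_refl,
      of j, unfolded Ex_minus Ex_Am]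
  show "Dt j \<in> L2" "tcol j \<in> Vt" "crd (tcol j) (int j) = 1" "int j < p ==> crd (tcol j) p = 0"
    unfolding Dt_def tcol_def by (rule wd; simp)+
qed

text \<open>A column is determined by its finitely many nonnegative coordinates, namely
  \<open>\<theta>\<^sub>j = \<Gamma> S P \<theta>\<^sub>j\<close>, and thus is a finite combination of columns of \<open>\<Gamma> S\<close>.\<close>

lemma tcol_expdec: "expdec (crd (tcol j))"
proof -
  obtain u where u: "u \<in> plus_space" "tcol j = actL Gm u" using wave_t(2)[of j] Vt_eq by blast
  have e: "tcol j = actL (Gm * Sm) (prP (tcol j))" using Sm_Gm(2)[OF u(1)] u(2) by (simp add: actL_mult)
  have "crd (tcol j) p = (\<Sum>q\<in>{0..int j}. ent (Gm * Sm) p q * crd (tcol j) q)" for p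
  proof -
    have "crd (tcol j) p = (\<Sum>q\<in>{0..int j}. ent (Gm * Sm) p q * crd (prP (tcol j)) q)"
      by (subst e, unfold crd_actL[of "Gm * Sm"] act_def, rule infsum_finite_support) (auto simp: crd_prP wave_t(4))
    then show ?thesis by (simp add: crd_prP)
  qed
  then have c: "crd (tcol j) = (\<lambda>p. \<Sum>q\<in>{0..int j}. ent (Gm * Sm) p q * crd (tcol j) q)" by blast
  show ?thesis by (subst c) (rule expdec_lincomb, auto intro: expdec_col)
qed

definition th :: emat where
  "th = (SOME B. periodic n B \<and> (\<forall>p q. ent B p q = crd (tcol (ps n q)) (p - bk n q * int n)))"

lemma per_th: "periodic n th" and ent_th: "ent th p q = crd (tcol (ps n q)) (p - bk n q * int n)"
proof -
  have "\<exists>B. periodic n B \<and> (\<forall>p q. ent B p q = crd (tcol (ps n q)) (p - bk n q * int n))"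
    by (rule periodic_extension[OF n, of "\<lambda>j. crd (tcol j)"]) (auto intro: tcol_expdec)
  from someI_ex[OF this] show "periodic n th" "ent th p q = crd (tcol (ps n q)) (p - bk n q * int n)"
    unfolding th_def by auto
qed

lemma th_col: "actL th (ev q) = actL (Zn (bk n q * int n)) (tcol (ps n q))"
  by (rule ell2_eqI) (simp add: crd_actL_ev ent_th crd_Zn)

lemma upper_th: "upper th"
  unfolding upper_def ent_th
proof (intro conjI allI impI)
  fix p q :: int
  have e: "p - bk n p * int n = int (ps n p)" for p using blk_pos[OF n, of p] by linarith
  show "crd (tcol (ps n q)) (p - bk n q * int n) = 0" if "q < p"
    by (rule wave_t(4)) (use e[of q] that in linarith)
  show "crd (tcol (ps n p)) (p - bk n p * int n) = 1" unfolding e by (rule wave_t(3))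
qed

text \<open>The columns of \<open>\<theta>\<close> lie in \<open>\<Gamma> H\<^sub>+\<close>.\<close>

lemma h_plus: "Pp * (Gim * th * Pp) = Gim * th * Pp"
proof (rule emat_eqI)
  fix p q
  have "ent (Gim * th) p q = 0" if pq: "p < 0" "0 \<le> q"
  proof -
    obtain u where u: "u \<in> plus_space" "tcol (ps n q) = actL Gm u" using wave_t(2)[of "ps n q"] Vt_eq by blast
    have "actL (Gim * th) (ev q) = actL Gim (actL (Zn (bk n q * int n)) (actL Gm u))"
      by (simp add: actL_mult th_col u(2))
    also have "\<dots> = actL (Gim * Gm) (actL (Zn (bk n q * int n)) u)"
      by (simp only: periodic_actL_Zn[OF per_Gm, symmetric] actL_mult)
    finally have e: "actL (Gim * th) (ev q) = actL (Zn (bk n q * int n)) u" by (simp add: Gm_Gim actL_one)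
    have "0 \<le> bk n q * int n" using pq n by (simp add: pos_imp_zdiv_nonneg_iff)
    then have "crd u (p - bk n q * int n) = 0" using u(1) pq by (simp add: plus_space_def)
    then show ?thesis by (simp add: crd_actL_ev[symmetric] e crd_Zn)
  qed
  then show "ent (Pp * (Gim * th * Pp)) p q = ent (Gim * th * Pp) p q"
    by (auto simp: ent_Pp_mult ent_mult_Pp)
qed

definition thi :: emat where "thi = (SOME B. th * B = 1 \<and> B * th = 1)"

lemma thi: "th * thi = 1" "thi * th = 1"
proof -
  have "\<exists>B. th * B = 1 \<and> B * th = 1"
    by (rule wave_matrix_inverse[OF n Gm_Gim per_Gm Sm(1,2,4) upper_th per_th h_plus]) blast
  from someI_ex[OF this] show "th * thi = 1" "thi * th = 1" unfolding thi_def by auto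
qed

definition cm :: emat where "cm = Aim * th"
definition cim :: emat where "cim = thi * Am"

lemma cm_cim: "cm * cim = 1" "cim * cm = 1"
proof -
  have "cm * cim = Aim * (th * thi) * Am" by (simp add: cm_def cim_def mult.assoc)
  then show "cm * cim = 1" by (simp add: thi Am_Aim)
  have "cim * cm = thi * (Am * Aim) * th" by (simp add: cm_def cim_def mult.assoc)
  then show "cim * cm = 1" by (simp add: thi Am_Aim)
qed

lemma per_cm: "periodic n cm" "periodic n cim"
proof -
  show "periodic n cm" unfolding cm_def by (rule periodic_mult[OF per_Am(2) per_th])
  then show "periodic n cim" by (rule periodic_inverse[OF _ cm_cim])
qed

lemma tau_identity:
  "det_on {..<m} (natpart Gm) = tau n W t * fredholm_det (\<lambda>p q. - (if min p q < m then 0 else natpart (cm * Qm * cim) p q))"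
proof -
  interpret tf: two_factors Am Aim bm bim by (rule factors)
  have tau: "tau n W t = fredholm_det (natpart tf.A)" using tau_eq tf.det_toeplitz_tendsto by (simp add: Am_bm)
  have Gh: "Am * bm * (Gim * th) = th" by (simp add: Am_bm mult.assoc[symmetric] Gm_Gim)
  have h2: "Pp * (Am * bm * (Gim * th) * Pp) = Pp * (Am * bm * (Gim * th))"
    unfolding Gh by (rule emat_eqI) (use upper_th in \<open>auto simp: ent_Pp_mult ent_mult_Pp upper_def\<close>)
  have h3: "Am * bm * (Gim * th) * thi = 1" unfolding Gh by (rule thi)
  have c: "cm = bm * (Gim * th)" by (simp add: cm_def Gim_def mult.assoc[symmetric] bim)
  from tf.det_toeplitz_eq[OF h_plus h2 h3 c cim_def cm_cim(1), of m]
  show ?thesis by (simp add: tau Am_bm)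
qed

lemma Dt_L2: "(D_t1 ^^ j) (psi n W) (\<lambda>m. - t m) \<in> L2" using wave_t(1)[of j] by (simp add: Dt_def)

abbreviation C :: loop where "C \<equiv> Psi n W (\<lambda>m. - t m)"

definition Pt :: loop where "Pt = (SOME P. mmat n P \<and> (\<forall>z. z ~= 0 --> C z = P z))"

lemma Pt: "mmat n Pt" "z ~= 0 ==> C z = Pt z"
proof -
  have "\<exists>P. mmat n P \<and> (\<forall>z. z ~= 0 --> C z = P z)"
    by (rule Psi_mmat[OF n Dt_L2]) blast
  from someI_ex[OF this] show "mmat n Pt" "z ~= 0 ==> C z = Pt z" unfolding Pt_def by auto
qed

lemma C_measurable: "a < n ==> b < n ==> (\<lambda>z. C z $$ (a, b)) \<in> borel_measurable borel"
  by (rule measurable_off_zero[OF mmatD(2)[OF Pt(1)]]) (simp_all add: Pt(2))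

lemma C_inv_measurable: "a < n ==> b < n ==> (\<lambda>z. inv_mat (C z) $$ (a, b)) \<in> borel_measurable borel"
  by (rule measurable_off_zero[OF measurable_inv_mat[OF Pt(1)]]) (simp_all add: Pt(2))

lemma C_carrier: "AE z in circle. C z \<in> carrier_mat n n"
  by (rule AE_circleI, subst Pt(2)) (auto intro: mmatD(1)[OF Pt(1)])

lemma C_columns: "AE z in circle. \<forall>a<n. \<forall>j<n. C z $$ (a, j) = HI n (FT (Dt j)) z $ a"
  unfolding Dt_def by (rule Psi_columns[OF n Dt_L2])

lemma C_blkent: "ent cm p q = blkent n C p q"
proof -
  have "actL cm (ev q) = actL Aim (actL (Zn (bk n q * int n)) (actL Am (FT (Dt (ps n q)))))"
    by (simp add: cm_def actL_mult th_col tcol_def)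
  also have "\<dots> = actL (Zn (bk n q * int n)) (actL (Aim * Am) (FT (Dt (ps n q))))"
    by (simp only: periodic_actL_Zn[OF per_Am(2)] actL_mult)
  finally have "ent cm p q = crd (FT (Dt (ps n q))) (p - bk n q * int n)"
    by (simp add: crd_actL_ev[symmetric] Am_Aim actL_one crd_Zn)
  then show ?thesis
    using matrix_columns(2)[OF n HI(1)[OF n] C_measurable C_columns] by (simp add: HI(2)[OF n])
qed

lemma C_regular: "regular n C"
  by (rule regular_if_emat[OF n matrix_columns(1)[OF n HI(1)[OF n] C_measurable C_columns] C_blkent])

text \<open>The functions with coefficients in the columns of \<open>c\<^sup>-\<^sup>1\<close> are mapped by \<open>\<Psi>(-t)\<close> to constant unit
  vectors, so they are the columns of the pointwise inverse.\<close>

lemma C_inv_columns: "AE z in circle. \<forall>a<n. \<forall>j<n. inv_mat (C z) $$ (a, j) = HI n (actL cim (ev (int j))) z $ a"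
proof -
  let ?f = "\<lambda>j. HI n (actL cim (ev (int j)))"
  have "AE z in circle. j < n --> C z *\<^sub>v ?f j z = unit_vec n j" for j
  proof (cases "j < n")
    case True
    obtain g where g: "g \<in> H_space n" "g \<approx> (\<lambda>z. C z *\<^sub>v ?f j z)" "EH n g = actL cm (EH n (?f j))"
      using matrix_mult_EH[OF n C_regular C_carrier C_blkent HI(1)[OF n]] by blast
    have "EH n g = ev (int j)" using g(3) by (simp add: HI(2)[OF n] actL_mult[symmetric] cm_cim actL_one)
    then have "g \<approx> (\<lambda>z. unit_vec n j)"
      using EH_eq_iff[OF n g(1) EH_const_unit(1)[OF n True]] EH_const_unit(2)[OF n True] by simp
    with g(2) show ?thesis unfolding ae_eq_def by eventually_elim simp
  qed simp
  then have "AE z in circle. \<forall>j. j < n --> C z *\<^sub>v ?f j z = unit_vec n j" unfolding AE_all_countable by blast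
  with C_carrier show ?thesis
  proof eventually_elim
    fix z assume z: "C z \<in> carrier_mat n n" "\<forall>j. j < n --> C z *\<^sub>v ?f j z = unit_vec n j"
    define F where "F = mat n n (\<lambda>(a, j). ?f j z $ a)"
    have F: "F \<in> carrier_mat n n" by (simp add: F_def)
    have fc: "?f j z \<in> carrier_vec n" for j by (rule H_space_carrier[OF HI(1)[OF n]])
    have "C z * F = 1\<^sub>m n"
    proof (rule eq_matI)
      fix a j assume "a < dim_row (1\<^sub>m n :: complex mat)" "j < dim_col (1\<^sub>m n :: complex mat)"
      then have aj: "a < n" "j < n" by auto
      have u: "C z *\<^sub>v ?f j z = unit_vec n j" using z(2) aj by blast
      have "(C z * F) $$ (a, j) = (\<Sum>k<n. C z $$ (a, k) * F $$ (k, j))" by (rule mat_mult_entry[OF z(1) F aj])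
      also have "\<dots> = (\<Sum>k<n. C z $$ (a, k) * ?f j z $ k)" by (rule sum.cong) (use aj in \<open>auto simp: F_def\<close>)
      also have "\<dots> = (C z *\<^sub>v ?f j z) $ a" by (rule mult_mat_vec_entry[OF z(1) fc aj(1), symmetric])
      also have "\<dots> = unit_vec n j $ a" by (simp only: u)
      finally show "(C z * F) $$ (a, j) = 1\<^sub>m n $$ (a, j)" using aj by simp
    qed (use z F in auto)
    then have "inv_mat (C z) = F" by (rule inv_mat_unique[OF z(1) F])
    then show "\<forall>a<n. \<forall>j<n. inv_mat (C z) $$ (a, j) = ?f j z $ a" by (simp add: F_def)
  qed
qed

lemma C_inv_blkent: "ent cim p q = blkent n (\<lambda>z. inv_mat (C z)) p q"
proof -
  have "blkent n (\<lambda>z. inv_mat (C z)) p q = ent cim (p - bk n q * int n) (int (ps n q))"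
    using matrix_columns(2)[OF n HI(1)[OF n] C_inv_measurable C_inv_columns]
    by (simp add: HI(2)[OF n] crd_actL_ev)
  also have "\<dots> = ent cim p q"
    using periodic_shift[OF per_cm(2), of "p - bk n q * int n" "bk n q" "int (ps n q)"] blk_pos[OF n, of q]
    by (simp add: add.commute)
  finally show ?thesis by simp
qed

text \<open>The sum over \<open>k\<close> of products of blocks is the sum over the negative scalar indices
  \<open>-(k+1) n + l\<close>, \<open>l < n\<close>, through which \<open>c Q c\<^sup>-\<^sup>1\<close> passes.\<close>

lemma K_mat_eq:
  "K_mat n W t N p q = (if min p q < N * n then 0 else natpart (cm * Qm * cim) p q)"
proof -
  define a where "a = p mod n"
  define b where "b = q mod n"
  define i where "i = p div n"
  define j where "j = q div n"
  have ab: "a < n" "b < n" using n by (simp_all add: a_def b_def)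
  have m: "min i j < N \<longleftrightarrow> min p q < N * n"
    using n by (auto simp: i_def j_def min_less_iff_disj div_less_iff_less_mult)
  show ?thesis
  proof (cases "min i j < N")
    case True
    then show ?thesis using m ab by (simp add: K_mat_def unblock_def K_block_def i_def j_def a_def b_def)
  next
    case False
    have P: "bk n (int p) = int i" "ps n (int p) = a" "bk n (int q) = int j" "ps n (int q) = b"
      by (simp_all add: i_def j_def a_def b_def zdiv_int[symmetric] zmod_int[symmetric])
    define g where "g l k = ent (cm * Qm) (int p) (k * int n + int l) * ent cim (k * int n + int l) (int q)" for l and k :: int
    have sg: "g l summable_on UNIV" for l
      unfolding g_def by (rule infsum_blocks(1)[OF n ent_mult_summable])
    have g0: "g l k = 0" if "0 \<le> k" for l k
    proof -
      have "\<not> k * int n + int l < 0" using that by (simp add: not_less)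
      then show ?thesis by (simp only: g_def ent_mult_Qm if_False mult_zero_left)
    qed
    have ge: "g l (- int k - 1) = fourier (\<lambda>z. C z $$ (a, l)) (int i + int (Suc k)) *
        fourier (\<lambda>z. inv_mat (C z) $$ (l, b)) (- int j - int (Suc k))" if l: "l < n" for l k
    proof -
      have "(- int k - 1) * int n \<le> - 1 * int n" by (rule mult_right_mono) auto
      then have "(- int k - 1) * int n + int l < 0" using l by linarith
      then have e: "g l (- int k - 1) = ent cm (int p) ((- int k - 1) * int n + int l) * ent cim ((- int k - 1) * int n + int l) (int q)"
        by (simp only: g_def ent_mult_Qm if_True)
      have "int i - (- int k - 1) = int i + int (Suc k)" "- int k - 1 - int j = - int j - int (Suc k)" by simp_all
      then show ?thesis
        unfolding e C_blkent C_inv_blkent blkent_def blk_combine[OF n l] pos_combine[OF n l] P by (simp only:)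
    qed
    have sums: "(\<lambda>k. g l (- int k - 1)) sums infsum (g l) UNIV" for l
    proof -
      have bij: "bij (\<lambda>k::int. - k - 1)" by (rule bij_betw_byWitness[of _ "\<lambda>k. - k - 1"]) auto
      have s: "(\<lambda>k. g l (- k - 1)) summable_on UNIV" using summable_on_reindex_bij_betw[OF bij, of "g l"] sg by blast
      have "(\<lambda>k. g l (- int k - 1)) sums (\<Sum>\<^sub>\<infinity>k. g l (- k - 1))"
        by (rule infsum_int_nat[OF _ s]) (simp add: g0)
      then show ?thesis using infsum_reindex_bij_betw[OF bij, of "g l"] by simp
    qed
    have "natpart (cm * Qm * cim) p q = (\<Sum>l<n. infsum (g l) UNIV)"
      unfolding natpart_def ent_mult[of "cm * Qm"] g_def by (rule infsum_blocks(2)[OF n ent_mult_summable])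
    also have "\<dots> = (\<Sum>k. \<Sum>l<n. g l (- int k - 1))" by (rule sums_unique[OF sums_sum[OF sums]])
    also have "\<dots> = (\<Sum>k. (loop_coeff n C (int i + int (Suc k)) * loop_coeff n (\<lambda>z. inv_mat (C z)) (- int j - int (Suc k))) $$ (a, b))"
    proof (rule suminf_cong)
      fix k
      have c: "loop_coeff n M m \<in> carrier_mat n n" for M m by (simp add: loop_coeff_def)
      show "(\<Sum>l<n. g l (- int k - 1)) =
        (loop_coeff n C (int i + int (Suc k)) * loop_coeff n (\<lambda>z. inv_mat (C z)) (- int j - int (Suc k))) $$ (a, b)"
        unfolding mat_mult_entry[OF c c ab]
        by (rule sum.cong[OF refl]) (use ab in \<open>simp add: ge loop_coeff_def del: of_nat_Suc\<close>)
    qed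
    also have "\<dots> = K_mat n W t N p q"
      using False ab by (simp add: K_mat_def unblock_def K_block_def i_def j_def a_def b_def)
    finally show ?thesis using False m by simp
  qed
qed

theorem tau_N_formula: "tau_N n W N t = tau n W t * fredholm_det (\<lambda>p q. - K_mat n W t N p q)"
  unfolding tau_N_eq K_mat_eq by (rule tau_identity)

end

theorem corollary5p7:
  fixes n N :: nat and W :: "(complex \<Rightarrow> complex vec) set" and t :: "nat \<Rightarrow> complex"
  assumes "n \<ge> 2"
    and "W \<in> Gr n"
    and "big_cell n W"
    and "W = loop_image n (Psi n W (\<lambda>i. 0)) (H_plus n)"
    and "t \<in> admissible_times n"
    and "extends_analytically n (W_loop n W t)"
    and "tau n W t \<noteq> 0"
    and "N > 0"
  shows "tau_N n W N t = tau n W t * fredholm_det (\<lambda>p q. - K_mat n W t N p q)"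
proof -
  have n: "0 < n" using assms(1) by simp
  interpret wave_setting_tau n W t by unfold_locales (rule n | fact assms)+
  show ?thesis by (rule tau_N_formula)
qed

end
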